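(* Let $\lambda=(\lambda_1,\lambda_2)\in P^+$, let $z_1,\dots,z_{\lambda_2}$ be pairwise-distinct complex numbers, and let $\kappa_1,\dots,\kappa_{\lambda_2}$ be complex numbers satisfying $\kappa_1+\dots+\kappa_{\lambda_2}=\lambda_1$. There is an isomorphism of $\mathfrak g[t]$-modules $$W(\lambda)\cong K(\kappa_1,1)^{z_1}*\dots*K(\kappa_{\lambda_2},1)^{z_{\lambda_2}}.$$ In particular, $\dim W(\lambda)=4^{\lambda_2}$.
   Context: All vector spaces are over $\mathbb C$. $\mathfrak g=\mathfrak{sl}(1|2)$ is the Lie superalgebra of $3\times 3$ complex matrices $A=(a_{ij})$ with $a_{11}-a_{22}-a_{33}=0$; the even part consists of block-diagonal matrices (blocks of size $1$ and $2$), the odd part of block-off-diagonal matrices, and $[A,B]=AB-(-1)^{\bar i\bar j}BA$ for $A,B$ of parity $\bar i,\bar j$. Let $E_{i,j}$ be the matrix units, $x_1=E_{1,2}$, $x_2=E_{2,3}$, $x_3=E_{1,3}$, $y_i=x_i^t$, $h_1=E_{1,1}+E_{2,2}$, $h_2=E_{2,2}-E_{3,3}$, $\mathfrak h=\mathrm{span}\{h_1,h_2\}$, $\mathfrak n^+=\mathrm{span}\{y_1,x_2,x_3\}$. A weight $\lambda\in\mathfrak h^*$ is identified with $(\lambda_1,\lambda_2)=(\lambda(h_1),\lambda(h_2))$, and $P^+=\{\lambda\in\mathfrak h^*\mid\lambda_2\in\mathbb Z_{\ge1}\}\cup\{0\}$. Modules are $\mathbb Z_2$-graded; homomorphisms are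 linear maps commuting with the action and need not preserve parity. $\mathfrak g[t]=\mathfrak g\otimes\mathbb C[t]$, $x(m):=x\otimes t^m$, $[x(m),y(n)]=[x,y](m+n)$; $x=x(0)$. For $\mu\in P^+$, the generalized Kac module $K(\mu)$ is the quotient of $\mathbf U(\mathfrak g)$ by the left ideal generated by $\mathfrak n^+$, $h-\mu(h)$ ($h\in\mathfrak h$), $y_2^{\mu_2+1}$; $k_\mu$ is the image of $1$. For $\lambda\in P^+$, the graded local Weyl module $W(\lambda)$ is the quotient of $\mathbf U(\mathfrak g[t])$ by the left ideal generated by $\mathfrak n^+[t]$, $h(r)-\delta_{r,0}\lambda(h)$ ($h\in\mathfrak h$, $r\ge0$), $y_2^{\lambda_2+1}$. For a $\mathfrak g$-module $V$ and $z\in\mathbb C$, $V^z$ is the $\mathfrak g[t]$-module $V$ with $x(a)v=z^a\,xv$. Grade $\mathbf U(\mathfrak g[t])=\bigoplus_{s\ge0}\mathbf U(\mathfrak g[t])[s]$ by degree in $t$. For a $\mathfrak g[t]$-module $V$ with cyclic vector $v$, put $V^{\le n}=\sum_{i=0}^n\mathbf U(\mathfrak g[t])[i]v$ and let $\mathrm{Gr}_v(V)=\bigoplus_{n\ge0}V^{\le n}/V^{\le n-1}$ (with $V^{\le -1}=0$) be the associated graded $\mathfrak g[t]$-module. For cyclic $\mathfrak g$-modules $V_1,\dots,V_n$ with cyclic homogeneous even vectors $v_1,\dots,v_n$ and pairwise-distinct $z_1,\dots,z_n\in\mathbb C$, the fusion product is $V_1^{z_1}*\dots*V_n^{z_n}:=\mathrm{Gr}_{v_1\otimes\dots\otimes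 v_n}(V_1^{z_1}\otimes\dots\otimes V_n^{z_n})$. For generalized Kac modules the cyclic vector used is $k_\mu$. (An empty fusion product is the trivial module.) *)

theory Defs
  imports
    "HOL-Library.Z2"
    "HOL-Library.Poly_Mapping"
    "HOL-Computational_Algebra.Polynomial"
    "HOL-Analysis.Cartesian_Space"
    "HOL-Algebra.AbelCoset"
    "HOL-Algebra.Module"
begin

section \<open>Complex Lie superalgebras\<close>

text \<open>The sign $(-1)^{pq}$; parities live in the two-element ring \<^typ>\<open>bit\<close>.\<close>

definition ssign :: "bit \<Rightarrow> bit \<Rightarrow> complex" where
  "ssign p q = (if p = 1 \<and> q = 1 then - 1 else 1)"

text \<open>\<open>lpart p x\<close> is the component of \<open>x\<close> of parity \<open>p\<close>, so that \<open>x\<close> is homogeneous of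
  parity \<open>p\<close> iff \<open>lpart p x = x\<close>.\<close>

class lie_superalgebra = ab_group_add +
  fixes lscale :: "complex \<Rightarrow> 'a \<Rightarrow> 'a"
    and lpart :: "bit \<Rightarrow> 'a \<Rightarrow> 'a"
    and lbracket :: "'a \<Rightarrow> 'a \<Rightarrow> 'a"
  assumes lscale_add_right: "lscale c (x + y) = lscale c x + lscale c y"
    and lscale_add_left: "lscale (c + d) x = lscale c x + lscale d x"
    and lscale_lscale: "lscale c (lscale d x) = lscale (c * d) x"
    and lscale_one: "lscale 1 x = x"
    and lpart_add: "lpart p (x + y) = lpart p x + lpart p y"
    and lpart_lscale: "lpart p (lscale c x) = lscale c (lpart p x)"
    and lpart_lpart: "lpart p (lpart q x) = (if p = q then lpart p x else 0)"
    and lpart_sum: "lpart 0 x + lpart 1 x = x"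
    and lbracket_add_left: "lbracket (x + y) z = lbracket x z + lbracket y z"
    and lbracket_add_right: "lbracket x (y + z) = lbracket x y + lbracket x z"
    and lbracket_lscale_left: "lbracket (lscale c x) y = lscale c (lbracket x y)"
    and lbracket_lscale_right: "lbracket x (lscale c y) = lscale c (lbracket x y)"
    and lbracket_grading: "lpart p x = x \<Longrightarrow> lpart q y = y \<Longrightarrow>
          lpart (p + q) (lbracket x y) = lbracket x y"
    and lbracket_skew: "lpart p x = x \<Longrightarrow> lpart q y = y \<Longrightarrow>
          lbracket x y = - lscale (ssign p q) (lbracket y x)"
    and lbracket_jacobi: "lpart p x = x \<Longrightarrow> lpart q y = y \<Longrightarrow> lpart r z = z \<Longrightarrow>
          lbracket x (lbracket y z) =
            lbracket (lbracket x y) z + lscale (ssign p q) (lbracket y (lbracket x z))"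

global_interpretation lie: vector_space "lscale :: complex \<Rightarrow> 'a :: lie_superalgebra \<Rightarrow> 'a"
  by standard (simp_all add: lscale_add_right lscale_add_left lscale_lscale lscale_one)

lemma lpart_zero [simp]: "lpart p (0 :: 'a :: lie_superalgebra) = 0"
  using lpart_add[of p "0 :: 'a" 0] by simp

lemma lbracket_zero_left [simp]: "lbracket 0 (x :: 'a :: lie_superalgebra) = 0"
  using lbracket_add_left[of "0 :: 'a" 0 x] by simp

lemma lbracket_zero_right [simp]: "lbracket (x :: 'a :: lie_superalgebra) 0 = 0"
  using lbracket_add_right[of x "0 :: 'a" 0] by simp


subsection \<open>The current algebra\<close>

text \<open>The current algebra of a Lie superalgebra \<open>L\<close> is \<open>L \<otimes> \<complex>[t]\<close>, that is, polynomials in \<open>t\<close>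
  with coefficients in \<open>L\<close>; the element $x(m) = x \otimes t^m$ is \<^term>\<open>monom x m\<close>.\<close>

instantiation poly :: (lie_superalgebra) lie_superalgebra
begin

definition lscale_poly :: "complex \<Rightarrow> 'a poly \<Rightarrow> 'a poly" where
  "lscale_poly c p = map_poly (lscale c) p"

definition lpart_poly :: "bit \<Rightarrow> 'a poly \<Rightarrow> 'a poly" where
  "lpart_poly q p = map_poly (lpart q) p"

definition lbracket_poly :: "'a poly \<Rightarrow> 'a poly \<Rightarrow> 'a poly" where
  "lbracket_poly p q =
     (\<Sum>i\<le>degree p. \<Sum>j\<le>degree q. monom (lbracket (coeff p i) (coeff q j)) (i + j))"

lemma coeff_lscale_poly: "coeff (lscale c p) n = lscale c (coeff p n)"
  by (simp add: lscale_poly_def coeff_map_poly)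

lemma coeff_lpart_poly: "coeff (lpart q p) n = lpart q (coeff p n)"
  for p :: "'a poly"
  by (simp add: lpart_poly_def coeff_map_poly)

lemma coeff_lbracket_poly:
  "coeff (lbracket p q) n = (\<Sum>i\<le>n. lbracket (coeff p i) (coeff q (n - i)))"
  for p q :: "'a poly"
proof -
  have "coeff (lbracket p q) n = (\<Sum>i\<le>degree p. \<Sum>j\<le>degree q.
      if i + j = n then lbracket (coeff p i) (coeff q j) else 0)"
    by (simp add: lbracket_poly_def coeff_sum)
  also have "\<dots> = (\<Sum>i\<le>degree p. if i \<le> n then lbracket (coeff p i) (coeff q (n - i)) else 0)"
  proof (rule sum.cong[OF refl])
    fix i
    have "(\<Sum>j\<le>degree q. if i + j = n then lbracket (coeff p i) (coeff q j) else 0)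
       = (\<Sum>j\<le>degree q. if j = n - i then (if i \<le> n then lbracket (coeff p i) (coeff q j) else 0) else 0)"
      by (rule sum.cong) auto
    also have "\<dots> = (if i \<le> n then lbracket (coeff p i) (coeff q (n - i)) else 0)"
      by (auto simp: sum.delta not_le coeff_eq_0)
    finally show "(\<Sum>j\<le>degree q. if i + j = n then lbracket (coeff p i) (coeff q j) else 0)
       = (if i \<le> n then lbracket (coeff p i) (coeff q (n - i)) else 0)" .
  qed
  also have "\<dots> = (\<Sum>i\<in>{..degree p} \<inter> {..n}. lbracket (coeff p i) (coeff q (n - i)))"
    by (subst sum.inter_restrict) auto
  also have "\<dots> = (\<Sum>i\<le>n. lbracket (coeff p i) (coeff q (n - i)))"
    by (rule sum.mono_neutral_left) (auto intro: ccontr simp: coeff_eq_0 not_le)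
  finally show ?thesis .
qed

lemma poly_additive_induct:
  fixes p :: "'a poly"
  assumes "\<And>i. H (coeff p i)" and "P 0" and "\<And>a b. P a \<Longrightarrow> P b \<Longrightarrow> P (a + b)"
    and "\<And>x i. H x \<Longrightarrow> P (monom x i)"
  shows "P p"
proof -
  have "P (\<Sum>i\<in>I. monom (coeff p i) i)" if "finite I" for I
    using that by induction (auto intro: assms)
  from this[of "{..degree p}"] show ?thesis
    by (simp add: poly_as_sum_of_monoms)
qed

lemma lscale_monom: "lscale c (monom x i) = monom (lscale c x) i"
  for x :: 'a
  by (rule poly_eqI) (simp add: coeff_lscale_poly)

lemma lbracket_monom: "lbracket (monom x i) (monom y j) = monom (lbracket x y) (i + j)"
  for x y :: 'a
proof (rule poly_eqI)
  fix n
  have "coeff (lbracket (monom x i) (monom y j)) n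
      = (\<Sum>k\<le>n. if k = i then lbracket x (coeff (monom y j) (n - k)) else 0)"
    unfolding coeff_lbracket_poly by (rule sum.cong) auto
  also have "\<dots> = coeff (monom (lbracket x y) (i + j)) n"
    by auto
  finally show "coeff (lbracket (monom x i) (monom y j)) n
      = coeff (monom (lbracket x y) (i + j)) n" .
qed

instance
proof
  fix c d :: complex and p q r :: bit and x y z :: "'a poly"
  show "lscale c (x + y) = lscale c x + lscale c y"
    by (rule poly_eqI) (simp add: coeff_lscale_poly lscale_add_right)
  show "lscale (c + d) x = lscale c x + lscale d x"
    by (rule poly_eqI) (simp add: coeff_lscale_poly lscale_add_left)
  show "lscale c (lscale d x) = lscale (c * d) x"
    by (rule poly_eqI) (simp add: coeff_lscale_poly lscale_lscale)
  show "lscale 1 x = x"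
    by (rule poly_eqI) (simp add: coeff_lscale_poly lscale_one)
  show "lpart p (x + y) = lpart p x + lpart p y"
    by (rule poly_eqI) (simp add: coeff_lpart_poly lpart_add)
  show "lpart p (lscale c x) = lscale c (lpart p x)"
    by (rule poly_eqI) (simp add: coeff_lpart_poly coeff_lscale_poly lpart_lscale)
  show "lpart p (lpart q x) = (if p = q then lpart p x else 0)"
    by (rule poly_eqI) (auto simp: coeff_lpart_poly lpart_lpart)
  show "lpart 0 x + lpart 1 x = x"
    by (rule poly_eqI) (simp add: coeff_lpart_poly lpart_sum)
  show bl: "lbracket (x + y) z = lbracket x z + lbracket y z" for x y z :: "'a poly"
    by (rule poly_eqI) (simp add: coeff_lbracket_poly lbracket_add_left sum.distrib)
  show br: "lbracket x (y + z) = lbracket x y + lbracket x z" for x y z :: "'a poly"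
    by (rule poly_eqI) (simp add: coeff_lbracket_poly lbracket_add_right sum.distrib)
  show "lbracket (lscale c x) y = lscale c (lbracket x y)"
    by (rule poly_eqI)
      (simp add: coeff_lbracket_poly coeff_lscale_poly lbracket_lscale_left lie.scale_sum_right)
  show "lbracket x (lscale c y) = lscale c (lbracket x y)"
    by (rule poly_eqI)
      (simp add: coeff_lbracket_poly coeff_lscale_poly lbracket_lscale_right lie.scale_sum_right)
  have sadd: "lscale c (x + y) = lscale c x + lscale c y" for c and x y :: "'a poly"
    by (rule poly_eqI) (simp add: coeff_lscale_poly lscale_add_right)
  have s0: "lscale c (0 :: 'a poly) = 0" for c
    using sadd[of c 0 0] by simp
  have b0: "lbracket 0 x = 0" "lbracket x 0 = 0" for x :: "'a poly"
    using bl[of 0 0 x] br[of x 0 0] by simp_all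
  show "lpart (p + q) (lbracket x y) = lbracket x y" if "lpart p x = x" "lpart q y = y"
  proof (rule poly_eqI)
    fix n
    have x: "lpart p (coeff x i) = coeff x i" for i
      using that(1) by (metis coeff_lpart_poly)
    have y: "lpart q (coeff y i) = coeff y i" for i
      using that(2) by (metis coeff_lpart_poly)
    define r where "r = p + q"
    have r: "lpart r (lbracket (coeff x i) (coeff y j)) = lbracket (coeff x i) (coeff y j)" for i j
      unfolding r_def by (rule lbracket_grading[OF x y])
    have "lpart r (\<Sum>i\<in>I. lbracket (coeff x i) (coeff y (n - i)))
        = (\<Sum>i\<in>I. lbracket (coeff x i) (coeff y (n - i)))" if "finite I" for I
      using that by induction (simp_all add: lpart_add r)
    then show "coeff (lpart (p + q) (lbracket x y)) n = coeff (lbracket x y) n"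
      unfolding r_def[symmetric] by (simp add: coeff_lpart_poly coeff_lbracket_poly)
  qed
  show "lbracket x y = - lscale (ssign p q) (lbracket y x)"
    if hx: "lpart p x = x" and hy: "lpart q y = y"
  proof (rule poly_additive_induct[where p = x and H = "\<lambda>a. lpart p a = a"], goal_cases)
    case (1 i) then show ?case using hx by (metis coeff_lpart_poly)
  next
    case 2 then show ?case by (simp add: b0 s0)
  next
    case (3 a b) then show ?case by (simp add: bl br sadd)
  next
    case x: (4 a i)
    show ?case
    proof (rule poly_additive_induct[where p = y and H = "\<lambda>a. lpart q a = a"], goal_cases)
      case (1 i) then show ?case using hy by (metis coeff_lpart_poly)
    next
      case 2 then show ?case by (simp add: b0 s0)
    next
      case (3 a b) then show ?case by (simp add: bl br sadd)
    next
      case y: (4 b j)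
      show ?case
        using lbracket_skew[OF x y]
        by (simp add: lbracket_monom lscale_monom minus_monom add.commute)
    qed
  qed
  show "lbracket x (lbracket y z) =
      lbracket (lbracket x y) z + lscale (ssign p q) (lbracket y (lbracket x z))"
    if hx: "lpart p x = x" and hy: "lpart q y = y" and hz: "lpart r z = z"
  proof (rule poly_additive_induct[where p = x and H = "\<lambda>a. lpart p a = a"], goal_cases)
    case (1 i) then show ?case using hx by (metis coeff_lpart_poly)
  next
    case 2 then show ?case by (simp add: b0 s0)
  next
    case (3 a b) then show ?case by (simp add: bl br sadd)
  next
    case x: (4 a i)
    show ?case
    proof (rule poly_additive_induct[where p = y and H = "\<lambda>a. lpart q a = a"], goal_cases)
      case (1 i) then show ?case using hy by (metis coeff_lpart_poly)
    next
      case 2 then show ?case by (simp add: b0 s0)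
    next
      case (3 a b) then show ?case by (simp add: bl br sadd)
    next
      case y: (4 b j)
      show ?case
      proof (rule poly_additive_induct[where p = z and H = "\<lambda>a. lpart r a = a"], goal_cases)
        case (1 i) then show ?case using hz by (metis coeff_lpart_poly)
      next
        case 2 then show ?case by (simp add: b0 s0)
      next
        case (3 a b) then show ?case by (simp add: bl br sadd)
      next
        case z: (4 c k)
        show ?case
          using lbracket_jacobi[OF x y z]
          by (simp add: lbracket_monom lscale_monom add_monom ac_simps)
      qed
    qed
  qed
qed

end


subsection \<open>The Lie superalgebra $\mathfrak{sl}(1|2)$\<close>

typedef sl12 = "{A :: complex^3^3. A $ 1 $ 1 - A $ 2 $ 2 - A $ 3 $ 3 = 0}"
  by (rule exI[of _ 0]) simp

setup_lifting type_definition_sl12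

definition idx_parity :: "3 \<Rightarrow> bit" where
  "idx_parity i = (if i = 1 then 0 else 1)"

definition mat_part :: "bit \<Rightarrow> complex^3^3 \<Rightarrow> complex^3^3" where
  "mat_part p A = (\<chi> i j. if idx_parity i + idx_parity j = p then A $ i $ j else 0)"

definition mat_scale :: "complex \<Rightarrow> complex^3^3 \<Rightarrow> complex^3^3" where
  "mat_scale c A = (\<chi> i j. c * A $ i $ j)"

text \<open>The supercommutator, extended bilinearly from homogeneous matrices.\<close>

definition mat_bracket :: "complex^3^3 \<Rightarrow> complex^3^3 \<Rightarrow> complex^3^3" where
  "mat_bracket A B = (\<Sum>p\<in>{0, 1}. \<Sum>q\<in>{0, 1}.
     mat_part p A ** mat_part q B - mat_scale (ssign p q) (mat_part q B ** mat_part p A))"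

lemma idx_parity_simps [simp]: "idx_parity 1 = 0" "idx_parity 2 = 1" "idx_parity 3 = 1"
  by (simp_all add: idx_parity_def)

lemma mat_bracket_simps:
  "mat_bracket (A + B) C = mat_bracket A C + mat_bracket B C"
  "mat_bracket C (A + B) = mat_bracket C A + mat_bracket C B"
  "mat_bracket (mat_scale c A) B = mat_scale c (mat_bracket A B)"
  "mat_bracket A (mat_scale c B) = mat_scale c (mat_bracket A B)"
  by (simp_all add: vec_eq_iff mat_bracket_def mat_part_def mat_scale_def ssign_def
      matrix_matrix_mult_def sum_3 forall_3 algebra_simps)

lemma mat_scale_mult:
  "mat_scale c A ** B = mat_scale c (A ** B)" "A ** mat_scale c B = mat_scale c (A ** B)"
  by (simp_all add: vec_eq_iff mat_scale_def matrix_matrix_mult_def sum_distrib_left mult_ac)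

lemma mat_scale_simps:
  "mat_scale c (mat_scale d A) = mat_scale (c * d) A" "mat_scale 1 A = A"
  "mat_scale c (A + B) = mat_scale c A + mat_scale c B"
  "mat_scale c (A - B) = mat_scale c A - mat_scale c B"
  "mat_scale (- 1) A = - A" "mat_scale c 0 = 0"
  by (simp_all add: vec_eq_iff mat_scale_def algebra_simps)

lemma mat_part_mat_part: "mat_part p (mat_part q A) = (if p = q then mat_part q A else 0)"
  by (auto simp: vec_eq_iff mat_part_def)

lemma mat_bracket_eq:
  assumes "mat_part p A = A" "mat_part q B = B"
  shows "mat_bracket A B = A ** B - mat_scale (ssign p q) (B ** A)"
proof -
  have "mat_part p' A = (if p' = p then A else 0)" "mat_part p' B = (if p' = q then B else 0)" for p'
    using assms mat_part_mat_part by (metis (full_types))+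
  then show ?thesis
    by (cases p; cases q) (simp_all add: mat_bracket_def mat_scale_simps)
qed

lemma mat_part_mult:
  assumes "mat_part p A = A" "mat_part q B = B"
  shows "mat_part (p + q) (A ** B) = A ** B"
proof -
  have A: "A $ i $ j = 0" if "idx_parity i + idx_parity j \<noteq> p" for i j
    using that by (subst assms(1)[symmetric]) (simp add: mat_part_def)
  have B: "B $ i $ j = 0" if "idx_parity i + idx_parity j \<noteq> q" for i j
    using that by (subst assms(2)[symmetric]) (simp add: mat_part_def)
  have AB: "A $ i $ k * B $ k $ j = 0" if "idx_parity i + idx_parity j \<noteq> r" "r = p + q" for i j k r
    using that A[of i k] B[of k j]
    by (cases "idx_parity i"; cases "idx_parity j"; cases "idx_parity k"; cases p; cases q) auto
  define r where "r = p + q"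
  have "mat_part r (A ** B) $ i $ j = (A ** B) $ i $ j" for i j
  proof (cases "idx_parity i + idx_parity j = r")
    case False
    then have "(A ** B) $ i $ j = 0"
      unfolding matrix_matrix_mult_def vec_lambda_beta
      by (intro sum.neutral ballI AB[OF False r_def])
    with False show ?thesis
      unfolding mat_part_def by simp
  qed (simp add: mat_part_def)
  then show ?thesis
    unfolding r_def[symmetric] by (simp add: vec_eq_iff)
qed

lemma mat_bracket_homogeneous:
  assumes "mat_part p A = A" "mat_part q B = B"
  shows "mat_part (p + q) (mat_bracket A B) = mat_bracket A B"
proof -
  have "mat_part r (X - mat_scale c Y) = X - mat_scale c Y"
    if "mat_part r X = X" "mat_part r Y = Y" for r c X Y
  proof -
    have "mat_part r (X - mat_scale c Y) = mat_part r X - mat_scale c (mat_part r Y)"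
      by (auto simp: vec_eq_iff mat_part_def mat_scale_def)
    with that show ?thesis by simp
  qed
  moreover have "mat_part (p + q) (B ** A) = B ** A"
    using mat_part_mult[OF assms(2,1)] by (metis add.commute)
  ultimately show ?thesis
    unfolding mat_bracket_eq[OF assms] using mat_part_mult[OF assms] by blast
qed

lemma mat_bracket_skew:
  assumes "mat_part p A = A" "mat_part q B = B"
  shows "mat_bracket A B = - mat_scale (ssign p q) (mat_bracket B A)"
  unfolding mat_bracket_eq[OF assms] mat_bracket_eq[OF assms(2,1)]
  by (auto simp: ssign_def mat_scale_simps)

lemma mat_bracket_jacobi:
  assumes "mat_part p A = A" "mat_part q B = B" "mat_part r C = C"
  shows "mat_bracket A (mat_bracket B C) =
    mat_bracket (mat_bracket A B) C + mat_scale (ssign p q) (mat_bracket B (mat_bracket A C))"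
proof -
  note AB = mat_bracket_homogeneous[OF assms(1,2)]
    and AC = mat_bracket_homogeneous[OF assms(1,3)]
    and BC = mat_bracket_homogeneous[OF assms(2,3)]
  have distr: "X ** (Y + Z) = X ** Y + X ** Z" "(Y + Z) ** X = Y ** X + Z ** X"
    "X ** (Y - Z) = X ** Y - X ** Z" "(Y - Z) ** X = Y ** X - Z ** X"
    "X ** (- Y) = - (X ** Y)" "(- Y) ** X = - (Y ** X)" for X Y Z :: "complex^3^3"
    by (simp_all add: vec_eq_iff matrix_matrix_mult_def sum.distrib sum_subtractf sum_negf
        algebra_simps)
  show ?thesis
    unfolding mat_bracket_eq[OF assms(1) BC] mat_bracket_eq[OF AB assms(3)]
      mat_bracket_eq[OF assms(2) AC]
    unfolding mat_bracket_eq[OF assms(1,2)] mat_bracket_eq[OF assms(1,3)]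
      mat_bracket_eq[OF assms(2,3)]
    by (cases p; cases q; cases r)
      (simp_all add: ssign_def distr mat_scale_simps matrix_mul_assoc)
qed

instantiation sl12 :: lie_superalgebra
begin

lift_definition zero_sl12 :: sl12 is 0 by simp
lift_definition plus_sl12 :: "sl12 \<Rightarrow> sl12 \<Rightarrow> sl12" is "(+)" by (simp add: algebra_simps)
lift_definition minus_sl12 :: "sl12 \<Rightarrow> sl12 \<Rightarrow> sl12" is "(-)" by (simp add: algebra_simps)
lift_definition uminus_sl12 :: "sl12 \<Rightarrow> sl12" is "uminus" by (simp add: algebra_simps)
lift_definition lscale_sl12 :: "complex \<Rightarrow> sl12 \<Rightarrow> sl12" is mat_scale
  by (simp add: mat_scale_def flip: right_diff_distrib)
lift_definition lpart_sl12 :: "bit \<Rightarrow> sl12 \<Rightarrow> sl12" is mat_part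
  by (simp add: mat_part_def)
lift_definition lbracket_sl12 :: "sl12 \<Rightarrow> sl12 \<Rightarrow> sl12" is mat_bracket
  by (simp add: mat_bracket_def mat_part_def mat_scale_def ssign_def
      matrix_matrix_mult_def sum_3 algebra_simps)

instance
proof
  fix c d :: complex and p q r :: bit and x y z :: sl12
  show "x + y + z = x + (y + z)" "x + y = y + x" "0 + x = x" "- x + x = 0" "x - y = x + - y"
    by (transfer; simp add: algebra_simps)+
  show "lscale c (x + y) = lscale c x + lscale c y"
    by transfer (simp add: vec_eq_iff mat_scale_def algebra_simps)
  show "lscale (c + d) x = lscale c x + lscale d x"
    by transfer (simp add: vec_eq_iff mat_scale_def algebra_simps)
  show "lscale c (lscale d x) = lscale (c * d) x" "lscale 1 x = x"
    by (transfer; simp add: vec_eq_iff mat_scale_def algebra_simps)+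
  show "lpart p (x + y) = lpart p x + lpart p y" "lpart p (lscale c x) = lscale c (lpart p x)"
    "lpart p (lpart q x) = (if p = q then lpart p x else 0)"
    by (transfer; auto simp: vec_eq_iff mat_scale_def mat_part_def)+
  show "lpart 0 x + lpart 1 x = x"
    by transfer (auto simp: vec_eq_iff mat_part_def)
  show "lbracket (x + y) z = lbracket x z + lbracket y z"
    "lbracket x (y + z) = lbracket x y + lbracket x z"
    "lbracket (lscale c x) y = lscale c (lbracket x y)"
    "lbracket x (lscale c y) = lscale c (lbracket x y)"
    by (transfer; simp add: mat_bracket_simps)+
  show "lpart (p + q) (lbracket x y) = lbracket x y" if "lpart p x = x" "lpart q y = y"
    using that by transfer (rule mat_bracket_homogeneous)
  show "lbracket x y = - lscale (ssign p q) (lbracket y x)" if "lpart p x = x" "lpart q y = y"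
    using that by transfer (rule mat_bracket_skew)
  show "lbracket x (lbracket y z) =
      lbracket (lbracket x y) z + lscale (ssign p q) (lbracket y (lbracket x z))"
    if "lpart p x = x" "lpart q y = y" "lpart r z = z"
    using that by transfer (rule mat_bracket_jacobi)
qed

end


text \<open>The matrix unit \<open>E\<^sub>i\<^sub>j\<close> itself need not lie in $\mathfrak{sl}(1|2)$, so \<open>mat_unit\<close> is used
  through \<open>Abs_sl12\<close> only on matrices of supertrace zero.\<close>

definition mat_unit :: "3 \<Rightarrow> 3 \<Rightarrow> complex^3^3" where
  "mat_unit i j = (\<chi> k l. if k = i \<and> l = j then 1 else 0)"

definition "sl_x1 = Abs_sl12 (mat_unit 1 2)"
definition "sl_x2 = Abs_sl12 (mat_unit 2 3)"
definition "sl_x3 = Abs_sl12 (mat_unit 1 3)"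
definition "sl_y1 = Abs_sl12 (mat_unit 2 1)"
definition "sl_y2 = Abs_sl12 (mat_unit 3 2)"
definition "sl_y3 = Abs_sl12 (mat_unit 3 1)"
definition "sl_h1 = Abs_sl12 (mat_unit 1 1 + mat_unit 2 2)"
definition "sl_h2 = Abs_sl12 (mat_unit 2 2 - mat_unit 3 3)"

definition nplus :: "sl12 set" where
  "nplus = lie.span {sl_y1, sl_x2, sl_x3}"

text \<open>A linear functional on the Cartan subalgebra spanned by \<open>sl_h1\<close> and \<open>sl_h2\<close> is stored as
  the pair of its values at these two elements.\<close>

type_synonym weight = "complex \<times> complex"

definition Pplus :: "weight set" where
  "Pplus = {l. \<exists>n::nat. n \<ge> 1 \<and> snd l = of_nat n} \<union> {(0, 0)}"

text \<open>Meaningful only if the value at \<open>sl_h2\<close> is a natural number, as it is on \<open>Pplus\<close>.\<close>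

definition wt_nat :: "weight \<Rightarrow> nat" where
  "wt_nat l = (THE n. snd l = of_nat n)"

definition cartan_elt :: "complex \<Rightarrow> complex \<Rightarrow> sl12" where
  "cartan_elt a b = lscale a sl_h1 + lscale b sl_h2"

definition wt_apply :: "weight \<Rightarrow> complex \<Rightarrow> complex \<Rightarrow> complex" where
  "wt_apply l a b = a * fst l + b * snd l" \<comment> \<open>the value of \<open>l\<close> at \<open>cartan_elt a b\<close>\<close>


section \<open>The universal enveloping algebra\<close>

text \<open>The tensor algebra of \<open>L\<close> is realised as the free algebra on the underlying set of \<open>L\<close>
  (the monoid algebra of the free monoid) modulo the relations that make \<open>L\<close> embed linearly.
  These relations are imposed together with the defining ones of the enveloping algebra.\<close>

datatype 'a free_monoid = Word (letters: "'a list")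

instantiation free_monoid :: (type) monoid_add
begin

definition zero_free_monoid :: "'a free_monoid" where
  "zero_free_monoid = Word []"

definition plus_free_monoid :: "'a free_monoid \<Rightarrow> 'a free_monoid \<Rightarrow> 'a free_monoid" where
  "plus_free_monoid v w = Word (letters v @ letters w)"

instance
  by standard (simp_all add: zero_free_monoid_def plus_free_monoid_def)

end

type_synonym 'a free_algebra = "'a free_monoid \<Rightarrow>\<^sub>0 complex"

definition free_gen :: "'a \<Rightarrow> 'a free_algebra" where
  "free_gen x = Poly_Mapping.single (Word [x]) 1"

definition free_const :: "complex \<Rightarrow> 'a free_algebra" where
  "free_const c = Poly_Mapping.single 0 c"

inductive_set uea_relators :: "'a :: lie_superalgebra free_algebra set" where
  add: "free_gen (x + y) - (free_gen x + free_gen y) \<in> uea_relators"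
| scale: "free_gen (lscale c x) - free_const c * free_gen x \<in> uea_relators"
| bracket: "lpart p x = x \<Longrightarrow> lpart q y = y \<Longrightarrow>
    free_gen x * free_gen y - free_const (ssign p q) * (free_gen y * free_gen x)
      - free_gen (lbracket x y) \<in> uea_relators"

inductive_set uea_ideal :: "'a :: lie_superalgebra free_algebra set" where
  zero: "0 \<in> uea_ideal"
| step: "r \<in> uea_relators \<Longrightarrow> a \<in> uea_ideal \<Longrightarrow> u * r * v + a \<in> uea_ideal"

lemma uea_ideal_add: "a \<in> uea_ideal \<Longrightarrow> b \<in> uea_ideal \<Longrightarrow> a + b \<in> uea_ideal"
  by (induction rule: uea_ideal.induct) (auto simp: add.assoc intro: uea_ideal.intros)

lemma uea_ideal_mult: "a \<in> uea_ideal \<Longrightarrow> u * a * v \<in> uea_ideal"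
proof (induction rule: uea_ideal.induct)
  case (step r a u' v')
  have "u * (u' * r * v' + a) * v = (u * u') * r * (v' * v) + u * a * v"
    by (simp add: algebra_simps)
  with step show ?case
    by (metis uea_ideal.step)
qed (simp add: uea_ideal.zero)

lemma uea_ideal_uminus: "a \<in> uea_ideal \<Longrightarrow> - a \<in> uea_ideal"
  using uea_ideal_mult[of a "- 1" 1] by simp

lemma uea_ideal_mult_left: "a \<in> uea_ideal \<Longrightarrow> u * a \<in> uea_ideal"
  using uea_ideal_mult[of a u 1] by simp

lemma uea_ideal_mult_right: "a \<in> uea_ideal \<Longrightarrow> a * v \<in> uea_ideal"
  using uea_ideal_mult[of a 1 v] by simp

lemma lookup_free_mult_zero:
  "Poly_Mapping.lookup (f * g) 0 = Poly_Mapping.lookup f 0 * Poly_Mapping.lookup g 0"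
  for f g :: "'a free_algebra"
proof -
  have 0: "(0 = v + w) \<longleftrightarrow> v = 0 \<and> w = 0" for v w :: "'a free_monoid"
    by (cases v; cases w) (auto simp: zero_free_monoid_def plus_free_monoid_def)
  have "(\<Sum>w. Poly_Mapping.lookup g w when v = 0 \<and> w = 0) = (Poly_Mapping.lookup g 0 when v = 0)"
    for v :: "'a free_monoid"
    by (cases "v = 0") simp_all
  then have "Poly_Mapping.lookup (f * g) 0
      = (\<Sum>v. Poly_Mapping.lookup f v * Poly_Mapping.lookup g 0 when v = 0)"
    unfolding lookup_mult 0 by (simp add: mult_when)
  then show ?thesis
    by simp
qed

lemma lookup_uea_ideal_zero: "a \<in> uea_ideal \<Longrightarrow> Poly_Mapping.lookup a 0 = 0"
proof (induction rule: uea_ideal.induct)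
  case (step r a u v)
  have "Poly_Mapping.lookup (free_gen x) 0 = 0" for x :: 'a
    by (simp add: free_gen_def zero_free_monoid_def lookup_single)
  with step(1) have "Poly_Mapping.lookup r 0 = 0"
    by cases (simp_all add: lookup_minus lookup_add lookup_free_mult_zero)
  with step show ?case
    by (simp add: lookup_add lookup_free_mult_zero)
qed simp

definition uea_eq :: "'a :: lie_superalgebra free_algebra \<Rightarrow> 'a free_algebra \<Rightarrow> bool" where
  "uea_eq a b \<longleftrightarrow> a - b \<in> uea_ideal"

lemma equivp_uea_eq:
  "equivp (uea_eq :: 'a :: lie_superalgebra free_algebra \<Rightarrow> 'a free_algebra \<Rightarrow> bool)"
proof (rule equivpI)
  show "reflp (uea_eq :: 'a free_algebra \<Rightarrow> _)"
    by (simp add: reflp_def uea_eq_def uea_ideal.zero)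
  show "symp (uea_eq :: 'a free_algebra \<Rightarrow> _)"
    unfolding symp_def uea_eq_def by (metis minus_diff_eq uea_ideal_uminus)
  show "transp (uea_eq :: 'a free_algebra \<Rightarrow> _)"
    unfolding transp_def uea_eq_def
  proof (intro allI impI)
    fix a b c :: "'a free_algebra"
    assume "a - b \<in> uea_ideal" "b - c \<in> uea_ideal"
    from uea_ideal_add[OF this] show "a - c \<in> uea_ideal"
      by simp
  qed
qed

quotient_type (overloaded) 'a uea = "'a :: lie_superalgebra free_algebra" / uea_eq
  by (rule equivp_uea_eq)

instantiation uea :: (lie_superalgebra) ring_1
begin

lift_definition zero_uea :: "'a uea" is 0 .
lift_definition one_uea :: "'a uea" is 1 .

lift_definition plus_uea :: "'a uea \<Rightarrow> 'a uea \<Rightarrow> 'a uea" is "(+)"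
  unfolding uea_eq_def by (metis add_diff_add uea_ideal_add)

lift_definition uminus_uea :: "'a uea \<Rightarrow> 'a uea" is uminus
  unfolding uea_eq_def by (metis minus_diff_minus uea_ideal_uminus)

lift_definition minus_uea :: "'a uea \<Rightarrow> 'a uea \<Rightarrow> 'a uea" is "(-)"
proof -
  fix a b c d :: "'a free_algebra"
  assume "uea_eq a b" "uea_eq c d"
  then have "(a - b) + - (c - d) \<in> uea_ideal"
    unfolding uea_eq_def by (intro uea_ideal_add uea_ideal_uminus)
  then show "uea_eq (a - c) (b - d)"
    by (simp add: uea_eq_def algebra_simps)
qed

lift_definition times_uea :: "'a uea \<Rightarrow> 'a uea \<Rightarrow> 'a uea" is "(*)"
proof -
  fix a b c d :: "'a free_algebra"
  assume "uea_eq a b" "uea_eq c d"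
  then have "(a - b) * c + b * (c - d) \<in> uea_ideal"
    unfolding uea_eq_def by (intro uea_ideal_add uea_ideal_mult_left uea_ideal_mult_right)
  then show "uea_eq (a * c) (b * d)"
    by (simp add: uea_eq_def algebra_simps)
qed

instance
proof
  have eqI: "uea_eq a b" if "a = b" for a b :: "'a free_algebra"
    using that by (simp add: uea_eq_def uea_ideal.zero)
  fix a b c :: "'a uea"
  show "a + b + c = a + (b + c)" "a + b = b + a" "0 + a = a" "- a + a = 0" "a - b = a + - b"
    "a * b * c = a * (b * c)" "1 * a = a" "a * 1 = a"
    "(a + b) * c = a * c + b * c" "a * (b + c) = a * b + a * c"
    by (transfer; rule eqI; simp add: algebra_simps)+
  show "(0 :: 'a uea) \<noteq> 1"
  proof (transfer, rule notI)
    assume "uea_eq (0 :: 'a free_algebra) 1"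
    then have "(- 1 :: 'a free_algebra) \<in> uea_ideal"
      by (simp add: uea_eq_def)
    from lookup_uea_ideal_zero[OF this] show False
      by simp
  qed
qed

end

lift_definition uea_const :: "complex \<Rightarrow> 'a :: lie_superalgebra uea" is free_const .

lift_definition uea_inc :: "'a :: lie_superalgebra \<Rightarrow> 'a uea" is free_gen .

definition uea_scale :: "complex \<Rightarrow> 'a :: lie_superalgebra uea \<Rightarrow> 'a uea" where
  "uea_scale c u = uea_const c * u"

lemma uea_const_simps:
  "uea_const (c + d) = uea_const c + uea_const d"
  "uea_const (c * d) = uea_const c * uea_const d"
  "uea_const 1 = 1"
  by (simp_all add: uea_const_def plus_uea.abs_eq times_uea.abs_eq one_uea.abs_eq
      free_const_def single_add mult_single)


global_interpretation uea: vector_space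
    "uea_scale :: complex \<Rightarrow> 'a :: lie_superalgebra uea \<Rightarrow> 'a uea"
  by standard (simp_all add: uea_scale_def uea_const_simps algebra_simps)

definition uea_par :: "bit \<Rightarrow> 'a :: lie_superalgebra uea set" where
  "uea_par q = uea.span {prod_list (map (uea_inc \<circ> snd) pxs) | pxs.
     (\<forall>(p, x) \<in> set pxs. lpart p x = x) \<and> sum_list (map fst pxs) = q}"

text \<open>The component \<open>U(L[t])[s]\<close> of degree \<open>s\<close> in \<open>t\<close>.\<close>

definition uea_deg :: "nat \<Rightarrow> 'a :: lie_superalgebra poly uea set" where
  "uea_deg s = uea.span {prod_list (map (\<lambda>(x, m). uea_inc (monom x m)) xms) | xms.
     sum_list (map snd xms) = s}"

inductive_set left_ideal :: "'a :: lie_superalgebra uea set \<Rightarrow> 'a uea set"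
  for S :: "'a uea set" where
  zero: "0 \<in> left_ideal S"
| step: "s \<in> S \<Longrightarrow> a \<in> left_ideal S \<Longrightarrow> u * s + a \<in> left_ideal S"


section \<open>Modules\<close>

text \<open>A $\mathbb{Z}_2$-graded module over a Lie superalgebra: a complex vector space with an
  action and the sets of homogeneous vectors of either parity. The fields \<open>mult\<close> and \<open>one\<close>
  inherited from the ring record carry no information.\<close>

record ('l, 'v) smodule = "(complex, 'v) module" +
  act :: "'l \<Rightarrow> 'v \<Rightarrow> 'v"
  par :: "bit \<Rightarrow> 'v set"

definition smod_iso :: "('l, 'v) smodule \<Rightarrow> ('l, 'w) smodule \<Rightarrow> bool" where
  "smod_iso M N \<longleftrightarrow> (\<exists>f. bij_betw f (carrier M) (carrier N)
     \<and> (\<forall>v\<in>carrier M. \<forall>w\<in>carrier M. f (v \<oplus>\<^bsub>M\<^esub> w) = f v \<oplus>\<^bsub>N\<^esub> f w)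
     \<and> (\<forall>c. \<forall>v\<in>carrier M. f (c \<odot>\<^bsub>M\<^esub> v) = c \<odot>\<^bsub>N\<^esub> f v)
     \<and> (\<forall>x. \<forall>v\<in>carrier M. f (act M x v) = act N x (f v)))"

definition smod_basis :: "('l, 'v) smodule \<Rightarrow> 'v set \<Rightarrow> bool" where
  "smod_basis M B \<longleftrightarrow> finite B \<and> B \<subseteq> carrier M \<and>
     (\<forall>v\<in>carrier M. \<exists>!c. (\<forall>b. b \<notin> B \<longrightarrow> c b = 0) \<and> v = (\<Oplus>\<^bsub>M\<^esub>b\<in>B. c b \<odot>\<^bsub>M\<^esub> b))"

definition has_dim :: "('l, 'v) smodule \<Rightarrow> nat \<Rightarrow> bool" where
  "has_dim M d \<longleftrightarrow> (\<exists>B. smod_basis M B \<and> card B = d)"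

definition smod_quotient :: "('l, 'v) smodule \<Rightarrow> 'v set \<Rightarrow> ('l, 'v set) smodule" where
  "smod_quotient M N =
    \<lparr>carrier = a_rcosets\<^bsub>M\<^esub> N, mult = undefined, one = undefined, zero = N, add = set_add M,
     smult = (\<lambda>c A. \<Union>a\<in>A. N +>\<^bsub>M\<^esub> (c \<odot>\<^bsub>M\<^esub> a)),
     act = (\<lambda>x A. \<Union>a\<in>A. N +>\<^bsub>M\<^esub> act M x a),
     par = (\<lambda>p. (\<lambda>a. N +>\<^bsub>M\<^esub> a) ` par M p)\<rparr>"

text \<open>The underlying graded vector space of a graded subspace; the action is merely inherited and
  need not preserve the subspace.\<close>

definition restrict_to :: "('l, 'v) smodule \<Rightarrow> 'v set \<Rightarrow> ('l, 'v) smodule" where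
  "restrict_to M S = M\<lparr>carrier := S, par := (\<lambda>p. par M p \<inter> S)\<rparr>"

text \<open>The action of the enveloping algebra induced by a module structure: a product
  \<open>x\<^sub>1 \<dots> x\<^sub>k\<close> acts by \<open>v \<mapsto> x\<^sub>1(\<dots>(x\<^sub>k v))\<close>. For an actual module the result does not depend on
  the representative \<open>rep_uea u\<close> in the free algebra.\<close>

definition uea_act :: "('l :: lie_superalgebra, 'v) smodule \<Rightarrow> 'l uea \<Rightarrow> 'v \<Rightarrow> 'v" where
  "uea_act M u v = (\<Oplus>\<^bsub>M\<^esub>w\<in>Poly_Mapping.keys (rep_uea u).
     Poly_Mapping.lookup (rep_uea u) w \<odot>\<^bsub>M\<^esub> foldr (act M) (letters w) v)"

definition uea_regular :: "('l :: lie_superalgebra, 'l uea) smodule" where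
  "uea_regular = \<lparr>carrier = UNIV, mult = undefined, one = undefined, zero = 0, add = (+),
     smult = uea_scale, act = (\<lambda>x u. uea_inc x * u), par = uea_par\<rparr>"


subsection \<open>Generalized Kac modules and graded local Weyl modules\<close>

definition kac_ideal :: "weight \<Rightarrow> sl12 uea set" where
  "kac_ideal l = left_ideal (uea_inc ` nplus
     \<union> {uea_inc (cartan_elt a b) - uea_const (wt_apply l a b) | a b. True}
     \<union> {uea_inc sl_y2 ^ (wt_nat l + 1)})"

definition kac :: "weight \<Rightarrow> (sl12, sl12 uea set) smodule" where
  "kac l = smod_quotient uea_regular (kac_ideal l)"

definition kac_gen :: "weight \<Rightarrow> sl12 uea set" where
  "kac_gen l = kac_ideal l +>\<^bsub>uea_regular :: (sl12, sl12 uea) smodule\<^esub> 1"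

definition weyl_ideal :: "weight \<Rightarrow> sl12 poly uea set" where
  "weyl_ideal l = left_ideal (uea_inc ` {p. \<forall>i. coeff p i \<in> nplus}
     \<union> {uea_inc (monom (cartan_elt a b) r) - uea_const (if r = 0 then wt_apply l a b else 0)
         | a b r. True}
     \<union> {uea_inc (monom sl_y2 0) ^ (wt_nat l + 1)})"

definition local_weyl :: "weight \<Rightarrow> (sl12 poly, sl12 poly uea set) smodule" where
  "local_weyl l = smod_quotient uea_regular (weyl_ideal l)"


subsection \<open>Evaluation modules\<close>

definition eval_module :: "complex \<Rightarrow> ('l :: lie_superalgebra, 'v) smodule \<Rightarrow> ('l poly, 'v) smodule"
  where
  "eval_module z V = \<lparr>carrier = carrier V, mult = undefined, one = undefined, zero = zero V,
     add = add V, smult = smult V,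
     act = (\<lambda>p. act V (\<Sum>a\<le>degree p. lscale (z ^ a) (coeff p a))),
     par = par V\<rparr>"


subsection \<open>Tensor products\<close>

definition par_comp :: "('l, 'v) smodule \<Rightarrow> bit \<Rightarrow> 'v \<Rightarrow> 'v" where
  "par_comp V p v = (THE w. w \<in> par V p \<and> (\<exists>w'\<in>par V (p + 1). v = w \<oplus>\<^bsub>V\<^esub> w'))"

text \<open>\<open>koszul V p\<close> multiplies a homogeneous \<open>v\<close> by $(-1)^{p |v|}$: the sign picked up when
  an operator of parity \<open>p\<close> passes \<open>v\<close>.\<close>

definition koszul :: "('l, 'v) smodule \<Rightarrow> bit \<Rightarrow> 'v \<Rightarrow> 'v" where
  "koszul V p v = (ssign p 0 \<odot>\<^bsub>V\<^esub> par_comp V 0 v) \<oplus>\<^bsub>V\<^esub> (ssign p 1 \<odot>\<^bsub>V\<^esub> par_comp V 1 v)"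

definition free_scale :: "complex \<Rightarrow> ('k \<Rightarrow>\<^sub>0 complex) \<Rightarrow> ('k \<Rightarrow>\<^sub>0 complex)" where
  "free_scale c f = Poly_Mapping.map ((*) c) f"

lemma lookup_free_scale: "Poly_Mapping.lookup (free_scale c f) k = c * Poly_Mapping.lookup f k"
  by (simp add: free_scale_def map.rep_eq when_def)

global_interpretation free: vector_space
    "free_scale :: complex \<Rightarrow> ('k \<Rightarrow>\<^sub>0 complex) \<Rightarrow> ('k \<Rightarrow>\<^sub>0 complex)"
  by standard
    (simp_all add: poly_mapping_eq_iff fun_eq_iff lookup_free_scale lookup_add algebra_simps)

text \<open>\<open>vs \<in> tuples Vs\<close> iff \<open>vs\<close> is a tuple of vectors \<open>vs ! i\<close> of \<open>Vs ! i\<close>.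
  The tensor product is the space freely spanned by such tuples modulo multilinearity.\<close>

definition tuples :: "('l, 'v) smodule list \<Rightarrow> 'v list set" where
  "tuples Vs = {vs. list_all2 (\<lambda>v V. v \<in> carrier V) vs Vs}"

abbreviation tuple :: "'v list \<Rightarrow> 'v list \<Rightarrow>\<^sub>0 complex" where
  "tuple vs \<equiv> Poly_Mapping.single vs 1"

text \<open>For homogeneous \<open>x\<close> and \<open>v\<^sub>1, \<dots>, v\<^sub>n\<close> this is the usual
  $\sum_i (-1)^{|x|(|v_1| + \dots + |v_{i-1}|)} v_1 \otimes \dots \otimes x v_i \otimes \dots \otimes v_n$.\<close>

definition tuple_act :: "('l :: lie_superalgebra, 'v) smodule list \<Rightarrow> 'l \<Rightarrow> 'v list \<Rightarrow> 'v list \<Rightarrow>\<^sub>0 complex"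
  where
  "tuple_act Vs x vs = (\<Sum>i<length Vs. \<Sum>p\<in>{0, 1}. tuple
     (map (\<lambda>j. koszul (Vs ! j) p (vs ! j)) [0..<i]
       @ act (Vs ! i) (lpart p x) (vs ! i) # drop (Suc i) vs))"

definition free_tensor ::
    "('l :: lie_superalgebra, 'v) smodule list \<Rightarrow> ('l, 'v list \<Rightarrow>\<^sub>0 complex) smodule" where
  "free_tensor Vs =
    \<lparr>carrier = {f. Poly_Mapping.keys f \<subseteq> tuples Vs}, mult = undefined, one = undefined, zero = 0,
     add = (+), smult = free_scale,
     act = (\<lambda>x f. \<Sum>vs\<in>Poly_Mapping.keys f.
       free_scale (Poly_Mapping.lookup f vs) (tuple_act Vs x vs)),
     par = (\<lambda>q. free.span {tuple vs | vs ps. vs \<in> tuples Vs \<and> length ps = length Vs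
       \<and> (\<forall>i<length Vs. vs ! i \<in> par (Vs ! i) (ps ! i)) \<and> sum_list ps = q})\<rparr>"

inductive_set multilinear_relators :: "('l, 'v) smodule list \<Rightarrow> ('v list \<Rightarrow>\<^sub>0 complex) set"
  for Vs :: "('l, 'v) smodule list" where
  add: "vs \<in> tuples Vs \<Longrightarrow> i < length Vs \<Longrightarrow> v \<in> carrier (Vs ! i) \<Longrightarrow> w \<in> carrier (Vs ! i) \<Longrightarrow>
    tuple (vs[i := v \<oplus>\<^bsub>Vs ! i\<^esub> w]) - (tuple (vs[i := v]) + tuple (vs[i := w]))
      \<in> multilinear_relators Vs"
| scale: "vs \<in> tuples Vs \<Longrightarrow> i < length Vs \<Longrightarrow> v \<in> carrier (Vs ! i) \<Longrightarrow>
    tuple (vs[i := c \<odot>\<^bsub>Vs ! i\<^esub> v]) - free_scale c (tuple (vs[i := v]))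
      \<in> multilinear_relators Vs"

definition tensor ::
    "('l :: lie_superalgebra, 'v) smodule list \<Rightarrow> ('l, ('v list \<Rightarrow>\<^sub>0 complex) set) smodule" where
  "tensor Vs = smod_quotient (free_tensor Vs) (free.span (multilinear_relators Vs))"

definition pure_tensor ::
    "('l :: lie_superalgebra, 'v) smodule list \<Rightarrow> 'v list \<Rightarrow> ('v list \<Rightarrow>\<^sub>0 complex) set" where
  "pure_tensor Vs vs = free.span (multilinear_relators Vs) +>\<^bsub>free_tensor Vs\<^esub> tuple vs"


subsection \<open>Associated graded modules and fusion products\<close>

definition filt :: "('l :: lie_superalgebra poly, 'v) smodule \<Rightarrow> 'v \<Rightarrow> nat \<Rightarrow> 'v set" where
  "filt M v n = {uea_act M (\<Sum>i\<le>n. u i) v | u. \<forall>i\<le>n. u i \<in> uea_deg i}"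

text \<open>\<open>filt_pred M v n\<close> is the step of index \<open>n - 1\<close>, with the convention that the step of index
  \<open>-1\<close> is the zero space.\<close>

definition filt_pred :: "('l :: lie_superalgebra poly, 'v) smodule \<Rightarrow> 'v \<Rightarrow> nat \<Rightarrow> 'v set" where
  "filt_pred M v n = (if n = 0 then {\<zero>\<^bsub>M\<^esub>} else filt M v (n - 1))"

definition gr_piece ::
    "('l :: lie_superalgebra poly, 'v) smodule \<Rightarrow> 'v \<Rightarrow> nat \<Rightarrow> ('l poly, 'v set) smodule" where
  "gr_piece M v n = smod_quotient (restrict_to M (filt M v n)) (filt_pred M v n)"

text \<open>The map from the piece of degree \<open>k\<close> to the piece of degree \<open>k + m\<close> induced by $x(m)$.\<close>

definition gr_shift ::
    "('l :: lie_superalgebra poly, 'v) smodule \<Rightarrow> 'v \<Rightarrow> 'l \<Rightarrow> nat \<Rightarrow> nat \<Rightarrow> 'v set \<Rightarrow> 'v set" where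
  "gr_shift M v x m k A = (\<Union>a\<in>A. filt_pred M v (k + m) +>\<^bsub>M\<^esub> act M (monom x m) a)"

definition gr_module ::
    "('l :: lie_superalgebra poly, 'v) smodule \<Rightarrow> 'v \<Rightarrow> ('l poly, nat \<Rightarrow> 'v set) smodule" where
  "gr_module M v = (let C = {f. (\<forall>n. f n \<in> carrier (gr_piece M v n))
        \<and> finite {n. f n \<noteq> \<zero>\<^bsub>gr_piece M v n\<^esub>}} in
    \<lparr>carrier = C, mult = undefined, one = undefined,
     zero = (\<lambda>n. \<zero>\<^bsub>gr_piece M v n\<^esub>),
     add = (\<lambda>f g n. f n \<oplus>\<^bsub>gr_piece M v n\<^esub> g n),
     smult = (\<lambda>c f n. c \<odot>\<^bsub>gr_piece M v n\<^esub> f n),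
     act = (\<lambda>p f n. \<Oplus>\<^bsub>gr_piece M v n\<^esub>m\<in>{..n}. gr_shift M v (coeff p m) m (n - m) (f (n - m))),
     par = (\<lambda>q. {f \<in> C. \<forall>n. f n \<in> par (gr_piece M v n) q})\<rparr>)"

text \<open>The fusion product of a list of triples \<open>(V, v, z)\<close>: a module, a cyclic vector of it, and an
  evaluation parameter.\<close>

definition fusion_product ::
    "(('l :: lie_superalgebra, 'v) smodule \<times> 'v \<times> complex) list
      \<Rightarrow> ('l poly, nat \<Rightarrow> ('v list \<Rightarrow>\<^sub>0 complex) set set) smodule" where
  "fusion_product Vs = (let Ws = map (\<lambda>(V, v, z). eval_module z V) Vs in
     gr_module (tensor Ws) (pure_tensor Ws (map (\<lambda>(V, v, z). v) Vs)))"

end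

theory Submission
  imports Defs "HOL-Library.Function_Algebras"
begin

text \<open>
Write \<open>n = \<lambda>\<^sub>2\<close>. The theorem follows from two estimates. The ideal \<open>I\<close> that defines \<open>W(\<lambda>)\<close> has
codimension at most \<open>4 ^ n\<close> in the enveloping algebra \<open>U\<close> of \<open>\<gg>[t]\<close>, and the fusion product is
\<open>U / K\<close> for a left ideal \<open>K\<close> that contains \<open>I\<close> and has codimension \<open>4 ^ n\<close>. Hence \<open>I = K\<close>, which
gives both the isomorphism and the dimension.

Upper bound (\<open>weyl_spanning\<close>). Modulo \<open>I\<close>, the algebra \<open>U\<close> is spanned by the monomials
\<open>y\<^sub>2(C) y\<^sub>3(B) x\<^sub>1(A)\<close> with lists of exponents \<open>C\<close>, \<open>B\<close>, \<open>A\<close>. The elements \<open>x\<^sub>1(a)\<close> anticommute, as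
do the \<open>y\<^sub>3(b)\<close>, so \<open>A\<close> and \<open>B\<close> may be taken to be finite sets. Filter these monomials by the number
of odd factors and by the degrees of \<open>A\<close> and \<open>B\<close>. In the corresponding subquotient, the monomial
\<open>y\<^sub>3(B) x\<^sub>1(A)\<close> is a highest weight vector of weight \<open>m = n - |A| - |B|\<close> for the current algebra of
the \<open>sl\<^sub>2\<close> spanned by \<open>x\<^sub>2\<close>, \<open>h\<^sub>2\<close>, \<open>y\<^sub>2\<close>. Two facts about such a vector \<open>v\<close> are used.

\<^item> \<open>y\<^sub>2(b) v = 0\<close> for \<open>b \<ge> m\<close>. Bracketing this relation with \<open>x\<^sub>3\<close> and with \<open>y\<^sub>1\<close> shows that only the
sets \<open>A \<subseteq> {0..<n}\<close> and \<open>B \<subseteq> {0..<n - |A|}\<close> matter.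

\<^item> The vectors \<open>y\<^sub>2(C) v\<close> span a space of dimension at most \<open>2 ^ m\<close> (\<open>ymon_spanning\<close>). By Garland's
identity, the products of \<open>k\<close> factors \<open>y\<^sub>2(c)\<close> span a quotient of the ring of symmetric polynomials
in \<open>k\<close> variables by the complete homogeneous polynomials of degree greater than \<open>m - k\<close>, and this
ring has dimension at most \<open>m choose k\<close> (\<open>span_symmetric_mod_hsum\<close>).

Summing \<open>2 ^ (n - |A| - |B|)\<close> over all admissible \<open>A\<close> and \<open>B\<close> gives \<open>4 ^ n\<close>.

Lower bound. The module \<open>K(\<kappa>, 1)\<close> has the basis \<open>k\<close>, \<open>x\<^sub>1 k\<close>, \<open>y\<^sub>3 k\<close>, \<open>y\<^sub>2 k\<close>, in which
\<open>\<gg>\<close> acts by explicit matrices (\<open>kac_matrix\<close>); the matrices give linear independence and the relations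
give spanning. The tensor product of \<open>n\<close> such modules, evaluated at distinct points, is generated by
the tensor product of the generators: an element \<open>x \<otimes> L\<close>, where the polynomial \<open>L\<close> vanishes at all
points but one, acts in a single factor, so every basis tensor is reached (\<open>unit_in_range\<close>). The
associated graded module therefore has dimension \<open>4 ^ n\<close>. The relations of \<open>W(\<lambda>)\<close> hold in it
(\<open>I_subset_K\<close>): only those for \<open>h(r)\<close> with \<open>r > 0\<close> fail in the tensor product itself, where
\<open>h(r)\<close> multiplies the generator by a scalar, and such a multiple of the generator lies in a lower
step of the filtration.

The comparison of the two ideals (\<open>ideal_eq_kernel\<close>) is carried out in \<open>U\<close>: a set of at most \<open>4 ^ n\<close>
homogeneous elements spans \<open>U\<close> modulo \<open>I\<close>, and as their values on the generator span the tensor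
product, they are linearly independent modulo \<open>K\<close>. The homogeneous components of
elements of \<open>U\<close> are obtained from a representation on power series (\<open>deg_act\<close>).

Modules given as records are handled through an injective linear map to a vector space, their
coordinates (\<open>coord_space\<close>).
\<close>

section \<open>The enveloping algebra and its representations\<close>

lemma poly_mapping_eq_sum_single:
  "f = (\<Sum>k\<in>Poly_Mapping.keys f. Poly_Mapping.single k (Poly_Mapping.lookup f k))"
  for f :: "'a \<Rightarrow>\<^sub>0 'b :: comm_monoid_add"
proof (rule poly_mapping_eqI)
  fix i
  show "Poly_Mapping.lookup f i = Poly_Mapping.lookup
      (\<Sum>k\<in>Poly_Mapping.keys f. Poly_Mapping.single k (Poly_Mapping.lookup f k)) i"
    by (simp add: lookup_sum lookup_single when_def in_keys_iff)
qed

lemma poly_mapping_single_induct [case_names single add]: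
  fixes f :: "'a \<Rightarrow>\<^sub>0 'b :: comm_monoid_add"
  assumes "\<And>k c. P (Poly_Mapping.single k c)" and "\<And>f g. P f \<Longrightarrow> P g \<Longrightarrow> P (f + g)"
  shows "P f"
proof -
  have "P (\<Sum>k\<in>S. Poly_Mapping.single k (Poly_Mapping.lookup f k))" if "finite S" for S
    using that
  proof (induction S)
    case empty
    show ?case using assms(1)[of undefined 0] by simp
  qed (simp add: assms)
  then show ?thesis
    using poly_mapping_eq_sum_single[of f] by (metis finite_keys)
qed

lemma uea_inc_add: "uea_inc (x + y) = uea_inc x + uea_inc y"
proof (transfer)
  fix x y :: 'a
  show "uea_eq (free_gen (x + y)) (free_gen x + free_gen y)"
    unfolding uea_eq_def
    using uea_ideal.step[OF uea_relators.add uea_ideal.zero, of 1 x y 1] by simp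
qed

lemma uea_inc_lscale: "uea_inc (lscale c x) = uea_scale c (uea_inc x)"
  unfolding uea_scale_def
proof (transfer)
  fix c and x :: 'a
  show "uea_eq (free_gen (lscale c x)) (free_const c * free_gen x)"
    unfolding uea_eq_def
    using uea_ideal.step[OF uea_relators.scale uea_ideal.zero, of 1 c x 1] by simp
qed

lemma uea_inc_bracket:
  assumes "lpart p x = x" "lpart q y = y"
  shows "uea_inc x * uea_inc y
    = uea_scale (ssign p q) (uea_inc y * uea_inc x) + uea_inc (lbracket x y)"
  using assms unfolding uea_scale_def
proof (transfer)
  fix p q and x y :: 'a
  assume "lpart p x = x" "lpart q y = y"
  then show "uea_eq (free_gen x * free_gen y)
      (free_const (ssign p q) * (free_gen y * free_gen x) + free_gen (lbracket x y))"
    unfolding uea_eq_def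
    using uea_ideal.step[OF uea_relators.bracket uea_ideal.zero, of p x q y 1 1]
    by (simp add: algebra_simps)
qed

lemma uea_inc_zero [simp]: "uea_inc 0 = 0"
  using uea_inc_add[of 0 0] by simp

lemma uea_inc_uminus: "uea_inc (- x) = - uea_inc x"
  using uea_inc_add[of x "- x"] by (simp add: eq_neg_iff_add_eq_0 add.commute)

lemma uea_inc_diff: "uea_inc (x - y) = uea_inc x - uea_inc y"
  using uea_inc_add[of x "- y"] by (simp add: uea_inc_uminus)

lemma uea_inc_sum: "uea_inc (sum f S) = (\<Sum>i\<in>S. uea_inc (f i))"
  by (induction S rule: infinite_finite_induct) (simp_all add: uea_inc_add)

lemma uea_const_commute: "uea_const c * u = u * uea_const c"
proof (transfer)
  fix c and u :: "'a free_algebra"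
  have "free_const c * u = u * free_const c"
  proof (induction u rule: poly_mapping_single_induct)
    case (single k v)
    show ?case by (simp add: free_const_def mult_single mult.commute)
  qed (simp add: algebra_simps)
  then show "uea_eq (free_const c * u) (u * free_const c)"
    by (simp add: uea_eq_def uea_ideal.zero)
qed

lemma uea_scale_mult_left [simp]: "uea_scale c u * v = uea_scale c (u * v)"
  by (simp add: uea_scale_def mult.assoc)

lemma uea_scale_mult_right [simp]: "u * uea_scale c v = uea_scale c (u * v)"
  by (metis mult.assoc uea_const_commute uea_scale_def)

lemma uea_const_eq_scale: "uea_const c = uea_scale c 1"
  by (simp add: uea_scale_def)

lemma abs_uea_sum:
  "abs_uea (sum f S) = (\<Sum>i\<in>S. abs_uea (f i :: 'a :: lie_superalgebra free_algebra))"
  by (induction S rule: infinite_finite_induct)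
    (simp_all add: zero_uea.abs_eq[symmetric] plus_uea.abs_eq[symmetric])

lemma abs_uea_single:
  "abs_uea (Poly_Mapping.single w c) = uea_scale c (prod_list (map uea_inc (letters w)))"
proof -
  have 1: "abs_uea (Poly_Mapping.single (Word xs) 1) = prod_list (map uea_inc xs)" for xs :: "'a list"
  proof (induction xs)
    case Nil
    have "(Poly_Mapping.single (Word []) 1 :: 'a free_algebra) = 1"
      by (simp flip: zero_free_monoid_def)
    then show ?case
      by (simp add: one_uea.abs_eq)
  next
    case (Cons x xs)
    have "(Poly_Mapping.single (Word (x # xs)) 1 :: 'a free_algebra)
        = free_gen x * Poly_Mapping.single (Word xs) 1"
      by (simp add: free_gen_def mult_single plus_free_monoid_def)
    then show ?case
      using Cons by (simp add: times_uea.abs_eq[symmetric] uea_inc.abs_eq)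
  qed
  have "(Poly_Mapping.single w c :: 'a free_algebra) = free_const c * Poly_Mapping.single w 1"
    by (simp add: free_const_def mult_single)
  then show ?thesis
    using 1[of "letters w"]
    by (simp add: times_uea.abs_eq[symmetric] uea_scale_def uea_const.abs_eq)
qed

lemma uea_span_words: "u \<in> uea.span (range (\<lambda>xs. prod_list (map uea_inc xs)))"
proof -
  obtain f where u: "u = abs_uea f"
    by (metis Quotient3_abs_rep Quotient3_uea)
  have "u = (\<Sum>w\<in>Poly_Mapping.keys f.
      uea_scale (Poly_Mapping.lookup f w) (prod_list (map uea_inc (letters w))))"
    unfolding u by (subst poly_mapping_eq_sum_single) (simp only: abs_uea_sum abs_uea_single)
  also have "\<dots> \<in> uea.span (range (\<lambda>xs. prod_list (map uea_inc xs)))"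
    by (intro uea.span_sum uea.span_scale uea.span_base) auto
  finally show ?thesis .
qed

lemma uea_induct [case_names one add scale mult]:
  assumes "P 1" and "\<And>u v. P u \<Longrightarrow> P v \<Longrightarrow> P (u + v)" and "\<And>c u. P u \<Longrightarrow> P (uea_scale c u)"
    and "\<And>x u. P u \<Longrightarrow> P (uea_inc x * u)"
  shows "P u"
proof -
  have "P (prod_list (map uea_inc xs))" for xs
    by (induction xs) (simp_all add: assms)
  moreover have "P 0"
    using assms(3)[OF assms(1), of 0] by simp
  ultimately show ?thesis
    by (intro uea.span_induct_alt[OF uea_span_words, of P u]) (auto intro: assms)
qed

locale complex_space = vector_space sc for sc :: "complex \<Rightarrow> 'v :: ab_group_add \<Rightarrow> 'v"
begin

definition lin_ext :: "('k \<Rightarrow> 'v) \<Rightarrow> ('k \<Rightarrow>\<^sub>0 complex) \<Rightarrow> 'v" where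
  "lin_ext F f = (\<Sum>k\<in>Poly_Mapping.keys f. sc (Poly_Mapping.lookup f k) (F k))"

lemma lin_ext_superset:
  assumes "finite S" "Poly_Mapping.keys f \<subseteq> S"
  shows "lin_ext F f = (\<Sum>k\<in>S. sc (Poly_Mapping.lookup f k) (F k))"
  unfolding lin_ext_def using assms
  by (intro sum.mono_neutral_left) (auto simp: in_keys_iff)

lemma lin_ext_add: "lin_ext F (f + g) = lin_ext F f + lin_ext F g"
proof -
  let ?S = "Poly_Mapping.keys f \<union> Poly_Mapping.keys g"
  have "Poly_Mapping.keys (f + g) \<subseteq> ?S"
    by (rule Poly_Mapping.keys_add)
  then show ?thesis
    by (simp add: lin_ext_superset[of ?S] lookup_add scale_left_distrib sum.distrib)
qed

lemma lin_ext_single: "lin_ext F (Poly_Mapping.single k c) = sc c (F k)"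
  by (simp add: lin_ext_def)

lemma lin_ext_zero [simp]: "lin_ext F 0 = 0"
  by (simp add: lin_ext_def)

lemma lin_ext_uminus: "lin_ext F (- f) = - lin_ext F f"
  using lin_ext_add[of F f "- f"] by (simp add: eq_neg_iff_add_eq_0 add.commute)

lemma lin_ext_diff: "lin_ext F (f - g) = lin_ext F f - lin_ext F g"
  using lin_ext_add[of F f "- g"] by (simp add: lin_ext_uminus)

lemma lin_ext_sum: "lin_ext F (sum f S) = (\<Sum>i\<in>S. lin_ext F (f i))"
  by (induction S rule: infinite_finite_induct) (simp_all add: lin_ext_add)

lemma lin_ext_free_scale: "lin_ext F (free_scale c f) = sc c (lin_ext F f)"
proof -
  have "Poly_Mapping.keys (free_scale c f) \<subseteq> Poly_Mapping.keys f"
    by (auto simp: in_keys_iff lookup_free_scale)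
  then show ?thesis
    by (simp add: lin_ext_superset[of "Poly_Mapping.keys f"] lookup_free_scale scale_sum_right)
qed

end

locale uea_rep = complex_space sc
  for sc :: "complex \<Rightarrow> 'w :: ab_group_add \<Rightarrow> 'w" +
  fixes \<rho> :: "'l :: lie_superalgebra \<Rightarrow> 'w \<Rightarrow> 'w"
  assumes rho_add_right: "\<rho> x (v + w) = \<rho> x v + \<rho> x w"
    and rho_scale_right: "\<rho> x (sc c w) = sc c (\<rho> x w)"
    and rho_add_left: "\<rho> (x + y) w = \<rho> x w + \<rho> y w"
    and rho_scale_left: "\<rho> (lscale c x) w = sc c (\<rho> x w)"
    and rho_bracket: "lpart p x = x \<Longrightarrow> lpart q y = y \<Longrightarrow>
      \<rho> x (\<rho> y w) - sc (ssign p q) (\<rho> y (\<rho> x w)) = \<rho> (lbracket x y) w"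
begin

lemma rho_zero_right [simp]: "\<rho> x 0 = 0"
  using rho_add_right[of x 0 0] by simp

lemma rho_zero_left [simp]: "\<rho> 0 w = 0"
  using rho_add_left[of 0 0 w] by simp

lemma rho_sum_right: "\<rho> x (sum f S) = (\<Sum>i\<in>S. \<rho> x (f i))"
  by (induction S rule: infinite_finite_induct) (simp_all add: rho_add_right)

lemma foldr_rho_linear:
  "foldr \<rho> xs (v + w) = foldr \<rho> xs v + foldr \<rho> xs w"
  "foldr \<rho> xs (sc c w) = sc c (foldr \<rho> xs w)"
  by (induction xs) (simp_all add: rho_add_right rho_scale_right)

definition free_act :: "'l free_algebra \<Rightarrow> 'w \<Rightarrow> 'w" where
  "free_act f w = lin_ext (\<lambda>k. foldr \<rho> (letters k) w) f"

lemma free_act_add: "free_act (f + g) w = free_act f w + free_act g w"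
  and free_act_diff: "free_act (f - g) w = free_act f w - free_act g w"
  and free_act_zero [simp]: "free_act 0 w = 0"
  and free_act_single: "free_act (Poly_Mapping.single k c) w = sc c (foldr \<rho> (letters k) w)"
  by (simp_all add: free_act_def lin_ext_add lin_ext_diff lin_ext_single)

lemma free_act_linear:
  "free_act f (v + w) = free_act f v + free_act f w"
  "free_act f (sc c w) = sc c (free_act f w)"
  by (simp_all add: free_act_def lin_ext_def foldr_rho_linear scale_right_distrib sum.distrib
      scale_sum_right mult.commute)

lemma free_act_mult: "free_act (f * g) w = free_act f (free_act g w)"
proof (induction f rule: poly_mapping_single_induct)
  case (single k c)
  show ?case
  proof (induction g rule: poly_mapping_single_induct)
    case (single l d)
    then show ?case
      by (simp add: mult_single free_act_single plus_free_monoid_def foldr_rho_linear)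
  qed (simp add: algebra_simps free_act_add free_act_linear)
qed (simp add: algebra_simps free_act_add)

text \<open>The assumptions on \<open>\<rho>\<close> say that the three kinds of relators act by zero. As a relator may stand
  between arbitrary elements \<open>u\<close> and \<open>v\<close>, the linearity of the operators is used as well.\<close>

lemma free_act_ideal: "a \<in> uea_ideal \<Longrightarrow> free_act a w = 0"
proof (induction rule: uea_ideal.induct)
  case (step r a u v)
  have "free_act r w' = 0" for w'
    using step(1)
  proof cases
    case (add x y)
    then show ?thesis
      by (simp add: free_act_add free_act_diff free_gen_def free_act_single rho_add_left)
  next
    case (scale c x)
    then show ?thesis
      by (simp add: free_act_diff free_act_mult free_gen_def free_const_def free_act_single
          rho_scale_left zero_free_monoid_def)
  next
    case (bracket p x q y)
    then show ?thesis
      by (simp add: free_act_diff free_act_mult free_gen_def free_const_def free_act_single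
          rho_bracket zero_free_monoid_def)
  qed
  then have "free_act u (free_act r (free_act v w)) = 0"
    using free_act_linear(2)[of u 0 0] by simp
  with step show ?case
    by (simp add: free_act_add free_act_mult)
qed simp

definition tact :: "'l uea \<Rightarrow> 'w \<Rightarrow> 'w" where
  "tact u w = free_act (rep_uea u) w"

lemma tact_abs: "tact (abs_uea f) w = free_act f w"
proof -
  have "uea_eq (rep_uea (abs_uea f)) f"
    by (simp add: Quotient3_uea rep_abs_rsp_left equivp_reflp[OF equivp_uea_eq])
  then show ?thesis
    unfolding tact_def uea_eq_def using free_act_ideal free_act_diff by fastforce
qed

lemma tact_add: "tact (u + v) w = tact u w + tact v w"
proof -
  obtain f g where "u = abs_uea f" "v = abs_uea g"
    by (metis Quotient3_abs_rep Quotient3_uea)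
  then show ?thesis
    by (simp add: plus_uea.abs_eq tact_abs free_act_add)
qed

lemma tact_mult: "tact (u * v) w = tact u (tact v w)"
proof -
  obtain f g where "u = abs_uea f" "v = abs_uea g"
    by (metis Quotient3_abs_rep Quotient3_uea)
  then show ?thesis
    by (simp add: times_uea.abs_eq tact_abs free_act_mult)
qed

lemma tact_const: "tact (uea_const c) w = sc c w"
  by (simp add: uea_const.abs_eq tact_abs free_const_def free_act_single zero_free_monoid_def)

lemma tact_scale: "tact (uea_scale c u) w = sc c (tact u w)"
  by (simp add: uea_scale_def tact_mult tact_const)

lemma tact_one [simp]: "tact 1 w = w"
  using tact_const[of 1 w] by (simp add: uea_const_simps)

lemma tact_inc: "tact (uea_inc x) w = \<rho> x w"
  by (simp add: uea_inc.abs_eq tact_abs free_gen_def free_act_single)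

lemma tact_zero [simp]: "tact 0 w = 0"
  using tact_add[of 0 0 w] by simp

lemma tact_diff: "tact (u - v) w = tact u w - tact v w"
  using tact_add[of "u - v" v w] by (simp add: algebra_simps)

lemma tact_sum: "tact (sum f S) w = (\<Sum>i\<in>S. tact (f i) w)"
  by (induction S rule: infinite_finite_induct) (simp_all add: tact_add)

lemma tact_linear:
  "tact u (v + w) = tact u v + tact u w" "tact u (sc c w) = sc c (tact u w)"
  by (simp_all add: tact_def free_act_linear)

lemma linear_tact: "Vector_Spaces.linear uea_scale sc (\<lambda>u. tact u w)"
  by unfold_locales (simp_all add: tact_add tact_scale uea_const_simps algebra_simps)

end

section \<open>Degree components in the enveloping algebra of a current algebra\<close>

definition fun_scale :: "(complex \<Rightarrow> 'b \<Rightarrow> 'b) \<Rightarrow> complex \<Rightarrow> ('a \<Rightarrow> 'b) \<Rightarrow> 'a \<Rightarrow> 'b" where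
  "fun_scale s c f = (\<lambda>i. s c (f i))"

lemma vector_space_fun_scale:
  assumes "vector_space s"
  shows "vector_space (fun_scale s)"
proof -
  interpret vector_space s by fact
  show ?thesis
    by standard (simp_all add: fun_scale_def fun_eq_iff scale_right_distrib scale_left_distrib)
qed

text \<open>A sequence \<open>f\<close> is read as the power series \<open>\<Sum> f(n) z^n\<close> over the enveloping algebra. The
  substitution \<open>t \<mapsto> t z\<close> sends \<open>p\<close> to the series \<open>\<Sum> p\<^sub>m(m) z^m\<close>, where \<open>p\<^sub>m\<close> is the coefficient of
  \<open>p\<close> at \<open>t^m\<close>, and \<open>deg_act p\<close> is the left multiplication by this series. The substitution is a
  homomorphism, so this is a representation of the current algebra. It splits the elements of the
  enveloping algebra into their homogeneous components.\<close>

definition deg_act :: "'l :: lie_superalgebra poly \<Rightarrow> (nat \<Rightarrow> 'l poly uea) \<Rightarrow> nat \<Rightarrow> 'l poly uea" where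
  "deg_act p f = (\<lambda>n. \<Sum>m\<le>n. uea_inc (monom (coeff p m) m) * f (n - m))"

lemma lpart_monom: "lpart q (monom x m) = monom (lpart q x) m" for x :: "'a :: lie_superalgebra"
  by (rule poly_eqI) (simp add: coeff_lpart_poly)

lemma uea_inc_monom_bracket:
  assumes "lpart p x = x" "lpart q y = y"
  shows "uea_inc (monom x a) * uea_inc (monom y b)
    = uea_scale (ssign p q) (uea_inc (monom y b) * uea_inc (monom x a))
      + uea_inc (monom (lbracket x y) (a + b))"
  using uea_inc_bracket[of p "monom x a" q "monom y b"] assms
  by (simp add: lpart_monom lbracket_monom)

global_interpretation deg: uea_rep "fun_scale uea_scale" deg_act
  defines deg_tact = deg.tact
proof -
  interpret complex_space "fun_scale uea_scale :: complex \<Rightarrow> (nat \<Rightarrow> 'l :: lie_superalgebra poly uea) \<Rightarrow> _"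
    unfolding complex_space_def by (rule vector_space_fun_scale) (rule uea.vector_space_axioms)
  show "uea_rep (fun_scale uea_scale :: complex \<Rightarrow> (nat \<Rightarrow> 'l poly uea) \<Rightarrow> _) deg_act"
  proof
    fix x y :: "'l poly" and v w :: "nat \<Rightarrow> 'l poly uea" and c p q
    show "deg_act x (v + w) = deg_act x v + deg_act x w"
      by (simp add: deg_act_def fun_eq_iff distrib_left sum.distrib)
    show "deg_act x (fun_scale uea_scale c w) = fun_scale uea_scale c (deg_act x w)"
      by (simp add: deg_act_def fun_scale_def fun_eq_iff uea.scale_sum_right)
    show "deg_act (x + y) w = deg_act x w + deg_act y w"
      by (simp add: deg_act_def fun_eq_iff distrib_right sum.distrib uea_inc_add flip: add_monom)
    show "deg_act (lscale c x) w = fun_scale uea_scale c (deg_act x w)"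
      by (simp add: deg_act_def fun_scale_def fun_eq_iff uea.scale_sum_right coeff_lscale_poly
          uea_inc_lscale flip: lscale_monom)
    assume x: "lpart p x = x" and y: "lpart q y = y"
    have xi: "lpart p (coeff x i) = coeff x i" and yi: "lpart q (coeff y i) = coeff y i" for i
      using x y by (metis coeff_lpart_poly)+
    let ?X = "\<lambda>i. uea_inc (monom (coeff x i) i)" and ?Y = "\<lambda>i. uea_inc (monom (coeff y i) i)"
    have nest: "(\<Sum>m\<le>n. a m * (\<Sum>k\<le>n - m. b k * w (n - m - k)))
        = (\<Sum>k\<le>n. \<Sum>i\<le>k. a i * b (k - i) * w (n - k))" for a b :: "nat \<Rightarrow> 'l poly uea" and n
    proof -
      have "(\<Sum>m\<le>n. a m * (\<Sum>k\<le>n - m. b k * w (n - m - k)))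
          = (\<Sum>m\<le>n. \<Sum>k\<le>n - m. a m * b k * w (n - (m + k)))"
        by (simp add: sum_distrib_left mult.assoc)
      also have "\<dots> = (\<Sum>(m, k)\<in>(SIGMA m:{..n}. {..n - m}). a m * b k * w (n - (m + k)))"
        by (simp add: sum.Sigma)
      also have "(SIGMA m:{..n}. {..n - m}) = {(m, k). m + k \<le> n}"
        by auto
      also have "(\<Sum>(m, k)\<in>{(m, k). m + k \<le> n}. a m * b k * w (n - (m + k)))
          = (\<Sum>k\<le>n. \<Sum>i\<le>k. a i * b (k - i) * w (n - (i + (k - i))))"
        by (rule sum.triangle_reindex_eq)
      also have "\<dots> = (\<Sum>k\<le>n. \<Sum>i\<le>k. a i * b (k - i) * w (n - k))"
        by (intro sum.cong) auto
      finally show ?thesis .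
    qed
    have flip: "(\<Sum>i\<le>k. ?Y i * ?X (k - i)) = (\<Sum>i\<le>k. ?Y (k - i) * ?X i)" for k
      by (rule sum.reindex_bij_witness[where i = "\<lambda>i. k - i" and j = "\<lambda>i. k - i"]) auto
    have br: "(\<Sum>i\<le>k. ?X i * ?Y (k - i))
        = uea_scale (ssign p q) (\<Sum>i\<le>k. ?Y i * ?X (k - i))
          + uea_inc (monom (coeff (lbracket x y) k) k)" for k
    proof -
      have "(\<Sum>i\<le>k. ?X i * ?Y (k - i)) = (\<Sum>i\<le>k. uea_scale (ssign p q) (?Y (k - i) * ?X i)
          + uea_inc (monom (lbracket (coeff x i) (coeff y (k - i))) k))"
        by (rule sum.cong[OF refl]) (subst uea_inc_monom_bracket[OF xi yi], simp)
      also have "\<dots> = uea_scale (ssign p q) (\<Sum>i\<le>k. ?Y (k - i) * ?X i)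
          + uea_inc (monom (coeff (lbracket x y) k) k)"
        by (simp add: sum.distrib uea.scale_sum_right coeff_lbracket_poly monom_sum
            flip: uea_inc_sum)
      finally show ?thesis
        by (simp add: flip)
    qed
    show "deg_act x (deg_act y w) - fun_scale uea_scale (ssign p q) (deg_act y (deg_act x w))
        = deg_act (lbracket x y) w"
    proof (rule ext)
      fix n
      have "deg_act x (deg_act y w) n = (\<Sum>k\<le>n. (\<Sum>i\<le>k. ?X i * ?Y (k - i)) * w (n - k))"
        unfolding deg_act_def nest sum_distrib_right ..
      moreover have "deg_act y (deg_act x w) n = (\<Sum>k\<le>n. (\<Sum>i\<le>k. ?Y i * ?X (k - i)) * w (n - k))"
        unfolding deg_act_def nest sum_distrib_right ..
      ultimately show "(deg_act x (deg_act y w)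
          - fun_scale uea_scale (ssign p q) (deg_act y (deg_act x w))) n = deg_act (lbracket x y) w n"
        by (simp add: br fun_scale_def distrib_right sum.distrib flip: uea.scale_sum_right)
          (simp add: deg_act_def)
    qed
  qed
qed

text \<open>The element \<open>u\<close> acts on the constant series \<open>1\<close>; the coefficient of the result at \<open>z^n\<close> is the
  component of \<open>u\<close> of degree \<open>n\<close> in \<open>t\<close>.\<close>

definition dcomp :: "nat \<Rightarrow> 'l :: lie_superalgebra poly uea \<Rightarrow> 'l poly uea" where
  "dcomp n u = deg_tact u (\<lambda>i. if i = 0 then 1 else 0) n"

lemma dcomp_add: "dcomp n (u + v) = dcomp n u + dcomp n v"
  by (simp add: dcomp_def deg.tact_add)

lemma dcomp_scale: "dcomp n (uea_scale c u) = uea_scale c (dcomp n u)"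
  by (simp add: dcomp_def deg.tact_scale fun_scale_def)

lemma dcomp_diff: "dcomp n (u - v) = dcomp n u - dcomp n v"
  by (simp add: dcomp_def deg.tact_diff)

lemma dcomp_zero [simp]: "dcomp n 0 = 0"
  by (simp add: dcomp_def deg.tact_zero)

lemma dcomp_sum: "dcomp n (sum f S) = (\<Sum>i\<in>S. dcomp n (f i))"
  by (induction S rule: infinite_finite_induct) (simp_all add: dcomp_add)

lemma dcomp_one: "dcomp n 1 = (if n = 0 then 1 else 0)"
  by (simp add: dcomp_def deg.tact_one)

lemma dcomp_inc_mult:
  "dcomp n (uea_inc p * u) = (\<Sum>m\<le>n. uea_inc (monom (coeff p m) m) * dcomp (n - m) u)"
  by (simp add: dcomp_def deg.tact_mult deg.tact_inc deg_act_def)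

lemma subspace_uea_deg: "uea.subspace (uea_deg s)"
  by (simp add: uea_deg_def uea.subspace_span)

lemma uea_deg_mult: "u \<in> uea_deg s \<Longrightarrow> uea_inc (monom x m) * u \<in> uea_deg (m + s)"
  unfolding uea_deg_def
proof (induction rule: uea.span_induct_alt)
  case (step c w v)
  then obtain xms where w: "w = prod_list (map (\<lambda>(x, m). uea_inc (monom x m)) xms)"
    "sum_list (map snd xms) = s" by auto
  have "uea_inc (monom x m) * w \<in> uea.span {prod_list (map (\<lambda>(x, m). uea_inc (monom x m)) xms) |xms.
             sum_list (map snd xms) = m + s}"
    using w by (intro uea.span_base CollectI exI[of _ "(x, m) # xms"]) simp
  with step show ?case
    by (simp add: distrib_left uea.span_add uea.span_scale)
qed (simp add: uea.span_zero)

lemma one_in_uea_deg: "1 \<in> uea_deg 0"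
  unfolding uea_deg_def by (rule uea.span_base) (auto intro!: exI[of _ "[]"])

lemma dcomp_in_uea_deg: "dcomp n u \<in> uea_deg n"
proof (induction u arbitrary: n rule: uea_induct)
  case one
  then show ?case
    using one_in_uea_deg uea.subspace_0[OF subspace_uea_deg] by (auto simp: dcomp_one)
next
  case (mult x u)
  have "uea_inc (monom (coeff x m) m) * dcomp (n - m) u \<in> uea_deg n" if "m \<le> n" for m
    using uea_deg_mult[OF mult[of "n - m"], of "coeff x m" m] that by simp
  then show ?case
    unfolding dcomp_inc_mult by (intro uea.subspace_sum[OF subspace_uea_deg]) auto
qed (simp_all add: dcomp_add dcomp_scale uea.subspace_add[OF subspace_uea_deg]
    uea.subspace_scale[OF subspace_uea_deg])

lemma dcomp_uea_deg: "u \<in> uea_deg s \<Longrightarrow> dcomp n u = (if n = s then u else 0)"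
proof -
  have word: "dcomp n (prod_list (map (\<lambda>(x, m). uea_inc (monom x m)) xms))
      = (if n = sum_list (map snd xms)
         then prod_list (map (\<lambda>(x, m). uea_inc (monom x m)) xms) else 0)"
    for n and xms :: "('a \<times> nat) list"
  proof (induction xms arbitrary: n)
    case (Cons xm xms)
    obtain x m where xm: "xm = (x, m)" by force
    have "dcomp n (uea_inc (monom x m) * prod_list (map (\<lambda>(x, m). uea_inc (monom x m)) xms))
       = (\<Sum>k\<le>n. if k = m then uea_inc (monom x m)
           * dcomp (n - m) (prod_list (map (\<lambda>(x, m). uea_inc (monom x m)) xms)) else 0)"
      unfolding dcomp_inc_mult by (rule sum.cong) auto
    also have "\<dots> = (if m \<le> n then uea_inc (monom x m)
           * dcomp (n - m) (prod_list (map (\<lambda>(x, m). uea_inc (monom x m)) xms)) else 0)"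
      by simp
    finally show ?case
      by (auto simp: xm Cons)
  qed (simp add: dcomp_one)
  assume "u \<in> uea_deg s"
  then show ?thesis
    unfolding uea_deg_def
    by (induction rule: uea.span_induct_alt) (auto simp: dcomp_add dcomp_scale word)
qed

lemma uea_deg_decomposition:
  "\<exists>N. (\<forall>n>N. dcomp n u = 0) \<and> u = (\<Sum>n\<le>N. dcomp n u)"
proof -
  have "u \<in> uea.span (\<Union>s. uea_deg s)"
  proof (induction u rule: uea_induct)
    case one
    then show ?case using one_in_uea_deg by (intro uea.span_base) blast
  next
    case (mult p u)
    from mult show ?case
    proof (induction rule: uea.span_induct_alt)
      case (step c w v)
      then obtain s where w: "w \<in> uea_deg s" by auto
      have "uea_inc p * w = (\<Sum>m\<le>degree p. uea_inc (monom (coeff p m) m) * w)"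
        by (simp add: poly_as_sum_of_monoms flip: sum_distrib_right uea_inc_sum)
      also have "\<dots> \<in> uea.span (\<Union>s. uea_deg s)"
        using uea_deg_mult[OF w] by (intro uea.span_sum uea.span_base) blast
      finally show ?case
        using step by (simp add: distrib_left uea.span_add uea.span_scale)
    qed (simp add: uea.span_zero)
  qed (simp_all add: uea.span_add uea.span_scale)
  then show ?thesis
  proof (induction rule: uea.span_induct_alt)
    case base
    show ?case by simp
  next
    case (step c w v)
    then obtain s N where w: "w \<in> uea_deg s" and N: "\<forall>n>N. dcomp n v = 0" "v = (\<Sum>n\<le>N. dcomp n v)"
      by auto
    let ?M = "max s N"
    have "v = (\<Sum>n\<le>?M. dcomp n v)"
      using N by (subst N(2), intro sum.mono_neutral_left) auto
    moreover have "w = (\<Sum>n\<le>?M. dcomp n w)"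
      by (simp add: dcomp_uea_deg[OF w])
    ultimately have "uea_scale c w + v = (\<Sum>n\<le>?M. dcomp n (uea_scale c w + v))"
      by (simp add: dcomp_add dcomp_scale sum.distrib flip: uea.scale_sum_right)
    moreover have "\<forall>n>?M. dcomp n (uea_scale c w + v) = 0"
      using N by (simp add: dcomp_add dcomp_scale dcomp_uea_deg[OF w])
    ultimately show ?case by blast
  qed
qed

section \<open>Symmetric families modulo complete homogeneous polynomials\<close>

text \<open>A family \<open>F\<close> indexed by lists of length \<open>k\<close> is the same as a linear map from the polynomials in
  \<open>t\<^sub>1, \<dots>, t\<^sub>k\<close>, sending the monomial with the exponents \<open>cs\<close> to \<open>F cs\<close>. Under this identification
  \<open>hsum s F cs\<close> is the value at the product of this monomial with the complete homogeneous symmetric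
  polynomial \<open>h\<^sub>s\<close> of degree \<open>s\<close>.\<close>

fun hsum :: "nat \<Rightarrow> (nat list \<Rightarrow> 'v :: comm_monoid_add) \<Rightarrow> nat list \<Rightarrow> 'v" where
  "hsum s F [] = (if s = 0 then F [] else 0)"
| "hsum s F (c # cs) = (\<Sum>j\<le>s. hsum (s - j) (\<lambda>l. F ((c + j) # l)) cs)"

text \<open>This is the identity
  \<open>h\<^sub>s\<^sub>+\<^sub>1(t\<^sub>1, \<dots>, t\<^sub>k) = h\<^sub>s\<^sub>+\<^sub>1(t\<^sub>2, \<dots>, t\<^sub>k) + t\<^sub>1 h\<^sub>s(t\<^sub>1, \<dots>, t\<^sub>k)\<close>.\<close>

lemma hsum_Cons_Suc:
  "hsum (Suc s) F (c # cs) = hsum (Suc s) (\<lambda>l. F (c # l)) cs + hsum s F (Suc c # cs)"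
  by (simp add: sum.atMost_Suc_shift del: sum.atMost_Suc)

lemma hsum_0 [simp]: "hsum 0 F cs = F cs"
  by (induction cs arbitrary: F) auto

lemma hsum_zero [simp]: "hsum s (\<lambda>l. 0) cs = 0"
  by (induction cs arbitrary: s) auto

lemma hsum_add: "hsum s (\<lambda>l. F l + G l) cs = hsum s F cs + hsum s G cs"
  by (induction cs arbitrary: s F G) (auto simp: sum.distrib)

lemma hsum_diff: "hsum s (\<lambda>l. F l - G l) cs = hsum s F cs - hsum s G cs"
  for F :: "nat list \<Rightarrow> 'v :: ab_group_add"
  by (induction cs arbitrary: s F G) (auto simp: sum_subtractf)

lemma hsum_sum: "hsum s (\<lambda>l. \<Sum>i\<in>I. F i l) cs = (\<Sum>i\<in>I. hsum s (F i) cs)"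
  by (induction I rule: infinite_finite_induct) (simp_all add: hsum_add)

lemma hsum_additive:
  assumes "f 0 = 0" "\<And>x y. f (x + y) = f x + f y"
  shows "hsum s (\<lambda>l. f (F l)) cs = f (hsum s F cs)"
proof (induction cs arbitrary: s F)
  case (Cons c cs)
  have "f (sum g I) = (\<Sum>i\<in>I. f (g i))" for g and I :: "nat set"
    by (induction I rule: infinite_finite_induct) (simp_all add: assms)
  with Cons show ?case by simp
qed (simp add: assms)

lemma hsum_hsum_commute: "hsum s (hsum t F) cs = hsum t (hsum s F) cs"
proof (induction cs arbitrary: s t F)
  case (Cons c cs)
  have "hsum s (hsum t F) (c # cs)
      = (\<Sum>j\<le>s. \<Sum>i\<le>t. hsum (s - j) (hsum (t - i) (\<lambda>l. F ((c + (j + i)) # l))) cs)"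
    by (simp add: hsum_sum add.assoc)
  also have "\<dots> = (\<Sum>j\<le>s. \<Sum>i\<le>t. hsum (t - i) (hsum (s - j) (\<lambda>l. F ((c + (j + i)) # l))) cs)"
    by (simp add: Cons)
  also have "\<dots> = (\<Sum>i\<le>t. \<Sum>j\<le>s. hsum (t - i) (hsum (s - j) (\<lambda>l. F ((c + (i + j)) # l))) cs)"
    by (subst sum.swap) (simp add: add.commute)
  also have "\<dots> = hsum t (hsum s F) (c # cs)"
    by (simp add: hsum_sum add.assoc)
  finally show ?case .
qed auto

text \<open>Adjacent transpositions generate the symmetric group, so these are the families that do not
  depend on the order of the exponents.\<close>

definition adj_sym :: "(nat list \<Rightarrow> 'v) \<Rightarrow> bool" where
  "adj_sym F \<longleftrightarrow> (\<forall>xs x y ys. F (xs @ x # y # ys) = F (xs @ y # x # ys))"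

lemma adj_symD: "adj_sym F \<Longrightarrow> F (xs @ x # y # ys) = F (xs @ y # x # ys)"
  by (simp add: adj_sym_def)

lemma adj_sym_Cons: "adj_sym F \<Longrightarrow> adj_sym (\<lambda>l. F (c # l))"
  unfolding adj_sym_def by (metis append_Cons)

lemma adj_sym_move: "adj_sym F \<Longrightarrow> F (xs @ x # ys) = F (x # xs @ ys)"
proof (induction xs arbitrary: F)
  case (Cons a xs)
  have "F (a # xs @ x # ys) = F (a # x # xs @ ys)"
    using Cons.IH[OF adj_sym_Cons[OF Cons.prems]] by simp
  then show ?case
    using adj_symD[OF Cons.prems, of "[]" a x] by simp
qed simp

lemma adj_sym_hsum:
  assumes "adj_sym F"
  shows "adj_sym (hsum s F)"
  unfolding adj_sym_def
proof (intro allI)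
  fix xs x y ys
  show "hsum s F (xs @ x # y # ys) = hsum s F (xs @ y # x # ys)"
    using assms
  proof (induction xs arbitrary: s F)
    case Nil
    have "hsum s F (x # y # ys)
        = (\<Sum>(i, j)\<in>(SIGMA i:{..s}. {..s - i}). hsum (s - i - j) (\<lambda>l. F ((x + i) # (y + j) # l)) ys)"
      by (simp add: sum.Sigma)
    also have "\<dots> = (\<Sum>(i, j)\<in>(SIGMA i:{..s}. {..s - i}).
        hsum (s - i - j) (\<lambda>l. F ((y + i) # (x + j) # l)) ys)"
      using adj_symD[OF Nil, of "[]"]
      by (intro sum.reindex_bij_witness[where i = prod.swap and j = prod.swap])
        (auto simp: add.commute diff_commute)
    also have "\<dots> = hsum s F (y # x # ys)"
      by (simp add: sum.Sigma)
    finally show ?case by simp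
  next
    case (Cons c xs)
    then show ?case by (simp add: adj_sym_Cons)
  qed
qed

text \<open>In terms of polynomials, \<open>zdel F\<close> is the composition of \<open>F\<close> with the sum over \<open>i\<close> of the maps
  that set the variable \<open>t\<^sub>i\<close> to zero and drop it. These maps send \<open>h\<^sub>s\<close> to \<open>h\<^sub>s\<close>, whence
  \<open>hsum_zdel\<close> below.\<close>

fun zdel :: "(nat list \<Rightarrow> 'v :: comm_monoid_add) \<Rightarrow> nat list \<Rightarrow> 'v" where
  "zdel F [] = 0"
| "zdel F (c # cs) = (if c = 0 then F cs else 0) + zdel (\<lambda>l. F (c # l)) cs"

lemma zdel_add: "zdel (\<lambda>l. F l + G l) cs = zdel F cs + zdel G cs"
  by (induction cs arbitrary: F G) (auto simp: ac_simps)

lemma zdel_zero: "zdel (\<lambda>l. 0) cs = 0"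
  by (induction cs) auto

lemma zdel_sum: "zdel (\<lambda>l. \<Sum>i\<in>I. F i l) cs = (\<Sum>i\<in>I. zdel (F i) cs)"
  by (induction I rule: infinite_finite_induct) (simp_all add: zdel_add zdel_zero)

lemma hsum_zdel: "hsum s (zdel F) cs = zdel (hsum s F) cs"
proof (induction cs arbitrary: s F)
  case (Cons c cs)
  have "hsum s (zdel F) (c # cs)
      = (\<Sum>j\<le>s. if j = 0 then if c = 0 then hsum s F cs else 0 else 0)
        + (\<Sum>j\<le>s. zdel (hsum (s - j) (\<lambda>l. F ((c + j) # l))) cs)"
    unfolding hsum.simps zdel.simps hsum_add Cons sum.distrib
    by (intro arg_cong2[where f = "(+)"] sum.cong) auto
  also have "\<dots> = zdel (hsum s F) (c # cs)"
    by (simp add: zdel_sum)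
  finally show ?case .
qed auto

context complex_space
begin

lemma hsum_subspace:
  assumes "subspace E"
  shows "(\<And>l. length l = length cs \<Longrightarrow> F l \<in> E) \<Longrightarrow> hsum s F cs \<in> E"
proof (induction cs arbitrary: s F)
  case Nil
  then show ?case
    using assms by (simp add: subspace_0)
next
  case (Cons c cs)
  then show ?case
    using assms by (auto intro!: subspace_sum)
qed

lemma zdel_adj_sym:
  "adj_sym F \<Longrightarrow> zdel F l = sc (of_nat (count_list l 0)) (F (remove1 0 l))"
proof (induction l arbitrary: F)
  case (Cons c l)
  have IH: "zdel (\<lambda>l. F (c # l)) l = sc (of_nat (count_list l 0)) (F (c # remove1 0 l))"
    using Cons.IH[OF adj_sym_Cons[OF Cons.prems]] .
  show ?case
  proof (cases "c = 0")
    case c: True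
    show ?thesis
    proof (cases "0 \<in> set l")
      case True
      then obtain xs ys where l: "l = xs @ 0 # ys" "0 \<notin> set xs"
        by (metis split_list_first)
      then have "F (c # remove1 0 l) = F l"
        using adj_sym_move[OF Cons.prems, of xs 0 ys] c by (simp add: remove1_append)
      then show ?thesis
        using IH c by (simp add: scale_left_distrib)
    next
      case False
      then have "count_list l 0 = 0"
        by (simp add: count_list_0_iff)
      then show ?thesis
        using IH c by simp
    qed
  next
    case False
    then show ?thesis using IH by simp
  qed
qed simp

text \<open>If \<open>h\<^sub>s\<close> in all \<open>k\<close> variables is sent into \<open>E\<close> for \<open>s > m - k\<close>, then so is \<open>h\<^sub>s\<close> in fewer
  variables, where the bound on \<open>s\<close> rises by one with each variable \<open>t\<close> that is dropped: \<open>h\<^sub>s\<close> without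
  \<open>t\<close> equals \<open>h\<^sub>s - t h\<^sub>s\<^sub>-\<^sub>1\<close>.\<close>

lemma hsum_suffix_subspace:
  assumes E: "subspace E"
    and h: "\<And>s cs. length cs = k \<Longrightarrow> m < s + k \<Longrightarrow> hsum s F cs \<in> E"
    and "k \<le> m"
  shows "length pre + length suf = k \<Longrightarrow> m + length pre < s + k \<Longrightarrow>
    hsum s (\<lambda>l. F (pre @ l)) suf \<in> E"
proof (induction pre arbitrary: s suf rule: rev_induct)
  case Nil
  then show ?case using h[of suf s] by simp
next
  case (snoc c pre)
  then obtain t where t: "s = Suc t"
    using \<open>k \<le> m\<close> by (cases s) auto
  have "hsum s (\<lambda>l. F ((pre @ [c]) @ l)) suf
      = hsum s (\<lambda>l. F (pre @ l)) (c # suf) - hsum t (\<lambda>l. F (pre @ l)) (Suc c # suf)"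
    unfolding t hsum_Cons_Suc by simp
  moreover have "hsum s (\<lambda>l. F (pre @ l)) (c # suf) \<in> E"
    using snoc.prems by (intro snoc.IH) auto
  moreover have "hsum t (\<lambda>l. F (pre @ l)) (Suc c # suf) \<in> E"
    using snoc.prems t by (intro snoc.IH) auto
  ultimately show ?case
    using subspace_diff[OF E] by simp
qed

text \<open>In the critical degree \<open>s = m - k\<close> the product \<open>t\<^sub>1 \<dots> t\<^sub>k h\<^sub>s\<close> is still sent into \<open>E\<close>, since
  \<open>t\<^sub>1 h\<^sub>s(t\<^sub>1, \<dots>, t\<^sub>k) = h\<^sub>s\<^sub>+\<^sub>1(t\<^sub>1, \<dots>, t\<^sub>k) - h\<^sub>s\<^sub>+\<^sub>1(t\<^sub>2, \<dots>, t\<^sub>k)\<close> and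
  the second term, multiplied by \<open>t\<^sub>2 \<dots> t\<^sub>k\<close>, is of the same kind with one variable less.\<close>

lemma hsum_map_Suc_subspace:
  assumes E: "subspace E"
    and h: "\<And>s cs. length cs = k \<Longrightarrow> m < s + k \<Longrightarrow> hsum s F cs \<in> E"
    and "0 < m" "k \<le> m"
  shows "length pre + length suf = k \<Longrightarrow> s + k = m + length pre \<Longrightarrow>
    hsum s (\<lambda>l. F (pre @ l)) (map Suc suf) \<in> E"
proof (induction suf arbitrary: s pre)
  case Nil
  then show ?case using \<open>0 < m\<close> subspace_0[OF E] by simp
next
  case (Cons c suf)
  have "hsum s (\<lambda>l. F (pre @ l)) (map Suc (c # suf))
      = hsum (Suc s) (\<lambda>l. F (pre @ l)) (c # map Suc suf)
        - hsum (Suc s) (\<lambda>l. F ((pre @ [c]) @ l)) (map Suc suf)"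
    unfolding hsum_Cons_Suc by simp
  moreover have "hsum (Suc s) (\<lambda>l. F (pre @ l)) (c # map Suc suf) \<in> E"
    using Cons.prems \<open>k \<le> m\<close>
    by (intro hsum_suffix_subspace[where k = k and m = m, OF E h]) auto
  moreover have "hsum (Suc s) (\<lambda>l. F ((pre @ [c]) @ l)) (map Suc suf) \<in> E"
    using Cons.prems by (intro Cons.IH) auto
  ultimately show ?case
    using subspace_diff[OF E] by simp
qed

text \<open>The symmetric polynomials in \<open>k\<close> variables modulo all \<open>h\<^sub>s\<close> with \<open>s > m - k\<close> form the cohomology
  ring of a Grassmannian, of dimension \<open>m choose k\<close>. The induction follows Pascal's rule.
  Passing from \<open>m + 1\<close> to \<open>m\<close> adds one relation, \<open>h\<^sub>t\<close> with \<open>t = m + 1 - k\<close>. The ideal that it generates modulo the other ones is the image of \<open>g = h\<^sub>t F\<close>. As \<open>g\<close> vanishes on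
  multiples of \<open>t\<^sub>1 \<dots> t\<^sub>k\<close>, it comes from a family \<open>G\<close> in \<open>k - 1\<close> variables, which satisfies
  the relations for \<open>m\<close> and \<open>k - 1\<close>.\<close>

lemma span_symmetric_mod_hsum:
  assumes "subspace E" "adj_sym F"
    and "\<And>s cs. length cs = k \<Longrightarrow> m < s + k \<Longrightarrow> hsum s F cs \<in> E"
  shows "\<exists>B. finite B \<and> card B \<le> m choose k \<and> (\<forall>cs. length cs = k \<longrightarrow> F cs \<in> span (B \<union> E))"
  using assms
proof (induction m arbitrary: k F E)
  case 0
  show ?case
  proof (cases k)
    case 0
    then show ?thesis
      by (intro exI[of _ "{F []}"]) (auto intro: span_base)
  next
    case (Suc k')
    then have "F cs \<in> E" if "length cs = k" for cs
      using 0(3)[of cs 0] that by simp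
    then show ?thesis
      by (intro exI[of _ "{}"]) (auto intro: span_base)
  qed
next
  case (Suc m)
  note E = Suc.prems(1) and sym = Suc.prems(2) and h = Suc.prems(3)
  consider "k = 0" | "Suc m < k" | k' where "k = Suc k'" "k \<le> Suc m"
    by (cases k; cases "k \<le> Suc m") auto
  then show ?case
  proof cases
    case 1
    then show ?thesis
      by (intro exI[of _ "{F []}"]) (auto intro: span_base)
  next
    case 2
    then have "F cs \<in> E" if "length cs = k" for cs
      using h[of cs 0] that by simp
    then show ?thesis
      by (intro exI[of _ "{}"]) (auto intro: span_base)
  next
    case (3 k')
    define t where "t = Suc m - k"
    define g where "g = hsum t F"
    have gsym: "adj_sym g"
      unfolding g_def by (rule adj_sym_hsum[OF sym])
    define E1 where "E1 = span (E \<union> {g cs | cs. length cs = k})"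
    have E1: "hsum s F cs \<in> E1" if "length cs = k" "m < s + k" for s cs
    proof (cases "s = t")
      case True
      then show ?thesis
        unfolding E1_def g_def using that by (intro span_base) auto
    next
      case False
      then show ?thesis
        unfolding E1_def using that 3 t_def by (intro span_base UnI1 h) auto
    qed
    obtain B1 where B1: "finite B1" "card B1 \<le> m choose k"
        "\<And>cs. length cs = k \<Longrightarrow> F cs \<in> span (B1 \<union> E1)"
      using Suc.IH[OF _ sym E1, of k] unfolding E1_def by auto
    \<comment> \<open>On a list with zeros, \<open>zdel G\<close> yields one term for each zero, all of them
      equal by symmetry; the factor compensates for their number.\<close>
    define G where "G = (\<lambda>l. sc (1 / of_nat (Suc (count_list l 0))) (g (0 # l)))"
    have Gsym: "adj_sym G"
      unfolding adj_sym_def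
    proof (intro allI)
      fix xs x y ys
      show "G (xs @ x # y # ys) = G (xs @ y # x # ys)"
        using adj_symD[OF gsym, of "0 # xs" x y ys] by (simp add: G_def count_list_append)
    qed
    have gpos: "g cs \<in> E" if "length cs = k" "0 \<notin> set cs" for cs
    proof -
      have "cs = map Suc (map (\<lambda>c. c - 1) cs)"
        using that(2) by (induction cs) auto
      moreover have "hsum t (\<lambda>l. F ([] @ l)) (map Suc (map (\<lambda>c. c - 1) cs)) \<in> E"
        using that 3 t_def
        by (intro hsum_map_Suc_subspace[where k = k and m = "Suc m", OF E h]) auto
      ultimately show ?thesis
        unfolding g_def by simp
    qed
    have gz: "g cs = zdel G cs" if z0: "0 \<in> set cs" for cs
    proof -
      obtain xs ys where cs: "cs = xs @ 0 # ys" "0 \<notin> set xs"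
        using split_list_first[OF z0] by blast
      then have "count_list cs 0 = Suc (count_list (remove1 0 cs) 0)"
        by (simp add: count_list_append remove1_append)
      moreover have "g (0 # remove1 0 cs) = g cs"
        using cs adj_sym_move[OF gsym, of xs 0 ys] by (simp add: remove1_append)
      ultimately show ?thesis
        unfolding zdel_adj_sym[OF Gsym] by (simp add: G_def del: of_nat_Suc)
    qed
    have zpos: "zdel G cs = 0" if "0 \<notin> set cs" for cs
      unfolding zdel_adj_sym[OF Gsym] using that by (simp add: count_list_0_iff)
    have gzd: "g cs - zdel G cs \<in> E" if "length cs = k" for cs
      using gpos[OF that] gz[of cs] zpos[of cs] subspace_0[OF E] by (cases "0 \<in> set cs") auto
    have hG: "hsum s G cs \<in> E" if "length cs = k'" "m < s + k'" for s cs
    proof -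
      have "hsum s g (0 # cs) \<in> E"
        unfolding g_def hsum_hsum_commute[of s]
        using that 3 by (intro hsum_subspace[OF E] h) auto
      moreover have "hsum s (\<lambda>l. g l - zdel G l) (0 # cs) \<in> E"
        using that 3 by (intro hsum_subspace[OF E] gzd) auto
      ultimately have "hsum s (zdel G) (0 # cs) \<in> E"
        unfolding hsum_diff using subspace_diff[OF E] by fastforce
      then have "sc (of_nat (Suc (count_list cs 0))) (hsum s G cs) \<in> E"
        unfolding hsum_zdel zdel_adj_sym[OF adj_sym_hsum[OF Gsym]] by simp
      from subspace_scale[OF E this, of "1 / of_nat (Suc (count_list cs 0))"] show ?thesis
        by (simp del: of_nat_Suc)
    qed
    obtain B2 where B2: "finite B2" "card B2 \<le> m choose k'"
        "\<And>cs. length cs = k' \<Longrightarrow> G cs \<in> span (B2 \<union> E)"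
      using Suc.IH[OF E Gsym hG] by auto
    have "g cs \<in> span (B2 \<union> E)" if "length cs = k" for cs
    proof (cases "0 \<in> set cs")
      case True
      then have "length (remove1 0 cs) = k'"
        using that 3 by (simp add: length_remove1)
      then show ?thesis
        unfolding gz[OF True] zdel_adj_sym[OF Gsym] by (intro span_scale B2(3))
    next
      case False
      then show ?thesis
        using gpos that by (intro span_base) auto
    qed
    then have "E1 \<subseteq> span (B2 \<union> E)"
      unfolding E1_def by (intro span_minimal) (auto intro: span_base)
    also have "\<dots> \<subseteq> span ((B1 \<union> B2) \<union> E)"
      by (rule span_mono) auto
    finally have "span (B1 \<union> E1) \<subseteq> span ((B1 \<union> B2) \<union> E)"
      by (intro span_minimal) (auto intro: span_base)
    then have "\<forall>cs. length cs = k \<longrightarrow> F cs \<in> span ((B1 \<union> B2) \<union> E)"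
      using B1(3) by auto
    moreover have "card (B1 \<union> B2) \<le> Suc m choose k"
      using card_Un_le[of B1 B2] B1(2) B2(2) 3(1) by simp
    ultimately show ?thesis
      using B1(1) B2(1) by blast
  qed
qed

end

section \<open>Commutation relations in \<open>sl(1|2)[t]\<close>\<close>

lemma Rep_sl_simps:
  "Rep_sl12 sl_x1 = mat_unit 1 2" "Rep_sl12 sl_x2 = mat_unit 2 3" "Rep_sl12 sl_x3 = mat_unit 1 3"
  "Rep_sl12 sl_y1 = mat_unit 2 1" "Rep_sl12 sl_y2 = mat_unit 3 2" "Rep_sl12 sl_y3 = mat_unit 3 1"
  "Rep_sl12 sl_h1 = mat_unit 1 1 + mat_unit 2 2" "Rep_sl12 sl_h2 = mat_unit 2 2 - mat_unit 3 3"
  by (simp_all add: sl_x1_def sl_x2_def sl_x3_def sl_y1_def sl_y2_def sl_y3_def sl_h1_def sl_h2_def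
      Abs_sl12_inverse mat_unit_def)

lemma lpart_sl_simps:
  "lpart 1 sl_x1 = sl_x1" "lpart 0 sl_x2 = sl_x2" "lpart 1 sl_x3 = sl_x3"
  "lpart 1 sl_y1 = sl_y1" "lpart 0 sl_y2 = sl_y2" "lpart 1 sl_y3 = sl_y3"
  "lpart 0 sl_h1 = sl_h1" "lpart 0 sl_h2 = sl_h2"
  by (simp_all add: Rep_sl12_inject[symmetric] lpart_sl12.rep_eq Rep_sl_simps mat_part_def mat_unit_def
      vec_eq_iff forall_3)

lemma mat_unit_mult: "mat_unit i j ** mat_unit k l = (if j = k then mat_unit i l else 0)"
  by (auto simp: vec_eq_iff matrix_matrix_mult_def mat_unit_def if_distrib[of "\<lambda>x. x * _"]
      if_distrib[of "\<lambda>x. _ * x"] cong: if_cong)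

lemma mat_mult_distribs:
  "A ** (B + C) = A ** B + A ** C" "(B + C) ** A = B ** A + C ** A"
  "A ** (B - C) = A ** B - A ** C" "(B - C) ** A = B ** A - C ** A"
  "A ** 0 = 0" "0 ** A = 0"
  for A B C :: "complex^3^3"
  by (simp_all add: vec_eq_iff matrix_matrix_mult_def algebra_simps sum.distrib sum_subtractf)

lemma Rep_lbracket:
  assumes "lpart p x = x" "lpart q y = y"
  shows "Rep_sl12 (lbracket x y)
    = Rep_sl12 x ** Rep_sl12 y - mat_scale (ssign p q) (Rep_sl12 y ** Rep_sl12 x)"
  using assms by transfer (rule mat_bracket_eq)

lemma lbracket_sl_simps:
  "lbracket sl_x2 sl_y2 = sl_h2" "lbracket sl_h2 sl_y2 = lscale (- 2) sl_y2"
  "lbracket sl_h2 sl_x1 = - sl_x1" "lbracket sl_h2 sl_y3 = - sl_y3"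
  "lbracket sl_x2 sl_x1 = - sl_x3" "lbracket sl_x2 sl_y3 = sl_y1"
  "lbracket sl_x3 sl_x1 = 0" "lbracket sl_y1 sl_x1 = sl_h1" "lbracket sl_y1 sl_y3 = 0"
  "lbracket sl_y1 sl_y2 = - sl_y3" "lbracket sl_x1 sl_y2 = 0" "lbracket sl_y3 sl_y2 = 0"
  "lbracket sl_x1 sl_x1 = 0" "lbracket sl_y3 sl_y3 = 0" "lbracket sl_x1 sl_y3 = sl_y2"
  "lbracket sl_x3 sl_y2 = sl_x1" "lbracket sl_h1 sl_x1 = 0" "lbracket sl_y2 sl_y2 = 0"
  by (simp_all add: Rep_sl12_inject[symmetric] Rep_sl_simps mat_unit_mult mat_mult_distribs
      Rep_lbracket[OF lpart_sl_simps(1) lpart_sl_simps(1)] Rep_lbracket[OF lpart_sl_simps(1) lpart_sl_simps(5)]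
      Rep_lbracket[OF lpart_sl_simps(1) lpart_sl_simps(6)] Rep_lbracket[OF lpart_sl_simps(2) lpart_sl_simps(5)]
      Rep_lbracket[OF lpart_sl_simps(8) lpart_sl_simps(5)] Rep_lbracket[OF lpart_sl_simps(8) lpart_sl_simps(1)]
      Rep_lbracket[OF lpart_sl_simps(8) lpart_sl_simps(6)] Rep_lbracket[OF lpart_sl_simps(2) lpart_sl_simps(1)]
      Rep_lbracket[OF lpart_sl_simps(2) lpart_sl_simps(6)] Rep_lbracket[OF lpart_sl_simps(3) lpart_sl_simps(1)]
      Rep_lbracket[OF lpart_sl_simps(4) lpart_sl_simps(1)] Rep_lbracket[OF lpart_sl_simps(4) lpart_sl_simps(6)]
      Rep_lbracket[OF lpart_sl_simps(4) lpart_sl_simps(5)] Rep_lbracket[OF lpart_sl_simps(6) lpart_sl_simps(5)]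
      Rep_lbracket[OF lpart_sl_simps(6) lpart_sl_simps(6)] Rep_lbracket[OF lpart_sl_simps(3) lpart_sl_simps(5)]
      Rep_lbracket[OF lpart_sl_simps(7) lpart_sl_simps(1)] Rep_lbracket[OF lpart_sl_simps(5) lpart_sl_simps(5)]
      ssign_def mat_scale_simps uminus_sl12.rep_eq zero_sl12.rep_eq lscale_sl12.rep_eq)
    (simp_all add: mat_scale_def vec_eq_iff mat_unit_def)

abbreviation cur :: "'l :: lie_superalgebra \<Rightarrow> nat \<Rightarrow> 'l poly uea" where
  "cur x m \<equiv> uea_inc (monom x m)"

lemma cur_uminus: "cur (- x) m = - cur x m"
  by (metis minus_monom uea_inc_uminus)

lemma cur_lscale: "cur (lscale c x) m = uea_scale c (cur x m)"
  by (simp flip: lscale_monom add: uea_inc_lscale)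

lemma cur_comm:
  "cur sl_y2 a * cur sl_y2 b = cur sl_y2 b * cur sl_y2 a"
  "cur sl_x1 a * cur sl_y2 b = cur sl_y2 b * cur sl_x1 a"
  "cur sl_y3 a * cur sl_y2 b = cur sl_y2 b * cur sl_y3 a"
  "cur sl_x1 a * cur sl_x1 b = - (cur sl_x1 b * cur sl_x1 a)"
  "cur sl_y3 a * cur sl_y3 b = - (cur sl_y3 b * cur sl_y3 a)"
  "cur sl_x1 a * cur sl_y3 b = - (cur sl_y3 b * cur sl_x1 a) + cur sl_y2 (a + b)"
  "cur sl_x2 a * cur sl_y2 b = cur sl_y2 b * cur sl_x2 a + cur sl_h2 (a + b)"
  "cur sl_x2 a * cur sl_x1 b = cur sl_x1 b * cur sl_x2 a - cur sl_x3 (a + b)"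
  "cur sl_x2 a * cur sl_y3 b = cur sl_y3 b * cur sl_x2 a + cur sl_y1 (a + b)"
  "cur sl_h2 a * cur sl_y2 b = cur sl_y2 b * cur sl_h2 a - uea_scale 2 (cur sl_y2 (a + b))"
  "cur sl_h2 a * cur sl_x1 b = cur sl_x1 b * cur sl_h2 a - cur sl_x1 (a + b)"
  "cur sl_h2 a * cur sl_y3 b = cur sl_y3 b * cur sl_h2 a - cur sl_y3 (a + b)"
  "cur sl_h1 a * cur sl_x1 b = cur sl_x1 b * cur sl_h1 a"
  "cur sl_x3 a * cur sl_x1 b = - (cur sl_x1 b * cur sl_x3 a)"
  "cur sl_x3 a * cur sl_y2 b = cur sl_y2 b * cur sl_x3 a + cur sl_x1 (a + b)"
  "cur sl_y1 a * cur sl_x1 b = - (cur sl_x1 b * cur sl_y1 a) + cur sl_h1 (a + b)"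
  "cur sl_y1 a * cur sl_y3 b = - (cur sl_y3 b * cur sl_y1 a)"
  "cur sl_y1 a * cur sl_y2 b = cur sl_y2 b * cur sl_y1 a - cur sl_y3 (a + b)"
  by (subst uea_inc_monom_bracket, rule lpart_sl_simps, rule lpart_sl_simps,
      simp add: lbracket_sl_simps ssign_def cur_uminus cur_lscale)+

section \<open>Power sums\<close>

text \<open>With the reading of families as linear maps on polynomials, \<open>dsum r F cs\<close> is the value at the
  product of the monomial with exponents \<open>cs\<close> and the power sum \<open>t\<^sub>1^r + \<dots> + t\<^sub>k^r\<close>.\<close>

fun dsum :: "nat \<Rightarrow> (nat list \<Rightarrow> 'v :: comm_monoid_add) \<Rightarrow> nat list \<Rightarrow> 'v" where
  "dsum r F [] = 0"
| "dsum r F (c # cs) = F ((c + r) # cs) + dsum r (\<lambda>l. F (c # l)) cs"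

lemma dsum_append: "dsum r F (xs @ ys) = dsum r (\<lambda>l. F (l @ ys)) xs + dsum r (\<lambda>l. F (xs @ l)) ys"
  by (induction xs arbitrary: F) (auto simp: ac_simps)

lemma dsum_add: "dsum r (\<lambda>l. F l + G l) cs = dsum r F cs + dsum r G cs"
  by (induction cs arbitrary: F G) (auto simp: ac_simps)

lemma dsum_zero: "dsum r (\<lambda>l. 0) cs = 0"
  by (induction cs) auto

lemma dsum_sum: "dsum r (\<lambda>l. \<Sum>i\<in>I. F i l) cs = (\<Sum>i\<in>I. dsum r (F i) cs)"
  by (induction I rule: infinite_finite_induct) (simp_all add: dsum_add dsum_zero)

lemma dsum_additive:
  assumes "f 0 = 0" "\<And>x y. f (x + y) = f x + f y"
  shows "dsum r (\<lambda>l. f (F l)) cs = f (dsum r F cs)"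
  by (induction cs arbitrary: F) (simp_all add: assms)

lemma hsum_dsum: "hsum s (dsum r F) cs = dsum r (hsum s F) cs"
proof (induction cs arbitrary: s F)
  case (Cons c cs)
  show ?case
    by (simp add: hsum_add Cons sum.distrib dsum_sum algebra_simps)
qed auto

context complex_space
begin

lemma dsum_subspace:
  assumes "subspace E"
  shows "(\<And>l. length l = length cs \<Longrightarrow> sum_list l = sum_list cs + r \<Longrightarrow> F l \<in> E) \<Longrightarrow>
    dsum r F cs \<in> E"
proof (induction cs arbitrary: F)
  case Nil
  then show ?case
    using assms by (simp add: subspace_0)
next
  case (Cons c cs)
  then show ?case
    using assms by (auto intro!: subspace_add)
qed

lemma dsum_replicate_0:
  assumes "adj_sym F"
  shows "dsum r F (replicate a 0) = sc (of_nat a) (F (r # replicate (a - 1) 0))"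
  using assms
proof (induction a arbitrary: F)
  case (Suc a)
  have "dsum r F (replicate (Suc a) 0)
      = F (r # replicate a 0) + sc (of_nat a) (F (0 # r # replicate (a - 1) 0))"
    using Suc.IH[OF adj_sym_Cons[OF Suc.prems]] by simp
  also have "sc (of_nat a) (F (0 # r # replicate (a - 1) 0)) = sc (of_nat a) (F (r # replicate a 0))"
    using adj_symD[OF Suc.prems, of "[]" 0 r] by (cases a) simp_all
  finally show ?case
    by (simp add: scale_left_distrib)
qed simp

text \<open>In characteristic zero the power sums generate the ring of symmetric polynomials. The induction is
  on the number of leading exponents that may differ from zero: multiplying a monomial whose last
  \<open>a + 1\<close> exponents vanish by a power sum of degree \<open>r\<close> yields \<open>a + 1\<close> times the monomial with one
  more exponent \<open>r\<close>, up to monomials in which no new variable occurs.\<close>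

lemma adj_sym_dsum_closed:
  assumes E: "subspace E" and G: "adj_sym G" and G0: "G (replicate k 0) \<in> E"
    and D: "\<And>r cs. length cs = k \<Longrightarrow> 0 < r \<Longrightarrow> G cs \<in> E \<Longrightarrow> dsum r G cs \<in> E"
    and k: "length cs = k"
  shows "G cs \<in> E"
proof -
  have "length ps \<le> k \<Longrightarrow> G (ps @ replicate (k - length ps) 0) \<in> E" for ps
  proof (induction "length ps" arbitrary: ps)
    case 0
    then show ?case using G0 by simp
  next
    case (Suc b)
    then obtain r qs where ps: "ps = r # qs" "length qs = b"
      by (cases ps) auto
    define a where "a = k - Suc b"
    have a: "k - length qs = Suc a" "k - length ps = a" "b \<le> k"
      using Suc ps by (auto simp: a_def)
    have IH: "G (xs @ replicate (Suc a) 0) \<in> E" if "length xs = b" for xs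
      using Suc.hyps(1)[of xs] that a ps by simp
    show ?case
    proof (cases "r = 0")
      case True
      have "G (0 # qs @ replicate a 0) = G (qs @ 0 # replicate a 0)"
        by (rule adj_sym_move[OF G, symmetric])
      then show ?thesis
        using IH[OF ps(2)] ps a True by simp
    next
      case False
      have sym': "adj_sym (\<lambda>l. G (qs @ l))"
        using G unfolding adj_sym_def by (metis append_assoc)
      have "dsum r G (qs @ replicate (Suc a) 0) \<in> E"
        using IH[OF ps(2)] False a ps by (intro D) auto
      moreover have "dsum r (\<lambda>l. G (l @ replicate (Suc a) 0)) qs \<in> E"
        using IH ps by (intro dsum_subspace[OF E]) auto
      ultimately have "dsum r (\<lambda>l. G (qs @ l)) (replicate (Suc a) 0) \<in> E"
        unfolding dsum_append using subspace_diff[OF E] by fastforce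
      then have "sc (of_nat (Suc a)) (G (qs @ r # replicate a 0)) \<in> E"
        unfolding dsum_replicate_0[OF sym'] by simp
      from subspace_scale[OF E this, of "1 / of_nat (Suc a)"] show ?thesis
        using ps a adj_sym_move[OF G, of qs r] by (simp del: of_nat_Suc)
    qed
  qed
  from this[of cs] show ?thesis
    using k by simp
qed

end

interpretation uea: complex_space "uea_scale :: complex \<Rightarrow> 'a :: lie_superalgebra uea \<Rightarrow> 'a uea"
  by unfold_locales

section \<open>Highest weight vectors for the current algebra of \<open>sl\<^sub>2\<close>\<close>

abbreviation ymon :: "nat list \<Rightarrow> sl12 poly uea" where
  "ymon cs \<equiv> prod_list (map (cur sl_y2) cs)"

lemma y2_left_commute: "cur sl_y2 c * (cur sl_y2 d * w) = cur sl_y2 d * (cur sl_y2 c * w)"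
  using cur_comm(1)[of c d] by (metis mult.assoc)

lemma adj_sym_ymon: "adj_sym (\<lambda>l. ymon l * v)"
  unfolding adj_sym_def
  by (intro allI) (simp only: map_append list.map prod_list.append prod_list.Cons mult.assoc
    y2_left_commute)

text \<open>An element \<open>h\<close> whose commutator with \<open>z(b)\<close> is a multiple of \<open>z(b + r)\<close> acts on products of such
  elements as a derivation, that is, as multiplication by a power sum in the exponents.\<close>

lemma commute_mon:
  assumes "\<And>b. h * z b = z b * h + uea_scale c (z (b + r))"
  shows "h * (prod_list (map z cs) * v)
    = prod_list (map z cs) * (h * v) + uea_scale c (dsum r (\<lambda>l. prod_list (map z l) * v) cs)"
proof (induction cs)
  case (Cons b cs)
  have "h * (prod_list (map z (b # cs)) * v)
      = z b * (h * (prod_list (map z cs) * v)) + uea_scale c (prod_list (map z ((b + r) # cs)) * v)"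
    using assms[of b] by (simp add: mult.assoc[symmetric] distrib_right)
  also have "\<dots> = prod_list (map z (b # cs)) * (h * v)
      + uea_scale c (z b * dsum r (\<lambda>l. prod_list (map z l) * v) cs + prod_list (map z ((b + r) # cs)) * v)"
    unfolding Cons by (simp add: distrib_left mult.assoc uea.scale_right_distrib)
  also have "z b * dsum r (\<lambda>l. prod_list (map z l) * v) cs
      = dsum r (\<lambda>l. prod_list (map z (b # l)) * v) cs"
    by (simp add: dsum_additive[symmetric] distrib_left mult.assoc)
  finally show ?case by (simp add: add.commute)
qed simp

lemma h2_ymon: "cur sl_h2 r * (ymon cs * v)
    = ymon cs * (cur sl_h2 r * v) - uea_scale 2 (dsum r (\<lambda>l. ymon l * v) cs)"
  using commute_mon[of "cur sl_h2 r" "cur sl_y2" "- 2" r cs v]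
  by (simp add: cur_comm(10) add.commute)

text \<open>Modulo the subspace \<open>E\<close>, which is stable under the current algebra of \<open>\<langle>x\<^sub>2, h\<^sub>2, y\<^sub>2\<rangle>\<close>, the vector
  \<open>v\<close> satisfies the relations of the generator of the local Weyl module of weight \<open>m\<close> over this
  algebra, except that the power of \<open>y\<^sub>2(0)\<close> that kills \<open>v\<close> may be larger than \<open>m + 1\<close>. For the
  monomials below, only the power \<open>n + 1\<close> is known to do so beforehand.\<close>

locale sl2_cyclic =
  fixes E :: "sl12 poly uea set" and v :: "sl12 poly uea" and m :: nat
  assumes E: "uea.subspace E"
    and x2_E: "u \<in> E \<Longrightarrow> cur sl_x2 r * u \<in> E"
    and y2_E: "u \<in> E \<Longrightarrow> cur sl_y2 r * u \<in> E"
    and h2_E: "u \<in> E \<Longrightarrow> cur sl_h2 r * u \<in> E"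
    and x2_v: "cur sl_x2 r * v \<in> E"
    and h2_v: "0 < r \<Longrightarrow> cur sl_h2 r * v \<in> E"
    and h2_0_v: "cur sl_h2 0 * v - uea_scale (of_nat m) v \<in> E"
    and y2_power_v: "\<exists>M. cur sl_y2 0 ^ M * v \<in> E"
begin

definition eqv :: "sl12 poly uea \<Rightarrow> sl12 poly uea \<Rightarrow> bool" (infix "\<simeq>" 50) where
  "u \<simeq> w \<longleftrightarrow> u - w \<in> E"

lemma eqv_refl [simp, intro!]: "u \<simeq> u"
  by (simp add: eqv_def uea.subspace_0[OF E])

lemma eqv_trans [trans]: "u \<simeq> w \<Longrightarrow> w \<simeq> x \<Longrightarrow> u \<simeq> x"
  unfolding eqv_def using uea.subspace_add[OF E] by fastforce

lemma eqv_eq_trans [trans]: "u \<simeq> w \<Longrightarrow> w = x \<Longrightarrow> u \<simeq> x" "u = w \<Longrightarrow> w \<simeq> x \<Longrightarrow> u \<simeq> x"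
  by simp_all

lemma eqv_add: "u \<simeq> u' \<Longrightarrow> w \<simeq> w' \<Longrightarrow> u + w \<simeq> u' + w'"
  unfolding eqv_def using uea.subspace_add[OF E, of "u - u'" "w - w'"] by (simp add: algebra_simps)

lemma eqv_diff: "u \<simeq> u' \<Longrightarrow> w \<simeq> w' \<Longrightarrow> u - w \<simeq> u' - w'"
  unfolding eqv_def using uea.subspace_diff[OF E, of "u - u'" "w - w'"] by (simp add: algebra_simps)

lemma eqv_scale: "u \<simeq> u' \<Longrightarrow> uea_scale c u \<simeq> uea_scale c u'"
  unfolding eqv_def using uea.subspace_scale[OF E, of "u - u'" c]
  by (simp add: uea.scale_right_diff_distrib)

lemma eqv_sum: "(\<And>i. i \<in> I \<Longrightarrow> f i \<simeq> g i) \<Longrightarrow> sum f I \<simeq> sum g I"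
  by (induction I rule: infinite_finite_induct) (auto intro: eqv_add)

lemma eqv_mult:
  "u \<simeq> u' \<Longrightarrow> cur sl_x2 r * u \<simeq> cur sl_x2 r * u'"
  "u \<simeq> u' \<Longrightarrow> cur sl_y2 r * u \<simeq> cur sl_y2 r * u'"
  "u \<simeq> u' \<Longrightarrow> cur sl_h2 r * u \<simeq> cur sl_h2 r * u'"
  unfolding eqv_def right_diff_distrib[symmetric] by (fact x2_E y2_E h2_E)+

lemma eqv_zero: "u \<simeq> 0 \<longleftrightarrow> u \<in> E"
  by (simp add: eqv_def)

lemma eqv_E: "u \<simeq> w \<Longrightarrow> u \<in> E \<Longrightarrow> w \<in> E"
  unfolding eqv_def using uea.subspace_diff[OF E, of u "u - w"] by simp

text \<open>With \<open>y(z) = \<Sum> y\<^sub>2(c) z^c\<close>, this is the coefficient of \<open>y(z)^k v\<close> at \<open>z^s\<close>. Equivalently, it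
  is the value of the family \<open>y\<^sub>2(c\<^sub>1) \<dots> y\<^sub>2(c\<^sub>k) v\<close> at the polynomial \<open>h\<^sub>s\<close>.\<close>

fun ypow :: "nat \<Rightarrow> nat \<Rightarrow> sl12 poly uea" where
  "ypow 0 s = (if s = 0 then v else 0)"
| "ypow (Suc k) s = (\<Sum>c\<le>s. cur sl_y2 c * ypow k (s - c))"

lemma hsum_replicate_ymon: "hsum s (\<lambda>l. ymon l * v) (replicate k 0) = ypow k s"
proof (induction k arbitrary: s)
  case (Suc k)
  have "hsum (s - c) (\<lambda>l. cur sl_y2 c * (ymon l * v)) (replicate k 0)
      = cur sl_y2 c * ypow k (s - c)" for c
    by (subst hsum_additive) (simp_all add: distrib_left Suc)
  then show ?case
    by (simp add: mult.assoc)
qed simp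

lemma ypow_1: "ypow (Suc 0) s = cur sl_y2 s * v"
proof -
  have "ypow (Suc 0) s = (\<Sum>c\<le>s. if c = s then cur sl_y2 c * v else 0)"
    unfolding ypow.simps by (rule sum.cong) auto
  then show ?thesis by simp
qed

lemma ypow_Suc_0: "ypow (Suc k) 0 = cur sl_y2 0 * ypow k 0"
  by simp

lemma triangle_swap:
  "(\<Sum>c\<le>s. \<Sum>d\<le>s - c. f c d) = (\<Sum>d\<le>s. \<Sum>c\<le>s - d. f c d)"
  for f :: "nat \<Rightarrow> nat \<Rightarrow> 'b :: comm_monoid_add"
proof -
  have "(\<Sum>c\<le>s. \<Sum>d\<le>s - c. f c d) = (\<Sum>(c, d)\<in>(SIGMA c:{..s}. {..s - c}). f c d)"
    by (simp add: sum.Sigma)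
  also have "\<dots> = (\<Sum>(d, c)\<in>(SIGMA d:{..s}. {..s - d}). f c d)"
    by (rule sum.reindex_bij_witness[where i = prod.swap and j = prod.swap]) auto
  finally show ?thesis by (simp add: sum.Sigma)
qed

lemma y2_ypow_commute:
  "(\<Sum>c\<le>s. cur sl_y2 c * (\<Sum>d\<le>s - c. uea_scale (a d) (cur sl_y2 (d + r) * ypow k (s - c - d))))
    = (\<Sum>d\<le>s. uea_scale (a d) (cur sl_y2 (d + r) * ypow (Suc k) (s - d)))"
proof -
  have "(\<Sum>c\<le>s. cur sl_y2 c * (\<Sum>d\<le>s - c. uea_scale (a d) (cur sl_y2 (d + r) * ypow k (s - c - d))))
     = (\<Sum>c\<le>s. \<Sum>d\<le>s - c. uea_scale (a d) (cur sl_y2 (d + r) * (cur sl_y2 c * ypow k (s - d - c))))"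
    by (simp add: sum_distrib_left y2_left_commute[of _ "_ + r"] diff_commute[of s] add.commute)
  also have "\<dots> = (\<Sum>d\<le>s. uea_scale (a d) (cur sl_y2 (d + r) * ypow (Suc k) (s - d)))"
    by (subst triangle_swap) (simp add: sum_distrib_left uea.scale_sum_right)
  finally show ?thesis .
qed

text \<open>The derivative of a power: \<open>z d/dz y(z)^(k+1) = (k + 1) (z y'(z)) y(z)^k\<close>, compared at \<open>z^s\<close>.\<close>

lemma ypow_weighted:
  "uea_scale (of_nat (Suc k)) (\<Sum>c\<le>s. uea_scale (of_nat c) (cur sl_y2 c * ypow k (s - c)))
    = uea_scale (of_nat s) (ypow (Suc k) s)"
proof (induction k arbitrary: s)
  case 0
  have "(\<Sum>c\<le>s. uea_scale (of_nat c) (cur sl_y2 c * ypow 0 (s - c)))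
      = (\<Sum>c\<le>s. if c = s then uea_scale (of_nat c) (cur sl_y2 c * v) else 0)"
    by (rule sum.cong) auto
  then show ?case
    by (simp add: ypow_1 del: ypow.simps)
next
  case (Suc k)
  let ?S = "\<lambda>k s. \<Sum>c\<le>s. uea_scale (of_nat c) (cur sl_y2 c * ypow k (s - c))"
  have "uea_scale (of_nat s) (ypow (Suc (Suc k)) s)
      = (\<Sum>c\<le>s. uea_scale (of_nat c) (cur sl_y2 c * ypow (Suc k) (s - c))
        + cur sl_y2 c * uea_scale (of_nat (s - c)) (ypow (Suc k) (s - c)))"
    unfolding ypow.simps(2)[of "Suc k"] uea.scale_sum_right
    by (rule sum.cong[OF refl])
      (simp del: ypow.simps add: of_nat_diff uea.scale_left_distrib[symmetric])
  also have "\<dots> = ?S (Suc k) s + uea_scale (of_nat (Suc k)) (\<Sum>c\<le>s. cur sl_y2 c * ?S k (s - c))"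
    by (simp only: sum.distrib Suc.IH[symmetric] uea_scale_mult_right)
      (simp only: uea.scale_sum_right)
  also have "(\<Sum>c\<le>s. cur sl_y2 c * ?S k (s - c)) = ?S (Suc k) s"
    using y2_ypow_commute[where s = s and a = of_nat and r = 0 and k = k] by simp
  finally show ?case
    by (simp only: of_nat_Suc[of "Suc k"] uea.scale_left_distrib uea.scale_one)
qed

lemma h2_ypow:
  assumes "0 < r"
  shows "cur sl_h2 r * ypow (Suc k) s
    \<simeq> uea_scale (- 2 * of_nat (Suc k)) (\<Sum>c\<le>s. cur sl_y2 (c + r) * ypow k (s - c))"
proof (induction k arbitrary: s)
  case 0
  have "cur sl_h2 r * ypow (Suc 0) s = cur sl_y2 s * (cur sl_h2 r * v) - uea_scale 2 (cur sl_y2 (s + r) * v)"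
    unfolding ypow_1 by (simp add: mult.assoc[symmetric] cur_comm(10) left_diff_distrib add.commute)
  also have "\<dots> \<simeq> 0 - uea_scale 2 (cur sl_y2 (s + r) * v)"
    by (intro eqv_diff eqv_refl) (simp add: eqv_zero y2_E h2_v assms)
  also have "\<dots> = uea_scale (- 2 * of_nat (Suc 0)) (\<Sum>c\<le>s. if c = s then cur sl_y2 (c + r) * v else 0)"
    by simp
  also have "(\<Sum>c\<le>s. if c = s then cur sl_y2 (c + r) * v else 0)
      = (\<Sum>c\<le>s. cur sl_y2 (c + r) * ypow 0 (s - c))"
    by (rule sum.cong) auto
  finally show ?case .
next
  case (Suc k)
  let ?R = "\<lambda>k s. \<Sum>c\<le>s. cur sl_y2 (c + r) * ypow k (s - c)"
  have "cur sl_h2 r * ypow (Suc (Suc k)) s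
      = (\<Sum>c\<le>s. cur sl_y2 c * (cur sl_h2 r * ypow (Suc k) (s - c))
          - uea_scale 2 (cur sl_y2 (c + r) * ypow (Suc k) (s - c)))"
    unfolding ypow.simps(2)[of "Suc k"] sum_distrib_left
    by (simp add: mult.assoc[symmetric] cur_comm(10) left_diff_distrib add.commute del: ypow.simps)
  also have "\<dots> \<simeq> (\<Sum>c\<le>s. cur sl_y2 c * uea_scale (- 2 * of_nat (Suc k)) (?R k (s - c))
          - uea_scale 2 (cur sl_y2 (c + r) * ypow (Suc k) (s - c)))"
    by (intro eqv_sum eqv_diff eqv_refl eqv_mult Suc)
  also have "\<dots> = uea_scale (- 2 * of_nat (Suc k)) (\<Sum>c\<le>s. cur sl_y2 c * ?R k (s - c))
          - uea_scale 2 (?R (Suc k) s)"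
    unfolding sum_subtractf uea_scale_mult_right uea.scale_sum_right[symmetric] ..
  also have "(\<Sum>c\<le>s. cur sl_y2 c * ?R k (s - c)) = ?R (Suc k) s"
    using y2_ypow_commute[where s = s and a = "\<lambda>_. 1" and r = r and k = k] by simp
  also have "uea_scale (- 2 * of_nat (Suc k)) (?R (Suc k) s) - uea_scale 2 (?R (Suc k) s)
      = uea_scale (- 2 * of_nat (Suc (Suc k))) (?R (Suc k) s)"
    unfolding uea.scale_left_diff_distrib[symmetric]
    by (rule arg_cong[where f = "\<lambda>c. uea_scale c _"], simp add: algebra_simps)
  finally show ?case .
qed

text \<open>The relevant case of Garland's identity: up to a nonzero factor, \<open>x\<^sub>2(1)\<close> turns the coefficient of
  \<open>y(z)^(k+1) v\<close> at \<open>z^s\<close> into the one of \<open>y(z)^k v\<close> at \<open>z^(s+1)\<close>. Commuting \<open>x\<^sub>2(1)\<close> with the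
  first factor \<open>y\<^sub>2(c)\<close> produces \<open>h\<^sub>2(c + 1)\<close>, whose action on the other factors is given by
  \<open>h2_ypow\<close>; the resulting sum carries the weight \<open>c\<close> and is evaluated by \<open>ypow_weighted\<close>.\<close>

lemma x2_ypow:
  "cur sl_x2 1 * ypow (Suc k) s \<simeq> uea_scale (- (of_nat (Suc k) * of_nat (Suc s))) (ypow k (Suc s))"
proof (induction k arbitrary: s)
  case 0
  have "cur sl_x2 1 * ypow (Suc 0) s = cur sl_y2 s * (cur sl_x2 1 * v) + cur sl_h2 (Suc s) * v"
    unfolding ypow_1 by (simp add: mult.assoc[symmetric] cur_comm(7) distrib_right)
  also have "\<dots> \<simeq> 0"
    unfolding eqv_zero by (intro uea.subspace_add[OF E] y2_E x2_v h2_v) simp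
  finally show ?case by simp
next
  case (Suc k)
  let ?K = "of_nat (Suc k) :: complex"
  let ?t = "Suc s"
  let ?S = "\<Sum>c\<le>?t. uea_scale (of_nat c) (cur sl_y2 c * ypow k (?t - c))"
  have "cur sl_x2 1 * ypow (Suc (Suc k)) s
      = (\<Sum>c\<le>s. cur sl_y2 c * (cur sl_x2 1 * ypow (Suc k) (s - c))
          + cur sl_h2 (Suc c) * ypow (Suc k) (s - c))"
    unfolding ypow.simps(2)[of "Suc k"] sum_distrib_left
    by (simp add: mult.assoc[symmetric] cur_comm(7) distrib_right del: ypow.simps)
  also have "\<dots> \<simeq> (\<Sum>c\<le>s. cur sl_y2 c * uea_scale (- (?K * of_nat (Suc (s - c)))) (ypow k (Suc (s - c)))
       + uea_scale (- 2 * ?K) (\<Sum>d\<le>s - c. cur sl_y2 (d + Suc c) * ypow k (s - c - d)))"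
    by (intro eqv_sum eqv_add eqv_mult Suc h2_ypow) simp
  also have "\<dots> = (\<Sum>c\<le>s. cur sl_y2 c * uea_scale (- (?K * of_nat (Suc (s - c)))) (ypow k (Suc (s - c))))
       + uea_scale (- 2 * ?K) (\<Sum>c\<le>s. \<Sum>d\<le>s - c. cur sl_y2 (d + Suc c) * ypow k (s - c - d))"
    by (simp only: sum.distrib uea.scale_sum_right)
  also have "(\<Sum>c\<le>s. \<Sum>d\<le>s - c. cur sl_y2 (d + Suc c) * ypow k (s - c - d)) = ?S"
  proof -
    have "(\<Sum>c\<le>s. \<Sum>d\<le>s - c. cur sl_y2 (d + Suc c) * ypow k (s - c - d))
       = (\<Sum>(c, d)\<in>{(c, d). c + d \<le> s}. cur sl_y2 (d + Suc c) * ypow k (s - c - d))"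
      by (simp add: sum.Sigma) (intro sum.cong, auto)
    also have "\<dots> = (\<Sum>e\<le>s. \<Sum>c\<le>e. cur sl_y2 (e - c + Suc c) * ypow k (s - c - (e - c)))"
      by (rule sum.triangle_reindex_eq)
    also have "\<dots> = (\<Sum>e\<le>s. \<Sum>c\<le>e. cur sl_y2 (Suc e) * ypow k (?t - Suc e))"
      by (intro sum.cong) auto
    also have "\<dots> = (\<Sum>e\<le>s. uea_scale (of_nat (Suc e)) (cur sl_y2 (Suc e) * ypow k (?t - Suc e)))"
      by (simp only: uea.sum_constant_scale card_atMost)
    also have "\<dots> = ?S"
      by (simp add: sum.atMost_Suc_shift del: sum.atMost_Suc)
    finally show ?thesis .
  qed
  also have "(\<Sum>c\<le>s. cur sl_y2 c * uea_scale (- (?K * of_nat (Suc (s - c)))) (ypow k (Suc (s - c))))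
      = uea_scale (- ?K) (uea_scale (of_nat ?t) (ypow (Suc k) ?t) - ?S)"
  proof -
    have "uea_scale (of_nat ?t) (ypow (Suc k) ?t) - ?S
        = (\<Sum>c\<le>?t. uea_scale (of_nat (?t - c)) (cur sl_y2 c * ypow k (?t - c)))"
      unfolding ypow.simps(2) uea.scale_sum_right sum_subtractf[symmetric]
      by (rule sum.cong[OF refl])
        (simp add: of_nat_diff uea.scale_left_diff_distrib[symmetric] del: of_nat_Suc)
    also have "\<dots> = (\<Sum>c\<le>s. uea_scale (of_nat (Suc (s - c))) (cur sl_y2 c * ypow k (Suc (s - c))))"
      by (simp add: Suc_diff_le of_nat_diff add_diff_eq)
    finally show ?thesis
      by (simp only: uea_scale_mult_right uea.scale_sum_right uea.scale_scale mult_minus_left)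
  qed
  also have "uea_scale (- ?K) (uea_scale (of_nat ?t) (ypow (Suc k) ?t) - ?S) + uea_scale (- 2 * ?K) ?S
      = uea_scale (- (?K * of_nat ?t)) (ypow (Suc k) ?t) - uea_scale ?K ?S"
    using uea.scale_left_distrib[of "- ?K" "- ?K" ?S]
    by (simp add: uea.scale_right_diff_distrib del: ypow.simps of_nat_Suc sum.atMost_Suc)
  also have "uea_scale ?K ?S = uea_scale (of_nat ?t) (ypow (Suc k) ?t)"
    by (rule ypow_weighted)
  also have "uea_scale (- (?K * of_nat ?t)) (ypow (Suc k) ?t) - uea_scale (of_nat ?t) (ypow (Suc k) ?t)
      = uea_scale (- (of_nat (Suc (Suc k)) * of_nat ?t)) (ypow (Suc k) ?t)"
    unfolding uea.scale_left_diff_distrib[symmetric]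
    by (rule arg_cong[where f = "\<lambda>c. uea_scale c _"], simp add: algebra_simps)
  finally show ?case .
qed

lemma h2_0_ypow: "cur sl_h2 0 * ypow k 0 \<simeq> uea_scale (of_nat m - 2 * of_nat k) (ypow k 0)"
proof (induction k)
  case 0
  show ?case using h2_0_v by (simp add: eqv_def)
next
  case (Suc k)
  have "cur sl_h2 0 * ypow (Suc k) 0 = cur sl_y2 0 * (cur sl_h2 0 * ypow k 0) - uea_scale 2 (ypow (Suc k) 0)"
    by (simp add: mult.assoc[symmetric] cur_comm(10) left_diff_distrib)
  also have "\<dots> \<simeq> cur sl_y2 0 * uea_scale (of_nat m - 2 * of_nat k) (ypow k 0) - uea_scale 2 (ypow (Suc k) 0)"
    by (intro eqv_diff eqv_refl eqv_mult Suc)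
  also have "\<dots> = uea_scale (of_nat m - 2 * of_nat (Suc k)) (ypow (Suc k) 0)"
    unfolding uea_scale_mult_right ypow_Suc_0[symmetric] uea.scale_left_diff_distrib[symmetric]
    by (rule arg_cong[where f = "\<lambda>c. uea_scale c _"], simp add: algebra_simps)
  finally show ?case .
qed

lemma x2_0_ypow:
  "cur sl_x2 0 * ypow (Suc k) 0 \<simeq> uea_scale (of_nat (Suc k) * (of_nat m - of_nat k)) (ypow k 0)"
proof (induction k)
  case 0
  have "cur sl_x2 0 * ypow (Suc 0) 0 = cur sl_y2 0 * (cur sl_x2 0 * v) + cur sl_h2 0 * v"
    by (simp add: mult.assoc[symmetric] cur_comm(7) distrib_right)
  also have "\<dots> \<simeq> 0 + uea_scale (of_nat m) v"
    using h2_0_v x2_v y2_E by (intro eqv_add) (simp_all add: eqv_def)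
  finally show ?case by simp
next
  case (Suc k)
  have "cur sl_x2 0 * ypow (Suc (Suc k)) 0
      = cur sl_y2 0 * (cur sl_x2 0 * ypow (Suc k) 0) + cur sl_h2 0 * ypow (Suc k) 0"
    unfolding ypow_Suc_0[of "Suc k"]
    by (simp add: mult.assoc[symmetric] cur_comm(7) distrib_right del: ypow.simps)
  also have "\<dots> \<simeq> cur sl_y2 0 * uea_scale (of_nat (Suc k) * (of_nat m - of_nat k)) (ypow k 0)
      + uea_scale (of_nat m - 2 * of_nat (Suc k)) (ypow (Suc k) 0)"
    by (intro eqv_add eqv_mult Suc h2_0_ypow)
  also have "\<dots> = uea_scale (of_nat (Suc (Suc k)) * (of_nat m - of_nat (Suc k))) (ypow (Suc k) 0)"
    unfolding uea_scale_mult_right ypow_Suc_0[symmetric] uea.scale_left_distrib[symmetric]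
    by (rule arg_cong[where f = "\<lambda>c. uea_scale c _"], simp add: algebra_simps)
  finally show ?case .
qed

text \<open>The powers \<open>y\<^sub>2(0)^k v\<close> vanish for large \<open>k\<close>, and \<open>x\<^sub>2(0)\<close> sends the power \<open>j + 1\<close> to
  \<open>(j + 1) (m - j)\<close> times the power \<open>j\<close>. The factor is nonzero for \<open>j > m\<close>, so the vanishing
  descends to all exponents above \<open>m\<close>.\<close>

lemma ypow_0_in_E: "m < k \<Longrightarrow> ypow k 0 \<in> E"
proof -
  obtain M where M: "cur sl_y2 0 ^ M * v \<in> E"
    using y2_power_v by blast
  have pow: "ypow k 0 = cur sl_y2 0 ^ k * v" for k
    by (induction k) (simp_all add: mult.assoc)
  have big: "ypow (M + j) 0 \<in> E" for j
    using M by (induction j) (simp_all add: pow[symmetric] y2_E)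
  have "m < k \<Longrightarrow> ypow k 0 \<in> E"
  proof (cases "k \<le> M")
    case True
    then show "m < k \<Longrightarrow> ypow k 0 \<in> E"
    proof (induction rule: inc_induct)
      case base
      show ?case using big[of 0] by simp
    next
      case (step j)
      then have "cur sl_x2 0 * ypow (Suc j) 0 \<in> E"
        by (intro x2_E) auto
      then have "uea_scale (of_nat (Suc j) * (of_nat m - of_nat j)) (ypow j 0) \<in> E"
        by (rule eqv_E[OF x2_0_ypow])
      from uea.subspace_scale[OF E this, of "inverse (of_nat (Suc j) * (of_nat m - of_nat j))"]
      moreover have "of_nat (Suc j) * (of_nat m - of_nat j) \<noteq> (0 :: complex)"
        using step.hyps step.prems by (simp del: of_nat_Suc)
      ultimately show ?case
        by (simp only: uea.scale_scale left_inverse uea.scale_one not_False_eq_True)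
    qed
  next
    case False
    then show ?thesis using big[of "k - M"] by simp
  qed
  then show "m < k \<Longrightarrow> ypow k 0 \<in> E" .
qed

text \<open>Each application of Garland's identity trades one factor \<open>y\<^sub>2\<close> for one degree in \<open>t\<close>, which
  leaves \<open>s + k\<close> unchanged. The case \<open>s = 0\<close> is the preceding lemma.\<close>

lemma ypow_in_E: "m < s + k \<Longrightarrow> ypow k s \<in> E"
proof (induction s arbitrary: k)
  case 0
  then show ?case by (simp add: ypow_0_in_E)
next
  case (Suc s)
  then have "cur sl_x2 1 * ypow (Suc k) s \<in> E"
    by (intro x2_E Suc.IH) simp
  then have "uea_scale (- (of_nat (Suc k) * of_nat (Suc s))) (ypow k (Suc s)) \<in> E"
    by (rule eqv_E[OF x2_ypow])
  from uea.subspace_scale[OF E this, of "inverse (- (of_nat (Suc k) * of_nat (Suc s)))"]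
  moreover have "- (of_nat (Suc k) * of_nat (Suc s)) \<noteq> (0 :: complex)"
    by (simp del: of_nat_Suc)
  ultimately show ?case
    by (simp only: uea.scale_scale left_inverse uea.scale_one not_False_eq_True)
qed

lemma y2_v_in_E: "m \<le> b \<Longrightarrow> cur sl_y2 b * v \<in> E"
  using ypow_in_E[of b "Suc 0"] by (simp add: ypow_1 del: ypow.simps)

text \<open>The relation \<open>h\<^sub>s = 0\<close> holds for the list of zero exponents by \<open>ypow_in_E\<close>. As \<open>h\<^sub>2(r)\<close> kills
  \<open>v\<close> for \<open>r > 0\<close>, it acts on the products of elements \<open>y\<^sub>2(c)\<close> as \<open>-2\<close> times the multiplication by
  a power sum, and the power sums generate all symmetric polynomials.\<close>

lemma hsum_ymon_in_E:
  assumes "length cs = k" "m < s + k"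
  shows "hsum s (\<lambda>l. ymon l * v) cs \<in> E"
proof (rule uea.adj_sym_dsum_closed[OF E adj_sym_hsum[OF adj_sym_ymon] _ _ assms(1)])
  show "hsum s (\<lambda>l. ymon l * v) (replicate k 0) \<in> E"
    unfolding hsum_replicate_ymon using ypow_in_E assms by simp
  fix r :: nat and cs
  assume r: "0 < r" and cs: "hsum s (\<lambda>l. ymon l * v) cs \<in> E"
  have yE: "u \<in> E \<Longrightarrow> ymon l * u \<in> E" for l u
    by (induction l) (auto simp: mult.assoc y2_E)
  have "cur sl_h2 r * hsum s (\<lambda>l. ymon l * v) cs
      = hsum s (\<lambda>l. cur sl_h2 r * (ymon l * v)) cs"
    by (rule hsum_additive[symmetric]) (simp_all add: distrib_left)
  also have "\<dots> = hsum s (\<lambda>l. ymon l * (cur sl_h2 r * v)) cs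
      - uea_scale 2 (hsum s (dsum r (\<lambda>l. ymon l * v)) cs)"
    unfolding h2_ymon hsum_diff
    by (subst hsum_additive[of "uea_scale 2"]) (simp_all add: uea.scale_right_distrib)
  finally have "uea_scale 2 (hsum s (dsum r (\<lambda>l. ymon l * v)) cs)
      = hsum s (\<lambda>l. ymon l * (cur sl_h2 r * v)) cs - cur sl_h2 r * hsum s (\<lambda>l. ymon l * v) cs"
    by simp
  also have "\<dots> \<in> E"
    by (intro uea.subspace_diff[OF E] uea.hsum_subspace[OF E] yE h2_v h2_E r cs)
  finally have "uea_scale 2 (hsum s (dsum r (\<lambda>l. ymon l * v)) cs) \<in> E" .
  from uea.subspace_scale[OF E this, of "1 / 2"]
  show "dsum r (hsum s (\<lambda>l. ymon l * v)) cs \<in> E"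
    by (simp add: hsum_dsum)
qed

lemma ymon_spanning:
  "\<exists>B. finite B \<and> card B \<le> 2 ^ m \<and> (\<forall>cs. ymon cs * v \<in> uea.span (B \<union> E))"
proof -
  have "\<exists>B. finite B \<and> card B \<le> m choose k \<and> (\<forall>cs. length cs = k \<longrightarrow> ymon cs * v \<in> uea.span (B \<union> E))"
    for k
    using hsum_ymon_in_E by (intro uea.span_symmetric_mod_hsum[OF E adj_sym_ymon]) auto
  then obtain B where B: "\<And>k. finite (B k)" "\<And>k. card (B k) \<le> m choose k"
    "\<And>cs. ymon cs * v \<in> uea.span (B (length cs) \<union> E)"
    by metis
  let ?B = "\<Union>k\<le>m. B k"
  have "card ?B \<le> (\<Sum>k\<le>m. card (B k))"
    by (rule card_UN_le) simp
  also have "\<dots> \<le> (\<Sum>k\<le>m. m choose k)"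
    by (intro sum_mono B)
  also have "\<dots> = 2 ^ m"
    by (rule choose_row_sum)
  finally have "card ?B \<le> 2 ^ m" .
  moreover have "ymon cs * v \<in> uea.span (?B \<union> E)" for cs
  proof (cases "length cs \<le> m")
    case True
    then have "uea.span (B (length cs) \<union> E) \<subseteq> uea.span (?B \<union> E)"
      by (intro uea.span_mono) auto
    then show ?thesis using B(3) by blast
  next
    case False
    then show ?thesis
      using hsum_ymon_in_E[of cs "length cs" 0] by (intro uea.span_base) auto
  qed
  ultimately show ?thesis
    using B(1) by (intro exI[of _ ?B]) auto
qed

end

section \<open>Left ideals and words in the negative generators\<close>

lemma left_ideal_add: "a \<in> left_ideal S \<Longrightarrow> b \<in> left_ideal S \<Longrightarrow> a + b \<in> left_ideal S"
  by (induction rule: left_ideal.induct) (auto simp: add.assoc intro: left_ideal.step)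

lemma left_ideal_mult: "a \<in> left_ideal S \<Longrightarrow> u * a \<in> left_ideal S"
proof (induction rule: left_ideal.induct)
  case (step s a w)
  have "u * (w * s + a) = (u * w) * s + u * a"
    by (simp add: distrib_left mult.assoc)
  with step show ?case
    by (metis left_ideal.step)
qed (simp add: left_ideal.zero)

lemma left_ideal_base: "s \<in> S \<Longrightarrow> s \<in> left_ideal S"
  using left_ideal.step[OF _ left_ideal.zero, of s S 1] by simp

lemma subspace_left_ideal: "uea.subspace (left_ideal S)"
  unfolding uea.subspace_def uea_scale_def
  by (auto intro: left_ideal.zero left_ideal_add left_ideal_mult)

lemma left_ideal_least:
  assumes "S \<subseteq> T" "0 \<in> T" "\<And>a b. a \<in> T \<Longrightarrow> b \<in> T \<Longrightarrow> a + b \<in> T" "\<And>u a. a \<in> T \<Longrightarrow> u * a \<in> T"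
  shows "left_ideal S \<subseteq> T"
proof
  fix a assume "a \<in> left_ideal S"
  then show "a \<in> T"
    by (induction rule: left_ideal.induct) (use assms in auto)
qed

lemma wt_nat_eq: "snd l = of_nat n \<Longrightarrow> wt_nat l = n"
  unfolding wt_nat_def by (rule the_equality) auto

lemma cartan_elt_simps: "cartan_elt 1 0 = sl_h1" "cartan_elt 0 1 = sl_h2"
  by (simp_all add: cartan_elt_def lscale_one)

lemma sl12_decomposition:
  fixes g :: sl12
  obtains a b c d e f k l where
    "g = lscale a sl_x1 + lscale b sl_y3 + lscale c sl_y2 + lscale d sl_y1 + lscale e sl_x2
      + lscale f sl_x3 + cartan_elt k l"
proof
  let ?A = "Rep_sl12 g"
  have tr: "?A $ 1 $ 1 = ?A $ 2 $ 2 + ?A $ 3 $ 3"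
    using Rep_sl12[of g] by (simp add: algebra_simps)
  show "g = lscale (?A $ 1 $ 2) sl_x1 + lscale (?A $ 3 $ 1) sl_y3 + lscale (?A $ 3 $ 2) sl_y2
      + lscale (?A $ 2 $ 1) sl_y1 + lscale (?A $ 2 $ 3) sl_x2 + lscale (?A $ 1 $ 3) sl_x3
      + cartan_elt (?A $ 1 $ 1) (- ?A $ 3 $ 3)"
    unfolding Rep_sl12_inject[symmetric] cartan_elt_def plus_sl12.rep_eq lscale_sl12.rep_eq
      Rep_sl_simps
    by (simp add: vec_eq_iff forall_3 mat_scale_def mat_unit_def tr)
qed

text \<open>The spanning part of the theorem of Poincare, Birkhoff and Witt: if every element of the Lie
  superalgebra is, modulo the left ideal \<open>J\<close>, a combination of elements of \<open>Z\<close> and of \<open>1\<close>, then the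
  words in \<open>Z\<close> span. To multiply a word by \<open>g\<close> from the left, move \<open>g\<close> past the first letter \<open>z\<close>;
  both \<open>g\<close> and the bracket of \<open>g\<close> and \<open>z\<close> then act on a shorter word.\<close>

lemma negative_words_generate:
  fixes J :: "'l :: lie_superalgebra uea set" and Z :: "'l set"
  assumes J: "\<And>u a. a \<in> J \<Longrightarrow> u * a \<in> J"
    and Z: "\<And>z. z \<in> Z \<Longrightarrow> \<exists>q. lpart q z = z"
    and base: "\<And>g. uea_inc g \<in> uea.span (uea_inc ` Z \<union> {1} \<union> J)"
  shows "u \<in> uea.span ({prod_list (map uea_inc zs) | zs. set zs \<subseteq> Z} \<union> J)"
proof -
  define W where "W = {prod_list (map uea_inc zs) | zs. set zs \<subseteq> Z}"
  let ?S = "uea.span (W \<union> J)"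
  have S_mult: "v * u \<in> ?S" if "u \<in> ?S" "\<And>w. w \<in> W \<Longrightarrow> v * w \<in> ?S" for v u
    using that(1)
  proof (induction rule: uea.span_induct_alt)
    case (step c x y)
    have "v * x \<in> ?S"
      using step(1) that(2) J by (auto intro: uea.span_base)
    with step show ?case
      by (simp add: distrib_left uea.span_add uea.span_scale)
  qed (simp add: uea.span_zero)
  have W_I: "prod_list (map uea_inc zs) \<in> ?S" if "set zs \<subseteq> Z" for zs
    unfolding W_def using that by (intro uea.span_base) auto
  have Z_mult: "uea_inc z * u \<in> ?S" if z: "z \<in> Z" and u: "u \<in> ?S" for z u
    using u
  proof (rule S_mult)
    fix w assume "w \<in> W"
    then obtain zs where "w = prod_list (map uea_inc zs)" "set zs \<subseteq> Z"
      unfolding W_def by blast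
    then show "uea_inc z * w \<in> ?S"
      using W_I[of "z # zs"] z by simp
  qed
  have word: "uea_inc g * prod_list (map uea_inc zs) \<in> ?S" if "set zs \<subseteq> Z" for g zs
    using that
  proof (induction zs arbitrary: g)
    case Nil
    have "uea_inc ` Z \<union> {1} \<union> J \<subseteq> ?S"
      using W_I[of "[]"] W_I[of "[_]"] by (auto intro: uea.span_base)
    then have "uea.span (uea_inc ` Z \<union> {1} \<union> J) \<subseteq> ?S"
      by (intro uea.span_minimal uea.subspace_span)
    then show ?case
      using base[of g] by auto
  next
    case (Cons z zs)
    obtain q where q: "lpart q z = z"
      using Z Cons.prems by auto
    let ?w = "prod_list (map uea_inc zs)"
    have IH: "uea_inc g' * ?w \<in> ?S" for g'
      using Cons by simp
    have hom: "uea_inc g' * (uea_inc z * ?w) \<in> ?S" if "lpart p g' = g'" for p g'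
    proof -
      have "uea_inc g' * (uea_inc z * ?w) = uea_scale (ssign p q) (uea_inc z * (uea_inc g' * ?w))
          + uea_inc (lbracket g' z) * ?w"
        using uea_inc_bracket[OF that q] by (simp add: distrib_right flip: mult.assoc)
      then show ?thesis
        using IH Z_mult[OF _ IH] Cons.prems by (simp add: uea.span_add uea.span_scale)
    qed
    have "uea_inc g = uea_inc (lpart 0 g) + uea_inc (lpart 1 g)"
      by (simp add: lpart_sum flip: uea_inc_add)
    then show ?case
      using hom[of 0 "lpart 0 g"] hom[of 1 "lpart 1 g"]
      by (simp add: distrib_right uea.span_add lpart_lpart)
  qed
  have "u \<in> ?S"
  proof (induction u rule: uea_induct)
    case one
    show ?case using W_I[of "[]"] by simp
  next
    case (mult g u)
    then show ?case
      by (rule S_mult) (use word in \<open>auto simp: W_def\<close>)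
  qed (simp_all add: uea.span_add uea.span_scale)
  then show ?thesis
    unfolding W_def .
qed

section \<open>Products of anticommuting elements\<close>

lemma anticomm_move:
  fixes z :: "'i \<Rightarrow> 'a :: ring_1"
  assumes "\<And>a b. z a * z b = - (z b * z a)"
  shows "prod_list (map z (xs @ x # ys)) = prod_list (map z (x # xs @ ys))
    \<or> prod_list (map z (xs @ x # ys)) = - prod_list (map z (x # xs @ ys))"
proof (induction xs)
  case (Cons a xs)
  have "z a * (z x * w) = - (z x * (z a * w))" for w
    using assms[of a x] by (simp flip: mult.assoc)
  with Cons show ?case by auto
qed simp

lemma anticomm_perm:
  fixes z :: "'i \<Rightarrow> 'a :: ring_1"
  assumes "\<And>a b. z a * z b = - (z b * z a)"
  shows "mset A = mset B \<Longrightarrow> prod_list (map z A) = prod_list (map z B)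
    \<or> prod_list (map z A) = - prod_list (map z B)"
proof (induction A arbitrary: B)
  case (Cons a A)
  then have "a \<in> set B"
    by (metis list.set_intros(1) set_mset_mset)
  then obtain xs ys where B: "B = xs @ a # ys"
    by (meson split_list)
  then have "mset A = mset (xs @ ys)"
    using Cons.prems by simp
  from Cons.IH[OF this] show ?case
    using anticomm_move[of z xs a ys, OF assms] unfolding B by auto
qed simp

lemma anticomm_not_distinct:
  assumes "\<And>a b. z a * z b = - (z b * z a)" "\<not> distinct A"
  shows "prod_list (map z A) = (0 :: 'l :: lie_superalgebra uea)"
proof -
  obtain xs x ys zs where A: "A = xs @ [x] @ ys @ [x] @ zs"
    using not_distinct_decomp[OF assms(2)] by auto
  have "z x * z x = 0"
  proof -
    have "uea_scale 2 (z x * z x) = z x * z x + z x * z x"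
      by (simp flip: uea.scale_left_distrib[of 1 1, simplified])
    also have "\<dots> = 0"
      using assms(1)[of x x] by (metis add.right_inverse)
    finally show ?thesis by simp
  qed
  then have "prod_list (map z (x # x # xs @ ys @ zs)) = 0"
    by (simp flip: mult.assoc)
  moreover have "mset A = mset (x # x # xs @ ys @ zs)"
    by (simp add: A)
  ultimately show ?thesis
    using anticomm_perm[of z A "x # x # xs @ ys @ zs", OF assms(1)] by auto
qed

section \<open>A spanning set of the local Weyl module\<close>

abbreviation xmon :: "nat list \<Rightarrow> sl12 poly uea" where
  "xmon A \<equiv> prod_list (map (cur sl_x1) A)"

abbreviation ymon3 :: "nat list \<Rightarrow> sl12 poly uea" where
  "ymon3 B \<equiv> prod_list (map (cur sl_y3) B)"

abbreviation oddmon :: "nat list \<Rightarrow> nat list \<Rightarrow> sl12 poly uea" where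
  "oddmon A B \<equiv> ymon3 B * xmon A"

lemma y2_commutes:
  "cur sl_y2 c * (ymon C * u) = ymon C * (cur sl_y2 c * u)"
  "cur sl_y3 c * (ymon C * u) = ymon C * (cur sl_y3 c * u)"
  "cur sl_x1 c * (ymon C * u) = ymon C * (cur sl_x1 c * u)"
proof -
  have l: "cur sl_y2 a * (cur sl_y2 b * u) = cur sl_y2 b * (cur sl_y2 a * u)"
    "cur sl_y3 a * (cur sl_y2 b * u) = cur sl_y2 b * (cur sl_y3 a * u)"
    "cur sl_x1 a * (cur sl_y2 b * u) = cur sl_y2 b * (cur sl_x1 a * u)" for a b u
    by (simp_all add: cur_comm(1)[of a b] cur_comm(2,3) flip: mult.assoc)
  show "cur sl_y2 c * (ymon C * u) = ymon C * (cur sl_y2 c * u)"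
    by (induction C) (simp_all add: mult.assoc l(1)[of c])
  show "cur sl_y3 c * (ymon C * u) = ymon C * (cur sl_y3 c * u)"
    "cur sl_x1 c * (ymon C * u) = ymon C * (cur sl_x1 c * u)"
    by (induction C) (simp_all add: mult.assoc l)
qed

lemma ymon3_ymon: "ymon3 B * (ymon C * u) = ymon C * (ymon3 B * u)"
  by (induction B) (simp_all add: mult.assoc y2_commutes)

lemma y2_pow_oddmon: "cur sl_y2 c ^ k * oddmon A B = oddmon A B * cur sl_y2 c ^ k"
proof (rule power_commuting_commutes)
  have 1: "xmon A * cur sl_y2 c = cur sl_y2 c * xmon A"
    by (induction A) (simp_all add: mult.assoc cur_comm(2), simp add: cur_comm(2) flip: mult.assoc)
  have 2: "ymon3 B * cur sl_y2 c = cur sl_y2 c * ymon3 B"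
    by (induction B) (simp_all add: mult.assoc cur_comm(3), simp add: cur_comm(3) flip: mult.assoc)
  show "cur sl_y2 c * oddmon A B = oddmon A B * cur sl_y2 c"
    unfolding mult.assoc 1 unfolding mult.assoc[symmetric] 2 ..
qed

locale weyl_weight =
  fixes lam :: weight and n :: nat
  assumes lam: "snd lam = of_nat n"
begin

definition I :: "sl12 poly uea set" where
  "I = weyl_ideal lam"

lemma I_subspace: "uea.subspace I"
  unfolding I_def weyl_ideal_def by (rule subspace_left_ideal)

lemma I_mult: "a \<in> I \<Longrightarrow> u * a \<in> I"
  unfolding I_def weyl_ideal_def by (rule left_ideal_mult)

lemma I_nplus: "x \<in> {sl_y1, sl_x2, sl_x3} \<Longrightarrow> cur x r \<in> I"
  unfolding I_def weyl_ideal_def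
  by (intro left_ideal_base UnI1 imageI)
    (auto simp: nplus_def intro: lie.span_base lie.span_zero)

lemma I_cartan: "cur (cartan_elt a b) r - uea_const (if r = 0 then wt_apply lam a b else 0) \<in> I"
  unfolding I_def weyl_ideal_def by (intro left_ideal_base UnI1[OF UnI2]) blast

lemma I_h1: "cur sl_h1 r - uea_scale (if r = 0 then fst lam else 0) 1 \<in> I"
  using I_cartan[of 1 0 r] by (cases "r = 0") (simp_all add: cartan_elt_simps wt_apply_def uea_const_eq_scale)

lemma I_h2: "cur sl_h2 r - uea_scale (if r = 0 then of_nat n else 0) 1 \<in> I"
  using I_cartan[of 0 1 r] by (cases "r = 0") (simp_all add: cartan_elt_simps wt_apply_def uea_const_eq_scale lam)

lemma I_y2: "cur sl_y2 0 ^ Suc n \<in> I"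
  unfolding I_def weyl_ideal_def wt_nat_eq[OF lam] by (rule left_ideal_base) simp

abbreviation mspan :: "sl12 poly uea set \<Rightarrow> sl12 poly uea set" where
  "mspan X \<equiv> uea.span (X \<union> I)"

lemma mspan_I: "u \<in> I \<Longrightarrow> u \<in> mspan X"
  by (rule uea.span_base) simp

lemma mspan_base: "u \<in> X \<Longrightarrow> u \<in> mspan X"
  by (rule uea.span_base) simp

lemma mspan_mult:
  assumes "u \<in> mspan X" "\<And>x. x \<in> X \<Longrightarrow> z * x \<in> mspan Y"
  shows "z * u \<in> mspan Y"
  using assms(1)
proof (induction rule: uea.span_induct_alt)
  case (step c x y)
  have "z * x \<in> mspan Y"
  proof (cases "x \<in> X")
    case True
    then show ?thesis by (rule assms(2))
  next
    case False
    then have "x \<in> I" using step by simp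
    then show ?thesis by (rule mspan_I[OF I_mult])
  qed
  with step show ?case
    by (simp add: distrib_left uea.span_add uea.span_scale)
qed (simp add: uea.span_zero)

lemma mult_h1: "u * cur sl_h1 r \<in> mspan {u}"
proof -
  have "u * cur sl_h1 r = u * (cur sl_h1 r - uea_scale (if r = 0 then fst lam else 0) 1)
      + uea_scale (if r = 0 then fst lam else 0) u"
    by (simp add: right_diff_distrib)
  also have "\<dots> \<in> mspan {u}"
    by (rule uea.span_add[OF mspan_I[OF I_mult[OF I_h1]] uea.span_scale[OF mspan_base]]) simp
  finally show ?thesis .
qed

lemma mult_h2: "u * cur sl_h2 r - uea_scale (if r = 0 then of_nat n else 0) u \<in> I"
  using I_mult[OF I_h2[of r], of u] by (simp add: right_diff_distrib)

text \<open>Moving \<open>y\<^sub>1\<close> to the right, each factor \<open>x\<^sub>1\<close> in turn is replaced by an element \<open>h\<^sub>1\<close>, which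
  commutes with \<open>x\<^sub>1\<close> and acts on the generator by a scalar.\<close>

lemma y1_xmon: "cur sl_y1 c * xmon A \<in> mspan {xmon A' | A'. Suc (length A') = length A}"
proof (induction A)
  case Nil
  then show ?case by (simp add: uea.span_base I_nplus)
next
  case (Cons a A)
  let ?S = "mspan {xmon A' | A'. Suc (length A') = length (a # A)}"
  have "cur sl_y1 c * xmon (a # A)
      = - (cur sl_x1 a * (cur sl_y1 c * xmon A)) + cur sl_h1 (c + a) * xmon A"
    by (simp add: mult.assoc[symmetric] cur_comm distrib_right left_diff_distrib)
  moreover have "cur sl_x1 a * (cur sl_y1 c * xmon A) \<in> ?S"
    using Cons
  proof (rule mspan_mult)
    fix x assume "x \<in> {xmon A' | A'. Suc (length A') = length A}"
    then obtain A' where "x = xmon A'" "Suc (length A') = length A" by blast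
    then have "cur sl_x1 a * x = xmon (a # A')" "Suc (length (a # A')) = length (a # A)"
      by simp_all
    then show "cur sl_x1 a * x \<in> ?S"
      by (intro mspan_base) blast
  qed
  moreover have "cur sl_h1 r * (cur sl_x1 b * w) = cur sl_x1 b * (cur sl_h1 r * w)" for r b w
    by (simp add: cur_comm flip: mult.assoc)
  then have "cur sl_h1 r * xmon A = xmon A * cur sl_h1 r" for r
    by (induction A) (simp_all add: mult.assoc)
  then have "cur sl_h1 (c + a) * xmon A \<in> mspan {xmon A}"
    using mult_h1[of "xmon A" "c + a"] by simp
  then have "cur sl_h1 (c + a) * xmon A \<in> ?S"
    by (rule rev_subsetD) (intro uea.span_mono, auto)
  ultimately show ?case
    by (simp add: uea.span_add uea.span_neg uea.span_diff)
qed

lemma x3_xmon: "cur sl_x3 c * xmon A \<in> I"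
proof (induction A)
  case (Cons a A)
  have "cur sl_x3 c * xmon (a # A) = (- cur sl_x1 a) * (cur sl_x3 c * xmon A)"
    by (simp add: mult.assoc[symmetric] cur_comm)
  then show ?case
    using Cons I_mult[of "cur sl_x3 c * xmon A" "- cur sl_x1 a"] by simp
qed (simp add: I_nplus)

lemma x2_xmon: "cur sl_x2 c * xmon A \<in> I"
proof (induction A)
  case (Cons a A)
  have "cur sl_x2 c * xmon (a # A) = cur sl_x1 a * (cur sl_x2 c * xmon A) - cur sl_x3 (c + a) * xmon A"
    by (simp add: mult.assoc[symmetric] cur_comm left_diff_distrib)
  then show ?case
    using Cons I_mult x3_xmon uea.subspace_diff[OF I_subspace] by simp
qed (simp add: I_nplus)

text \<open>The element \<open>x\<^sub>2\<close> takes one \<open>y\<^sub>3\<close> to \<open>y\<^sub>1\<close>, and this \<open>y\<^sub>1\<close> removes one \<open>x\<^sub>1\<close>.\<close>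

lemma x2_oddmon: "cur sl_x2 c * oddmon A B
    \<in> mspan {oddmon A' B' | A' B'. Suc (length A') = length A \<and> Suc (length B') = length B}"
proof (induction B)
  case Nil
  then show ?case by (simp add: uea.span_base x2_xmon)
next
  case (Cons b B)
  let ?S = "mspan {oddmon A' B' | A' B'. Suc (length A') = length A \<and> Suc (length B') = length (b # B)}"
  have "cur sl_x2 c * oddmon A (b # B)
      = cur sl_y3 b * (cur sl_x2 c * oddmon A B) + cur sl_y1 (c + b) * oddmon A B"
    by (simp add: mult.assoc[symmetric] cur_comm distrib_right)
  moreover have "cur sl_y3 b * (cur sl_x2 c * oddmon A B) \<in> ?S"
    using Cons
  proof (rule mspan_mult)
    fix x assume "x \<in> {oddmon A' B' | A' B'. Suc (length A') = length A \<and> Suc (length B') = length B}"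
    then obtain A' B' where "x = oddmon A' B'" "Suc (length A') = length A" "Suc (length B') = length B"
      by blast
    then have "cur sl_y3 b * x = oddmon A' (b # B')" "Suc (length A') = length A"
      "Suc (length (b # B')) = length (b # B)"
      by (simp_all add: mult.assoc)
    then show "cur sl_y3 b * x \<in> ?S"
      by (intro mspan_base) blast
  qed
  moreover have "cur sl_y1 r * oddmon A B
      \<in> mspan {oddmon A' B' | A' B'. Suc (length A') = length A \<and> length B' = length B}" for r
  proof (induction B)
    case Nil
    then show ?case using y1_xmon[of r A] by simp
  next
    case (Cons b B)
    have "cur sl_y1 r * oddmon A (b # B) = - (cur sl_y3 b * (cur sl_y1 r * oddmon A B))"
      by (simp add: mult.assoc[symmetric] cur_comm)
    moreover have "cur sl_y3 b * (cur sl_y1 r * oddmon A B)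
      \<in> mspan {oddmon A' B' | A' B'. Suc (length A') = length A \<and> length B' = length (b # B)}"
      using Cons
    proof (rule mspan_mult)
      fix x assume "x \<in> {oddmon A' B' | A' B'. Suc (length A') = length A \<and> length B' = length B}"
      then obtain A' B' where "x = oddmon A' B'" "Suc (length A') = length A" "length B' = length B"
        by blast
      then have "cur sl_y3 b * x = oddmon A' (b # B')" "Suc (length A') = length A"
        "length (b # B') = length (b # B)"
        by (simp_all add: mult.assoc)
      then show "cur sl_y3 b * x
          \<in> mspan {oddmon A' B' | A' B'. Suc (length A') = length A \<and> length B' = length (b # B)}"
        by (intro mspan_base) blast
    qed
    ultimately show ?case
      by (simp add: uea.span_neg)
  qed
  then have "cur sl_y1 (c + b) * oddmon A B \<in> ?S" by simp
  ultimately show ?case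
    by (simp add: uea.span_add)
qed

lemma h2_oddmon: "cur sl_h2 r * oddmon A B = oddmon A B * cur sl_h2 r
    - dsum r (\<lambda>l. oddmon A l) B - dsum r (\<lambda>l. oddmon l B) A"
proof -
  have "cur sl_h2 r * oddmon A B
      = ymon3 B * (cur sl_h2 r * xmon A) - dsum r (\<lambda>l. oddmon A l) B"
    using commute_mon[of "cur sl_h2 r" "cur sl_y3" "- 1" r B "xmon A"]
    by (simp add: cur_comm add.commute)
  also have "cur sl_h2 r * xmon A = xmon A * cur sl_h2 r - dsum r xmon A"
    using commute_mon[of "cur sl_h2 r" "cur sl_x1" "- 1" r A 1]
    by (simp add: cur_comm add.commute)
  also have "ymon3 B * (xmon A * cur sl_h2 r - dsum r xmon A)
      = oddmon A B * cur sl_h2 r - dsum r (\<lambda>l. oddmon l B) A"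
    by (simp add: right_diff_distrib mult.assoc dsum_additive[symmetric] distrib_left)
  finally show ?thesis by simp
qed

lemma dsum_0: "dsum 0 F cs = uea_scale (of_nat (length cs)) (F cs)"
  for F :: "nat list \<Rightarrow> 'l :: lie_superalgebra uea"
  by (induction cs arbitrary: F) (simp_all add: uea.scale_left_distrib)

lemma h2_0_oddmon: "cur sl_h2 0 * oddmon A B
    - uea_scale (of_nat n - of_nat (length A) - of_nat (length B)) (oddmon A B) \<in> I"
proof -
  have "cur sl_h2 0 * oddmon A B
    - uea_scale (of_nat n - of_nat (length A) - of_nat (length B)) (oddmon A B)
    = oddmon A B * cur sl_h2 0 - uea_scale (of_nat n) (oddmon A B)"
    by (simp add: h2_oddmon dsum_0 uea.scale_left_diff_distrib)
  then show ?thesis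
    using mult_h2[of "oddmon A B" 0] by simp
qed

text \<open>The statistics of a monomial \<open>y\<^sub>2(C) y\<^sub>3(B) x\<^sub>1(A)\<close> are the number and the sum of the exponents
  \<open>A\<close>, followed by those of \<open>B\<close>. A condition \<open>Q\<close> on them defines the subspace \<open>D Q\<close>. The operators
  \<open>h\<^sub>2(r)\<close> raise the sum of \<open>A\<close> or of \<open>B\<close> by \<open>r\<close>, and the operators \<open>x\<^sub>2(r)\<close> remove one factor of
  either kind, so \<open>stat_closed\<close> makes \<open>D Q\<close> stable under the current algebra of
  \<open>\<langle>x\<^sub>2, h\<^sub>2, y\<^sub>2\<rangle>\<close>.\<close>

type_synonym stat = "nat \<Rightarrow> nat \<Rightarrow> nat \<Rightarrow> nat \<Rightarrow> bool"

abbreviation holds :: "stat \<Rightarrow> nat list \<Rightarrow> nat list \<Rightarrow> bool" where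
  "holds Q A B \<equiv> Q (length A) (sum_list A) (length B) (sum_list B)"

definition D :: "stat \<Rightarrow> sl12 poly uea set" where
  "D Q = mspan {ymon C * oddmon A B | C A B. holds Q A B}"

definition stat_closed :: "stat \<Rightarrow> bool" where
  "stat_closed Q \<longleftrightarrow> (\<forall>p a q b. Q p a q b \<longrightarrow>
     (\<forall>r. Q p (a + r) q b \<and> Q p a q (b + r)) \<and>
     (\<forall>p' a' q' b'. p = Suc p' \<longrightarrow> q = Suc q' \<longrightarrow> Q p' a' q' b'))"

lemma D_subspace: "uea.subspace (D Q)"
  by (simp add: D_def uea.subspace_span)

lemma D_I: "u \<in> I \<Longrightarrow> u \<in> D Q"
  by (simp add: D_def mspan_I)

lemma D_mon: "holds Q A B \<Longrightarrow> ymon C * oddmon A B \<in> D Q"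
  unfolding D_def by (rule mspan_base) blast

lemma D_oddmon: "holds Q A B \<Longrightarrow> oddmon A B \<in> D Q"
  using D_mon[of Q A B "[]"] by simp

lemma D_mult:
  assumes "u \<in> D Q" "\<And>C A B. holds Q A B \<Longrightarrow> z * (ymon C * oddmon A B) \<in> D Q'"
  shows "z * u \<in> D Q'"
  using assms(1) unfolding D_def by (rule mspan_mult) (use assms(2) D_def in auto)

lemma D_y2: "u \<in> D Q \<Longrightarrow> cur sl_y2 r * u \<in> D Q"
proof (rule D_mult)
  fix C A B assume "holds Q A B"
  then have "ymon (r # C) * oddmon A B \<in> D Q"
    by (rule D_mon)
  then show "cur sl_y2 r * (ymon C * oddmon A B) \<in> D Q"
    by (simp add: mult.assoc)
qed

lemma D_ymon: "u \<in> D Q \<Longrightarrow> ymon C * u \<in> D Q"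
  by (induction C) (simp_all add: mult.assoc D_y2)

lemma D_h2_oddmon:
  assumes "\<And>A'. length A' = length A \<Longrightarrow> sum_list A' = sum_list A + r \<Longrightarrow> holds Q A' B"
    and "\<And>B'. length B' = length B \<Longrightarrow> sum_list B' = sum_list B + r \<Longrightarrow> holds Q A B'"
    and "r = 0 \<Longrightarrow> holds Q A B"
  shows "cur sl_h2 r * oddmon A B \<in> D Q"
proof -
  have "oddmon A B * cur sl_h2 r \<in> D Q"
  proof -
    have "uea_scale (if r = 0 then of_nat n else 0) (oddmon A B) \<in> D Q"
    proof (cases "r = 0")
      case True
      then show ?thesis
        by (intro uea.subspace_scale[OF D_subspace] D_oddmon assms(3))
    next
      case False
      then show ?thesis by (simp add: uea.subspace_0[OF D_subspace])
    qed
    from uea.subspace_add[OF D_subspace D_I[OF mult_h2[of "oddmon A B" r]] this] show ?thesis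
      by simp
  qed
  then show ?thesis
    unfolding h2_oddmon
    by (intro uea.subspace_diff[OF D_subspace] uea.dsum_subspace[OF D_subspace] D_oddmon assms)
qed

lemma D_h2:
  assumes "stat_closed Q" "u \<in> D Q"
  shows "cur sl_h2 r * u \<in> D Q"
  using assms(2)
proof (rule D_mult)
  fix C A B assume Q: "holds Q A B"
  have "cur sl_h2 r * oddmon A B \<in> D Q"
    using assms(1) Q unfolding stat_closed_def by (intro D_h2_oddmon) auto
  then have "ymon C * (cur sl_h2 r * oddmon A B) \<in> D Q"
    by (rule D_ymon)
  moreover have "dsum r (\<lambda>l. ymon l * oddmon A B) C \<in> D Q"
    using Q by (intro uea.dsum_subspace[OF D_subspace] D_mon)
  ultimately show "cur sl_h2 r * (ymon C * oddmon A B) \<in> D Q"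
    unfolding h2_ymon by (intro uea.subspace_diff[OF D_subspace] uea.subspace_scale[OF D_subspace])
qed

lemma D_x2_oddmon:
  assumes "\<And>p' a' q' b'. length A = Suc p' \<Longrightarrow> length B = Suc q' \<Longrightarrow> Q p' a' q' b'"
  shows "cur sl_x2 r * oddmon A B \<in> D Q"
proof -
  have "mspan {oddmon A' B' | A' B'. Suc (length A') = length A \<and> Suc (length B') = length B} \<subseteq> D Q"
    using assms[OF sym sym] by (intro uea.span_minimal[OF _ D_subspace]) (auto intro: D_I D_oddmon)
  then show ?thesis
    using x2_oddmon by blast
qed

lemma D_x2:
  assumes Q: "stat_closed Q" and "u \<in> D Q"
  shows "cur sl_x2 r * u \<in> D Q"
  using assms(2)
proof (rule D_mult)
  fix C A B assume h: "holds Q A B"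
  show "cur sl_x2 r * (ymon C * oddmon A B) \<in> D Q"
  proof (induction C)
    case Nil
    show ?case
      using Q h unfolding stat_closed_def by (simp, intro D_x2_oddmon) blast
  next
    case (Cons c C)
    have "cur sl_x2 r * (ymon (c # C) * oddmon A B)
      = cur sl_y2 c * (cur sl_x2 r * (ymon C * oddmon A B)) + cur sl_h2 (r + c) * (ymon C * oddmon A B)"
      by (simp add: mult.assoc[symmetric] cur_comm distrib_right)
    then show ?case
      using Cons by (simp add: uea.subspace_add[OF D_subspace] D_y2 D_h2[OF Q] D_mon[where Q = Q and A = A and B = B, OF h])
  qed
qed

text \<open>If \<open>Q\<close> holds for all statistics that \<open>x\<^sub>2(r)\<close> and, for \<open>r > 0\<close>, \<open>h\<^sub>2(r)\<close> can produce from
  \<open>y\<^sub>3(B) x\<^sub>1(A)\<close>, this monomial is a highest weight vector modulo \<open>D Q\<close>. Each odd factor has weight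
  \<open>-1\<close> for \<open>h\<^sub>2\<close> and commutes with \<open>y\<^sub>2\<close>.\<close>

lemma sl2_cyclic_oddmon:
  assumes Q: "stat_closed Q" and "length A + length B \<le> n"
    and "\<And>A' r. 0 < r \<Longrightarrow> length A' = length A \<Longrightarrow> sum_list A' = sum_list A + r \<Longrightarrow> holds Q A' B"
    and "\<And>B' r. 0 < r \<Longrightarrow> length B' = length B \<Longrightarrow> sum_list B' = sum_list B + r \<Longrightarrow> holds Q A B'"
    and "\<And>p' a' q' b'. length A = Suc p' \<Longrightarrow> length B = Suc q' \<Longrightarrow> Q p' a' q' b'"
  shows "sl2_cyclic (D Q) (oddmon A B) (n - length A - length B)"
proof
  show "uea.subspace (D Q)"
    by (rule D_subspace)
  fix r
  show "u \<in> D Q \<Longrightarrow> cur sl_x2 r * u \<in> D Q" "u \<in> D Q \<Longrightarrow> cur sl_y2 r * u \<in> D Q"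
    "u \<in> D Q \<Longrightarrow> cur sl_h2 r * u \<in> D Q" for u
    by (simp_all add: D_x2[OF Q] D_h2[OF Q] D_y2)
  show "cur sl_x2 r * oddmon A B \<in> D Q"
    using assms(5) by (rule D_x2_oddmon)
  show "0 < r \<Longrightarrow> cur sl_h2 r * oddmon A B \<in> D Q"
    using assms(3,4) by (intro D_h2_oddmon) auto
  show "cur sl_h2 0 * oddmon A B - uea_scale (of_nat (n - length A - length B)) (oddmon A B) \<in> D Q"
    using D_I[OF h2_0_oddmon[where A = A and B = B], of Q] assms(2)
    by (simp add: of_nat_diff diff_diff_eq)
  have "cur sl_y2 0 ^ Suc n * oddmon A B \<in> D Q"
    unfolding y2_pow_oddmon by (intro D_I I_mult I_y2)
  then show "\<exists>M. cur sl_y2 0 ^ M * oddmon A B \<in> D Q" ..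
qed

lemma D_False: "D (\<lambda>p a q b. False) = I"
  by (simp add: D_def uea.span_eq_iff[THEN iffD2, OF I_subspace])

text \<open>The generator itself is a highest weight vector of weight \<open>n\<close>, so \<open>y\<^sub>2(a)\<close> lies in \<open>I\<close> for
  \<open>a \<ge> n\<close>, and the bracket of \<open>x\<^sub>3\<close> and \<open>y\<^sub>2(a)\<close> is \<open>x\<^sub>1(a)\<close>.\<close>

lemma x1_in_I: "n \<le> a \<Longrightarrow> cur sl_x1 a \<in> I"
proof -
  assume "n \<le> a"
  interpret sl2_cyclic "D (\<lambda>p a q b. False)" "oddmon [] []" "n - length ([] :: nat list) - length ([] :: nat list)"
  proof (rule sl2_cyclic_oddmon, goal_cases)
    case 1 then show ?case by (simp add: stat_closed_def)
  qed simp_all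
  have "cur sl_y2 a \<in> I"
    using y2_v_in_E[of a] \<open>n \<le> a\<close> by (simp add: D_False)
  then have "cur sl_x3 0 * cur sl_y2 a - cur sl_y2 a * cur sl_x3 0 \<in> I"
    by (intro uea.subspace_diff[OF I_subspace]) (simp_all add: I_mult I_nplus)
  then show "cur sl_x1 a \<in> I"
    by (simp add: cur_comm)
qed

lemma y1_D:
  assumes "u \<in> D (\<lambda>p' a' q' b'. p' = p \<and> q' = 0 \<and> a < a')"
  shows "cur sl_y1 r * u \<in> D (\<lambda>p' a' q' b'. p' + q' < Suc p \<or> p' = p \<and> q' = 1 \<and> a < a')"
    (is "_ \<in> D ?Q")
  using assms
proof (rule D_mult)
  fix C A B :: "nat list" assume h: "length A = p \<and> length B = 0 \<and> a < sum_list A"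
  show "cur sl_y1 r * (ymon C * oddmon A B) \<in> D ?Q"
  proof (induction C)
    case Nil
    have "mspan {xmon A' | A'. Suc (length A') = length A} \<subseteq> D ?Q"
      using h D_oddmon[of ?Q _ "[]"]
      by (intro uea.span_minimal[OF _ D_subspace]) (auto intro: D_I)
    then show ?case
      using y1_xmon[of r A] h by auto
  next
    case (Cons c C)
    have "cur sl_y1 r * (ymon (c # C) * oddmon A B)
        = cur sl_y2 c * (cur sl_y1 r * (ymon C * oddmon A B)) - ymon C * oddmon A [r + c]"
      using h y2_commutes(2)[of "r + c" C "xmon A"]
      by (simp add: cur_comm left_diff_distrib flip: mult.assoc)
    also have "\<dots> \<in> D ?Q"
      using h by (intro uea.subspace_diff[OF D_subspace] D_y2 Cons D_mon) simp
    finally show ?case .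
  qed
qed

text \<open>The monomial \<open>x\<^sub>1(A)\<close> is a highest weight vector of weight \<open>n - |A|\<close> modulo monomials in which the
  exponents of \<open>x\<^sub>1\<close> have a larger sum. Hence \<open>y\<^sub>2(b) x\<^sub>1(A)\<close> is a combination of such monomials, and
  applying \<open>y\<^sub>1\<close> turns \<open>y\<^sub>2(b)\<close> into \<open>- y\<^sub>3(b)\<close>. The other terms that arise have fewer odd factors, or
  one factor \<open>y\<^sub>3\<close> and a larger sum.\<close>

lemma y3_xmon_large:
  assumes "length A \<le> n" "n \<le> b + length A"
  shows "cur sl_y3 b * xmon A
    \<in> D (\<lambda>p a q b. p + q < Suc (length A) \<or> p = length A \<and> q = 1 \<and> sum_list A < a)"
    (is "_ \<in> D ?Q")
proof -
  let ?P = "\<lambda>p a q b. p = length A \<and> q = 0 \<and> sum_list A < a"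
  interpret sl2_cyclic "D ?P" "oddmon A []" "n - length A - length ([] :: nat list)"
    using assms(1) by (intro sl2_cyclic_oddmon) (auto simp: stat_closed_def)
  have "cur sl_y2 b * xmon A \<in> D ?P"
    using y2_v_in_E[of b] assms by simp
  then have "cur sl_y1 0 * (cur sl_y2 b * xmon A) \<in> D ?Q"
    by (rule y1_D)
  moreover have "cur sl_y2 b * (cur sl_y1 0 * xmon A) \<in> D ?Q"
  proof (rule D_y2)
    have "mspan {xmon A' | A'. Suc (length A') = length A} \<subseteq> D ?Q"
      using D_oddmon[of ?Q _ "[]"]
      by (intro uea.span_minimal[OF _ D_subspace]) (auto intro: D_I)
    then show "cur sl_y1 0 * xmon A \<in> D ?Q"
      using y1_xmon by blast
  qed
  ultimately have "cur sl_y2 b * (cur sl_y1 0 * xmon A) - cur sl_y1 0 * (cur sl_y2 b * xmon A) \<in> D ?Q"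
    by (intro uea.subspace_diff[OF D_subspace])
  then show ?thesis
    by (simp add: mult.assoc[symmetric] cur_comm left_diff_distrib)
qed

lemma ymon3_D:
  assumes "u \<in> D Q" "\<And>p a q b b'. Q p a q b \<Longrightarrow> Q' p a (q + length B) b'"
  shows "ymon3 B * u \<in> D Q'"
  using assms(1)
proof (rule D_mult)
  fix C A B' assume "holds Q A B'"
  then have "holds Q' A (B @ B')"
    using assms(2)[of "length A" "sum_list A" "length B'"] by (simp add: add.commute)
  then have "ymon C * oddmon A (B @ B') \<in> D Q'"
    by (rule D_mon)
  then show "ymon3 B * (ymon C * oddmon A B') \<in> D Q'"
    by (simp add: ymon3_ymon mult.assoc)
qed

lemma I_neg: "- u \<in> I \<longleftrightarrow> u \<in> I"
  using uea.subspace_neg[OF I_subspace] by (metis minus_minus)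

lemma D_neg: "- u \<in> D Q \<longleftrightarrow> u \<in> D Q"
  using uea.subspace_neg[OF D_subspace] by (metis minus_minus)

lemma xmon_in_I:
  assumes "x \<in> set A" "n \<le> x"
  shows "xmon A \<in> I"
proof -
  obtain xs ys where A: "A = xs @ x # ys"
    using assms(1) by (meson split_list)
  have "mset A = mset (xs @ ys @ [x])"
    by (simp add: A)
  then have "xmon A = xmon (xs @ ys @ [x]) \<or> xmon A = - xmon (xs @ ys @ [x])"
    by (rule anticomm_perm[OF cur_comm(4)])
  moreover have "xmon (xs @ ys @ [x]) \<in> I"
    using I_mult[OF x1_in_I[OF assms(2)], of "xmon (xs @ ys)"] by (simp add: mult.assoc)
  ultimately show ?thesis
    by (elim disjE) (simp_all add: I_neg)
qed

lemma oddmon_large: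
  assumes "length A \<le> n" "b \<in> set B" "n \<le> b + length A"
  shows "oddmon A B \<in> D (\<lambda>p a q b. p + q < length A + length B
    \<or> p = length A \<and> q = length B \<and> sum_list A < a)" (is "_ \<in> D ?Q")
proof -
  obtain xs ys where B: "B = xs @ b # ys"
    using assms(2) by (meson split_list)
  have "mset B = mset (xs @ ys @ [b])"
    by (simp add: B)
  then have "ymon3 B = ymon3 (xs @ ys @ [b]) \<or> ymon3 B = - ymon3 (xs @ ys @ [b])"
    by (rule anticomm_perm[OF cur_comm(5)])
  moreover have "ymon3 (xs @ ys) * (cur sl_y3 b * xmon A) \<in> D ?Q"
    by (rule ymon3_D[OF y3_xmon_large[OF assms(1,3)]]) (auto simp: B)
  ultimately show ?thesis
    by (elim disjE) (simp_all add: D_neg mult.assoc)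
qed

lemma sum_list_less:
  assumes "\<And>x. x \<in> set xs \<Longrightarrow> x < n" "xs \<noteq> []"
  shows "sum_list xs < n * length xs"
  using assms
proof (induction xs)
  case (Cons x xs)
  then show ?case by (cases xs) (auto simp: add_less_mono)
qed simp

lemma sum_Pow_power:
  fixes x :: nat
  assumes S: "finite S"
  shows "(\<Sum>T\<in>Pow S. x ^ (card S - card T)) = (x + 1) ^ card S"
proof -
  have "(x + 1) ^ card S = (\<Prod>i\<in>S. 1 + x)"
    by (simp add: add.commute)
  also have "\<dots> = (\<Sum>T\<in>Pow S. (\<Prod>i\<in>T. 1) * (\<Prod>i\<in>S - T. x))"
    by (rule prod_add[OF S])
  also have "\<dots> = (\<Sum>T\<in>Pow S. x ^ (card S - card T))"
    using S by (intro sum.cong) (auto simp: card_Diff_subset finite_subset)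
  finally show ?thesis by simp
qed

text \<open>The sets of exponents of the factors \<open>x\<^sub>1\<close> and \<open>y\<^sub>3\<close> in the monomials that generate the
  subquotients.\<close>

definition good :: "(nat set \<times> nat set) set" where
  "good = (SIGMA S:Pow {..<n}. Pow {..<n - card S})"

lemma sum_good: "(\<Sum>(S, T)\<in>good. 2 ^ (n - card S - card T)) = (4 ^ n :: nat)"
proof -
  have "(\<Sum>(S, T)\<in>good. (2 :: nat) ^ (n - card S - card T))
      = (\<Sum>S\<in>Pow {..<n}. \<Sum>T\<in>Pow {..<n - card S}. 2 ^ (card {..<n - card S} - card T))"
    unfolding good_def card_lessThan by (rule sum.Sigma[symmetric]) auto
  also have "\<dots> = (\<Sum>S\<in>Pow {..<n}. 3 ^ (card {..<n} - card S))"
    by (rule sum.cong[OF refl]) (subst sum_Pow_power, simp_all)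
  also have "\<dots> = 4 ^ n"
    by (subst sum_Pow_power) simp_all
  finally show ?thesis .
qed

text \<open>The monomials are treated in the order given by the number of odd factors, then by decreasing sum
  of the exponents of \<open>x\<^sub>1\<close>, then by decreasing sum of those of \<open>y\<^sub>3\<close>. All exponents may be assumed to
  be less than \<open>n\<close>, so these sums are bounded and the order is well-founded. A monomial with a repeated
  exponent vanishes, one with a large exponent is a combination of smaller ones, and a remaining one,
  whose exponents form a pair in \<open>good\<close>, contributes at most \<open>2 ^ (n - |A| - |B|)\<close> vectors.\<close>

lemma monomials_spanning:
  "\<exists>X. finite X \<and> card X \<le> 4 ^ n \<and> (\<forall>C A B. ymon C * oddmon A B \<in> mspan X)"
proof -
  let ?Q = "\<lambda>A B p a q b. p + q < length A + length B \<or>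
    p = length A \<and> q = length B \<and> (sum_list A < a \<or> a = sum_list A \<and> sum_list B < b)"
  let ?P = "\<lambda>S T X. finite X \<and> card X \<le> 2 ^ (n - card S - card T) \<and>
    (\<forall>C. ymon C * oddmon (sorted_list_of_set S) (sorted_list_of_set T) \<in> uea.span (X \<union>
        D (?Q (sorted_list_of_set S) (sorted_list_of_set T))))"
  have ex: "\<exists>X. ?P S T X"
    if "(S, T) \<in> good" for S T
  proof -
    have fin: "finite S" "finite T"
      using that by (auto simp: good_def intro: finite_subset)
    have "card S \<le> n" "card T \<le> n - card S"
      using that card_mono[of "{..<n}" S] card_mono[of "{..<n - card S}" T] by (auto simp: good_def)
    then interpret sl2_cyclic "D (?Q (sorted_list_of_set S) (sorted_list_of_set T))"
      "oddmon (sorted_list_of_set S) (sorted_list_of_set T)"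
      "n - length (sorted_list_of_set S) - length (sorted_list_of_set T)"
      using fin by (intro sl2_cyclic_oddmon) (auto simp: stat_closed_def)
    show ?thesis
      using ymon_spanning fin by simp
  qed
  define X where "X = (\<lambda>S T. SOME X. ?P S T X)"
  have P: "?P S T (X S T)" if "(S, T) \<in> good" for S T
    unfolding X_def by (rule someI_ex[OF ex[OF that]])
  have X: "finite (X S T)" "card (X S T) \<le> 2 ^ (n - card S - card T)"
    "ymon C * oddmon (sorted_list_of_set S) (sorted_list_of_set T)
      \<in> uea.span (X S T \<union> D (?Q (sorted_list_of_set S) (sorted_list_of_set T)))"
    if "(S, T) \<in> good" for S T C
    using P[OF that] by blast+
  define Y where "Y = (\<Union>(S, T)\<in>good. X S T)"
  have fin: "finite good"
    unfolding good_def by (intro finite_SigmaI) auto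
  have "card Y \<le> (\<Sum>(S, T)\<in>good. card (X S T))"
    unfolding Y_def using card_UN_le[OF fin, of "\<lambda>(S, T). X S T"] by (simp add: case_prod_unfold)
  also have "\<dots> \<le> (\<Sum>(S, T)\<in>good. 2 ^ (n - card S - card T))"
    using X(2) by (intro sum_mono) auto
  finally have "card Y \<le> 4 ^ n"
    by (simp only: sum_good)
  moreover have "finite Y"
    unfolding Y_def using fin X(1) by auto
  \<comment> \<open>As long as all exponents are below \<open>n\<close>, the difference \<open>n * length A - sum_list A\<close> is positive,
    so it does decrease when the sum grows.\<close>
  moreover have "\<forall>C. ymon C * oddmon A B \<in> mspan Y" for A B
  proof (induction "(A, B)" arbitrary: A B rule: wf_induct_rule[OF wf_measures[of
      "[\<lambda>(A, B). length A + length B, \<lambda>(A, B). n * length A - sum_list A,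
        \<lambda>(A, B). n * length B - sum_list B]"]])
    case less: (1 A B)
    have D_Y: "D Q \<subseteq> mspan Y"
      if "\<And>A' B'. holds Q A' B' \<Longrightarrow> length A' + length B' < length A + length B \<or>
         length A' = length A \<and> length B' = length B \<and>
         (n * length A - sum_list A' < n * length A - sum_list A \<or>
          sum_list A' = sum_list A \<and> n * length B - sum_list B' < n * length B - sum_list B)" for Q
      unfolding D_def
    proof (rule uea.span_minimal[OF _ uea.subspace_span], rule Un_least; rule subsetI)
      fix u assume "u \<in> {ymon C * oddmon A B | C A B. holds Q A B}"
      then obtain C A' B' where u: "u = ymon C * oddmon A' B'" "holds Q A' B'" by blast
      show "u \<in> mspan Y"
        unfolding u(1) using that[OF u(2)] by (intro less[rule_format]) auto
    qed (simp add: mspan_I)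
    show ?case
    proof (cases "\<exists>x\<in>set A. n \<le> x")
      case True
      then show ?thesis
        using xmon_in_I I_mult by (auto intro!: mspan_I)
    next
      case False
      then have A: "x < n" if "x \<in> set A" for x
        using that by force
      have sA: "n * length A - a < n * length A - sum_list A"
        if "length A' = length A" "sum_list A < a" "a = sum_list A'" for a and A' :: "nat list"
        using sum_list_less[of A] A that by (cases "A = []") auto
      show ?thesis
      proof (cases "distinct A")
        case False
        then have "xmon A = 0"
          by (rule anticomm_not_distinct[OF cur_comm(4)])
        then show ?thesis by (simp add: uea.span_zero)
      next
        case dA: True
        have cA: "card (set A) = length A"
          by (rule distinct_card[OF dA])
        have pA: "length A \<le> n"
          using card_mono[of "{..<n}" "set A"] A cA by auto
        show ?thesis
        proof (cases "\<exists>b\<in>set B. n \<le> b + length A")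
          case True
          then obtain b where b: "b \<in> set B" "n \<le> b + length A" by blast
          have "D (\<lambda>p a q b. p + q < length A + length B
              \<or> p = length A \<and> q = length B \<and> sum_list A < a) \<subseteq> mspan Y"
            using sA by (intro D_Y) auto
          then show ?thesis
            using D_ymon[OF oddmon_large[OF pA b]] by blast
        next
          case False
          then have B: "b < n - length A" if "b \<in> set B" for b
            using that by force
          show ?thesis
          proof (cases "distinct B")
            case False
            then have "ymon3 B = 0"
              by (rule anticomm_not_distinct[OF cur_comm(5)])
            then show ?thesis by (simp add: uea.span_zero)
          next
            case dB: True
            let ?A = "sorted_list_of_set (set A)" and ?B = "sorted_list_of_set (set B)"
            have sB: "n * length B - b < n * length B - sum_list B"
              if "length B' = length B" "sum_list B < b" "b = sum_list B'" for b and B' :: "nat list"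
            proof -
              have "B \<noteq> []" using that by auto
              moreover have "x < n" if "x \<in> set B" for x
                using B[OF that] by simp
              ultimately show ?thesis
                using sum_list_less[of B] that by auto
            qed
            have m: "mset A = mset ?A" "mset B = mset ?B"
              using dA dB by (simp_all add: sorted_list_of_set_sort_remdups distinct_remdups_id)
            then have l: "length ?A = length A" "length ?B = length B"
              "sum_list ?A = sum_list A" "sum_list ?B = sum_list B"
              by (metis size_mset, metis size_mset, metis sum_mset_sum_list, metis sum_mset_sum_list)
            have "(set A, set B) \<in> good"
              using A B by (auto simp: good_def cA)
            then have "ymon C * oddmon ?A ?B \<in> uea.span (X (set A) (set B) \<union> D (?Q ?A ?B))" for C
              by (rule X(3))
            moreover have "uea.span (X (set A) (set B) \<union> D (?Q ?A ?B)) \<subseteq> mspan Y"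
            proof (rule uea.span_minimal[OF _ uea.subspace_span], rule Un_least)
              show "X (set A) (set B) \<subseteq> mspan Y"
                using \<open>(set A, set B) \<in> good\<close> unfolding Y_def by (auto intro!: mspan_base)
              show "D (?Q ?A ?B) \<subseteq> mspan Y"
                unfolding l using sA sB by (intro D_Y) auto
            qed
            ultimately have "ymon C * oddmon ?A ?B \<in> mspan Y" for C
              by blast
            moreover have "oddmon A B = oddmon ?A ?B \<or> oddmon A B = - oddmon ?A ?B"
              using anticomm_perm[where z = "cur sl_x1", OF cur_comm(4) m(1)]
                anticomm_perm[where z = "cur sl_y3", OF cur_comm(5) m(2)]
              by auto
            ultimately show ?thesis
              by (auto simp: uea.span_neg)
          qed
        qed
      qed
    qed
  qed
  ultimately show ?thesis by blast
qed

text \<open>Words in \<open>x\<^sub>1\<close>, \<open>y\<^sub>3\<close>, \<open>y\<^sub>2\<close> span by \<open>negative_words_generate\<close>. They are brought into the required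
  order by means of the bracket of \<open>x\<^sub>1\<close> and \<open>y\<^sub>3\<close>, which is the central element \<open>y\<^sub>2\<close> of the
  subalgebra that they span.\<close>

lemma monomials_generate: "u \<in> mspan {ymon C * oddmon A B | C A B. True}" (is "u \<in> mspan ?M")
proof -
  define M where "M = uea.span ?M"
  have M: "ymon C * oddmon A B \<in> M" for C A B
    unfolding M_def by (rule uea.span_base) blast
  have M_mult: "z * u \<in> M" if "u \<in> M" "\<And>C A B. z * (ymon C * oddmon A B) \<in> M" for z u
    using that(1) unfolding M_def
  proof (induction rule: uea.span_induct_alt)
    case (step c x y)
    then have "z * x \<in> M"
      using that(2) by blast
    with step show ?case
      unfolding M_def by (simp add: distrib_left uea.span_add uea.span_scale)
  qed (simp add: uea.span_zero)
  have y2: "cur sl_y2 r * u \<in> M" if "u \<in> M" for r u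
    using M[where C = "r # _"] by (intro M_mult[OF that]) (simp add: mult.assoc)
  have y3: "cur sl_y3 r * u \<in> M" if "u \<in> M" for r u
    using M[where B = "r # _"] by (intro M_mult[OF that]) (simp add: y2_commutes mult.assoc)
  have x1: "cur sl_x1 r * u \<in> M" if "u \<in> M" for r u
  proof (rule M_mult[OF that])
    fix C A B
    have "cur sl_x1 r * oddmon A B \<in> M"
    proof (induction B)
      case Nil
      show ?case using M[where C = "[]" and A = "r # A" and B = "[]"] by simp
    next
      case (Cons b B)
      have "cur sl_x1 r * oddmon A (b # B)
          = - (cur sl_y3 b * (cur sl_x1 r * oddmon A B)) + cur sl_y2 (r + b) * oddmon A B"
        by (simp add: mult.assoc[symmetric] cur_comm left_diff_distrib distrib_right)
      moreover have "oddmon A B \<in> M"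
        using M[where C = "[]"] by simp
      ultimately show ?case
        using y3[OF Cons] y2 unfolding M_def
        by (simp add: uea.span_add uea.span_neg uea.span_diff)
    qed
    then have "ymon C * (cur sl_x1 r * oddmon A B) \<in> M"
      by (induction C) (simp_all add: mult.assoc y2)
    then show "cur sl_x1 r * (ymon C * oddmon A B) \<in> M"
      by (simp add: y2_commutes)
  qed
  let ?Z = "{monom z m | z m. z \<in> {sl_x1, sl_y3, sl_y2}}"
  have W: "u \<in> mspan {prod_list (map uea_inc zs) | zs. set zs \<subseteq> ?Z}"
  proof (rule negative_words_generate)
    fix z assume "z \<in> ?Z"
    then show "\<exists>q. lpart q z = z"
      using lpart_sl_simps by (auto simp: lpart_monom)
  next
    fix p :: "sl12 poly"
    let ?S = "mspan (uea_inc ` ?Z \<union> {1})"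
    have "cur g m \<in> ?S" for g m
    proof -
      obtain a b c d e f k l where g: "g = lscale a sl_x1 + lscale b sl_y3 + lscale c sl_y2
          + lscale d sl_y1 + lscale e sl_x2 + lscale f sl_x3 + cartan_elt k l"
        by (rule sl12_decomposition)
      have "cur z m \<in> ?S" if "z \<in> {sl_x1, sl_y3, sl_y2}" for z
        using that by (intro mspan_base) blast
      moreover have "cur z m \<in> ?S" if "z \<in> {sl_y1, sl_x2, sl_x3}" for z
        using I_nplus[OF that] by (rule mspan_I)
      moreover have "cur (cartan_elt k l) m \<in> ?S"
      proof -
        have "cur (cartan_elt k l) m
            = (cur (cartan_elt k l) m - uea_const (if m = 0 then wt_apply lam k l else 0))
              + uea_scale (if m = 0 then wt_apply lam k l else 0) 1"
          by (simp add: uea_const_eq_scale)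
        also have "\<dots> \<in> ?S"
          by (intro uea.span_add mspan_I[OF I_cartan] uea.span_scale mspan_base) simp
        finally show ?thesis .
      qed
      ultimately show ?thesis
        unfolding g by (simp add: cur_lscale uea_inc_add uea.span_add uea.span_scale flip: add_monom)
    qed
    then have "(\<Sum>m\<le>degree p. cur (coeff p m) m) \<in> ?S"
      by (intro uea.span_sum)
    then show "uea_inc p \<in> ?S"
      by (simp add: poly_as_sum_of_monoms flip: uea_inc_sum)
  qed (rule I_mult)
  have "{prod_list (map uea_inc zs) | zs. set zs \<subseteq> ?Z} \<subseteq> M"
  proof
    fix w assume "w \<in> {prod_list (map uea_inc zs) | zs. set zs \<subseteq> ?Z}"
    then obtain zs where w: "w = prod_list (map uea_inc zs)" "set zs \<subseteq> ?Z"
      by blast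
    show "w \<in> M"
      using w(2) unfolding w(1)
    proof (induction zs)
      case Nil
      show ?case using M[where C = "[]" and A = "[]" and B = "[]"] by simp
    qed (auto simp: x1 y2 y3)
  qed
  moreover have "M \<subseteq> mspan ?M"
    unfolding M_def by (rule uea.span_mono) blast
  ultimately have "mspan {prod_list (map uea_inc zs) | zs. set zs \<subseteq> ?Z} \<subseteq> mspan ?M"
    by (intro uea.span_minimal[OF _ uea.subspace_span]) (auto intro: mspan_I)
  then show ?thesis
    using W by blast
qed

theorem weyl_spanning: "\<exists>X. finite X \<and> card X \<le> 4 ^ n \<and> mspan X = UNIV"
proof -
  obtain X where X: "finite X" "card X \<le> 4 ^ n" "\<And>C A B. ymon C * oddmon A B \<in> mspan X"
    using monomials_spanning by blast
  have "mspan {ymon C * oddmon A B | C A B. True} \<subseteq> mspan X"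
    using X(3) by (intro uea.span_minimal[OF _ uea.subspace_span]) (auto intro: mspan_I)
  then have "mspan X = UNIV"
    using monomials_generate by blast
  then show ?thesis using X by blast
qed

end

section \<open>Modules in coordinates\<close>

text \<open>A module is given by a record with a carrier set. An injective linear map \<open>\<theta>\<close> to a vector space
  allows to compute with its elements as with vectors.\<close>

locale coord_space = complex_space sc
  for sc :: "complex \<Rightarrow> 'w :: ab_group_add \<Rightarrow> 'w" +
  fixes M :: "('l, 'v) smodule" and \<theta> :: "'v \<Rightarrow> 'w"
  assumes add_closed: "a \<in> carrier M \<Longrightarrow> b \<in> carrier M \<Longrightarrow> a \<oplus>\<^bsub>M\<^esub> b \<in> carrier M"
    and theta_add: "a \<in> carrier M \<Longrightarrow> b \<in> carrier M \<Longrightarrow> \<theta> (a \<oplus>\<^bsub>M\<^esub> b) = \<theta> a + \<theta> b"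
    and zero_closed: "\<zero>\<^bsub>M\<^esub> \<in> carrier M"
    and theta_zero: "\<theta> \<zero>\<^bsub>M\<^esub> = 0"
    and smult_closed: "a \<in> carrier M \<Longrightarrow> c \<odot>\<^bsub>M\<^esub> a \<in> carrier M"
    and theta_smult: "a \<in> carrier M \<Longrightarrow> \<theta> (c \<odot>\<^bsub>M\<^esub> a) = sc c (\<theta> a)"
    and theta_inj: "inj_on \<theta> (carrier M)"
begin

lemma theta_eqI: "a \<in> carrier M \<Longrightarrow> b \<in> carrier M \<Longrightarrow> \<theta> a = \<theta> b \<Longrightarrow> a = b"
  using theta_inj by (rule inj_onD)

lemma abelian_group_M: "abelian_group M"
proof (rule abelian_groupI)
  fix x assume x: "x \<in> carrier M"
  show "\<exists>y\<in>carrier M. y \<oplus>\<^bsub>M\<^esub> x = \<zero>\<^bsub>M\<^esub>"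
    using x by (intro bexI[of _ "(- 1) \<odot>\<^bsub>M\<^esub> x"] theta_eqI)
      (simp_all add: add_closed smult_closed zero_closed theta_add theta_smult theta_zero)
qed (auto intro!: theta_eqI simp: add_closed zero_closed theta_add theta_zero ac_simps)

sublocale abelian_group M
  by (rule abelian_group_M)

lemma theta_finsum:
  assumes "\<And>i. i \<in> S \<Longrightarrow> f i \<in> carrier M" "finite S"
  shows "finsum M f S \<in> carrier M \<and> \<theta> (finsum M f S) = (\<Sum>i\<in>S. \<theta> (f i))"
  using assms(2,1)
proof (induction S)
  case empty
  then show ?case by (simp add: zero_closed theta_zero)
next
  case (insert i S)
  then have "finsum M f (insert i S) = f i \<oplus>\<^bsub>M\<^esub> finsum M f S"
    by (intro finsum_insert) auto
  then show ?case
    using insert by (simp add: add_closed theta_add)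
qed

end

locale coord_quotient = coord_space sc M \<theta>
  for sc :: "complex \<Rightarrow> 'w :: ab_group_add \<Rightarrow> 'w"
    and M :: "('l, 'v) smodule" and \<theta> :: "'v \<Rightarrow> 'w" +
  fixes S :: "'w set"
  assumes S: "subspace S"
begin

definition N :: "'v set" where
  "N = {a \<in> carrier M. \<theta> a \<in> S}"

abbreviation Q :: "('l, 'v set) smodule" where
  "Q \<equiv> smod_quotient M N"

abbreviation cos :: "'v \<Rightarrow> 'v set" where
  "cos a \<equiv> N +>\<^bsub>M\<^esub> a"

lemma cos_eq: "a \<in> carrier M \<Longrightarrow> cos a = {b \<in> carrier M. \<theta> b - \<theta> a \<in> S}"
proof (intro Set.set_eqI iffI)
  fix b assume a: "a \<in> carrier M" and "b \<in> {b \<in> carrier M. \<theta> b - \<theta> a \<in> S}"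
  then have b: "b \<in> carrier M" "\<theta> b - \<theta> a \<in> S" by auto
  let ?h = "b \<oplus>\<^bsub>M\<^esub> ((- 1) \<odot>\<^bsub>M\<^esub> a)"
  have h: "?h \<in> carrier M" "\<theta> ?h = \<theta> b - \<theta> a"
    using a b by (simp_all add: add_closed smult_closed theta_add theta_smult)
  then have "b = ?h \<oplus>\<^bsub>M\<^esub> a"
    using a b by (intro theta_eqI) (simp_all add: add_closed theta_add)
  moreover have "?h \<in> N"
    using h b by (simp add: N_def)
  ultimately show "b \<in> cos a"
    unfolding a_r_coset_def' by blast
qed (auto simp: a_r_coset_def' N_def add_closed theta_add)

lemma cos_eq_iff:
  assumes "a \<in> carrier M" "b \<in> carrier M"
  shows "cos a = cos b \<longleftrightarrow> \<theta> a - \<theta> b \<in> S"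
proof
  assume "cos a = cos b"
  moreover have "a \<in> cos a"
    using assms by (simp add: cos_eq subspace_0[OF S])
  ultimately show "\<theta> a - \<theta> b \<in> S"
    using assms by (simp add: cos_eq)
next
  assume ab: "\<theta> a - \<theta> b \<in> S"
  have "\<theta> c - \<theta> a \<in> S \<longleftrightarrow> \<theta> c - \<theta> b \<in> S" for c
    using subspace_add[OF S ab, of "\<theta> c - \<theta> a"] subspace_diff[OF S _ ab, of "\<theta> c - \<theta> b"] by auto
  then show "cos a = cos b"
    using assms by (simp add: cos_eq)
qed

lemma carrier_Q: "carrier Q = cos ` carrier M"
  by (auto simp: smod_quotient_def A_RCOSETS_def')

lemma zero_Q: "\<zero>\<^bsub>Q\<^esub> = cos \<zero>\<^bsub>M\<^esub>"
  by (auto simp: smod_quotient_def cos_eq zero_closed theta_zero N_def)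

lemma add_Q:
  assumes a: "a \<in> carrier M" and b: "b \<in> carrier M"
  shows "cos a \<oplus>\<^bsub>Q\<^esub> cos b = cos (a \<oplus>\<^bsub>M\<^esub> b)"
proof -
  have "cos a \<oplus>\<^bsub>Q\<^esub> cos b = (\<Union>x\<in>cos a. \<Union>y\<in>cos b. {x \<oplus>\<^bsub>M\<^esub> y})"
    by (simp add: smod_quotient_def set_add_def set_mult_def)
  also have "\<dots> = cos (a \<oplus>\<^bsub>M\<^esub> b)"
  proof (intro Set.set_eqI iffI)
    fix c assume "c \<in> (\<Union>x\<in>cos a. \<Union>y\<in>cos b. {x \<oplus>\<^bsub>M\<^esub> y})"
    then obtain x y where xy: "x \<in> carrier M" "y \<in> carrier M" "\<theta> x - \<theta> a \<in> S" "\<theta> y - \<theta> b \<in> S"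
      "c = x \<oplus>\<^bsub>M\<^esub> y"
      using a b by (auto simp: cos_eq)
    then have "(\<theta> x - \<theta> a) + (\<theta> y - \<theta> b) \<in> S"
      by (intro subspace_add[OF S])
    then show "c \<in> cos (a \<oplus>\<^bsub>M\<^esub> b)"
      using a b xy by (simp add: cos_eq add_closed theta_add algebra_simps)
  next
    fix c assume "c \<in> cos (a \<oplus>\<^bsub>M\<^esub> b)"
    then have c: "c \<in> carrier M" "\<theta> c - (\<theta> a + \<theta> b) \<in> S"
      using a b by (simp_all add: cos_eq add_closed theta_add)
    let ?x = "c \<oplus>\<^bsub>M\<^esub> ((- 1) \<odot>\<^bsub>M\<^esub> b)"
    have x: "?x \<in> carrier M" "\<theta> ?x = \<theta> c - \<theta> b"
      using b c by (simp_all add: add_closed smult_closed theta_add theta_smult)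
    then have "c = ?x \<oplus>\<^bsub>M\<^esub> b"
      using b c by (intro theta_eqI) (simp_all add: add_closed theta_add)
    moreover have "?x \<in> cos a" "b \<in> cos b"
      using a b c x(1) by (simp_all add: cos_eq subspace_0[OF S] x(2) diff_diff_eq add.commute)
    ultimately show "c \<in> (\<Union>x\<in>cos a. \<Union>y\<in>cos b. {x \<oplus>\<^bsub>M\<^esub> y})"
      by blast
  qed
  finally show ?thesis .
qed

lemma UN_cos:
  assumes a: "a \<in> carrier M"
    and f: "\<And>b. b \<in> carrier M \<Longrightarrow> f b \<in> carrier M"
    and S': "\<And>b. b \<in> carrier M \<Longrightarrow> \<theta> b - \<theta> a \<in> S \<Longrightarrow> \<theta> (f b) - \<theta> (f a) \<in> S"
  shows "(\<Union>b\<in>cos a. cos (f b)) = cos (f a)"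
proof -
  have "cos (f b) = cos (f a)" if "b \<in> cos a" for b
    using that a by (subst cos_eq_iff) (auto simp: cos_eq f S')
  moreover have "a \<in> cos a"
    using a by (simp add: cos_eq subspace_0[OF S])
  ultimately show ?thesis by blast
qed

lemma smult_Q: "a \<in> carrier M \<Longrightarrow> c \<odot>\<^bsub>Q\<^esub> cos a = cos (c \<odot>\<^bsub>M\<^esub> a)"
  unfolding smod_quotient_def
  by simp (rule UN_cos, auto simp: smult_closed theta_smult subspace_scale[OF S]
      scale_right_diff_distrib[symmetric])

lemma act_Q:
  assumes "a \<in> carrier M" "\<And>b. b \<in> carrier M \<Longrightarrow> act M x b \<in> carrier M"
    and "\<And>b. b \<in> carrier M \<Longrightarrow> \<theta> b - \<theta> a \<in> S \<Longrightarrow> \<theta> (act M x b) - \<theta> (act M x a) \<in> S"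
  shows "act Q x (cos a) = cos (act M x a)"
  unfolding smod_quotient_def by simp (rule UN_cos[where f = "act M x", OF assms])

text \<open>A linear map \<open>\<eta>\<close> whose kernel corresponds to the submodule supplies coordinates on the quotient.\<close>

lemma coord_space_Q:
  assumes "vector_space s" "Vector_Spaces.linear sc s \<eta>"
    and ker: "\<And>a. a \<in> carrier M \<Longrightarrow> \<eta> (\<theta> a) = 0 \<longleftrightarrow> \<theta> a \<in> S"
  shows "coord_space s Q (\<lambda>A. \<eta> (\<theta> (SOME a. a \<in> A)))"
    and "a \<in> carrier M \<Longrightarrow> \<eta> (\<theta> (SOME b. b \<in> cos a)) = \<eta> (\<theta> a)"
proof -
  interpret s: vector_space s by fact
  interpret \<eta>: Vector_Spaces.linear sc s \<eta> by fact
  have eta: "\<eta> (\<theta> a) = \<eta> (\<theta> b) \<longleftrightarrow> \<theta> a - \<theta> b \<in> S" if "a \<in> carrier M" "b \<in> carrier M" for a b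
  proof -
    have "a \<oplus>\<^bsub>M\<^esub> ((- 1) \<odot>\<^bsub>M\<^esub> b) \<in> carrier M" "\<theta> (a \<oplus>\<^bsub>M\<^esub> ((- 1) \<odot>\<^bsub>M\<^esub> b)) = \<theta> a - \<theta> b"
      using that by (simp_all add: add_closed smult_closed theta_add theta_smult)
    then show ?thesis
      using ker by (metis \<eta>.diff right_minus_eq)
  qed
  have val: "\<eta> (\<theta> (SOME b. b \<in> cos a)) = \<eta> (\<theta> a)" if a: "a \<in> carrier M" for a
  proof -
    have "a \<in> cos a"
      using a by (simp add: cos_eq subspace_0[OF S])
    then have "(SOME b. b \<in> cos a) \<in> cos a"
      by (rule someI)
    then show ?thesis
      using a eta by (auto simp: cos_eq)
  qed
  then show "a \<in> carrier M \<Longrightarrow> \<eta> (\<theta> (SOME b. b \<in> cos a)) = \<eta> (\<theta> a)" .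
  show "coord_space s Q (\<lambda>A. \<eta> (\<theta> (SOME a. a \<in> A)))"
  proof
    show "inj_on (\<lambda>A. \<eta> (\<theta> (SOME a. a \<in> A))) (carrier Q)"
    proof (rule inj_onI)
      fix A B assume "A \<in> carrier Q" "B \<in> carrier Q"
        and AB: "\<eta> (\<theta> (SOME a. a \<in> A)) = \<eta> (\<theta> (SOME a. a \<in> B))"
      then obtain a b where ab: "a \<in> carrier M" "b \<in> carrier M" "A = cos a" "B = cos b"
        by (auto simp: carrier_Q)
      with AB show "A = B"
        by (simp add: val eta cos_eq_iff)
    qed
  qed (auto simp: carrier_Q zero_Q add_Q smult_Q val add_closed smult_closed theta_add theta_smult
      theta_zero zero_closed \<eta>.add \<eta>.scale)
qed

lemma abelian_group_Q: "abelian_group Q"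
proof (rule abelian_groupI)
  fix x assume "x \<in> carrier Q"
  then obtain a where a: "a \<in> carrier M" "x = cos a"
    by (auto simp: carrier_Q)
  then show "\<exists>y\<in>carrier Q. y \<oplus>\<^bsub>Q\<^esub> x = \<zero>\<^bsub>Q\<^esub>"
    by (intro bexI[of _ "cos ((- 1) \<odot>\<^bsub>M\<^esub> a)"])
      (simp_all add: carrier_Q add_Q zero_Q smult_closed cos_eq_iff add_closed zero_closed theta_add
        theta_smult theta_zero subspace_0[OF S])
qed (auto simp: carrier_Q add_Q zero_Q add_closed zero_closed a_ac)

lemma finsum_Q:
  assumes "\<And>i. i \<in> X \<Longrightarrow> f i \<in> carrier M" "finite X"
  shows "finsum Q (\<lambda>i. cos (f i)) X = cos (finsum M f X)"
proof -
  interpret Q: abelian_group Q by (rule abelian_group_Q)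
  show ?thesis
    using assms(2,1)
  proof (induction X)
    case empty
    then show ?case by (simp add: zero_Q)
  next
    case (insert i X)
    then have "finsum Q (\<lambda>i. cos (f i)) (insert i X) = cos (f i) \<oplus>\<^bsub>Q\<^esub> finsum Q (\<lambda>i. cos (f i)) X"
      by (intro Q.finsum_insert) (auto simp: carrier_Q)
    moreover have "finsum M f (insert i X) = f i \<oplus>\<^bsub>M\<^esub> finsum M f X"
      using insert by (intro finsum_insert) auto
    ultimately show ?case
      using insert by (simp add: add_Q)
  qed
qed

end

locale coord_module = coord_space sc M \<theta> + uea_rep sc \<rho>
  for sc :: "complex \<Rightarrow> 'w :: ab_group_add \<Rightarrow> 'w"
    and M :: "('l :: lie_superalgebra, 'v) smodule" and \<theta> :: "'v \<Rightarrow> 'w"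
    and \<rho> :: "'l \<Rightarrow> 'w \<Rightarrow> 'w" +
  assumes act_closed: "a \<in> carrier M \<Longrightarrow> act M x a \<in> carrier M"
    and theta_act: "a \<in> carrier M \<Longrightarrow> \<theta> (act M x a) = \<rho> x (\<theta> a)"
begin

lemma uea_act_closed: "a \<in> carrier M \<Longrightarrow> uea_act M u a \<in> carrier M"
  and theta_uea_act: "a \<in> carrier M \<Longrightarrow> \<theta> (uea_act M u a) = tact u (\<theta> a)"
proof -
  assume a: "a \<in> carrier M"
  have foldr: "foldr (act M) xs a \<in> carrier M \<and> \<theta> (foldr (act M) xs a) = foldr \<rho> xs (\<theta> a)" for xs
    by (induction xs) (simp_all add: a act_closed theta_act)
  have "uea_act M u a \<in> carrier M \<and> \<theta> (uea_act M u a) = tact u (\<theta> a)"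
    unfolding uea_act_def tact_def free_act_def lin_ext_def
    using theta_finsum[of "Poly_Mapping.keys (rep_uea u)"
        "\<lambda>w. Poly_Mapping.lookup (rep_uea u) w \<odot>\<^bsub>M\<^esub> foldr (act M) (letters w) a"]
    by (simp add: foldr smult_closed theta_smult)
  then show "uea_act M u a \<in> carrier M" "\<theta> (uea_act M u a) = tact u (\<theta> a)"
    by auto
qed

end

lemma coord_space_regular: "coord_space uea_scale (uea_regular :: ('l :: lie_superalgebra, 'l uea) smodule) id"
  by unfold_locales (simp_all add: uea_regular_def)

text \<open>If \<open>J\<close> is the annihilator of a vector \<open>w\<close>, then \<open>u \<mapsto> u w\<close> embeds the quotient of the enveloping
  algebra by \<open>J\<close>.\<close>

lemma (in uea_rep) coord_module_cyclic:
  fixes J :: "'l uea set" and w :: 'w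
  assumes J: "\<And>u. u \<in> J \<longleftrightarrow> tact u w = 0"
  defines "M \<equiv> smod_quotient (uea_regular :: ('l, 'l uea) smodule) J"
    and "cs \<equiv> a_r_coset (uea_regular :: ('l, 'l uea) smodule) J"
  shows "coord_module sc M (\<lambda>A. tact (SOME u. u \<in> A) w) \<rho>"
    and "carrier M = range cs" and "tact (SOME v. v \<in> cs u) w = tact u w"
proof -
  interpret lin: Vector_Spaces.linear uea_scale sc "\<lambda>u. tact u w"
    by (rule linear_tact)
  interpret reg: coord_space uea_scale "uea_regular :: ('l, 'l uea) smodule" id
    by (rule coord_space_regular)
  interpret q: coord_quotient uea_scale "uea_regular :: ('l, 'l uea) smodule" id J
    by unfold_locales (auto simp: uea.subspace_def J tact_add tact_scale)
  have N: "q.N = J"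
    unfolding q.N_def by (simp add: uea_regular_def)
  have crr: "u \<in> carrier (uea_regular :: ('l, 'l uea) smodule)" for u
    by (simp add: uea_regular_def)
  note Q = q.coord_space_Q[OF vector_space_axioms linear_tact, unfolded N id_apply, OF J[symmetric]]
  interpret Q: coord_space sc M "\<lambda>A. tact (SOME u. u \<in> A) w"
    unfolding M_def by (rule Q(1))
  show car: "carrier M = range cs"
    using q.carrier_Q unfolding N M_def cs_def by (simp add: uea_regular_def)
  show val: "tact (SOME v. v \<in> cs u) w = tact u w" for u
    unfolding cs_def by (rule Q(2)) (rule crr)
  have act: "act M x (cs u) = cs (uea_inc x * u)" for x u
    unfolding M_def cs_def using q.act_Q[of u x, unfolded N]
    by (simp add: crr J tact_diff tact_mult uea_regular_def)
  show "coord_module sc M (\<lambda>A. tact (SOME u. u \<in> A) w) \<rho>"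
  proof
    fix a x assume "a \<in> carrier M"
    then obtain u where a: "a = cs u" by (auto simp: car)
    show "act M x a \<in> carrier M"
      by (simp add: a act car)
    show "tact (SOME u. u \<in> act M x a) w = \<rho> x (tact (SOME u. u \<in> a) w)"
      by (simp add: a act val tact_mult tact_inc)
  qed
qed

section \<open>The associated graded module\<close>

locale coord_current = coord_module sc M \<theta> \<rho>
  for sc :: "complex \<Rightarrow> 'w :: ab_group_add \<Rightarrow> 'w"
    and M :: "('l :: lie_superalgebra poly, 'v) smodule" and \<theta> :: "'v \<Rightarrow> 'w"
    and \<rho> :: "'l poly \<Rightarrow> 'w \<Rightarrow> 'w" +
  fixes v :: 'v
  assumes v: "v \<in> carrier M"
begin

abbreviation ev :: "'l poly uea \<Rightarrow> 'w" where
  "ev u \<equiv> tact u (\<theta> v)"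

text \<open>In coordinates, \<open>G n\<close> is the step of index \<open>n\<close> of the filtration that defines the associated
  graded module, and \<open>Gpred n\<close> is the preceding one.\<close>

definition G :: "nat \<Rightarrow> 'w set" where
  "G n = {ev (\<Sum>i\<le>n. u i) | u. \<forall>i\<le>n. u i \<in> uea_deg i}"

definition Gpred :: "nat \<Rightarrow> 'w set" where
  "Gpred n = (if n = 0 then {0} else G (n - 1))"

lemma subspace_G: "subspace (G n)"
  unfolding subspace_def
proof (intro conjI ballI allI)
  show "0 \<in> G n"
    unfolding G_def by (rule CollectI, rule exI[of _ "\<lambda>_. 0"])
      (simp add: uea.subspace_0[OF subspace_uea_deg])
next
  fix x y assume "x \<in> G n" "y \<in> G n"
  then obtain a b where "x = ev (\<Sum>i\<le>n. a i)" "\<forall>i\<le>n. a i \<in> uea_deg i"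
    "y = ev (\<Sum>i\<le>n. b i)" "\<forall>i\<le>n. b i \<in> uea_deg i"
    unfolding G_def by blast
  then show "x + y \<in> G n"
    unfolding G_def by (intro CollectI exI[of _ "\<lambda>i. a i + b i"])
      (simp add: sum.distrib tact_add uea.subspace_add[OF subspace_uea_deg])
next
  fix c x assume "x \<in> G n"
  then obtain a where "x = ev (\<Sum>i\<le>n. a i)" "\<forall>i\<le>n. a i \<in> uea_deg i"
    unfolding G_def by blast
  then show "sc c x \<in> G n"
    unfolding G_def by (intro CollectI exI[of _ "\<lambda>i. uea_scale c (a i)"])
      (simp add: uea.scale_sum_right[symmetric] tact_scale uea.subspace_scale[OF subspace_uea_deg])
qed

lemma subspace_Gpred: "subspace (Gpred n)"
  by (simp add: Gpred_def subspace_G subspace_single_0)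

lemma G_I: "u \<in> uea_deg m \<Longrightarrow> m \<le> n \<Longrightarrow> ev u \<in> G n"
  unfolding G_def by (intro CollectI exI[of _ "\<lambda>i. if i = m then u else 0"])
    (auto simp: uea.subspace_0[OF subspace_uea_deg])

lemma G_decompose:
  assumes "x \<in> G n"
  obtains u w where "u \<in> uea_deg n" "w \<in> Gpred n" "x = ev u + w"
proof -
  obtain a where a: "x = ev (\<Sum>i\<le>n. a i)" "\<forall>i\<le>n. a i \<in> uea_deg i"
    using assms unfolding G_def by blast
  show ?thesis
  proof (cases n)
    case 0
    then show ?thesis
      using that[of "a 0" 0] a by (simp add: Gpred_def)
  next
    case (Suc k)
    then have "ev (\<Sum>i\<le>k. a i) \<in> Gpred n"
      using a unfolding Gpred_def G_def by auto
    then show ?thesis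
      using that[of "a n"] a Suc by (simp add: tact_add add.commute)
  qed
qed

lemma Gpred_subset: "Gpred n \<subseteq> G n"
proof (cases n)
  case (Suc k)
  have "x \<in> G (Suc k)" if x: "x \<in> G k" for x
  proof -
    obtain a where "x = ev (\<Sum>i\<le>k. a i)" "\<forall>i\<le>k. a i \<in> uea_deg i"
      using x unfolding G_def by blast
    then show ?thesis
      unfolding G_def by (intro CollectI exI[of _ "\<lambda>i. if i \<le> k then a i else 0"])
        (auto simp: uea.subspace_0[OF subspace_uea_deg])
  qed
  then show ?thesis using Suc by (auto simp: Gpred_def)
qed (simp add: Gpred_def subspace_0[OF subspace_G])

lemma rho_G: "w \<in> G n \<Longrightarrow> \<rho> (monom x m) w \<in> G (m + n)"
proof -
  assume "w \<in> G n"
  then obtain a where a: "w = ev (\<Sum>i\<le>n. a i)" "\<forall>i\<le>n. a i \<in> uea_deg i"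
    unfolding G_def by blast
  have "\<rho> (monom x m) w = (\<Sum>i\<le>n. ev (cur x m * a i))"
    by (simp add: a tact_sum rho_sum_right tact_mult tact_inc)
  also have "\<dots> \<in> G (m + n)"
    using a by (intro subspace_sum[OF subspace_G] G_I[of _ "m + _"] uea_deg_mult) auto
  finally show ?thesis .
qed

lemma rho_Gpred: "w \<in> Gpred n \<Longrightarrow> \<rho> (monom x m) w \<in> Gpred (m + n)"
  using rho_G[of w "n - 1" x m] subspace_0[OF subspace_Gpred]
  by (cases n) (auto simp: Gpred_def split: if_splits)

lemma filt_eq: "filt M v n = {a \<in> carrier M. \<theta> a \<in> G n}"
proof (intro Set.set_eqI iffI)
  fix a assume "a \<in> filt M v n"
  then obtain u where "a = uea_act M (\<Sum>i\<le>n. u i) v" "\<forall>i\<le>n. u i \<in> uea_deg i"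
    unfolding filt_def by blast
  then show "a \<in> {a \<in> carrier M. \<theta> a \<in> G n}"
    using v unfolding G_def by (auto simp: uea_act_closed theta_uea_act)
next
  fix a assume "a \<in> {a \<in> carrier M. \<theta> a \<in> G n}"
  then obtain u where a: "a \<in> carrier M" "\<theta> a = ev (\<Sum>i\<le>n. u i)" "\<forall>i\<le>n. u i \<in> uea_deg i"
    unfolding G_def by blast
  then have "a = uea_act M (\<Sum>i\<le>n. u i) v"
    using v by (intro theta_eqI) (simp_all add: uea_act_closed theta_uea_act)
  then show "a \<in> filt M v n"
    using a unfolding filt_def by blast
qed

lemma filt_pred_eq: "filt_pred M v n = {a \<in> carrier M. \<theta> a \<in> Gpred n}"
  unfolding filt_pred_def Gpred_def filt_eq
  by (auto simp: zero_closed theta_zero intro: theta_eqI)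

abbreviation R :: "nat \<Rightarrow> ('l poly, 'v) smodule" where
  "R n \<equiv> restrict_to M (filt M v n)"

lemma coord_quotient_filt: "coord_quotient sc (R n) \<theta> (Gpred n)"
proof
  show "inj_on \<theta> (carrier (R n))"
    using theta_inj by (rule inj_on_subset) (auto simp: restrict_to_def filt_eq)
qed (auto simp: restrict_to_def filt_eq add_closed theta_add zero_closed theta_zero smult_closed
    theta_smult subspace_Gpred subspace_0[OF subspace_G] subspace_add[OF subspace_G]
    subspace_scale[OF subspace_G])

lemma N_filt: "coord_quotient.N (R n) \<theta> (Gpred n) = filt_pred M v n"
  unfolding coord_quotient.N_def[OF coord_quotient_filt] filt_pred_eq
  using Gpred_subset by (auto simp: restrict_to_def filt_eq)

lemma coset_restrict: "N' +>\<^bsub>restrict_to M F\<^esub> a = N' +>\<^bsub>M\<^esub> a"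
  by (simp add: a_r_coset_def' restrict_to_def)

text \<open>Every element of the piece of degree \<open>n\<close> is represented by \<open>u v\<close> for some \<open>u\<close> that is homogeneous
  of degree \<open>n\<close>. Hence the associated graded module is the image of the enveloping algebra under the
  map that sends \<open>u\<close> to the family of the classes of its components; see \<open>gr_carrier\<close>.\<close>

definition cls :: "nat \<Rightarrow> 'l poly uea \<Rightarrow> 'v set" where
  "cls n u = filt_pred M v n +>\<^bsub>M\<^esub> uea_act M (dcomp n u) v"

lemma uea_act_filt: "uea_act M (dcomp n u) v \<in> carrier (R n)"
  using v by (auto simp: restrict_to_def filt_eq uea_act_closed theta_uea_act intro: G_I dcomp_in_uea_deg)

lemma cls_eq_iff: "cls n u = cls n u' \<longleftrightarrow> ev (dcomp n u) - ev (dcomp n u') \<in> Gpred n"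
proof -
  interpret q: coord_quotient sc "R n" \<theta> "Gpred n" by (rule coord_quotient_filt)
  show ?thesis
    using q.cos_eq_iff[OF uea_act_filt uea_act_filt, of u u'] v
    unfolding N_filt coset_restrict by (simp add: cls_def theta_uea_act)
qed

lemma carrier_piece: "carrier (gr_piece M v n) = range (cls n)"
proof -
  interpret q: coord_quotient sc "R n" \<theta> "Gpred n" by (rule coord_quotient_filt)
  have "\<exists>u. q.cos a = cls n u" if a: "a \<in> carrier (R n)" for a
  proof -
    have "\<theta> a \<in> G n"
      using a by (simp add: restrict_to_def filt_eq)
    then obtain u w where u: "u \<in> uea_deg n" "w \<in> Gpred n" "\<theta> a = ev u + w"
      by (rule G_decompose)
    then have "q.cos a = q.cos (uea_act M (dcomp n u) v)"
      using a v by (subst q.cos_eq_iff[OF a uea_act_filt])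
        (simp add: theta_uea_act dcomp_uea_deg)
    then show ?thesis
      unfolding N_filt coset_restrict cls_def by blast
  qed
  then have "q.cos ` carrier (R n) \<subseteq> range (cls n)" by blast
  moreover have "cls n u \<in> q.cos ` carrier (R n)" for u
    using imageI[OF uea_act_filt, of q.cos n u] unfolding N_filt coset_restrict cls_def .
  ultimately have "carrier q.Q = range (cls n)"
    unfolding q.carrier_Q by blast
  then show ?thesis
    unfolding gr_piece_def N_filt .
qed

lemma piece_ops:
  "\<zero>\<^bsub>gr_piece M v n\<^esub> = cls n 0"
  "cls n u \<oplus>\<^bsub>gr_piece M v n\<^esub> cls n u' = cls n (u + u')"
  "c \<odot>\<^bsub>gr_piece M v n\<^esub> cls n u = cls n (uea_scale c u)"
proof -
  interpret q: coord_quotient sc "R n" \<theta> "Gpred n" by (rule coord_quotient_filt)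
  have cls: "q.cos (uea_act M (dcomp n u) v) = cls n u" for u
    unfolding N_filt coset_restrict cls_def ..
  have eq: "q.cos a = cls n u" if "a \<in> carrier (R n)" "\<theta> a = ev (dcomp n u)" for a u
    unfolding cls[symmetric] using that v
    by (subst q.cos_eq_iff[OF that(1) uea_act_filt])
      (simp add: theta_uea_act subspace_0[OF subspace_Gpred])
  have Q: "gr_piece M v n = q.Q"
    unfolding gr_piece_def N_filt ..
  show "\<zero>\<^bsub>gr_piece M v n\<^esub> = cls n 0"
    unfolding Q q.zero_Q by (rule eq) (simp_all add: q.zero_closed q.theta_zero)
  show "cls n u \<oplus>\<^bsub>gr_piece M v n\<^esub> cls n u' = cls n (u + u')"
    unfolding Q cls[symmetric] q.add_Q[OF uea_act_filt uea_act_filt] unfolding cls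
    using v by (intro eq q.add_closed uea_act_filt)
      (simp add: q.theta_add uea_act_filt theta_uea_act dcomp_add tact_add)
  show "c \<odot>\<^bsub>gr_piece M v n\<^esub> cls n u = cls n (uea_scale c u)"
    unfolding Q cls[symmetric] q.smult_Q[OF uea_act_filt] unfolding cls
    using v by (intro eq q.smult_closed uea_act_filt)
      (simp add: q.theta_smult uea_act_filt theta_uea_act dcomp_scale tact_scale)
qed

lemma gr_shift_cls:
  assumes "m \<le> n"
  shows "gr_shift M v x m (n - m) (cls (n - m) u)
    = filt_pred M v n +>\<^bsub>M\<^esub> uea_act M (cur x m * dcomp (n - m) u) v"
proof -
  interpret q: coord_quotient sc "R n" \<theta> "Gpred n" by (rule coord_quotient_filt)
  interpret q': coord_quotient sc "R (n - m)" \<theta> "Gpred (n - m)" by (rule coord_quotient_filt)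
  have cls: "cls (n - m) u = q'.cos (uea_act M (dcomp (n - m) u) v)"
    unfolding N_filt coset_restrict cls_def ..
  let ?c = "uea_act M (cur x m * dcomp (n - m) u) v"
  have c: "?c \<in> carrier (R n)"
    using v uea_deg_mult[OF dcomp_in_uea_deg, of x m "n - m" u] assms
    by (auto simp: restrict_to_def filt_eq uea_act_closed theta_uea_act intro: G_I)
  have 1: "filt_pred M v n +>\<^bsub>M\<^esub> act M (monom x m) a = filt_pred M v n +>\<^bsub>M\<^esub> ?c"
    if "a \<in> cls (n - m) u" for a
  proof -
    have a: "a \<in> carrier M" "\<theta> a \<in> G (n - m)" "\<theta> a - ev (dcomp (n - m) u) \<in> Gpred (n - m)"
      using that v unfolding cls q'.cos_eq[OF uea_act_filt]
      by (auto simp: restrict_to_def filt_eq theta_uea_act)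
    have act_a: "act M (monom x m) a \<in> carrier (R n)"
      using a rho_G[OF a(2), of x m] assms by (simp add: restrict_to_def filt_eq act_closed theta_act)
    have "\<rho> (monom x m) (\<theta> a - ev (dcomp (n - m) u)) \<in> Gpred n"
      using rho_Gpred[OF a(3), of x m] assms by simp
    moreover have "\<rho> (monom x m) (\<theta> a - ev (dcomp (n - m) u))
        = \<theta> (act M (monom x m) a) - \<theta> ?c"
      using a v tact_linear(1)[of "cur x m" "\<theta> a - ev (dcomp (n - m) u)" "ev (dcomp (n - m) u)"]
      by (simp add: theta_act theta_uea_act tact_mult tact_inc)
    ultimately have "q.cos (act M (monom x m) a) = q.cos ?c"
      by (simp add: q.cos_eq_iff[OF act_a c])
    then show ?thesis
      unfolding N_filt coset_restrict .
  qed
  have "uea_act M (dcomp (n - m) u) v \<in> cls (n - m) u"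
    unfolding cls q'.cos_eq[OF uea_act_filt]
    using uea_act_filt by (simp add: subspace_0[OF subspace_Gpred])
  then show ?thesis
    unfolding gr_shift_def using 1 assms by auto
qed

lemma gr_act_cls: "act (gr_module M v) p (\<lambda>n. cls n u) = (\<lambda>n. cls n (uea_inc p * u))"
proof
  fix n
  interpret q: coord_quotient sc "R n" \<theta> "Gpred n" by (rule coord_quotient_filt)
  let ?f = "\<lambda>m. uea_act M (cur (coeff p m) m * dcomp (n - m) u) v"
  have f: "?f m \<in> carrier (R n)" if "m \<le> n" for m
    using v uea_deg_mult[OF dcomp_in_uea_deg, of "coeff p m" m "n - m" u] that
    by (auto simp: restrict_to_def filt_eq uea_act_closed theta_uea_act intro: G_I)
  have Q: "gr_piece M v n = q.Q"
    unfolding gr_piece_def N_filt ..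
  interpret Q: abelian_group "q.Q" by (rule q.abelian_group_Q)
  have "act (gr_module M v) p (\<lambda>n. cls n u) n
      = finsum q.Q (\<lambda>m. gr_shift M v (coeff p m) m (n - m) (cls (n - m) u)) {..n}"
    by (simp add: gr_module_def Let_def Q)
  also have "\<dots> = finsum q.Q (\<lambda>m. q.cos (?f m)) {..n}"
  proof (rule Q.finsum_cong'[OF refl])
    show "(\<lambda>m. q.cos (?f m)) \<in> {..n} \<rightarrow> carrier q.Q"
      using f by (auto simp: q.carrier_Q)
    show "gr_shift M v (coeff p m) m (n - m) (cls (n - m) u) = q.cos (?f m)" if "m \<in> {..n}" for m
      unfolding N_filt coset_restrict using that by (intro gr_shift_cls) simp
  qed
  also have "\<dots> = q.cos (finsum (R n) ?f {..n})"
    using f by (intro q.finsum_Q) auto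
  also have "\<dots> = q.cos (uea_act M (dcomp n (uea_inc p * u)) v)"
  proof -
    have "finsum (R n) ?f {..n} \<in> carrier (R n)"
      and "\<theta> (finsum (R n) ?f {..n}) = \<theta> (uea_act M (dcomp n (uea_inc p * u)) v)"
      using q.theta_finsum[of "{..n}" ?f] f v
      by (simp_all add: theta_uea_act dcomp_inc_mult tact_sum)
    then show ?thesis
      by (subst q.cos_eq_iff[OF _ uea_act_filt]) (simp_all add: subspace_0[OF subspace_Gpred])
  qed
  also have "\<dots> = cls n (uea_inc p * u)"
    unfolding N_filt coset_restrict cls_def ..
  finally show "act (gr_module M v) p (\<lambda>n. cls n u) n = cls n (uea_inc p * u)" .
qed

lemma gr_carrier: "carrier (gr_module M v) = range (\<lambda>u n. cls n u)"
proof -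
  have C: "carrier (gr_module M v) = {f. (\<forall>n. f n \<in> range (cls n)) \<and> finite {n. f n \<noteq> cls n 0}}"
    by (simp add: gr_module_def Let_def carrier_piece piece_ops)
  show ?thesis
    unfolding C
  proof (intro Set.set_eqI iffI)
    fix f :: "nat \<Rightarrow> 'v set" assume "f \<in> {f. (\<forall>n. f n \<in> range (cls n)) \<and> finite {n. f n \<noteq> cls n 0}}"
    then have "\<forall>n. \<exists>u. f n = cls n u" and fin: "finite {n. f n \<noteq> cls n 0}" by auto
    then obtain u where u: "\<And>n. f n = cls n (u n)" by metis
    define w where "w = (\<Sum>m | f m \<noteq> cls m 0. dcomp m (u m))"
    have "dcomp n w = (if f n \<noteq> cls n 0 then dcomp n (u n) else 0)" for n
      unfolding w_def dcomp_sum dcomp_uea_deg[OF dcomp_in_uea_deg]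
      using fin by (simp add: sum.delta)
    then have "dcomp n w = dcomp n (if f n = cls n 0 then 0 else u n)" for n
      by simp
    then have "cls n w = cls n (if f n = cls n 0 then 0 else u n)" for n
      by (simp only: cls_def)
    then have "f n = cls n w" for n
      using u[of n] by (cases "f n = cls n 0") simp_all
    then show "f \<in> range (\<lambda>u n. cls n u)" by blast
  next
    fix f :: "nat \<Rightarrow> 'v set" assume "f \<in> range (\<lambda>u n. cls n u)"
    then obtain u where f: "f = (\<lambda>n. cls n u)" by blast
    obtain N where N: "\<forall>n>N. dcomp n u = 0"
      using uea_deg_decomposition by blast
    have "{n. f n \<noteq> cls n 0} \<subseteq> {..N}"
      using N by (force simp: f cls_def not_le[symmetric])
    then show "f \<in> {f. (\<forall>n. f n \<in> range (cls n)) \<and> finite {n. f n \<noteq> cls n 0}}"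
      by (auto simp: f intro: finite_subset)
  qed
qed

lemma gr_ops:
  "(\<lambda>n. cls n u) \<oplus>\<^bsub>gr_module M v\<^esub> (\<lambda>n. cls n u') = (\<lambda>n. cls n (u + u'))"
  "c \<odot>\<^bsub>gr_module M v\<^esub> (\<lambda>n. cls n u) = (\<lambda>n. cls n (uea_scale c u))"
  by (simp_all add: gr_module_def Let_def piece_ops)

text \<open>The annihilator of the generator of the associated graded module.\<close>

definition K :: "'l poly uea set" where
  "K = {u. \<forall>n. ev (dcomp n u) \<in> Gpred n}"

lemma gr_eq_iff: "(\<lambda>n. cls n u) = (\<lambda>n. cls n u') \<longleftrightarrow> u - u' \<in> K"
  by (simp add: fun_eq_iff cls_eq_iff K_def dcomp_diff tact_diff)

lemma subspace_K: "uea.subspace K"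
  by (auto simp: uea.subspace_def K_def dcomp_add dcomp_scale tact_add tact_scale
      subspace_0[OF subspace_Gpred] subspace_add[OF subspace_Gpred] subspace_scale[OF subspace_Gpred])

lemma K_mult: "a \<in> K \<Longrightarrow> u * a \<in> K"
proof (induction u arbitrary: a rule: uea_induct)
  case (mult p u)
  have "uea_inc p * a \<in> K" if "a \<in> K" for a
    unfolding K_def
  proof (rule CollectI, rule allI)
    fix n
    have "\<rho> (monom (coeff p m) m) (ev (dcomp (n - m) a)) \<in> Gpred n" if "m \<le> n" for m
      using rho_Gpred[of "ev (dcomp (n - m) a)" "n - m" "coeff p m" m] \<open>a \<in> K\<close> that
      by (simp add: K_def)
    then show "ev (dcomp n (uea_inc p * a)) \<in> Gpred n"
      unfolding dcomp_inc_mult tact_sum tact_mult tact_inc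
      by (intro subspace_sum[OF subspace_Gpred]) simp
  qed
  then show ?case
    using mult by (simp add: mult.assoc)
qed (simp_all add: distrib_right uea.subspace_add[OF subspace_K] uea.subspace_scale[OF subspace_K])

lemma K_I: "(\<And>n. ev (dcomp n u) \<in> Gpred n) \<Longrightarrow> u \<in> K"
  by (simp add: K_def)

end

section \<open>Tensor products in coordinates\<close>

abbreviation cscale :: "complex \<Rightarrow> ('a \<Rightarrow> complex) \<Rightarrow> 'a \<Rightarrow> complex" where
  "cscale \<equiv> fun_scale (*)"

global_interpretation funs: complex_space "cscale :: complex \<Rightarrow> ('a \<Rightarrow> complex) \<Rightarrow> _"
  by standard (simp_all add: fun_scale_def fun_eq_iff algebra_simps)

interpretation free: complex_space "free_scale :: complex \<Rightarrow> ('k \<Rightarrow>\<^sub>0 complex) \<Rightarrow> _"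
  by unfold_locales

lemma free_scale_single: "free_scale c (Poly_Mapping.single k a) = Poly_Mapping.single k (c * a)"
  by (rule poly_mapping_eqI) (simp add: lookup_free_scale lookup_single when_def)

lemma sum_fun_apply: "(\<Sum>i\<in>A. f i) x = (\<Sum>i\<in>A. f i x)"
  by (induction A rule: infinite_finite_induct) simp_all

lemma ssign_simps [simp]: "ssign 0 q = 1" "ssign q 0 = 1" "ssign 1 1 = - 1"
  by (simp_all add: ssign_def)

lemma ssign_add_left: "ssign (p + q) r = ssign p r * ssign q r"
  by (cases p; cases q; cases r) simp_all

lemma ssign_add_right: "ssign r (p + q) = ssign r p * ssign r q"
  by (cases p; cases q; cases r) simp_all

text \<open>A family of representations by \<open>d \<times> d\<close> matrices, indexed by \<open>p\<close>, on a graded space whose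
  \<open>i\<close>-th basis vector has the parity \<open>kpar i\<close>.\<close>

locale super_matrices =
  fixes mat :: "'p \<Rightarrow> 'l :: lie_superalgebra \<Rightarrow> nat \<Rightarrow> nat \<Rightarrow> complex"
    and kpar :: "nat \<Rightarrow> bit" and d :: nat
  assumes mat_add: "mat p (x + y) i j = mat p x i j + mat p y i j"
    and mat_lscale: "mat p (lscale c x) i j = c * mat p x i j"
    and mat_bracket: "lpart a x = x \<Longrightarrow> lpart b y = y \<Longrightarrow>
      (\<Sum>k<d. mat p x i k * mat p y k j) - ssign a b * (\<Sum>k<d. mat p y i k * mat p x k j)
        = mat p (lbracket x y) i j"
    and mat_parity: "lpart a x = x \<Longrightarrow> mat p x i j \<noteq> 0 \<Longrightarrow> kpar i = a + kpar j"
begin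

lemma mat_zero [simp]: "mat p 0 i j = 0"
  using mat_add[of p 0 0 i j] by simp

text \<open>Functions on lists of indices are the coordinate vectors of tensors. Passing the first factor, the
  homogeneous components of \<open>x\<close> pick up the sign determined by the parity of the index \<open>a\<close>.\<close>

fun tensor_act :: "'p list \<Rightarrow> 'l \<Rightarrow> (nat list \<Rightarrow> complex) \<Rightarrow> nat list \<Rightarrow> complex" where
  "tensor_act [] x f l = 0"
| "tensor_act (p # ps) x f [] = 0"
| "tensor_act (p # ps) x f (a # l) = (\<Sum>b<d. mat p x a b * f (b # l))
     + (\<Sum>q\<in>{0, 1}. ssign q (kpar a) * tensor_act ps (lpart q x) (\<lambda>l'. f (a # l')) l)"

lemma tensor_act_add_right:
  "tensor_act ps x (\<lambda>l. f l + g l) l = tensor_act ps x f l + tensor_act ps x g l"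
proof (induction ps arbitrary: x f g l)
  case (Cons p ps)
  then show ?case
    by (cases l) (simp_all add: algebra_simps sum.distrib)
qed simp

lemma tensor_act_scale_right: "tensor_act ps x (\<lambda>l. c * f l) l = c * tensor_act ps x f l"
  by (induction ps x f l rule: tensor_act.induct) (simp_all add: algebra_simps sum_distrib_left)

lemma tensor_act_add_left:
  "tensor_act ps (x + y) f l = tensor_act ps x f l + tensor_act ps y f l"
proof (induction ps arbitrary: x y f l)
  case (Cons p ps)
  then show ?case
    by (cases l) (simp_all add: algebra_simps sum.distrib mat_add lpart_add)
qed simp

lemma tensor_act_scale_left: "tensor_act ps (lscale c x) f l = c * tensor_act ps x f l"
  by (induction ps x f l rule: tensor_act.induct)
    (simp_all add: algebra_simps sum_distrib_left mat_lscale lpart_lscale)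

lemma tensor_act_zero_left [simp]: "tensor_act ps 0 f l = 0"
  using tensor_act_add_left[of ps 0 0 f l] by simp

lemma tensor_act_zero_right [simp]: "tensor_act ps x (\<lambda>l. 0) l = 0"
  using tensor_act_add_right[of ps x "\<lambda>_. 0" "\<lambda>_. 0" l] by simp

lemma tensor_act_sum_right:
  "tensor_act ps x (\<lambda>l. \<Sum>b\<in>B. c b * f b l) l = (\<Sum>b\<in>B. c b * tensor_act ps x (f b) l)"
  by (induction B rule: infinite_finite_induct)
    (simp_all add: tensor_act_add_right tensor_act_scale_right)

lemma tensor_act_homogeneous:
  assumes "lpart q x = x"
  shows "tensor_act (p # ps) x f (a # l) = (\<Sum>b<d. mat p x a b * f (b # l))
     + ssign q (kpar a) * tensor_act ps x (\<lambda>l'. f (a # l')) l"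
proof -
  have "lpart r x = (if r = q then x else 0)" for r
    using lpart_lpart[of r q x] assms by (auto split: if_splits)
  then show ?thesis
    by (cases q) simp_all
qed

lemma mat_ssign:
  assumes "lpart a x = x"
  shows "mat p x i j * ssign b (kpar j) = mat p x i j * ssign b (kpar i) * ssign a b"
proof (cases "mat p x i j = 0")
  case False
  have "ssign b (kpar i) * ssign a b = ssign b (kpar j)"
    unfolding mat_parity[OF assms False] ssign_add_right by (simp add: ssign_def)
  then show ?thesis by (simp add: mult.assoc)
qed simp

text \<open>The mixed terms, in which \<open>x\<close> and \<open>y\<close> act in different factors, cancel: the matrix of \<open>x\<close> changes
  the parity of the index by that of \<open>x\<close>, which accounts for the sign in the supercommutator.\<close>

lemma tensor_act_bracket:
  assumes x: "lpart p x = x" and y: "lpart q y = y"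
  shows "tensor_act ps x (tensor_act ps y f) l - ssign p q * tensor_act ps y (tensor_act ps x f) l
    = tensor_act ps (lbracket x y) f l"
proof (induction ps arbitrary: f l)
  case (Cons r ps)
  show ?case
  proof (cases l)
    case (Cons a l')
    let ?f = "\<lambda>b l'. f (b # l')"
    have xy: "tensor_act (r # ps) x (tensor_act (r # ps) y f) l
      = (\<Sum>b<d. \<Sum>c<d. mat r x a b * mat r y b c * f (c # l'))
        + (\<Sum>b<d. mat r x a b * ssign q (kpar b) * tensor_act ps y (?f b) l')
        + ssign p (kpar a) * (\<Sum>b<d. mat r y a b * tensor_act ps x (?f b) l')
        + ssign p (kpar a) * ssign q (kpar a) * tensor_act ps x (tensor_act ps y (?f a)) l'"
      if x: "lpart p x = x" and y: "lpart q y = y" for x y p q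
      unfolding Cons tensor_act_homogeneous[OF x] tensor_act_homogeneous[OF y]
      by (simp add: tensor_act_add_right tensor_act_scale_right tensor_act_sum_right
          distrib_left sum.distrib sum_distrib_left mult.assoc)
    have comm: "(\<Sum>b<d. mat r x a b * ssign q (kpar b) * g b)
        = ssign p q * (ssign q (kpar a) * (\<Sum>b<d. mat r x a b * g b))"
      if "lpart p x = x" for x p q and g :: "nat \<Rightarrow> complex"
      unfolding sum_distrib_left
      by (rule sum.cong[OF refl]) (subst mat_ssign[OF that], simp)
    have main: "(\<Sum>b<d. \<Sum>c<d. mat r x a b * mat r y b c * f (c # l'))
        - ssign p q * (\<Sum>b<d. \<Sum>c<d. mat r y a b * mat r x b c * f (c # l'))
        = (\<Sum>c<d. mat r (lbracket x y) a c * f (c # l'))"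
    proof -
      have sw: "(\<Sum>b<d. \<Sum>c<d. u b * w b c * f (c # l')) = (\<Sum>c<d. (\<Sum>b<d. u b * w b c) * f (c # l'))"
        for u w
        by (subst sum.swap) (simp add: sum_distrib_right)
      have "(\<Sum>c<d. u c * g c) - k * (\<Sum>c<d. w c * g c) = (\<Sum>c<d. (u c - k * w c) * g c)"
        for u w g :: "nat \<Rightarrow> complex" and k
        by (simp add: left_diff_distrib sum_subtractf sum_distrib_left mult.assoc)
      then show ?thesis
        unfolding sw mat_bracket[OF x y, symmetric] .
    qed
    have "ssign p q * ssign q p = 1"
      by (simp add: ssign_def)
    then have sq: "ssign p q * (ssign q p * c) = c" for c
      by (simp flip: mult.assoc)
    show ?thesis
      unfolding xy[OF x y] xy[OF y x] comm[OF x] comm[OF y]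
      unfolding Cons tensor_act_homogeneous[OF lbracket_grading[OF x y]]
      unfolding main[symmetric] Cons.IH[symmetric] ssign_add_left
      by (simp add: algebra_simps sq)
  qed simp
qed simp

lemma uea_rep_tensor: "uea_rep cscale (tensor_act ps)"
proof
  fix x y :: 'l and v w :: "nat list \<Rightarrow> complex" and c p q
  show "tensor_act ps x (v + w) = tensor_act ps x v + tensor_act ps x w"
    by (simp add: fun_eq_iff plus_fun_def tensor_act_add_right)
  show "tensor_act ps x (cscale c w) = cscale c (tensor_act ps x w)"
    by (simp add: fun_eq_iff fun_scale_def tensor_act_scale_right)
  show "tensor_act ps (x + y) w = tensor_act ps x w + tensor_act ps y w"
    by (simp add: fun_eq_iff tensor_act_add_left)
  show "tensor_act ps (lscale c x) w = cscale c (tensor_act ps x w)"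
    by (simp add: fun_eq_iff fun_scale_def tensor_act_scale_left)
  show "tensor_act ps x (tensor_act ps y w) - cscale (ssign p q) (tensor_act ps y (tensor_act ps x w))
      = tensor_act ps (lbracket x y) w" if "lpart p x = x" "lpart q y = y"
    using tensor_act_bracket[OF that] by (simp add: fun_eq_iff fun_scale_def)
qed

end

text \<open>Modules \<open>V p\<close> that become the space of \<open>d\<close>-vectors with the given matrices in the coordinates
  \<open>co p\<close>.\<close>

locale coord_family = super_matrices mat kpar d
  for mat :: "'p \<Rightarrow> 'l :: lie_superalgebra \<Rightarrow> nat \<Rightarrow> nat \<Rightarrow> complex"
    and kpar :: "nat \<Rightarrow> bit" and d :: nat +
  fixes V :: "'p \<Rightarrow> ('l, 'v) smodule" and co :: "'p \<Rightarrow> 'v \<Rightarrow> nat \<Rightarrow> complex"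
  assumes V_add: "a \<in> carrier (V p) \<Longrightarrow> b \<in> carrier (V p) \<Longrightarrow> a \<oplus>\<^bsub>V p\<^esub> b \<in> carrier (V p)"
      "a \<in> carrier (V p) \<Longrightarrow> b \<in> carrier (V p) \<Longrightarrow> co p (a \<oplus>\<^bsub>V p\<^esub> b) i = co p a i + co p b i"
    and V_smult: "a \<in> carrier (V p) \<Longrightarrow> c \<odot>\<^bsub>V p\<^esub> a \<in> carrier (V p)"
      "a \<in> carrier (V p) \<Longrightarrow> co p (c \<odot>\<^bsub>V p\<^esub> a) i = c * co p a i"
    and V_act: "a \<in> carrier (V p) \<Longrightarrow> act (V p) x a \<in> carrier (V p)"
      "a \<in> carrier (V p) \<Longrightarrow> co p (act (V p) x a) i = (\<Sum>j<d. mat p x i j * co p a j)"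
    and V_koszul: "a \<in> carrier (V p) \<Longrightarrow> koszul (V p) q a \<in> carrier (V p)"
      "a \<in> carrier (V p) \<Longrightarrow> co p (koszul (V p) q a) i = ssign q (kpar i) * co p a i"
    and V_inj: "a \<in> carrier (V p) \<Longrightarrow> b \<in> carrier (V p) \<Longrightarrow> co p a = co p b \<Longrightarrow> a = b"
    and V_support: "a \<in> carrier (V p) \<Longrightarrow> d \<le> i \<Longrightarrow> co p a i = 0"
    and V_basis: "i < d \<Longrightarrow> \<exists>a\<in>carrier (V p). co p a = (\<lambda>j. if j = i then 1 else 0)"
begin

fun coprod :: "'p list \<Rightarrow> 'v list \<Rightarrow> nat list \<Rightarrow> complex" where
  "coprod [] [] [] = 1"
| "coprod (p # ps) (v # vs) (c # cs) = co p v c * coprod ps vs cs"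
| "coprod _ _ _ = 0"

abbreviation in_V :: "'p list \<Rightarrow> 'v list \<Rightarrow> bool" where
  "in_V ps vs \<equiv> list_all2 (\<lambda>v p. v \<in> carrier (V p)) vs ps"

lemma tuples_iff: "vs \<in> tuples (map V ps) \<longleftrightarrow> in_V ps vs"
  by (simp add: tuples_def list_all2_map2)

definition \<Theta> :: "'p list \<Rightarrow> ('v list \<Rightarrow>\<^sub>0 complex) \<Rightarrow> nat list \<Rightarrow> complex" where
  "\<Theta> ps = funs.lin_ext (coprod ps)"

lemma Theta_tuple: "\<Theta> ps (tuple vs) = coprod ps vs"
  by (simp add: \<Theta>_def funs.lin_ext_single)

lemma Theta_add: "\<Theta> ps (f + g) = \<Theta> ps f + \<Theta> ps g"
  and Theta_diff: "\<Theta> ps (f - g) = \<Theta> ps f - \<Theta> ps g"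
  and Theta_scale: "\<Theta> ps (free_scale c f) = cscale c (\<Theta> ps f)"
  and Theta_sum: "\<Theta> ps (sum h X) = (\<Sum>i\<in>X. \<Theta> ps (h i))"
  by (simp_all add: \<Theta>_def funs.lin_ext_add funs.lin_ext_diff funs.lin_ext_free_scale
      funs.lin_ext_sum)

lemma linear_Theta: "Vector_Spaces.linear free_scale cscale (\<Theta> ps)"
  by unfold_locales (simp_all add: Theta_add Theta_scale)

lemma in_V_update: "in_V ps vs \<Longrightarrow> i < length ps \<Longrightarrow> v \<in> carrier (V (ps ! i)) \<Longrightarrow> in_V ps (vs[i := v])"
  by (auto simp: list_all2_conv_all_nth nth_list_update)

lemma coprod_update_add:
  "in_V ps vs \<Longrightarrow> i < length ps \<Longrightarrow> v \<in> carrier (V (ps ! i)) \<Longrightarrow> w \<in> carrier (V (ps ! i)) \<Longrightarrow>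
    coprod ps (vs[i := v \<oplus>\<^bsub>V (ps ! i)\<^esub> w]) cs = coprod ps (vs[i := v]) cs + coprod ps (vs[i := w]) cs"
proof (induction ps arbitrary: vs i cs)
  case (Cons p ps)
  then show ?case
    by (cases i; cases cs) (auto simp: list_all2_Cons2 V_add algebra_simps)
qed simp

lemma coprod_update_smult:
  "in_V ps vs \<Longrightarrow> i < length ps \<Longrightarrow> v \<in> carrier (V (ps ! i)) \<Longrightarrow>
    coprod ps (vs[i := c \<odot>\<^bsub>V (ps ! i)\<^esub> v]) cs = c * coprod ps (vs[i := v]) cs"
proof (induction ps arbitrary: vs i cs)
  case (Cons p ps)
  then show ?case
    by (cases i; cases cs) (auto simp: list_all2_Cons2 V_smult)
qed simp

abbreviation relspan :: "'p list \<Rightarrow> ('v list \<Rightarrow>\<^sub>0 complex) set" where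
  "relspan ps \<equiv> free.span (multilinear_relators (map V ps))"

abbreviation FT :: "'p list \<Rightarrow> ('l, 'v list \<Rightarrow>\<^sub>0 complex) smodule" where
  "FT ps \<equiv> free_tensor (map V ps)"

lemma FT_carrier_tuple: "in_V ps vs \<Longrightarrow> tuple vs \<in> carrier (FT ps)"
  by (simp add: free_tensor_def tuples_iff)

lemma FT_subspace: "free.subspace (carrier (FT ps))"
  unfolding free.subspace_def
proof (intro conjI ballI allI)
  fix f g assume "f \<in> carrier (FT ps)" "g \<in> carrier (FT ps)"
  then show "f + g \<in> carrier (FT ps)"
    using Poly_Mapping.keys_add[of f g] by (auto simp: free_tensor_def)
next
  fix c f assume "f \<in> carrier (FT ps)"
  then show "free_scale c f \<in> carrier (FT ps)"
    by (auto simp: free_tensor_def in_keys_iff lookup_free_scale)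
qed (simp add: free_tensor_def)

lemma Theta_relators: "f \<in> relspan ps \<Longrightarrow> f \<in> carrier (FT ps) \<and> \<Theta> ps f = 0"
proof (induction rule: free.span_induct_alt)
  case base
  show ?case
    using free.subspace_0[OF FT_subspace] by (simp add: \<Theta>_def)
next
  case (step c r f)
  have "r \<in> carrier (FT ps) \<and> \<Theta> ps r = 0"
    using step(1)
  proof cases
    case (add vs i v w)
    then have *: "in_V ps vs" "i < length ps" "v \<in> carrier (V (ps ! i))" "w \<in> carrier (V (ps ! i))"
      by (simp_all add: tuples_iff)
    then show ?thesis
      unfolding add
      by (auto intro!: free.subspace_diff[OF FT_subspace] free.subspace_add[OF FT_subspace]
          FT_carrier_tuple in_V_update V_add
          simp: Theta_add Theta_diff Theta_tuple fun_eq_iff coprod_update_add)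
  next
    case (scale vs i v c)
    then have *: "in_V ps vs" "i < length ps" "v \<in> carrier (V (ps ! i))"
      by (simp_all add: tuples_iff)
    then show ?thesis
      unfolding scale
      by (auto intro!: free.subspace_diff[OF FT_subspace] free.subspace_scale[OF FT_subspace]
          FT_carrier_tuple in_V_update V_smult
          simp: Theta_scale Theta_diff Theta_tuple fun_eq_iff coprod_update_smult fun_scale_def)
  qed
  with step(2) show ?case
    using free.subspace_add[OF FT_subspace] free.subspace_scale[OF FT_subspace]
    by (auto simp: Theta_add Theta_scale fun_scale_def fun_eq_iff)
qed

definition bas :: "'p \<Rightarrow> nat \<Rightarrow> 'v" where
  "bas p i = (SOME a. a \<in> carrier (V p) \<and> co p a = (\<lambda>j. if j = i then 1 else 0))"

lemma bas: "i < d \<Longrightarrow> bas p i \<in> carrier (V p)"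
  "i < d \<Longrightarrow> co p (bas p i) = (\<lambda>j. if j = i then 1 else 0)"
  using someI_ex[OF V_basis[of i p, unfolded Bex_def]] unfolding bas_def by auto

definition eqv :: "'p list \<Rightarrow> ('v list \<Rightarrow>\<^sub>0 complex) \<Rightarrow> ('v list \<Rightarrow>\<^sub>0 complex) \<Rightarrow> bool" where
  "eqv ps f g \<longleftrightarrow> f - g \<in> relspan ps"

lemma eqv_refl: "eqv ps f f"
  by (simp add: eqv_def free.span_zero)

lemma eqv_trans [trans]: "eqv ps f g \<Longrightarrow> eqv ps g h \<Longrightarrow> eqv ps f h"
  unfolding eqv_def using free.span_add by fastforce

lemma eqv_add: "eqv ps f f' \<Longrightarrow> eqv ps g g' \<Longrightarrow> eqv ps (f + g) (f' + g')"
  unfolding eqv_def using free.span_add[of "f - f'" _ "g - g'"] by (simp add: algebra_simps)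

lemma eqv_scale: "eqv ps f f' \<Longrightarrow> eqv ps (free_scale c f) (free_scale c f')"
  unfolding eqv_def using free.span_scale[of "f - f'" _ c]
  by (simp add: free.scale_right_diff_distrib)

lemma eqv_sum: "(\<And>i. i \<in> X \<Longrightarrow> eqv ps (f i) (g i)) \<Longrightarrow> eqv ps (sum f X) (sum g X)"
  by (induction X rule: infinite_finite_induct) (auto intro: eqv_add eqv_refl)

text \<open>The components of the entry \<open>v\<close> are split off one basis vector at a time; when none is left, \<open>v\<close> is
  zero by injectivity of the coordinates, and a tuple with a zero entry is a relator.\<close>

lemma expand_slot:
  assumes vs: "in_V ps vs" and i: "i < length ps" and "finite X" "X \<subseteq> {..<d}"
  shows "v \<in> carrier (V (ps ! i)) \<Longrightarrow> (\<And>c. c \<notin> X \<Longrightarrow> co (ps ! i) v c = 0) \<Longrightarrow>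
    eqv ps (tuple (vs[i := v]))
      (\<Sum>c\<in>X. free_scale (co (ps ! i) v c) (tuple (vs[i := bas (ps ! i) c])))"
  using \<open>finite X\<close> \<open>X \<subseteq> {..<d}\<close>
proof (induction X arbitrary: v)
  case empty
  then have "v = 0 \<odot>\<^bsub>V (ps ! i)\<^esub> v"
    by (intro V_inj) (auto simp: V_smult)
  moreover have "tuple (vs[i := 0 \<odot>\<^bsub>V (ps ! i)\<^esub> v]) - free_scale 0 (tuple (vs[i := v])) \<in> relspan ps"
    using multilinear_relators.scale[of vs "map V ps" i v 0] vs i empty
    by (intro free.span_base) (simp add: tuples_iff)
  ultimately show ?case
    by (simp add: eqv_def)
next
  case (insert c X)
  let ?p = "ps ! i" and ?b = "bas (ps ! i) c"
  have b: "?b \<in> carrier (V ?p)" "co ?p ?b = (\<lambda>j. if j = c then 1 else 0)"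
    using insert.prems by (simp_all add: bas)
  let ?cb = "co ?p v c \<odot>\<^bsub>V ?p\<^esub> ?b" and ?w = "v \<oplus>\<^bsub>V ?p\<^esub> ((- co ?p v c) \<odot>\<^bsub>V ?p\<^esub> ?b)"
  have w: "?w \<in> carrier (V ?p)" "co ?p ?w j = (if j = c then 0 else co ?p v j)" for j
    using insert.prems b by (simp_all add: V_add V_smult)
  have cb: "?cb \<in> carrier (V ?p)"
    using b by (simp add: V_smult)
  have "v = ?w \<oplus>\<^bsub>V ?p\<^esub> ?cb"
    using insert.prems b w cb by (intro V_inj) (auto simp: V_add V_smult)
  moreover have "eqv ps (tuple (vs[i := ?w \<oplus>\<^bsub>V ?p\<^esub> ?cb])) (tuple (vs[i := ?w]) + tuple (vs[i := ?cb]))"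
    unfolding eqv_def using multilinear_relators.add[of vs "map V ps" i ?w ?cb] vs i w cb
    by (intro free.span_base) (simp add: tuples_iff)
  ultimately have "eqv ps (tuple (vs[i := v])) (tuple (vs[i := ?w]) + tuple (vs[i := ?cb]))"
    by simp
  also have "eqv ps (tuple (vs[i := ?w]) + tuple (vs[i := ?cb]))
      ((\<Sum>e\<in>X. free_scale (co ?p ?w e) (tuple (vs[i := bas ?p e])))
        + free_scale (co ?p v c) (tuple (vs[i := ?b])))"
  proof (rule eqv_add)
    show "eqv ps (tuple (vs[i := ?w])) (\<Sum>e\<in>X. free_scale (co ?p ?w e) (tuple (vs[i := bas ?p e])))"
      using insert.prems by (intro insert.IH w(1)) (auto simp: w(2))
    show "eqv ps (tuple (vs[i := ?cb])) (free_scale (co ?p v c) (tuple (vs[i := ?b])))"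
      unfolding eqv_def using multilinear_relators.scale[of vs "map V ps" i ?b "co ?p v c"] vs i b
      by (intro free.span_base) (simp add: tuples_iff)
  qed
  also have "(\<Sum>e\<in>X. free_scale (co ?p ?w e) (tuple (vs[i := bas ?p e])))
      = (\<Sum>e\<in>X. free_scale (co ?p v e) (tuple (vs[i := bas ?p e])))"
    using insert.hyps by (intro sum.cong) (auto simp: w(2))
  finally show ?case
    using insert.hyps by (simp add: add.commute)
qed

definition box :: "nat \<Rightarrow> nat list set" where
  "box n = {cs. length cs = n \<and> set cs \<subseteq> {..<d}}"

lemma finite_box: "finite (box n)" and card_box: "card (box n) = d ^ n"
  using finite_lists_length_eq[of "{..<d}" n] card_lists_length_eq[of "{..<d}" n]
  by (simp_all add: box_def conj_commute)

lemma box_0: "box 0 = {[]}"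
  by (auto simp: box_def)

lemma box_Suc: "box (Suc n) = (\<lambda>(c, cs). c # cs) ` ({..<d} \<times> box n)"
  unfolding box_def by (auto simp: length_Suc_conv image_iff)

lemma sum_box_Suc: "(\<Sum>cs\<in>box (Suc n). h cs) = (\<Sum>c<d. \<Sum>cs\<in>box n. h (c # cs))"
proof -
  have "(\<Sum>cs\<in>box (Suc n). h cs) = (\<Sum>(c, cs)\<in>{..<d} \<times> box n. h (c # cs))"
    unfolding box_Suc by (subst sum.reindex) (auto simp: inj_on_def case_prod_unfold)
  then show ?thesis by (simp add: sum.cartesian_product)
qed

lemma expand_tuple:
  "in_V pre_ps pre \<Longrightarrow> in_V ps vs \<Longrightarrow>
    eqv (pre_ps @ ps) (tuple (pre @ vs))
      (\<Sum>cs\<in>box (length ps). free_scale (coprod ps vs cs) (tuple (pre @ map2 bas ps cs)))"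
proof (induction ps arbitrary: vs pre_ps pre)
  case Nil
  then show ?case
    by (simp add: box_0 eqv_refl)
next
  case (Cons p ps)
  then obtain v vs' where vs: "vs = v # vs'" "v \<in> carrier (V p)" "in_V ps vs'"
    by (auto simp: list_all2_Cons2)
  have len: "length pre = length pre_ps"
    using Cons.prems by (simp add: list_all2_lengthD)
  have "in_V (pre_ps @ p # ps) (pre @ vs)"
    using Cons.prems by (simp add: list_all2_appendI)
  then have "eqv (pre_ps @ p # ps) (tuple ((pre @ vs)[length pre := v]))
      (\<Sum>c<d. free_scale (co p v c) (tuple ((pre @ vs)[length pre := bas p c])))"
    using expand_slot[where ps = "pre_ps @ p # ps" and vs = "pre @ vs" and i = "length pre"
        and X = "{..<d}" and v = v] len vs
    by (simp add: nth_append V_support)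
  then have "eqv (pre_ps @ p # ps) (tuple (pre @ vs))
      (\<Sum>c<d. free_scale (co p v c) (tuple ((pre @ [bas p c]) @ vs')))"
    by (simp add: vs list_update_append)
  also have "eqv (pre_ps @ p # ps)
      (\<Sum>c<d. free_scale (co p v c) (tuple ((pre @ [bas p c]) @ vs')))
      (\<Sum>c<d. free_scale (co p v c) (\<Sum>cs\<in>box (length ps).
        free_scale (coprod ps vs' cs) (tuple ((pre @ [bas p c]) @ map2 bas ps cs))))"
  proof (intro eqv_sum eqv_scale)
    fix c assume "c \<in> {..<d}"
    then have "in_V (pre_ps @ [p]) (pre @ [bas p c])"
      using Cons.prems by (intro list_all2_appendI) (simp_all add: bas)
    from Cons.IH[OF this vs(3)]
    show "eqv (pre_ps @ p # ps) (tuple ((pre @ [bas p c]) @ vs')) (\<Sum>cs\<in>box (length ps).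
        free_scale (coprod ps vs' cs) (tuple ((pre @ [bas p c]) @ map2 bas ps cs)))"
      by simp
  qed
  also have "(\<Sum>c<d. free_scale (co p v c) (\<Sum>cs\<in>box (length ps).
        free_scale (coprod ps vs' cs) (tuple ((pre @ [bas p c]) @ map2 bas ps cs))))
      = (\<Sum>cs\<in>box (length (p # ps)). free_scale (coprod (p # ps) vs cs) (tuple (pre @ map2 bas (p # ps) cs)))"
    by (simp add: sum_box_Suc vs free.scale_sum_right)
  finally show ?case .
qed

text \<open>Modulo the relators, an element of the free space is a combination of tuples of basis vectors. The
  coefficient at such a tuple is the coordinate given by \<open>\<Theta>\<close>, so \<open>\<Theta>\<close> induces coordinates on the
  tensor product.\<close>

lemma Theta_kernel:
  assumes f: "f \<in> carrier (FT ps)"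
  shows "f \<in> relspan ps \<longleftrightarrow> \<Theta> ps f = 0"
proof
  assume 0: "\<Theta> ps f = 0"
  let ?K = "Poly_Mapping.keys f" and ?l = "Poly_Mapping.lookup f"
  have "eqv ps (\<Sum>vs\<in>?K. free_scale (?l vs) (tuple vs))
    (\<Sum>vs\<in>?K. free_scale (?l vs) (\<Sum>cs\<in>box (length ps). free_scale (coprod ps vs cs) (tuple (map2 bas ps cs))))"
  proof (intro eqv_sum eqv_scale)
    fix vs assume "vs \<in> ?K"
    then have "in_V ps vs"
      using f by (auto simp: free_tensor_def tuples_iff)
    from expand_tuple[of "[]" "[]", OF _ this]
    show "eqv ps (tuple vs) (\<Sum>cs\<in>box (length ps). free_scale (coprod ps vs cs) (tuple (map2 bas ps cs)))"
      by simp
  qed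
  also have "(\<Sum>vs\<in>?K. free_scale (?l vs) (tuple vs)) = f"
    by (simp add: free_scale_single flip: poly_mapping_eq_sum_single)
  also have "(\<Sum>vs\<in>?K. free_scale (?l vs) (\<Sum>cs\<in>box (length ps).
        free_scale (coprod ps vs cs) (tuple (map2 bas ps cs))))
      = (\<Sum>cs\<in>box (length ps). free_scale (\<Theta> ps f cs) (tuple (map2 bas ps cs)))"
  proof -
    have "\<Theta> ps f cs = (\<Sum>vs\<in>?K. ?l vs * coprod ps vs cs)" for cs
      unfolding \<Theta>_def funs.lin_ext_def by (simp add: fun_scale_def sum_fun_apply)
    then show ?thesis
      by (simp add: free.scale_sum_right free.scale_sum_left) (rule sum.swap)
  qed
  also have "\<dots> = 0"
    by (simp add: 0)
  finally show "f \<in> relspan ps"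
    by (simp add: eqv_def)
qed (simp add: Theta_relators)

text \<open>The summand of the action of \<open>x\<close> on a tuple in which the component of \<open>x\<close> of parity \<open>q\<close> acts on
  the entry \<open>i\<close>.\<close>

abbreviation slot :: "'p list \<Rightarrow> 'l \<Rightarrow> 'v list \<Rightarrow> nat \<Rightarrow> bit \<Rightarrow> 'v list" where
  "slot ps x vs i q \<equiv> map (\<lambda>j. koszul (map V ps ! j) q (vs ! j)) [0..<i]
     @ act (map V ps ! i) (lpart q x) (vs ! i) # drop (Suc i) vs"

lemma slot_in_V:
  assumes "in_V ps vs" "i < length ps"
  shows "in_V ps (slot ps x vs i q)"
  unfolding list_all2_conv_all_nth
proof (intro conjI allI impI)
  have vs: "length vs = length ps" "\<And>j. j < length ps \<Longrightarrow> vs ! j \<in> carrier (V (ps ! j))"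
    using assms(1) by (simp_all add: list_all2_conv_all_nth)
  then show len: "length (slot ps x vs i q) = length ps"
    using assms(2) by simp
  fix j assume "j < length (slot ps x vs i q)"
  then show "slot ps x vs i q ! j \<in> carrier (V (ps ! j))"
    unfolding len using vs assms(2)
    by (cases "j < i"; cases "j = i") (auto simp: nth_append V_koszul V_act nth_Cons')
qed

lemma slot_Suc:
  "slot (p # ps) x (v # vs) (Suc i) q = koszul (V p) q v # slot ps x vs i q"
  by (simp add: upt_conv_Cons map_Suc_upt[symmetric] del: upt_Suc)

lemma coprod_slot_zero:
  "in_V ps vs \<Longrightarrow> i < length ps \<Longrightarrow> lpart q x = 0 \<Longrightarrow> coprod ps (slot ps x vs i q) cs = 0"
proof (induction ps arbitrary: vs i cs)
  case (Cons p ps)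
  then obtain v vs' where vs: "vs = v # vs'" "v \<in> carrier (V p)" "in_V ps vs'"
    by (auto simp: list_all2_Cons2)
  show ?case
  proof (cases cs)
    case Nil
    then show ?thesis
      by (cases "slot (p # ps) x vs i q") simp_all
  next
    case (Cons c cs')
    show ?thesis
    proof (cases i)
      case 0
      then show ?thesis using Cons.prems vs Cons by (simp add: V_act)
    next
      case (Suc i')
      then have "coprod ps (slot ps x vs' i' q) cs' = 0"
        using Cons.prems vs by (intro Cons.IH) auto
      then show ?thesis
        unfolding Suc vs slot_Suc Cons coprod.simps by simp
    qed
  qed
qed simp

text \<open>The sum over the slots follows the recursion of \<open>tensor_act\<close>: the slot \<open>0\<close> gives the matrix acting
  on the first index, and all other slots carry the sign of the first entry.\<close>

lemma Theta_tuple_act: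
  "in_V ps vs \<Longrightarrow> (\<Sum>i<length ps. \<Sum>q\<in>{0, 1}. coprod ps (slot ps x vs i q) cs)
    = tensor_act ps x (coprod ps vs) cs"
proof (induction ps arbitrary: vs x cs)
  case (Cons p ps)
  then obtain v vs' where vs: "vs = v # vs'" "v \<in> carrier (V p)" "in_V ps vs'"
    by (auto simp: list_all2_Cons2)
  show ?case
  proof (cases cs)
    case Nil
    have "coprod (p # ps) (slot (p # ps) x vs i q) [] = 0" for i q
      by (cases "slot (p # ps) x vs i q") simp_all
    then show ?thesis by (simp add: Nil)
  next
    case cs: (Cons c cs')
    have part: "(\<Sum>i<length ps. coprod ps (slot ps x vs' i q) cs')
        = tensor_act ps (lpart q x) (coprod ps vs') cs'" for q
    proof -
      have "coprod ps (slot ps (lpart q x) vs' i r) cs'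
          = (if r = q then coprod ps (slot ps x vs' i q) cs' else 0)" if "i < length ps" for i r
        using coprod_slot_zero[OF vs(3) that, of r "lpart q x" cs'] by (auto simp: lpart_lpart)
      then have "(\<Sum>i<length ps. coprod ps (slot ps x vs' i q) cs')
          = (\<Sum>i<length ps. \<Sum>r\<in>{0, 1}. coprod ps (slot ps (lpart q x) vs' i r) cs')"
        by (intro sum.cong) (cases q; simp)+
      then show ?thesis
        using Cons.IH[OF vs(3)] by simp
    qed
    have "(\<Sum>i<length (p # ps). \<Sum>q\<in>{0, 1}. coprod (p # ps) (slot (p # ps) x vs i q) cs)
        = (\<Sum>q\<in>{0, 1}. coprod (p # ps) (slot (p # ps) x vs 0 q) cs)
          + (\<Sum>i<length ps. \<Sum>q\<in>{0, 1}. coprod (p # ps) (slot (p # ps) x vs (Suc i) q) cs)"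
      unfolding length_Cons by (rule sum.lessThan_Suc_shift)
    also have "(\<Sum>i<length ps. \<Sum>q\<in>{0, 1}. coprod (p # ps) (slot (p # ps) x vs (Suc i) q) cs)
        = (\<Sum>q\<in>{0, 1}. ssign q (kpar c) * co p v c * (\<Sum>i<length ps. coprod ps (slot ps x vs' i q) cs'))"
      unfolding vs slot_Suc cs coprod.simps V_koszul(2)[OF vs(2)]
      by (subst sum.swap) (simp add: sum_distrib_left)
    also have "(\<Sum>q\<in>{0, 1}. coprod (p # ps) (slot (p # ps) x vs 0 q) cs)
        = (\<Sum>j<d. mat p x c j * co p v j) * coprod ps vs' cs'"
    proof -
      have "mat p x c j = mat p (lpart 0 x) c j + mat p (lpart 1 x) c j" for j
        by (simp add: lpart_sum flip: mat_add)
      then show ?thesis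
        using vs by (simp add: cs V_act distrib_right sum.distrib)
    qed
    finally have eq: "(\<Sum>i<length (p # ps). \<Sum>q\<in>{0, 1}. coprod (p # ps) (slot (p # ps) x vs i q) cs)
        = (\<Sum>j<d. mat p x c j * co p v j) * coprod ps vs' cs'
          + (\<Sum>q\<in>{0, 1}. ssign q (kpar c) * co p v c * (\<Sum>i<length ps. coprod ps (slot ps x vs' i q) cs'))" .
    show ?thesis
      unfolding eq part
      by (simp add: vs cs tensor_act_scale_right sum_distrib_right mult.assoc)
  qed
qed simp

lemma FT_act: "act (FT ps) x f = free.lin_ext (tuple_act (map V ps) x) f"
  by (simp add: free_tensor_def free.lin_ext_def)

lemma tuple_act_closed: "in_V ps vs \<Longrightarrow> tuple_act (map V ps) x vs \<in> carrier (FT ps)"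
  unfolding tuple_act_def
  by (intro free.subspace_sum[OF FT_subspace] FT_carrier_tuple slot_in_V) auto

lemma FT_act_closed: "f \<in> carrier (FT ps) \<Longrightarrow> act (FT ps) x f \<in> carrier (FT ps)"
  unfolding FT_act free.lin_ext_def
  by (intro free.subspace_sum[OF FT_subspace] free.subspace_scale[OF FT_subspace] tuple_act_closed)
    (auto simp: free_tensor_def tuples_iff)

lemma Theta_act:
  assumes "f \<in> carrier (FT ps)"
  shows "\<Theta> ps (act (FT ps) x f) = tensor_act ps x (\<Theta> ps f)"
proof -
  interpret rep: uea_rep cscale "tensor_act ps" by (rule uea_rep_tensor)
  have "\<Theta> ps (tuple_act (map V ps) x vs) = tensor_act ps x (coprod ps vs)"
    if "vs \<in> Poly_Mapping.keys f" for vs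
  proof -
    have vs: "in_V ps vs"
      using assms that by (auto simp: free_tensor_def tuples_iff)
    show ?thesis
    proof (rule ext)
      fix cs
      show "\<Theta> ps (tuple_act (map V ps) x vs) cs = tensor_act ps x (coprod ps vs) cs"
        unfolding Theta_tuple_act[OF vs, symmetric] tuple_act_def Theta_sum Theta_tuple
        by (simp add: sum_fun_apply)
    qed
  qed
  then have "\<Theta> ps (act (FT ps) x f) = (\<Sum>vs\<in>Poly_Mapping.keys f.
      cscale (Poly_Mapping.lookup f vs) (tensor_act ps x (coprod ps vs)))"
    unfolding FT_act free.lin_ext_def by (simp add: Theta_sum Theta_scale)
  also have "\<dots> = tensor_act ps x (\<Theta> ps f)"
    by (simp add: \<Theta>_def funs.lin_ext_def rep.rho_sum_right rep.rho_scale_right)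
  finally show ?thesis .
qed

abbreviation T :: "'p list \<Rightarrow> ('l, ('v list \<Rightarrow>\<^sub>0 complex) set) smodule" where
  "T ps \<equiv> tensor (map V ps)"

definition tcoord :: "'p list \<Rightarrow> ('v list \<Rightarrow>\<^sub>0 complex) set \<Rightarrow> nat list \<Rightarrow> complex" where
  "tcoord ps = (\<lambda>A. \<Theta> ps (SOME f. f \<in> A))"

lemma coord_module_tensor: "coord_module cscale (T ps) (tcoord ps) (tensor_act ps)"
  and pure_tensor_closed: "in_V ps vs \<Longrightarrow> pure_tensor (map V ps) vs \<in> carrier (T ps)"
  and tcoord_pure_tensor: "in_V ps vs \<Longrightarrow> tcoord ps (pure_tensor (map V ps) vs) = coprod ps vs"
proof -
  interpret rep: uea_rep cscale "tensor_act ps" by (rule uea_rep_tensor)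
  interpret F: coord_space free_scale "FT ps" id
    using free.subspace_0[OF FT_subspace] free.subspace_add[OF FT_subspace]
      free.subspace_scale[OF FT_subspace]
    by unfold_locales (simp_all add: free_tensor_def)
  interpret q: coord_quotient free_scale "FT ps" id "relspan ps"
    by unfold_locales (rule free.subspace_span)
  have N: "q.N = relspan ps"
    using Theta_relators by (auto simp: q.N_def)
  have T: "T ps = q.Q"
    by (simp add: tensor_def N)
  have ker: "\<Theta> ps (id f) = 0 \<longleftrightarrow> id f \<in> relspan ps" if "f \<in> carrier (FT ps)" for f
    using Theta_kernel[OF that] by simp
  note Q = q.coord_space_Q[OF funs.vector_space_axioms linear_Theta[of ps] ker]
  have tcoord: "tcoord ps = (\<lambda>A. \<Theta> ps (id (SOME f. f \<in> A)))"
    by (simp add: tcoord_def)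
  have val: "tcoord ps (q.cos f) = \<Theta> ps f" if "f \<in> carrier (FT ps)" for f
    using Q(2)[OF _ that] unfolding tcoord by simp
  have carrier: "A \<in> carrier (T ps) \<Longrightarrow> \<exists>f\<in>carrier (FT ps). A = q.cos f" for A
    unfolding T q.carrier_Q by blast
  have act: "act (T ps) x (q.cos f) = q.cos (act (FT ps) x f)" if f: "f \<in> carrier (FT ps)" for x f
    unfolding T
  proof (rule q.act_Q[OF f FT_act_closed], assumption)
    fix g assume g: "g \<in> carrier (FT ps)" and gf: "id g - id f \<in> relspan ps"
    have "act (FT ps) x g - act (FT ps) x f \<in> carrier (FT ps)"
      using f g by (intro free.subspace_diff[OF FT_subspace] FT_act_closed)
    moreover have "\<Theta> ps g = \<Theta> ps f"
      using Theta_relators[of "g - f" ps] gf by (simp add: Theta_diff)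
    then have "\<Theta> ps (act (FT ps) x g - act (FT ps) x f) = 0"
      using f g by (simp add: Theta_diff Theta_act)
    ultimately show "id (act (FT ps) x g) - id (act (FT ps) x f) \<in> relspan ps"
      by (simp add: Theta_kernel)
  qed
  interpret TQ: coord_space cscale "T ps" "tcoord ps"
    unfolding T tcoord by (rule Q(1))
  show "coord_module cscale (T ps) (tcoord ps) (tensor_act ps)"
  proof
    fix A x assume "A \<in> carrier (T ps)"
    then obtain f where f: "f \<in> carrier (FT ps)" "A = q.cos f"
      using carrier by blast
    show "act (T ps) x A \<in> carrier (T ps)"
      unfolding f act[OF f(1)] unfolding T q.carrier_Q using FT_act_closed[OF f(1)] by blast
    show "tcoord ps (act (T ps) x A) = tensor_act ps x (tcoord ps A)"
      unfolding f act[OF f(1)] by (simp add: val FT_act_closed f Theta_act)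
  qed
  assume vs: "in_V ps vs"
  show "pure_tensor (map V ps) vs \<in> carrier (T ps)"
    unfolding pure_tensor_def T q.carrier_Q
    by (rule image_eqI[OF _ FT_carrier_tuple[OF vs]]) (simp add: N)
  show "tcoord ps (pure_tensor (map V ps) vs) = coprod ps vs"
    using val[OF FT_carrier_tuple[OF vs]] unfolding pure_tensor_def N by (simp add: Theta_tuple)
qed

end

section \<open>Evaluation at a point\<close>

definition evalp :: "complex \<Rightarrow> 'l :: lie_superalgebra poly \<Rightarrow> 'l" where
  "evalp z p = (\<Sum>a\<le>degree p. lscale (z ^ a) (coeff p a))"

lemma evalp_superset: "degree p \<le> N \<Longrightarrow> evalp z p = (\<Sum>a\<le>N. lscale (z ^ a) (coeff p a))"
  unfolding evalp_def by (intro sum.mono_neutral_left) (auto simp: coeff_eq_0 not_le)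

lemma evalp_add: "evalp z (p + q) = evalp z p + evalp z q"
proof -
  have "degree (p + q) \<le> max (degree p) (degree q)"
    by (rule degree_add_le_max)
  then show ?thesis
    by (simp add: evalp_superset[of _ "max (degree p) (degree q)"] lscale_add_right sum.distrib)
qed

lemma evalp_zero [simp]: "evalp z 0 = 0"
  by (simp add: evalp_def)

lemma evalp_monom: "evalp z (monom x m) = lscale (z ^ m) x"
proof -
  have "evalp z (monom x m) = (\<Sum>a\<le>m. lscale (z ^ a) (coeff (monom x m) a))"
    by (rule evalp_superset[OF degree_monom_le])
  also have "\<dots> = (\<Sum>a\<le>m. if a = m then lscale (z ^ m) x else 0)"
    by (rule sum.cong) auto
  finally show ?thesis by simp
qed

lemma evalp_lscale: "evalp z (lscale c p) = lscale c (evalp z p)"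
proof -
  have "degree (lscale c p) \<le> degree p"
    by (rule degree_le) (simp add: coeff_lscale_poly coeff_eq_0)
  then show ?thesis
    by (simp add: evalp_superset[of _ "degree p"] coeff_lscale_poly lie.scale_sum_right mult.commute)
qed

lemma evalp_lpart: "evalp z (lpart q p) = lpart q (evalp z p)"
proof -
  have "lpart q (sum f A) = (\<Sum>i\<in>A. lpart q (f i))" for f :: "nat \<Rightarrow> 'a" and A
    by (induction A rule: infinite_finite_induct) (simp_all add: lpart_add)
  moreover have "degree (lpart q p) \<le> degree p"
    by (rule degree_le) (simp add: coeff_lpart_poly coeff_eq_0)
  ultimately show ?thesis
    by (simp add: evalp_superset[of _ "degree p"] coeff_lpart_poly lpart_lscale)
qed

lemma evalp_bracket: "evalp z (lbracket p q) = lbracket (evalp z p) (evalp z q)"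
proof (induction p rule: poly_additive_induct[where H = "\<lambda>_. True"])
  case (4 x i)
  show ?case
    by (induction q rule: poly_additive_induct[where H = "\<lambda>_. True"])
      (simp_all add: evalp_add lbracket_add_right lbracket_monom evalp_monom lbracket_lscale_left
        lbracket_lscale_right power_add mult.commute)
qed (simp_all add: evalp_add lbracket_add_left)

context super_matrices
begin

lemma super_matrices_evalp: "super_matrices (\<lambda>(p, z) x. mat p (evalp z x)) kpar d"
proof
  fix pz :: "'p \<times> complex" and x y :: "'l poly" and i j c a b
  obtain p z where pz: "pz = (p, z)" by force
  show "(case pz of (p, z) \<Rightarrow> \<lambda>x. mat p (evalp z x)) (x + y) i j
    = (case pz of (p, z) \<Rightarrow> \<lambda>x. mat p (evalp z x)) x i j + (case pz of (p, z) \<Rightarrow> \<lambda>x. mat p (evalp z x)) y i j"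
    by (simp add: pz evalp_add mat_add)
  show "(case pz of (p, z) \<Rightarrow> \<lambda>x. mat p (evalp z x)) (lscale c x) i j
    = c * (case pz of (p, z) \<Rightarrow> \<lambda>x. mat p (evalp z x)) x i j"
    by (simp add: pz evalp_lscale mat_lscale)
  have hom: "lpart a (evalp z x) = evalp z x" if "lpart a x = x" for a x
    using evalp_lpart[of z a x] that by simp
  show "kpar i = a + kpar j"
    if "lpart a x = x" "(case pz of (p, z) \<Rightarrow> \<lambda>x. mat p (evalp z x)) x i j \<noteq> 0"
    using mat_parity[OF hom[OF that(1)]] that(2) by (simp add: pz)
  show "(\<Sum>k<d. (case pz of (p, z) \<Rightarrow> \<lambda>x. mat p (evalp z x)) x i k
        * (case pz of (p, z) \<Rightarrow> \<lambda>x. mat p (evalp z x)) y k j)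
      - ssign a b * (\<Sum>k<d. (case pz of (p, z) \<Rightarrow> \<lambda>x. mat p (evalp z x)) y i k
        * (case pz of (p, z) \<Rightarrow> \<lambda>x. mat p (evalp z x)) x k j)
      = (case pz of (p, z) \<Rightarrow> \<lambda>x. mat p (evalp z x)) (lbracket x y) i j"
    if "lpart a x = x" "lpart b y = y"
    using mat_bracket[OF hom[OF that(1)] hom[OF that(2)]] by (simp add: pz evalp_bracket)
qed

definition vec_act :: "'p \<Rightarrow> 'l \<Rightarrow> (nat \<Rightarrow> complex) \<Rightarrow> nat \<Rightarrow> complex" where
  "vec_act p x f = (\<lambda>i. \<Sum>j<d. mat p x i j * f j)"

lemma uea_rep_vec_act: "uea_rep cscale (vec_act p)"
proof
  fix x y :: 'l and v w :: "nat \<Rightarrow> complex" and c a b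
  show "vec_act p x (v + w) = vec_act p x v + vec_act p x w"
    by (simp add: vec_act_def fun_eq_iff distrib_left sum.distrib)
  show "vec_act p x (cscale c w) = cscale c (vec_act p x w)"
    by (simp add: vec_act_def fun_eq_iff fun_scale_def sum_distrib_left mult_ac)
  show "vec_act p (x + y) w = vec_act p x w + vec_act p y w"
    by (simp add: vec_act_def fun_eq_iff mat_add distrib_right sum.distrib)
  show "vec_act p (lscale c x) w = cscale c (vec_act p x w)"
    by (simp add: vec_act_def fun_eq_iff fun_scale_def mat_lscale sum_distrib_left mult_ac)
  assume h: "lpart a x = x" "lpart b y = y"
  have sw: "(\<Sum>k<d. u k * (\<Sum>j<d. t k j * w j)) = (\<Sum>j<d. (\<Sum>k<d. u k * t k j) * w j)" for u t
    by (simp add: sum_distrib_left sum_distrib_right mult.assoc) (rule sum.swap)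
  have lin: "(\<Sum>j<d. u j * w j) - k * (\<Sum>j<d. t j * w j) = (\<Sum>j<d. (u j - k * t j) * w j)" for u t k
    by (simp add: left_diff_distrib sum_subtractf sum_distrib_left mult.assoc)
  show "vec_act p x (vec_act p y w) - cscale (ssign a b) (vec_act p y (vec_act p x w))
      = vec_act p (lbracket x y) w"
    unfolding vec_act_def fun_eq_iff fun_scale_def minus_apply sw lin mat_bracket[OF h] by simp
qed

end

section \<open>The four-dimensional Kac modules\<close>

definition kpar :: "nat \<Rightarrow> bit" where
  "kpar i = (if i = 1 \<or> i = 2 then 1 else 0)"

text \<open>The action on the basis \<open>k\<^sub>\<mu>\<close>, \<open>x\<^sub>1 k\<^sub>\<mu>\<close>, \<open>y\<^sub>3 k\<^sub>\<mu>\<close>, \<open>y\<^sub>2 k\<^sub>\<mu>\<close> of the Kac module for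
  \<open>\<mu> = (k, 1)\<close>, whose parities are given by \<open>kpar\<close>.\<close>

definition kac_matrix :: "complex \<Rightarrow> sl12 \<Rightarrow> nat \<Rightarrow> nat \<Rightarrow> complex" where
  "kac_matrix k x i j = (let A = Rep_sl12 x in if i < 4 \<and> j < 4 then
     [[k * A $ 1 $ 1 - A $ 3 $ 3, k * A $ 2 $ 1, (k - 1) * A $ 1 $ 3, A $ 2 $ 3],
      [A $ 1 $ 2, k * A $ 1 $ 1, 0, A $ 1 $ 3],
      [A $ 3 $ 1, 0, (k - 1) * A $ 1 $ 1, - A $ 2 $ 1],
      [A $ 3 $ 2, k * A $ 3 $ 1, (1 - k) * A $ 1 $ 2, (k - 1) * A $ 1 $ 1 + A $ 3 $ 3]] ! i ! j
     else 0)"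

lemma kac_matrix_entries:
  fixes x :: sl12
  defines "A \<equiv> Rep_sl12 x"
  shows "kac_matrix k x 0 0 = k * A $ 1 $ 1 - A $ 3 $ 3" "kac_matrix k x 0 1 = k * A $ 2 $ 1"
    "kac_matrix k x 0 2 = (k - 1) * A $ 1 $ 3" "kac_matrix k x 0 3 = A $ 2 $ 3"
    "kac_matrix k x 1 0 = A $ 1 $ 2" "kac_matrix k x 1 1 = k * A $ 1 $ 1"
    "kac_matrix k x 1 2 = 0" "kac_matrix k x 1 3 = A $ 1 $ 3"
    "kac_matrix k x 2 0 = A $ 3 $ 1" "kac_matrix k x 2 1 = 0"
    "kac_matrix k x 2 2 = (k - 1) * A $ 1 $ 1" "kac_matrix k x 2 3 = - A $ 2 $ 1"
    "kac_matrix k x 3 0 = A $ 3 $ 2" "kac_matrix k x 3 1 = k * A $ 3 $ 1"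
    "kac_matrix k x 3 2 = (1 - k) * A $ 1 $ 2" "kac_matrix k x 3 3 = (k - 1) * A $ 1 $ 1 + A $ 3 $ 3"
  by (simp_all add: kac_matrix_def A_def Let_def)

lemmas kac_matrix_entries_Suc = kac_matrix_entries kac_matrix_entries[unfolded One_nat_def]

lemma kac_matrix_support: "4 \<le> i \<Longrightarrow> kac_matrix k x i j = 0" "4 \<le> j \<Longrightarrow> kac_matrix k x i j = 0"
  by (simp_all add: kac_matrix_def Let_def)

lemma lpart_entries:
  assumes "lpart a x = x"
  shows "a = 1 \<Longrightarrow> Rep_sl12 x $ 1 $ 1 = 0" "a = 1 \<Longrightarrow> Rep_sl12 x $ 2 $ 2 = 0"
    "a = 1 \<Longrightarrow> Rep_sl12 x $ 3 $ 3 = 0" "a = 1 \<Longrightarrow> Rep_sl12 x $ 2 $ 3 = 0"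
    "a = 1 \<Longrightarrow> Rep_sl12 x $ 3 $ 2 = 0" "a = 0 \<Longrightarrow> Rep_sl12 x $ 1 $ 2 = 0"
    "a = 0 \<Longrightarrow> Rep_sl12 x $ 1 $ 3 = 0" "a = 0 \<Longrightarrow> Rep_sl12 x $ 2 $ 1 = 0"
    "a = 0 \<Longrightarrow> Rep_sl12 x $ 3 $ 1 = 0"
proof -
  have e: "Rep_sl12 x $ i $ j = 0" if ne: "idx_parity i + idx_parity j \<noteq> a" for i j
  proof -
    have "Rep_sl12 x $ i $ j = mat_part a (Rep_sl12 x) $ i $ j"
      using assms by (simp flip: lpart_sl12.rep_eq)
    also have "\<dots> = 0"
      using ne by (simp add: mat_part_def)
    finally show ?thesis .
  qed
  show "a = 1 \<Longrightarrow> Rep_sl12 x $ 1 $ 1 = 0" "a = 1 \<Longrightarrow> Rep_sl12 x $ 2 $ 2 = 0"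
    "a = 1 \<Longrightarrow> Rep_sl12 x $ 3 $ 3 = 0" "a = 1 \<Longrightarrow> Rep_sl12 x $ 2 $ 3 = 0"
    "a = 1 \<Longrightarrow> Rep_sl12 x $ 3 $ 2 = 0" "a = 0 \<Longrightarrow> Rep_sl12 x $ 1 $ 2 = 0"
    "a = 0 \<Longrightarrow> Rep_sl12 x $ 1 $ 3 = 0" "a = 0 \<Longrightarrow> Rep_sl12 x $ 2 $ 1 = 0"
    "a = 0 \<Longrightarrow> Rep_sl12 x $ 3 $ 1 = 0"
    by (rule e; simp)+
qed

lemma sl12_trace: "Rep_sl12 x $ 1 $ 1 = Rep_sl12 x $ 2 $ 2 + Rep_sl12 x $ 3 $ 3"
  using Rep_sl12[of x] by (simp add: algebra_simps)

lemma sum_lessThan_4: "(\<Sum>k<4. f k) = f 0 + f 1 + f 2 + f (3 :: nat)"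
  by (simp add: numeral_eq_Suc)

lemma kac_matrix_parity:
  assumes "lpart a x = x" "kac_matrix k x i j \<noteq> 0"
  shows "kpar i = a + kpar j"
proof -
  have i: "i = 0 \<or> i = 1 \<or> i = 2 \<or> i = 3" and j: "j = 0 \<or> j = 1 \<or> j = 2 \<or> j = 3"
  proof -
    have "i < 4" "j < 4"
      using assms(2) kac_matrix_support[of i k x j] kac_matrix_support[of j k x i]
      by (meson not_le)+
    then show "i = 0 \<or> i = 1 \<or> i = 2 \<or> i = 3" "j = 0 \<or> j = 1 \<or> j = 2 \<or> j = 3"
      by auto
  qed
  have a: "a = 0 \<or> a = 1"
    by (cases a) simp_all
  note e = lpart_entries[OF assms(1)]
  from a i j assms(2) show ?thesis
    by (elim disjE; simp only: kac_matrix_entries e) (simp_all add: kpar_def)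
qed

lemma kac_matrix_bracket:
  assumes x: "lpart a x = x" and y: "lpart b y = y"
  shows "(\<Sum>l<4. kac_matrix k x i l * kac_matrix k y l j)
      - ssign a b * (\<Sum>l<4. kac_matrix k y i l * kac_matrix k x l j) = kac_matrix k (lbracket x y) i j"
proof (cases "i < 4 \<and> j < 4")
  case False
  then show ?thesis by (auto simp: kac_matrix_support)
next
  case True
  define X where "X r s = Rep_sl12 x $ r $ s" for r s
  define Y where "Y r s = Rep_sl12 y $ r $ s" for r s
  have br: "Rep_sl12 (lbracket x y) $ r $ s = (X r 1 * Y 1 s + X r 2 * Y 2 s + X r 3 * Y 3 s)
      - ssign a b * (Y r 1 * X 1 s + Y r 2 * X 2 s + Y r 3 * X 3 s)" for r s
    unfolding Rep_lbracket[OF x y] X_def Y_def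
    by (simp add: matrix_matrix_mult_def mat_scale_def sum_3)
  note ex = lpart_entries[OF x, folded X_def] and ey = lpart_entries[OF y, folded Y_def]
  have tr: "X 1 1 = X 2 2 + X 3 3" "Y 1 1 = Y 2 2 + Y 3 3"
    by (simp_all add: X_def Y_def sl12_trace)
  note entries = kac_matrix_entries[where x = x, folded X_def]
    kac_matrix_entries[where x = y, folded Y_def]
    kac_matrix_entries[where x = "lbracket x y", unfolded br]
  have "a = 0 \<or> a = 1" "b = 0 \<or> b = 1"
    by (cases a; simp) (cases b; simp)
  moreover have "i = 0 \<or> i = 1 \<or> i = 2 \<or> i = 3" "j = 0 \<or> j = 1 \<or> j = 2 \<or> j = 3"
    using True by auto
  ultimately show ?thesis
    unfolding sum_lessThan_4
    by (elim disjE; simp only: entries ex ey tr refl ssign_simps; simp add: algebra_simps)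
qed

global_interpretation kacm: super_matrices kac_matrix kpar 4
  defines kac_act = kacm.vec_act
proof
  fix k :: complex and x y :: sl12 and i j :: nat and c and a b :: bit
  show "kac_matrix k (x + y) i j = kac_matrix k x i j + kac_matrix k y i j"
  proof (cases "i < 4 \<and> j < 4")
    case True
    then have "i = 0 \<or> i = 1 \<or> i = 2 \<or> i = 3" "j = 0 \<or> j = 1 \<or> j = 2 \<or> j = 3"
      by auto
    then show ?thesis
      by (elim disjE; simp add: kac_matrix_entries_Suc plus_sl12.rep_eq algebra_simps)
  qed (auto simp: kac_matrix_support)
  show "kac_matrix k (lscale c x) i j = c * kac_matrix k x i j"
  proof (cases "i < 4 \<and> j < 4")
    case True
    then have "i = 0 \<or> i = 1 \<or> i = 2 \<or> i = 3" "j = 0 \<or> j = 1 \<or> j = 2 \<or> j = 3"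
      by auto
    then show ?thesis
      by (elim disjE; simp add: kac_matrix_entries_Suc lscale_sl12.rep_eq mat_scale_def algebra_simps)
  qed (auto simp: kac_matrix_support)
qed (simp_all add: kac_matrix_parity kac_matrix_bracket)

lemma cscale_add_apply: "(cscale c f + g) i = c * f i + g i"
  by (simp add: fun_scale_def)

lemma uea_scale_2: "uea_scale 2 w = w + w"
  using uea.scale_left_distrib[of 1 1 w] by simp

lemma lbracket_x3_y3: "lbracket sl_x3 sl_y3 = sl_h1 - sl_h2"
  by (simp add: Rep_sl12_inject[symmetric] Rep_sl_simps mat_unit_mult mat_mult_distribs
      Rep_lbracket[OF lpart_sl_simps(3) lpart_sl_simps(6)] minus_sl12.rep_eq
      ssign_def mat_scale_simps)

lemma inc_comm:
  "uea_inc sl_x1 * uea_inc sl_x1 = 0"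
  "uea_inc sl_y3 * uea_inc sl_y3 = 0"
  "uea_inc sl_x1 * uea_inc sl_y2 = uea_inc sl_y2 * uea_inc sl_x1"
  "uea_inc sl_y3 * uea_inc sl_y2 = uea_inc sl_y2 * uea_inc sl_y3"
  "uea_inc sl_y3 * uea_inc sl_x1 = uea_inc sl_y2 - uea_inc sl_x1 * uea_inc sl_y3"
  "uea_inc sl_x3 * uea_inc sl_y2 = uea_inc sl_y2 * uea_inc sl_x3 + uea_inc sl_x1"
  "uea_inc sl_y1 * uea_inc sl_y2 = uea_inc sl_y2 * uea_inc sl_y1 - uea_inc sl_y3"
  "uea_inc sl_x2 * uea_inc sl_x1 = uea_inc sl_x1 * uea_inc sl_x2 - uea_inc sl_x3"
  "uea_inc sl_x2 * uea_inc sl_y3 = uea_inc sl_y3 * uea_inc sl_x2 + uea_inc sl_y1"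
  "uea_inc sl_x3 * uea_inc sl_y3 = - (uea_inc sl_y3 * uea_inc sl_x3) + uea_inc sl_h1 - uea_inc sl_h2"
  "uea_inc sl_x2 * uea_inc sl_y2 = uea_inc sl_y2 * uea_inc sl_x2 + uea_inc sl_h2"
  "uea_inc sl_h2 * uea_inc sl_x1 = uea_inc sl_x1 * uea_inc sl_h2 - uea_inc sl_x1"
  "uea_inc sl_h2 * uea_inc sl_y3 = uea_inc sl_y3 * uea_inc sl_h2 - uea_inc sl_y3"
  "uea_inc sl_h2 * uea_inc sl_y2 = uea_inc sl_y2 * uea_inc sl_h2 - uea_scale 2 (uea_inc sl_y2)"
proof -
  have sq: "w = 0" if "w = - w" for w :: "sl12 uea"
  proof -
    have "uea_scale 2 w = w + w"
      by (rule uea_scale_2)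
    also have "\<dots> = 0"
      using that by (metis add.right_inverse)
    finally show ?thesis by simp
  qed
  have odd: "uea_inc x * uea_inc y = - (uea_inc y * uea_inc x) + uea_inc (lbracket x y)"
    if "lpart 1 x = x" "lpart 1 y = y" for x y :: sl12
    using uea_inc_bracket[OF that] by simp
  have even: "uea_inc x * uea_inc y = uea_inc y * uea_inc x + uea_inc (lbracket x y)"
    if "lpart p x = x" "lpart q y = y" "p = 0 \<or> q = 0" for x y :: sl12 and p q
    using uea_inc_bracket[OF that(1,2)] that(3) by auto
  note lp = lpart_sl_simps and lb = lbracket_sl_simps lbracket_x3_y3
  show "uea_inc sl_x1 * uea_inc sl_x1 = 0" "uea_inc sl_y3 * uea_inc sl_y3 = 0"
    using odd[OF lp(1) lp(1)] odd[OF lp(6) lp(6)] by (auto intro: sq simp: lb)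
  show "uea_inc sl_x1 * uea_inc sl_y2 = uea_inc sl_y2 * uea_inc sl_x1"
    "uea_inc sl_y3 * uea_inc sl_y2 = uea_inc sl_y2 * uea_inc sl_y3"
    "uea_inc sl_x3 * uea_inc sl_y2 = uea_inc sl_y2 * uea_inc sl_x3 + uea_inc sl_x1"
    "uea_inc sl_y1 * uea_inc sl_y2 = uea_inc sl_y2 * uea_inc sl_y1 - uea_inc sl_y3"
    "uea_inc sl_x2 * uea_inc sl_x1 = uea_inc sl_x1 * uea_inc sl_x2 - uea_inc sl_x3"
    "uea_inc sl_x2 * uea_inc sl_y3 = uea_inc sl_y3 * uea_inc sl_x2 + uea_inc sl_y1"
    "uea_inc sl_x2 * uea_inc sl_y2 = uea_inc sl_y2 * uea_inc sl_x2 + uea_inc sl_h2"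
    "uea_inc sl_h2 * uea_inc sl_x1 = uea_inc sl_x1 * uea_inc sl_h2 - uea_inc sl_x1"
    "uea_inc sl_h2 * uea_inc sl_y3 = uea_inc sl_y3 * uea_inc sl_h2 - uea_inc sl_y3"
    "uea_inc sl_h2 * uea_inc sl_y2 = uea_inc sl_y2 * uea_inc sl_h2 - uea_scale 2 (uea_inc sl_y2)"
    using even[OF lp(1) lp(5)] even[OF lp(6) lp(5)] even[OF lp(3) lp(5)] even[OF lp(4) lp(5)]
      even[OF lp(2) lp(1)] even[OF lp(2) lp(6)] even[OF lp(2) lp(5)] even[OF lp(8) lp(1)]
      even[OF lp(8) lp(6)] even[OF lp(8) lp(5)]
    by (simp_all add: lb uea_inc_uminus uea_inc_lscale)
  show "uea_inc sl_y3 * uea_inc sl_x1 = uea_inc sl_y2 - uea_inc sl_x1 * uea_inc sl_y3"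
    "uea_inc sl_x3 * uea_inc sl_y3 = - (uea_inc sl_y3 * uea_inc sl_x3) + uea_inc sl_h1 - uea_inc sl_h2"
    using odd[OF lp(1) lp(6)] odd[OF lp(3) lp(6)] by (simp_all add: lb uea_inc_diff)
qed

lemma kac_matrix_basis:
  "kac_matrix k sl_x1 i 0 = (if i = 1 then 1 else 0)"
  "kac_matrix k sl_y3 i 0 = (if i = 2 then 1 else 0)"
  "kac_matrix k sl_y2 i j = (if i = 3 \<and> j = 0 then 1 else 0)"
  "kac_matrix k sl_y1 i 0 = 0" "kac_matrix k sl_x2 i 0 = 0" "kac_matrix k sl_x3 i 0 = 0"
  "kac_matrix k (cartan_elt a b) i 0 = (if i = 0 then a * k + b else 0)"
proof -
  note e = kac_matrix_entries_Suc Rep_sl_simps mat_unit_def cartan_elt_def plus_sl12.rep_eq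
    lscale_sl12.rep_eq mat_scale_def
  have i: "4 \<le> i \<or> i = 0 \<or> i = 1 \<or> i = 2 \<or> i = 3" and j: "4 \<le> j \<or> j = 0 \<or> j = 1 \<or> j = 2 \<or> j = 3"
    by auto
  from i show "kac_matrix k sl_x1 i 0 = (if i = 1 then 1 else 0)"
    "kac_matrix k sl_y3 i 0 = (if i = 2 then 1 else 0)"
    "kac_matrix k sl_y1 i 0 = 0" "kac_matrix k sl_x2 i 0 = 0" "kac_matrix k sl_x3 i 0 = 0"
    "kac_matrix k (cartan_elt a b) i 0 = (if i = 0 then a * k + b else 0)"
    by (elim disjE; simp add: e kac_matrix_support)+
  from i j show "kac_matrix k sl_y2 i j = (if i = 3 \<and> j = 0 then 1 else 0)"
    by (elim disjE; simp add: e kac_matrix_support)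
qed

definition unit_fun :: "'i \<Rightarrow> 'i \<Rightarrow> complex" where
  "unit_fun i j = (if j = i then 1 else 0)"

lemma kac_act_unit: "j < 4 \<Longrightarrow> kac_act k x (unit_fun j) = (\<lambda>i. kac_matrix k x i j)"
proof
  fix i assume "j < 4"
  have "kac_act k x (unit_fun j) i = (\<Sum>l<4. if l = j then kac_matrix k x i l else 0)"
    unfolding kacm.vec_act_def unit_fun_def by (rule sum.cong) auto
  then show "kac_act k x (unit_fun j) i = kac_matrix k x i j"
    using \<open>j < 4\<close> by simp
qed

lemma kac_act_apply: "kac_act k x f i = (\<Sum>j<4. kac_matrix k x i j * f j)"
  by (simp add: kacm.vec_act_def)

locale kac_module =
  fixes k :: complex
begin

sublocale rep: uea_rep cscale "kac_act k"
  by (rule kacm.uea_rep_vec_act)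

abbreviation J :: "sl12 uea set" where
  "J \<equiv> kac_ideal (k, 1)"

abbreviation ev :: "sl12 uea \<Rightarrow> nat \<Rightarrow> complex" where
  "ev u \<equiv> rep.tact u (unit_fun 0)"

lemma wt_nat_1: "wt_nat (k, 1) = 1"
  by (rule wt_nat_eq) simp

lemma J_def: "J = left_ideal (uea_inc ` nplus
     \<union> {uea_inc (cartan_elt a b) - uea_const (a * k + b) | a b. True} \<union> {uea_inc sl_y2 * uea_inc sl_y2})"
  by (simp add: kac_ideal_def wt_nat_1 wt_apply_def)

lemma J_mult: "a \<in> J \<Longrightarrow> u * a \<in> J"
  unfolding J_def by (rule left_ideal_mult)

lemma J_subspace: "uea.subspace J"
  unfolding J_def by (rule subspace_left_ideal)

lemma J_nplus: "x \<in> {sl_y1, sl_x2, sl_x3} \<Longrightarrow> uea_inc x \<in> J"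
  unfolding J_def by (intro left_ideal_base UnI1 imageI) (auto simp: nplus_def intro: lie.span_base)

lemma J_cartan: "uea_inc (cartan_elt a b) - uea_const (a * k + b) \<in> J"
  unfolding J_def by (intro left_ideal_base UnI1[OF UnI2]) blast

lemma J_h1: "uea_inc sl_h1 - uea_scale k 1 \<in> J" and J_h2: "uea_inc sl_h2 - 1 \<in> J"
  using J_cartan[of 1 0] J_cartan[of 0 1] by (simp_all add: cartan_elt_simps uea_const_eq_scale)

lemma J_y2y2: "uea_inc sl_y2 * uea_inc sl_y2 \<in> J"
  unfolding J_def by (rule left_ideal_base) simp

lemma ev_J: "u \<in> J \<Longrightarrow> ev u = 0"
proof -
  have "left_ideal (uea_inc ` nplus
     \<union> {uea_inc (cartan_elt a b) - uea_const (a * k + b) | a b. True} \<union> {uea_inc sl_y2 * uea_inc sl_y2})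
     \<subseteq> {u. ev u = 0}"
  proof (rule left_ideal_least)
    have np: "kac_act k x (unit_fun 0) = 0" if "x \<in> nplus" for x
      using that unfolding nplus_def
    proof (induction rule: lie.span_induct_alt)
      case (step c x y)
      then show ?case
        by (auto simp: rep.rho_add_left rep.rho_scale_left kac_act_unit kac_matrix_basis
            fun_scale_def fun_eq_iff)
    qed simp
    have "ev (uea_inc (cartan_elt a b) - uea_const (a * k + b)) = 0" for a b
      by (simp add: rep.tact_diff rep.tact_inc rep.tact_const kac_act_unit kac_matrix_basis
          fun_eq_iff fun_scale_def unit_fun_def)
    moreover have "ev (uea_inc sl_y2 * uea_inc sl_y2) = 0"
    proof -
      have "kac_act k sl_y2 (unit_fun 0) = unit_fun 3"
        by (simp add: kac_act_unit kac_matrix_basis fun_eq_iff unit_fun_def)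
      then show ?thesis
        by (simp add: rep.tact_mult rep.tact_inc kac_act_unit kac_matrix_basis fun_eq_iff)
    qed
    ultimately show "uea_inc ` nplus \<union> {uea_inc (cartan_elt a b) - uea_const (a * k + b) | a b. True}
        \<union> {uea_inc sl_y2 * uea_inc sl_y2} \<subseteq> {u. ev u = 0}"
      using np by (auto simp: rep.tact_inc)
    show "u * a \<in> {u. ev u = 0}" if "a \<in> {u. ev u = 0}" for u a
      using that rep.tact_linear(2)[of u 0 0] by (simp add: rep.tact_mult)
  qed (simp_all add: rep.tact_add)
  then show "u \<in> J \<Longrightarrow> ev u = 0"
    unfolding J_def by blast
qed

text \<open>Apply \<open>x\<^sub>3\<close> to the relation \<open>y\<^sub>2^2 = 0\<close>.\<close>

lemma J_x1y2: "uea_inc sl_x1 * uea_inc sl_y2 \<in> J"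
proof -
  let ?y = "uea_inc sl_y2"
  have "uea_inc sl_x3 * (?y * w) = ?y * (uea_inc sl_x3 * w) + uea_inc sl_x1 * w" for w
    by (simp add: inc_comm distrib_right flip: mult.assoc)
  then have "uea_inc sl_x3 * (?y * ?y) - ?y * ?y * uea_inc sl_x3 = uea_scale 2 (uea_inc sl_x1 * ?y)"
    by (simp add: inc_comm distrib_left uea_scale_2 mult.assoc)
  moreover have "uea_inc sl_x3 * (?y * ?y) - ?y * ?y * uea_inc sl_x3 \<in> J"
    by (intro uea.subspace_diff[OF J_subspace]) (simp_all add: J_mult J_y2y2 J_nplus)
  ultimately show ?thesis
    using uea.subspace_scale[OF J_subspace, of "uea_scale 2 (uea_inc sl_x1 * ?y)" "1/2"] by simp
qed

text \<open>Apply \<open>y\<^sub>1\<close> to the relation \<open>y\<^sub>2^2 = 0\<close>.\<close>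

lemma J_y3y2: "uea_inc sl_y3 * uea_inc sl_y2 \<in> J"
proof -
  let ?y = "uea_inc sl_y2"
  have "uea_inc sl_y1 * (?y * w) = ?y * (uea_inc sl_y1 * w) - uea_inc sl_y3 * w" for w
    by (simp add: inc_comm left_diff_distrib flip: mult.assoc)
  then have "?y * ?y * uea_inc sl_y1 - uea_inc sl_y1 * (?y * ?y) = uea_scale 2 (uea_inc sl_y3 * ?y)"
    by (simp add: inc_comm right_diff_distrib uea_scale_2 mult.assoc)
  moreover have "?y * ?y * uea_inc sl_y1 - uea_inc sl_y1 * (?y * ?y) \<in> J"
    by (intro uea.subspace_diff[OF J_subspace]) (simp_all add: J_mult J_y2y2 J_nplus)
  ultimately show ?thesis
    using uea.subspace_scale[OF J_subspace, of "uea_scale 2 (uea_inc sl_y3 * ?y)" "1/2"] by simp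
qed

text \<open>The difference \<open>u\<close> of the two sides is annihilated by \<open>x\<^sub>2\<close> and by \<open>y\<^sub>2\<close>, hence by their bracket
  \<open>h\<^sub>2\<close>. On the other hand \<open>u\<close> has weight \<open>-1\<close> for \<open>h\<^sub>2\<close>, so it vanishes.\<close>

lemma J_x1y3: "uea_inc sl_x1 * uea_inc sl_y3 - uea_scale (1 - k) (uea_inc sl_y2) \<in> J"
proof -
  let ?y = "uea_inc sl_y2" and ?x = "uea_inc sl_x2" and ?a = "uea_inc sl_x1" and ?b = "uea_inc sl_y3"
  let ?h1 = "uea_inc sl_h1" and ?h = "uea_inc sl_h2"
  define u where "u = ?a * ?b - uea_scale (1 - k) ?y"
  have yu: "?y * u \<in> J"
  proof -
    have "?y * (?a * ?b) = ?a * (?b * ?y)"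
      by (metis inc_comm(3,4) mult.assoc)
    then have "?y * u = ?a * (?b * ?y) - uea_scale (1 - k) (?y * ?y)"
      by (simp add: u_def right_diff_distrib)
    then show ?thesis
      using J_y3y2 J_y2y2
      by (simp add: uea.subspace_diff[OF J_subspace] uea.subspace_scale[OF J_subspace] J_mult)
  qed
  have xu: "?x * u \<in> J"
  proof -
    have "?x * (?a * ?b) = (?a * ?x - uea_inc sl_x3) * ?b"
      by (simp add: inc_comm flip: mult.assoc)
    also have "\<dots> = ?a * (?b * ?x + uea_inc sl_y1) - (- (?b * uea_inc sl_x3) + ?h1 - ?h)"
      by (simp add: left_diff_distrib mult.assoc inc_comm)
    finally have "?x * u = ?a * (?b * ?x) + ?a * uea_inc sl_y1 + ?b * uea_inc sl_x3
        - (?h1 - uea_scale k 1) + uea_scale k (?h - 1)  - uea_scale (1 - k) (?y * ?x)"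
      by (simp add: u_def right_diff_distrib inc_comm distrib_left uea.scale_right_distrib
          uea.scale_right_diff_distrib uea.scale_left_diff_distrib)
    moreover have "p1 + p2 + p3 - p4 + p5 - p6 \<in> J"
      if "p1 \<in> J" "p2 \<in> J" "p3 \<in> J" "p4 \<in> J" "p5 \<in> J" "p6 \<in> J" for p1 p2 p3 p4 p5 p6
      by (intro uea.subspace_diff[OF J_subspace] uea.subspace_add[OF J_subspace] that)
    ultimately show ?thesis
      using J_h1 J_h2 by (simp add: J_mult J_nplus uea.subspace_scale[OF J_subspace])
  qed
  have "?x * (?y * u) - ?y * (?x * u) \<in> J"
    by (intro uea.subspace_diff[OF J_subspace] J_mult xu yu)
  then have "?h * u \<in> J"
    by (simp add: inc_comm distrib_right flip: mult.assoc)
  moreover have "?h * u = u * ?h - uea_scale 2 u"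
  proof -
    have "?h * (?a * ?b) = (?a * ?h - ?a) * ?b"
      by (simp add: inc_comm flip: mult.assoc)
    also have "\<dots> = ?a * (?b * ?h - ?b) - ?a * ?b"
      by (simp add: left_diff_distrib mult.assoc inc_comm)
    finally have "?h * (?a * ?b) = ?a * ?b * ?h - uea_scale 2 (?a * ?b)"
      by (simp add: right_diff_distrib mult.assoc uea_scale_2)
    then show ?thesis
      by (simp add: u_def right_diff_distrib left_diff_distrib inc_comm uea.scale_right_diff_distrib
          mult.commute)
  qed
  moreover have "u * (?h - 1) \<in> J"
    by (intro J_mult J_h2)
  ultimately have "?h * u - u * (?h - 1) \<in> J"
    using uea.subspace_diff[OF J_subspace] by blast
  then have "u - uea_scale 2 u \<in> J"
    by (simp add: \<open>?h * u = u * ?h - uea_scale 2 u\<close> right_diff_distrib)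
  moreover have "u - uea_scale 2 u = - u"
    using uea.scale_left_distrib[of 1 1 u] by simp
  ultimately show ?thesis
    using uea.subspace_neg[OF J_subspace, of "- u"] by (simp add: u_def)
qed

text \<open>Words in \<open>x\<^sub>1\<close>, \<open>y\<^sub>3\<close>, \<open>y\<^sub>2\<close> span, and by the preceding relations every product of two of these
  letters reduces to a multiple of \<open>y\<^sub>2\<close> or to zero.\<close>

lemma kac_spanning:
  obtains c0 c1 c2 c3 where "u - (uea_scale c0 1 + uea_scale c1 (uea_inc sl_x1)
    + uea_scale c2 (uea_inc sl_y3) + uea_scale c3 (uea_inc sl_y2)) \<in> J"
proof -
  let ?a = "uea_inc sl_x1" and ?b = "uea_inc sl_y3" and ?y = "uea_inc sl_y2"
  let ?B = "{1, ?a, ?b, ?y}"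
  let ?S = "uea.span (?B \<union> J)"
  have SB: "w \<in> ?S" if "w \<in> ?B" for w
    using that by (intro uea.span_base) auto
  have SJ: "w \<in> ?S" if "w - w' \<in> J" "w' \<in> ?S" for w w'
    using uea.span_add[OF uea.span_base[of "w - w'"] that(2)] that(1) by simp
  have mult: "z * w \<in> ?S" if "w \<in> ?S" "\<And>b. b \<in> ?B \<Longrightarrow> z * b \<in> ?S" for z w
    using that(1)
  proof (induction rule: uea.span_induct_alt)
    case (step c x y)
    have "z * x \<in> ?S"
      using step(1) that(2) J_mult by (auto intro: uea.span_base)
    with step show ?case
      by (simp add: distrib_left uea.span_add uea.span_scale)
  qed (simp add: uea.span_zero)
  have ba: "?b * ?a - uea_scale k ?y \<in> J"
    using uea.subspace_neg[OF J_subspace J_x1y3]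
    by (simp add: inc_comm uea.scale_left_diff_distrib algebra_simps)
  have J0: "w \<in> ?S" if "w \<in> J" for w
    using that by (intro uea.span_base) auto
  have Sy: "uea_scale c ?y \<in> ?S" for c
    by (intro uea.span_scale SB) simp
  have "?a * ?a \<in> ?S" "?b * ?b \<in> ?S"
    unfolding inc_comm by (simp_all only: uea.span_zero)
  moreover have "?y * ?a \<in> ?S" "?y * ?b \<in> ?S"
    unfolding inc_comm(3,4)[symmetric] by (rule J0[OF J_x1y2], rule J0[OF J_y3y2])
  moreover have "?a * 1 \<in> ?S" "?b * 1 \<in> ?S" "?y * 1 \<in> ?S"
    unfolding mult_1_right by (rule SB, simp)+
  ultimately have products: "z * b \<in> ?S" if "z \<in> {?a, ?b, ?y}" "b \<in> ?B" for z b
    using that SJ[OF J_x1y3 Sy] SJ[OF ba Sy] J0[OF J_x1y2] J0[OF J_y3y2] J0[OF J_y2y2]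
    by (elim insertE emptyE; simp only:)
  have step: "z * w \<in> ?S" if "z \<in> {?a, ?b, ?y}" "w \<in> ?S" for z w
    using that(2)
  proof (rule mult)
    show "z * b \<in> ?S" if "b \<in> ?B" for b
      using products[OF \<open>z \<in> {?a, ?b, ?y}\<close> that] .
  qed
  have "u \<in> uea.span ({prod_list (map uea_inc zs) | zs. set zs \<subseteq> {sl_x1, sl_y3, sl_y2}} \<union> J)"
  proof (rule negative_words_generate)
    fix z assume "z \<in> {sl_x1, sl_y3, sl_y2}"
    then show "\<exists>q. lpart q z = z"
      using lpart_sl_simps by auto
  next
    fix g :: sl12
    obtain a b c d e f l m where g: "g = lscale a sl_x1 + lscale b sl_y3 + lscale c sl_y2
        + lscale d sl_y1 + lscale e sl_x2 + lscale f sl_x3 + cartan_elt l m"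
      by (rule sl12_decomposition)
    let ?U = "uea.span (uea_inc ` {sl_x1, sl_y3, sl_y2} \<union> {1} \<union> J)"
    have "uea_inc z \<in> ?U" if "z \<in> {sl_x1, sl_y3, sl_y2}" for z
      using that by (intro uea.span_base) blast
    moreover have "uea_inc z \<in> ?U" if "z \<in> {sl_y1, sl_x2, sl_x3}" for z
      using J_nplus[OF that] by (intro uea.span_base) blast
    moreover have "uea_inc (cartan_elt l m) \<in> ?U"
    proof -
      have "uea_inc (cartan_elt l m) = (uea_inc (cartan_elt l m) - uea_const (l * k + m))
          + uea_scale (l * k + m) 1"
        by (simp add: uea_const_eq_scale)
      also have "\<dots> \<in> ?U"
        by (intro uea.span_add uea.span_scale uea.span_base) (simp_all add: J_cartan)
      finally show ?thesis .
    qed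
    ultimately show "uea_inc g \<in> ?U"
      unfolding g by (simp add: uea_inc_lscale uea_inc_add uea.span_add uea.span_scale
          del: image_insert)
  qed (rule J_mult)
  moreover have "prod_list (map uea_inc zs) \<in> ?S" if "set zs \<subseteq> {sl_x1, sl_y3, sl_y2}" for zs
    using that
  proof (induction zs)
    case Nil
    show ?case using SB[of 1] by simp
  next
    case (Cons z zs)
    then have "uea_inc z \<in> {?a, ?b, ?y}" "prod_list (map uea_inc zs) \<in> ?S"
      by auto
    then show ?case
      using step by (simp del: Un_insert_left)
  qed
  then have "{prod_list (map uea_inc zs) | zs. set zs \<subseteq> {sl_x1, sl_y3, sl_y2}} \<union> J \<subseteq> ?S"
    using J0 by blast
  then have "uea.span ({prod_list (map uea_inc zs) | zs. set zs \<subseteq> {sl_x1, sl_y3, sl_y2}} \<union> J) \<subseteq> ?S"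
    by (intro uea.span_minimal uea.subspace_span)
  ultimately have "u \<in> ?S" by blast
  then have "\<exists>c0 c1 c2 c3. u - (uea_scale c0 1 + uea_scale c1 ?a + uea_scale c2 ?b + uea_scale c3 ?y) \<in> J"
  proof (induction rule: uea.span_induct_alt)
    case base
    show ?case
      using uea.subspace_0[OF J_subspace] by (intro exI[of _ 0]) simp
  next
    case (step c x w)
    then obtain c0 c1 c2 c3 where
      w: "w - (uea_scale c0 1 + uea_scale c1 ?a + uea_scale c2 ?b + uea_scale c3 ?y) \<in> J" by blast
    have "\<exists>d0 d1 d2 d3. x - (uea_scale d0 1 + uea_scale d1 ?a + uea_scale d2 ?b + uea_scale d3 ?y) \<in> J"
    proof (cases "x \<in> J")
      case True
      then show ?thesis
        by (intro exI[of _ 0]) simp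
    next
      case False
      then consider "x = 1" | "x = ?a" | "x = ?b" | "x = ?y"
        using step(1) by blast
      then show ?thesis
      proof cases
        case 1
        show ?thesis
          unfolding 1 by (rule exI[of _ 1], rule exI[of _ 0], rule exI[of _ 0], rule exI[of _ 0])
            (simp add: uea.subspace_0[OF J_subspace])
      next
        case 2
        show ?thesis
          unfolding 2 by (rule exI[of _ 0], rule exI[of _ 1], rule exI[of _ 0], rule exI[of _ 0])
            (simp add: uea.subspace_0[OF J_subspace])
      next
        case 3
        show ?thesis
          unfolding 3 by (rule exI[of _ 0], rule exI[of _ 0], rule exI[of _ 1], rule exI[of _ 0])
            (simp add: uea.subspace_0[OF J_subspace])
      next
        case 4
        show ?thesis
          unfolding 4 by (rule exI[of _ 0], rule exI[of _ 0], rule exI[of _ 0], rule exI[of _ 1])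
            (simp add: uea.subspace_0[OF J_subspace])
      qed
    qed
    then obtain d0 d1 d2 d3 where
      x: "x - (uea_scale d0 1 + uea_scale d1 ?a + uea_scale d2 ?b + uea_scale d3 ?y) \<in> J" by blast
    have "uea_scale c x + w - (uea_scale (c * d0 + c0) 1 + uea_scale (c * d1 + c1) ?a
        + uea_scale (c * d2 + c2) ?b + uea_scale (c * d3 + c3) ?y)
      = uea_scale c (x - (uea_scale d0 1 + uea_scale d1 ?a + uea_scale d2 ?b + uea_scale d3 ?y))
        + (w - (uea_scale c0 1 + uea_scale c1 ?a + uea_scale c2 ?b + uea_scale c3 ?y))"
      by (simp add: uea.scale_left_distrib uea.scale_right_distrib uea.scale_right_diff_distrib
          algebra_simps)
    also have "\<dots> \<in> J"
      by (intro uea.subspace_add[OF J_subspace] uea.subspace_scale[OF J_subspace] x w)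
    finally show ?case by blast
  qed
  then show ?thesis
    using that by blast
qed

lemma ev_basis:
  "ev 1 = unit_fun 0" "ev (uea_inc sl_x1) = unit_fun 1"
  "ev (uea_inc sl_y3) = unit_fun 2" "ev (uea_inc sl_y2) = unit_fun 3"
  by (simp_all add: rep.tact_inc kac_act_unit kac_matrix_basis unit_fun_def fun_eq_iff)

text \<open>The four spanning elements take the four unit vectors as values at the generator, so no relations
  besides those in \<open>J\<close> hold.\<close>

lemma J_iff: "u \<in> J \<longleftrightarrow> ev u = 0"
proof
  assume 0: "ev u = 0"
  obtain c0 c1 c2 c3 where c: "u - (uea_scale c0 1 + uea_scale c1 (uea_inc sl_x1)
    + uea_scale c2 (uea_inc sl_y3) + uea_scale c3 (uea_inc sl_y2)) \<in> J"
    by (rule kac_spanning)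
  have "ev u - (cscale c0 (unit_fun 0) + cscale c1 (unit_fun 1) + cscale c2 (unit_fun 2)
      + cscale c3 (unit_fun 3)) = 0"
    using ev_J[OF c] by (simp only: rep.tact_diff rep.tact_add rep.tact_scale ev_basis)
  then have "cscale c0 (unit_fun 0) + cscale c1 (unit_fun 1) + cscale c2 (unit_fun 2)
      + cscale c3 (unit_fun 3) = (0 :: nat \<Rightarrow> complex)"
    using 0 by (simp only: diff_0 neg_equal_0_iff_equal)
  from fun_cong[OF this] have "c0 * unit_fun 0 i + c1 * unit_fun 1 i + c2 * unit_fun 2 i
      + c3 * unit_fun 3 i = 0" for i :: nat
    by (simp add: fun_scale_def)
  from this[of 0] this[of 1] this[of 2] this[of 3] have "c0 = 0" "c1 = 0" "c2 = 0" "c3 = 0"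
    by (simp_all add: unit_fun_def)
  with c show "u \<in> J" by simp
qed (rule ev_J)

abbreviation cls :: "sl12 uea \<Rightarrow> sl12 uea set" where
  "cls \<equiv> a_r_coset (uea_regular :: (sl12, sl12 uea) smodule) J"

definition co :: "sl12 uea set \<Rightarrow> nat \<Rightarrow> complex" where
  "co = (\<lambda>A. ev (SOME u. u \<in> A))"

lemma coord_module_kac: "coord_module cscale (kac (k, 1)) co (kac_act k)"
  unfolding kac_def co_def by (rule rep.coord_module_cyclic(1)[OF J_iff])

sublocale K: coord_module cscale "kac (k, 1)" co "kac_act k"
  by (rule coord_module_kac)

lemma carrier_kac: "carrier (kac (k, 1)) = range cls"
  unfolding kac_def by (rule rep.coord_module_cyclic(2)[OF J_iff])

lemma co_cls: "co (cls u) = ev u"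
  unfolding co_def by (rule rep.coord_module_cyclic(3)[OF J_iff])

lemma ev_inc_mult: "ev (uea_inc x * u) i = (\<Sum>j<4. kac_matrix k x i j * ev u j)"
  by (simp only: rep.tact_mult rep.tact_inc kac_act_apply)

lemma ev_support: "4 \<le> i \<Longrightarrow> ev u i = 0"
proof (induction u rule: uea_induct)
  case (mult x u)
  then show ?case
    by (simp add: ev_inc_mult kac_matrix_support)
qed (simp_all add: rep.tact_add rep.tact_scale unit_fun_def fun_scale_def)

lemma co_support: "a \<in> carrier (kac (k, 1)) \<Longrightarrow> 4 \<le> i \<Longrightarrow> co a i = 0"
  by (auto simp: carrier_kac co_cls ev_support)

lemma ev_parity:
  assumes "u \<in> uea_par q" "kpar i \<noteq> q"
  shows "ev u i = 0"
proof -
  have word: "kpar i \<noteq> sum_list (map fst pxs) \<Longrightarrow> ev (prod_list (map (uea_inc \<circ> snd) pxs)) i = 0"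
    if "\<forall>(p, x) \<in> set pxs. lpart p x = x" for pxs :: "(bit \<times> sl12) list" and i
    using that
  proof (induction pxs arbitrary: i)
    case Nil
    then show ?case by (cases "i = 0") (simp_all add: unit_fun_def kpar_def)
  next
    case (Cons px pxs)
    obtain p x where px: "px = (p, x)" by force
    have x: "lpart p x = x"
      using Cons.prems px by auto
    let ?w = "prod_list (map (uea_inc \<circ> snd) pxs)"
    have "kac_matrix k x i j * ev ?w j = 0" for j
    proof (cases "kac_matrix k x i j = 0")
      case False
      then have "kpar i = p + kpar j"
        by (rule kacm.mat_parity[OF x])
      then have "kpar j \<noteq> sum_list (map fst pxs)"
        using Cons.prems px by auto
      then have "ev ?w j = 0"
        using Cons.prems by (intro Cons.IH) auto
      then show ?thesis
        by (simp only: mult_zero_right)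
    qed simp
    then have "(\<Sum>j<4. kac_matrix k x i j * ev ?w j) = 0"
      by (intro sum.neutral) blast
    moreover have "prod_list (map (uea_inc \<circ> snd) (px # pxs)) = uea_inc x * ?w"
      by (simp add: px)
    ultimately show ?case
      by (simp only: ev_inc_mult)
  qed
  show ?thesis
    using assms(1) unfolding uea_par_def
  proof (induction rule: uea.span_induct_alt)
    case (step c x y)
    then obtain pxs where "x = prod_list (map (uea_inc \<circ> snd) pxs)"
      "\<forall>(p, x) \<in> set pxs. lpart p x = x" "sum_list (map fst pxs) = q"
      by blast
    then have "ev x i = 0"
      using word[of pxs i] assms(2) by blast
    moreover have "ev (uea_scale c x + y) i = c * ev x i + ev y i"
      by (simp only: rep.tact_add rep.tact_scale cscale_add_apply)
    ultimately show ?case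
      using step(2) by (simp only: mult_zero_right add_0)
  qed simp
qed

lemma par_kac: "par (kac (k, 1)) q = cls ` uea_par q"
  by (simp add: kac_def smod_quotient_def uea_regular_def)

lemma uea_par_subspace: "uea.subspace (uea_par q)"
  unfolding uea_par_def by (rule uea.subspace_span)

lemma uea_par_basis:
  "1 \<in> uea_par 0" "lpart q x = x \<Longrightarrow> uea_inc x \<in> uea_par q"
  unfolding uea_par_def
  by (intro uea.span_base CollectI exI[of _ "[]"], simp)
    (intro uea.span_base CollectI exI[of _ "[(q, x)]"], simp)

lemma par_component:
  assumes "a \<in> carrier (kac (k, 1))"
  shows "\<exists>b\<in>par (kac (k, 1)) q. b \<in> carrier (kac (k, 1)) \<and> co b = (\<lambda>i. if kpar i = q then co a i else 0)"
proof -
  obtain u where u: "a = cls u"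
    using assms by (auto simp: carrier_kac)
  obtain c0 c1 c2 c3 where c: "u - (uea_scale c0 1 + uea_scale c1 (uea_inc sl_x1)
    + uea_scale c2 (uea_inc sl_y3) + uea_scale c3 (uea_inc sl_y2)) \<in> J"
    by (rule kac_spanning)
  let ?e = "uea_scale c0 1 + uea_scale c3 (uea_inc sl_y2)"
  let ?o = "uea_scale c1 (uea_inc sl_x1) + uea_scale c2 (uea_inc sl_y3)"
  have e: "?e \<in> uea_par 0"
    by (intro uea.subspace_add[OF uea_par_subspace] uea.subspace_scale[OF uea_par_subspace]
        uea_par_basis lpart_sl_simps)
  have o: "?o \<in> uea_par 1"
    by (intro uea.subspace_add[OF uea_par_subspace] uea.subspace_scale[OF uea_par_subspace]
        uea_par_basis lpart_sl_simps)
  have ev_u: "ev u = ev ?e + ev ?o"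
    using ev_J[OF c] by (simp add: rep.tact_diff rep.tact_add algebra_simps)
  define w where "w = (if q = 0 then ?e else ?o)"
  have "w \<in> uea_par q"
    using e o by (cases q) (simp_all add: w_def)
  moreover have "ev w = (\<lambda>i. if kpar i = q then ev u i else 0)"
  proof
    fix i
    show "ev w i = (if kpar i = q then ev u i else 0)"
      using ev_parity[OF e, of i] ev_parity[OF o, of i]
      by (cases q; cases "kpar i") (simp_all add: w_def ev_u)
  qed
  ultimately show ?thesis
    unfolding par_kac carrier_kac u co_cls by (intro bexI[of _ "cls w"]) (auto simp: co_cls)
qed

lemma par_parity: "a \<in> par (kac (k, 1)) q \<Longrightarrow> a \<in> carrier (kac (k, 1)) \<and> (\<forall>i. kpar i \<noteq> q \<longrightarrow> co a i = 0)"
  unfolding par_kac by (auto simp: carrier_kac co_cls ev_parity)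

text \<open>The parity component is determined by its coordinates, because the two summands of a decomposition
  are supported on the complementary sets of even and of odd indices.\<close>

lemma par_comp_kac:
  assumes a: "a \<in> carrier (kac (k, 1))"
  shows "par_comp (kac (k, 1)) q a \<in> carrier (kac (k, 1))"
    "co (par_comp (kac (k, 1)) q a) = (\<lambda>i. if kpar i = q then co a i else 0)"
proof -
  obtain b b' where b: "b \<in> par (kac (k, 1)) q" "b \<in> carrier (kac (k, 1))"
      "co b = (\<lambda>i. if kpar i = q then co a i else 0)"
    and b': "b' \<in> par (kac (k, 1)) (q + 1)" "b' \<in> carrier (kac (k, 1))"
      "co b' = (\<lambda>i. if kpar i = q + 1 then co a i else 0)"
    using par_component[OF a, of q] par_component[OF a, of "q + 1"] by blast
  have split: "kpar i = q + 1 \<longleftrightarrow> kpar i \<noteq> q" for i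
    by (cases q; cases "kpar i") simp_all
  have "par_comp (kac (k, 1)) q a = b"
    unfolding par_comp_def
  proof (rule the_equality)
    have "a = b \<oplus>\<^bsub>kac (k, 1)\<^esub> b'"
      using a b b' by (intro K.theta_eqI) (auto simp: K.add_closed K.theta_add fun_eq_iff split)
    then show "b \<in> par (kac (k, 1)) q \<and> (\<exists>w'\<in>par (kac (k, 1)) (q + 1). a = b \<oplus>\<^bsub>kac (k, 1)\<^esub> w')"
      using b b' by blast
    fix w assume "w \<in> par (kac (k, 1)) q \<and> (\<exists>w'\<in>par (kac (k, 1)) (q + 1). a = w \<oplus>\<^bsub>kac (k, 1)\<^esub> w')"
    then obtain w' where w: "w \<in> carrier (kac (k, 1))" "\<And>i. kpar i \<noteq> q \<Longrightarrow> co w i = 0"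
      and w': "w' \<in> carrier (kac (k, 1))" "\<And>i. kpar i \<noteq> q + 1 \<Longrightarrow> co w' i = 0"
      and "a = w \<oplus>\<^bsub>kac (k, 1)\<^esub> w'"
      using par_parity by blast
    then have "co a i = co w i + co w' i" for i
      by (simp add: K.theta_add)
    then have "co w = co b"
      using w w' unfolding b(3) fun_eq_iff split by auto
    then show "w = b"
      using w b by (intro K.theta_eqI)
  qed
  then show "par_comp (kac (k, 1)) q a \<in> carrier (kac (k, 1))"
    "co (par_comp (kac (k, 1)) q a) = (\<lambda>i. if kpar i = q then co a i else 0)"
    using b by simp_all
qed

lemma koszul_kac:
  assumes a: "a \<in> carrier (kac (k, 1))"
  shows "koszul (kac (k, 1)) q a \<in> carrier (kac (k, 1))"
    "co (koszul (kac (k, 1)) q a) i = ssign q (kpar i) * co a i"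
proof -
  show "koszul (kac (k, 1)) q a \<in> carrier (kac (k, 1))"
    unfolding koszul_def by (intro K.add_closed K.smult_closed par_comp_kac a)
  show "co (koszul (kac (k, 1)) q a) i = ssign q (kpar i) * co a i"
    unfolding koszul_def using par_comp_kac[OF a]
    by (cases "kpar i") (simp_all add: K.theta_add K.theta_smult K.smult_closed fun_scale_def)
qed

lemma kac_basis: "i < 4 \<Longrightarrow> \<exists>a\<in>carrier (kac (k, 1)). co a = (\<lambda>j. if j = i then 1 else 0)"
proof -
  assume "i < 4"
  then have "i = 0 \<or> i = 1 \<or> i = 2 \<or> i = 3" by auto
  then have "\<exists>u. ev u = unit_fun i"
    by (elim disjE; simp only:) (rule exI, rule ev_basis)+
  then show ?thesis
    unfolding carrier_kac by (auto simp: co_cls unit_fun_def fun_eq_iff)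
qed

lemma co_kac_gen: "kac_gen (k, 1) \<in> carrier (kac (k, 1))" "co (kac_gen (k, 1)) = unit_fun 0"
  unfolding kac_gen_def carrier_kac by (simp_all add: co_cls)

end

abbreviation eval_kac :: "complex \<times> complex \<Rightarrow> (sl12 poly, sl12 uea set) smodule" where
  "eval_kac p \<equiv> eval_module (snd p) (kac (fst p, 1))"

abbreviation kac_eval_matrix :: "complex \<times> complex \<Rightarrow> sl12 poly \<Rightarrow> nat \<Rightarrow> nat \<Rightarrow> complex" where
  "kac_eval_matrix \<equiv> \<lambda>(k, z) x. kac_matrix k (evalp z x)"

lemma eval_module_simps [simp]:
  "carrier (eval_module z V) = carrier V" "add (eval_module z V) = add V"
  "module.smult (eval_module z V) = module.smult V" "par (eval_module z V) = par V"
  "act (eval_module z V) p = act V (evalp z p)"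
  by (simp_all add: eval_module_def evalp_def)

lemma koszul_eval_module [simp]: "koszul (eval_module z V) = koszul V"
  by (simp add: koszul_def par_comp_def fun_eq_iff)

global_interpretation fam: coord_family kac_eval_matrix kpar 4 eval_kac "\<lambda>p. kac_module.co (fst p)"
  defines fam_tensor_act = fam.tensor_act
proof -
  interpret super_matrices kac_eval_matrix kpar 4
    by (rule kacm.super_matrices_evalp)
  show "coord_family kac_eval_matrix kpar 4 eval_kac (\<lambda>p. kac_module.co (fst p))"
  proof (unfold_locales, goal_cases)
    case (1 a p b) interpret kac_module "fst p" . from 1 show ?case by (simp add: K.add_closed)
  next
    case (2 a p b i) interpret kac_module "fst p" . from 2 show ?case by (simp add: K.theta_add)
  next
    case (3 a p c) interpret kac_module "fst p" . from 3 show ?case by (simp add: K.smult_closed)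
  next
    case (4 a p c i) interpret kac_module "fst p" . from 4 show ?case
      by (simp add: K.theta_smult fun_scale_def)
  next
    case (5 a p x) interpret kac_module "fst p" . from 5 show ?case by (simp add: K.act_closed)
  next
    case (6 a p x i) interpret kac_module "fst p" . from 6 show ?case
      by (simp add: K.theta_act kac_act_apply case_prod_unfold)
  next
    case (7 a p q) interpret kac_module "fst p" . from 7 show ?case by (simp add: koszul_kac)
  next
    case (8 a p q i) interpret kac_module "fst p" . from 8 show ?case by (simp add: koszul_kac)
  next
    case (9 a p b) interpret kac_module "fst p" . from 9 show ?case by (intro K.theta_eqI) simp_all
  next
    case (10 a p i) interpret kac_module "fst p" . from 10 show ?case by (simp add: co_support)
  next
    case (11 i p) interpret kac_module "fst p" . from 11 show ?case using kac_basis by simp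
  qed
qed

section \<open>Special operators on tensors\<close>

context super_matrices
begin

lemma tensor_act_zero_mat:
  assumes "lpart q x = x"
  shows "(\<And>p i j. p \<in> set ps \<Longrightarrow> mat p x i j = 0) \<Longrightarrow> tensor_act ps x f l = 0"
proof (induction ps arbitrary: f l)
  case (Cons p ps)
  then show ?case
    by (cases l) (simp_all add: tensor_act_homogeneous[OF assms] del: tensor_act.simps(3))
qed simp

text \<open>If \<open>x\<close> acts by zero in all factors but one, the only trace of the other factors is a sign.\<close>

lemma tensor_act_site:
  assumes x: "lpart q x = x" and p: "\<And>i. mat p x i 0 = (if i = c then 1 else 0)" and d: "0 < d"
    and 2: "\<And>p i j. p \<in> set ps2 \<Longrightarrow> mat p x i j = 0"
  shows "(\<And>p i j. p \<in> set ps1 \<Longrightarrow> mat p x i j = 0) \<Longrightarrow> length pre = length ps1 \<Longrightarrow>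
    \<exists>\<epsilon>. \<epsilon> \<noteq> 0 \<and> tensor_act (ps1 @ p # ps2) x (unit_fun (pre @ 0 # suf))
      = cscale \<epsilon> (unit_fun (pre @ c # suf))"
proof (induction ps1 arbitrary: pre)
  case Nil
  have "tensor_act (p # ps2) x (unit_fun (0 # suf)) l = unit_fun (c # suf) l" for l
  proof (cases l)
    case (Cons a l')
    have "(\<Sum>b<d. mat p x a b * unit_fun (0 # suf) (b # l'))
        = (\<Sum>b<d. if b = 0 then mat p x a 0 * unit_fun suf l' else 0)"
      by (rule sum.cong) (auto simp: unit_fun_def)
    also have "\<dots> = unit_fun (c # suf) l"
      using d by (simp add: p Cons unit_fun_def)
    finally show ?thesis
      using tensor_act_zero_mat[OF x 2]
      by (simp add: Cons tensor_act_homogeneous[OF x] del: tensor_act.simps(3))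
  qed (simp add: unit_fun_def)
  then show ?case
    using Nil by (intro exI[of _ 1]) (simp add: fun_eq_iff fun_scale_def)
next
  case (Cons r ps1)
  then obtain b pre' where pre: "pre = b # pre'" "length pre' = length ps1"
    by (cases pre) auto
  obtain \<epsilon> where \<epsilon>: "\<epsilon> \<noteq> 0" "tensor_act (ps1 @ p # ps2) x (unit_fun (pre' @ 0 # suf))
      = cscale \<epsilon> (unit_fun (pre' @ c # suf))"
    using Cons.IH[OF _ pre(2)] Cons.prems(1) by auto
  have "tensor_act ((r # ps1) @ p # ps2) x (unit_fun (pre @ 0 # suf)) l
      = ssign q (kpar b) * \<epsilon> * unit_fun (pre @ c # suf) l" for l
  proof (cases l)
    case l: (Cons a l')
    have "(\<lambda>l'. unit_fun (pre @ 0 # suf) (a # l'))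
        = (if a = b then unit_fun (pre' @ 0 # suf) else (\<lambda>_. 0))"
      by (auto simp: pre unit_fun_def fun_eq_iff)
    then show ?thesis
      using Cons.prems(1) \<epsilon>(2)
      by (simp add: l tensor_act_homogeneous[OF x] del: tensor_act.simps(3))
        (simp add: pre unit_fun_def fun_scale_def)
  qed (simp add: unit_fun_def pre)
  moreover have "ssign q (kpar b) * \<epsilon> \<noteq> 0"
    using \<epsilon>(1) by (simp add: ssign_def)
  ultimately show ?case
    by (intro exI[of _ "ssign q (kpar b) * \<epsilon>"]) (simp add: fun_eq_iff fun_scale_def)
qed

lemma tensor_act_vacuum:
  assumes x: "lpart q x = x" and d: "0 < d" and kpar: "kpar 0 = 0"
  shows "(\<And>p i. p \<in> set ps \<Longrightarrow> mat p x i 0 = (if i = 0 then w p else 0)) \<Longrightarrow>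
    tensor_act ps x (unit_fun (replicate (length ps) 0))
      = cscale (\<Sum>p\<leftarrow>ps. w p) (unit_fun (replicate (length ps) 0))"
proof (induction ps)
  case Nil
  show ?case by (simp add: fun_eq_iff fun_scale_def)
next
  case (Cons p ps)
  let ?u = "unit_fun (replicate (length ps) (0 :: nat))"
  have "tensor_act (p # ps) x (unit_fun (0 # replicate (length ps) 0)) l
      = (\<Sum>p\<leftarrow>p # ps. w p) * unit_fun (0 # replicate (length ps) 0) l" for l
  proof (cases l)
    case l: (Cons a l')
    have "(\<Sum>b<d. mat p x a b * unit_fun (0 # replicate (length ps) 0) (b # l'))
        = (\<Sum>b<d. if b = 0 then mat p x a 0 * ?u l' else 0)"
      by (rule sum.cong) (auto simp: unit_fun_def)
    also have "\<dots> = (if a = 0 then w p * ?u l' else 0)"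
      using d Cons.prems by simp
    finally have 1: "(\<Sum>b<d. mat p x a b * unit_fun (0 # replicate (length ps) 0) (b # l'))
        = (if a = 0 then w p * ?u l' else 0)" .
    have "(\<lambda>l'. unit_fun (0 # replicate (length ps) 0) (a # l')) = (if a = 0 then ?u else (\<lambda>_. 0))"
      by (auto simp: unit_fun_def fun_eq_iff)
    moreover have "tensor_act ps x ?u l' = (\<Sum>p\<leftarrow>ps. w p) * ?u l'"
      using Cons by (simp add: fun_scale_def)
    ultimately show ?thesis
      unfolding l tensor_act_homogeneous[OF x] 1
      by (simp add: kpar distrib_right) (simp add: unit_fun_def)
  qed (simp add: unit_fun_def)
  then show ?case
    by (simp add: fun_eq_iff fun_scale_def del: tensor_act.simps)
qed

text \<open>The matrix unit has square zero because \<open>e \<noteq> 0\<close>. An even \<open>x\<close> that acts by it in each of \<open>n\<close>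
  factors is thus a sum of \<open>n\<close> commuting operators with square zero, and its power of exponent
  \<open>n + 1\<close> vanishes. The induction is
  based on the binomial expansion of the powers with respect to the first factor.\<close>

lemma tensor_act_nilpotent:
  assumes x: "lpart 0 x = x" and d: "0 < d" and e: "e \<noteq> 0"
  shows "(\<And>p i j. p \<in> set ps \<Longrightarrow> mat p x i j = (if i = e \<and> j = 0 then 1 else 0)) \<Longrightarrow>
    (tensor_act ps x ^^ Suc (length ps)) f = (\<lambda>_. 0)"
proof (induction ps arbitrary: f)
  case Nil
  show ?case by (simp add: fun_eq_iff)
next
  case (Cons p ps)
  let ?t = "tensor_act ps x" and ?T = "tensor_act (p # ps) x"
  have step: "?T g (a # l) = (if a = e then g (0 # l) else 0) + ?t (\<lambda>l'. g (a # l')) l" for g a l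
  proof -
    have "(\<Sum>b<d. mat p x a b * g (b # l)) = (\<Sum>b<d. if b = 0 then (if a = e then g (0 # l) else 0) else 0)"
      using Cons.prems[of p] by (intro sum.cong) auto
    then show ?thesis
      unfolding tensor_act_homogeneous[OF x] using d by simp
  qed
  have pow: "(?T ^^ k) f (a # l) = (?t ^^ k) (\<lambda>l'. f (a # l')) l
      + of_nat k * (if a = e then (?t ^^ (k - 1)) (\<lambda>l'. f (0 # l')) l else 0)" for k f a l
  proof (induction k arbitrary: a l)
    case (Suc k)
    have 0: "(?T ^^ k) f (0 # l) = (?t ^^ k) (\<lambda>l'. f (0 # l')) l" for l
      using e by (simp add: Suc)
    have "(?T ^^ Suc k) f (a # l) = ?T ((?T ^^ k) f) (a # l)"
      by simp
    also have "\<dots> = (if a = e then (?t ^^ k) (\<lambda>l'. f (0 # l')) l else 0)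
        + ?t (\<lambda>l'. (?t ^^ k) (\<lambda>l'. f (a # l')) l'
          + of_nat k * (if a = e then (?t ^^ (k - 1)) (\<lambda>l'. f (0 # l')) l' else 0)) l"
      unfolding step 0 unfolding Suc ..
    also have "?t (\<lambda>l'. (?t ^^ k) (\<lambda>l'. f (a # l')) l'
          + of_nat k * (if a = e then (?t ^^ (k - 1)) (\<lambda>l'. f (0 # l')) l' else 0)) l
        = (?t ^^ Suc k) (\<lambda>l'. f (a # l')) l
          + of_nat k * (if a = e then (?t ^^ k) (\<lambda>l'. f (0 # l')) l else 0)"
      by (cases k) (simp_all add: tensor_act_add_right tensor_act_scale_right)
    finally show ?case
      by (simp add: algebra_simps)
  qed simp
  have zf: "(?t ^^ Suc (length ps)) g = (\<lambda>_. 0)" for g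
    by (rule Cons.IH) (use Cons.prems in auto)
  then have z: "(?t ^^ Suc (length ps)) g l = 0" for g l
    by (simp only:)
  have z': "(?t ^^ Suc (Suc (length ps))) g l = 0" for g l
    unfolding funpow.simps(2)[of "Suc (length ps)"] comp_apply zf by simp
  have "(?T ^^ Suc (length (p # ps))) f l = 0" for l
  proof (cases l)
    case (Cons a l')
    show ?thesis
      unfolding Cons pow length_Cons z' diff_Suc_1 z by simp
  qed simp
  then show ?case by (simp add: fun_eq_iff)
qed

end

lemma (in coord_family) coprod_unit:
  "list_all2 (\<lambda>v p. co p v = unit_fun 0) vs ps \<Longrightarrow> coprod ps vs = unit_fun (replicate (length ps) 0)"
proof (rule ext)
  fix cs
  show "list_all2 (\<lambda>v p. co p v = unit_fun 0) vs ps \<Longrightarrow>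
      coprod ps vs cs = unit_fun (replicate (length ps) 0) cs"
  proof (induction ps arbitrary: vs cs)
    case Nil
    then show ?case by (cases cs) (simp_all add: unit_fun_def)
  next
    case (Cons p ps)
    then show ?case by (cases cs) (auto simp: list_all2_Cons2 unit_fun_def)
  qed
qed

lemma (in uea_rep) tact_power: "tact (uea_inc x ^ k) w = (\<rho> x ^^ k) w"
  by (induction k) (simp_all add: tact_mult tact_inc)

section \<open>Interpolation\<close>

lemma evalp_map_poly: "evalp z (map_poly (\<lambda>c. lscale c x) L) = lscale (poly L z) x"
proof -
  have "evalp z (map_poly (\<lambda>c. lscale c x) L)
      = (\<Sum>a\<le>degree L. lscale (z ^ a) (coeff (map_poly (\<lambda>c. lscale c x) L) a))"
    by (intro evalp_superset degree_le) (simp add: coeff_map_poly coeff_eq_0)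
  also have "\<dots> = lscale (poly L z) x"
    by (simp add: coeff_map_poly lscale_lscale poly_altdef lie.scale_sum_left mult.commute)
  finally show ?thesis .
qed

lemma interpolation_poly:
  assumes "finite S" "a \<notin> S"
  shows "\<exists>L :: complex poly. poly L a = 1 \<and> (\<forall>z\<in>S. poly L z = 0)"
proof -
  let ?P = "\<Prod>s\<in>S. [:- s, 1:]"
  have "poly ?P a \<noteq> 0"
    using assms by (auto simp: poly_prod)
  moreover have "poly ?P z = 0" if "z \<in> S" for z
    using assms that by (auto simp: poly_prod)
  ultimately show ?thesis
    by (intro exI[of _ "Polynomial.smult (inverse (poly ?P a)) ?P"]) simp
qed

section \<open>Comparison of an ideal with the annihilator in the graded module\<close>

lemma dcomp_inc: "dcomp n (uea_inc p) = cur (coeff p n) n"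
proof -
  have "dcomp n (uea_inc p * 1) = (\<Sum>m\<le>n. if m = n then cur (coeff p m) m else 0)"
    unfolding dcomp_inc_mult by (rule sum.cong) (auto simp: dcomp_one)
  then show ?thesis by simp
qed

context coord_current
begin

text \<open>A basis of \<open>I\<close> is extended by a set \<open>B\<close> of homogeneous elements to a basis of the enveloping
  algebra. By assumption \<open>B\<close> has at most as many elements as the independent set \<open>C\<close>. Because
  components of elements of \<open>I\<close> take values in a lower step of the filtration, the values of the
  elements of \<open>B\<close> of degree less than \<open>j\<close> span \<open>Gpred j\<close>, and those of all of \<open>B\<close> span the space
  that contains \<open>C\<close>. Thus the two sets have the same size and the values are linearly independent. A
  combination of elements of \<open>B\<close> that lies in \<open>K\<close> would express the value of an element of degree
  \<open>j\<close> by the values of other elements, so it is trivial, and \<open>K\<close> is not larger than \<open>I\<close>.\<close>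

lemma ideal_eq_kernel:
  assumes I: "uea.subspace I" "I \<subseteq> K" and X: "finite X" "uea.span (X \<union> I) = UNIV"
    and C: "independent C" "finite C" "C \<subseteq> range ev" and card: "card X \<le> card C"
  shows "I = K"
    and "\<exists>B. finite B \<and> card B = card C \<and> uea.span (B \<union> I) = UNIV
      \<and> (\<forall>c. (\<Sum>b\<in>B. uea_scale (c b) b) \<in> I \<longrightarrow> (\<forall>b\<in>B. c b = 0))"
proof -
  interpret pair: vector_space_pair "uea_scale :: complex \<Rightarrow> 'l poly uea \<Rightarrow> _" "uea_scale :: complex \<Rightarrow> 'l poly uea \<Rightarrow> _"
    by unfold_locales
  obtain BI where BI: "BI \<subseteq> I" "uea.independent BI" "I \<subseteq> uea.span BI"
    using uea.maximal_independent_subset[of I] by blast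
  let ?H = "\<Union>s. uea_deg s :: 'l poly uea set"
  obtain Bf where Bf: "BI \<subseteq> Bf" "Bf \<subseteq> BI \<union> ?H" "uea.independent Bf" "BI \<union> ?H \<subseteq> uea.span Bf"
    using uea.maximal_independent_subset_extend[of BI "BI \<union> ?H"] BI(2) by auto
  have Bf_span: "u \<in> uea.span Bf" for u
  proof -
    obtain N where "u = (\<Sum>n\<le>N. dcomp n u)"
      using uea_deg_decomposition by blast
    also have "\<dots> \<in> uea.span Bf"
      using Bf(4) dcomp_in_uea_deg by (intro uea.span_sum) blast
    finally show ?thesis .
  qed
  define B where "B = Bf - BI"
  have B_deg: "\<exists>s. b \<in> uea_deg s" if "b \<in> B" for b
    using that Bf(2) by (auto simp: B_def)
  have B_ind: "uea.independent B"
    using uea.independent_mono[OF Bf(3)] by (auto simp: B_def)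
  then have B_0: "b \<noteq> 0" if "b \<in> B" for b
    using that uea.dependent_zero by blast
  \<comment> \<open>The projection onto the span of \<open>B\<close> along \<open>I\<close>; it bounds the size of \<open>B\<close> by that of \<open>X\<close>.\<close>
  obtain P where P: "Vector_Spaces.linear uea_scale uea_scale P"
      "\<And>b. b \<in> Bf \<Longrightarrow> P b = (if b \<in> BI then 0 else b)"
    using pair.linear_independent_extend[OF Bf(3), of "\<lambda>b. if b \<in> BI then 0 else b"] by blast
  interpret P: Vector_Spaces.linear uea_scale uea_scale P by (rule P(1))
  have PI: "P i = 0" if "i \<in> I" for i
  proof (rule P.eq_0_on_span)
    show "i \<in> uea.span BI" using BI(3) that by blast
    show "P b = 0" if "b \<in> BI" for b
      using P(2)[of b] Bf(1) that by auto
  qed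
  have "B \<subseteq> uea.span (P ` X)"
  proof
    fix b assume b: "b \<in> B"
    then have "P b = b"
      using P(2)[of b] by (simp add: B_def)
    moreover have "P ` uea.span (X \<union> I) = uea.span (P ` (X \<union> I))"
      by (rule P.span_image[symmetric])
    moreover have "uea.span (P ` (X \<union> I)) \<subseteq> uea.span (P ` X)"
      using PI by (intro uea.span_minimal) (auto intro: uea.span_base uea.span_zero)
    ultimately show "b \<in> uea.span (P ` X)"
      using X(2) by (metis UNIV_I imageI subsetD)
  qed
  then have B: "finite B" "card B \<le> card (P ` X)"
    using uea.independent_span_bound[OF _ B_ind] X(1) by auto
  then have B_card: "card B \<le> card X"
    using card_image_le[OF X(1), of P] by linarith
  have decomp: "\<exists>c. \<exists>i\<in>I. u = (\<Sum>b\<in>B. uea_scale (c b) b) + i" for u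
  proof -
    have "Bf = B \<union> BI"
      using Bf(1) by (auto simp: B_def)
    then obtain x y where "u = x + y" "x \<in> uea.span B" "y \<in> uea.span BI"
      using Bf_span[of u] uea.span_Un[of B BI] by auto
    moreover have "uea.span BI \<subseteq> I"
      by (rule uea.span_minimal[OF BI(1) I(1)])
    ultimately show ?thesis
      using uea.span_finite[OF B(1)] by auto
  qed
  have dcomp_b: "dcomp j b = (if b \<in> uea_deg j then b else 0)" if b: "b \<in> B" for b j
  proof -
    obtain s where s: "b \<in> uea_deg s"
      using B_deg[OF b] by blast
    show ?thesis
      using dcomp_uea_deg[OF s, of j] dcomp_uea_deg[of b j j] B_0[OF b] s by auto
  qed
  have ev_comb: "ev (dcomp j (\<Sum>b\<in>B. uea_scale (c b) b))
      = (\<Sum>b\<in>{b \<in> B. b \<in> uea_deg j}. sc (c b) (ev b))" for c j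
  proof -
    have "ev (dcomp j (\<Sum>b\<in>B. uea_scale (c b) b)) = (\<Sum>b\<in>B. sc (c b) (ev (dcomp j b)))"
      by (simp add: dcomp_sum dcomp_scale tact_sum tact_scale)
    also have "\<dots> = (\<Sum>b\<in>B. if b \<in> uea_deg j then sc (c b) (ev b) else 0)"
      by (rule sum.cong) (auto simp: dcomp_b)
    finally show ?thesis
      using B(1) by (simp add: sum.inter_filter)
  qed
  define L where "L j = span (ev ` {b \<in> B. \<exists>i<j. b \<in> uea_deg i})" for j
  have Gpred_L: "Gpred j \<subseteq> L j" for j
  proof (induction j)
    case 0
    show ?case by (simp add: Gpred_def L_def span_zero)
  next
    case (Suc j)
    have mono: "L j \<subseteq> L (Suc j)"
      unfolding L_def by (intro span_mono) (auto intro: less_SucI)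
    show ?case
    proof
      fix x assume "x \<in> Gpred (Suc j)"
      then have "x \<in> G j" by (simp add: Gpred_def)
      then obtain u w where u: "u \<in> uea_deg j" "w \<in> Gpred j" "x = ev u + w"
        by (rule G_decompose)
      obtain c i where i: "i \<in> I" "u = (\<Sum>b\<in>B. uea_scale (c b) b) + i"
        using decomp by blast
      have "dcomp j u = u"
        using dcomp_uea_deg[OF u(1)] by simp
      moreover have "dcomp j u = dcomp j (\<Sum>b\<in>B. uea_scale (c b) b) + dcomp j i"
        unfolding i(2) by (rule dcomp_add)
      ultimately have "ev u = ev (dcomp j (\<Sum>b\<in>B. uea_scale (c b) b)) + ev (dcomp j i)"
        by (metis tact_add)
      moreover have "ev (dcomp j i) \<in> Gpred j"
        using i(1) I(2) by (auto simp: K_def)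
      moreover have "ev (dcomp j (\<Sum>b\<in>B. uea_scale (c b) b)) \<in> L (Suc j)"
        unfolding ev_comb L_def by (intro span_sum span_scale span_base) auto
      ultimately show "x \<in> L (Suc j)"
        using u(2,3) Suc mono by (auto simp: L_def intro!: span_add)
    qed
  qed
  have "range ev \<subseteq> span (ev ` B)"
  proof
    fix x assume "x \<in> range ev"
    then obtain u where u: "x = ev u" by blast
    obtain N where N: "u = (\<Sum>n\<le>N. dcomp n u)"
      using uea_deg_decomposition by blast
    have "ev (dcomp n u) \<in> span (ev ` B)" for n
    proof -
      have "ev (dcomp n u) \<in> Gpred (Suc n)"
        using G_I[OF dcomp_in_uea_deg, of n n u] by (simp add: Gpred_def)
      then have "ev (dcomp n u) \<in> L (Suc n)"
        using Gpred_L by blast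
      moreover have "L (Suc n) \<subseteq> span (ev ` B)"
        unfolding L_def by (intro span_mono) auto
      ultimately show ?thesis by blast
    qed
    then have "ev (\<Sum>n\<le>N. dcomp n u) \<in> span (ev ` B)"
      unfolding tact_sum by (intro span_sum)
    then show "x \<in> span (ev ` B)"
      unfolding u using N by simp
  qed
  then have C_B: "C \<subseteq> span (ev ` B)"
    using C(3) by blast
  then have "card C \<le> card (ev ` B)"
    using independent_span_bound[OF _ C(1)] B(1) by blast
  also have "\<dots> \<le> card B"
    by (rule card_image_le[OF B(1)])
  finally have card_B: "card B = card C"
    using B_card card by linarith
  have ev_ind: "ev b \<notin> span (ev ` (B - {b}))" if b: "b \<in> B" for b
  proof
    assume "ev b \<in> span (ev ` (B - {b}))"
    then have "ev ` B \<subseteq> span (ev ` (B - {b}))"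
      by (auto intro: span_base)
    then have "C \<subseteq> span (ev ` (B - {b}))"
      using C_B span_minimal[OF _ subspace_span] by blast
    then have "card C \<le> card (ev ` (B - {b}))"
      using independent_span_bound[OF _ C(1)] B(1) by blast
    also have "\<dots> \<le> card (B - {b})"
      using B(1) by (intro card_image_le) auto
    also have "\<dots> < card B"
      using B(1) b by (meson card_Diff1_less)
    finally show False
      using card_B by simp
  qed
  have key: "\<forall>b\<in>B. c b = 0" if s: "(\<Sum>b\<in>B. uea_scale (c b) b) \<in> K" for c
  proof (rule ccontr)
    assume "\<not> (\<forall>b\<in>B. c b = 0)"
    then obtain b where b: "b \<in> B" "c b \<noteq> 0" by blast
    obtain j where j: "b \<in> uea_deg j"
      using B_deg[OF b(1)] by blast
    let ?S = "span (ev ` (B - {b}))" and ?Bj = "{b \<in> B. b \<in> uea_deg j}"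
    have "L j \<subseteq> ?S"
      unfolding L_def
    proof (rule span_mono, rule image_mono, rule subsetI)
      fix b' assume "b' \<in> {b \<in> B. \<exists>i<j. b \<in> uea_deg i}"
      then obtain i where "b' \<in> B" "i < j" "b' \<in> uea_deg i" by blast
      moreover have "b \<notin> uea_deg i" if "i < j" for i
        using dcomp_b[OF b(1), of i] dcomp_uea_deg[OF j, of i] B_0[OF b(1)] that by auto
      ultimately show "b' \<in> B - {b}" by auto
    qed
    moreover have "(\<Sum>b\<in>?Bj. sc (c b) (ev b)) \<in> Gpred j"
      using s unfolding ev_comb[symmetric] by (simp add: K_def)
    ultimately have "(\<Sum>b\<in>?Bj. sc (c b) (ev b)) \<in> ?S"
      using Gpred_L by blast
    moreover have "(\<Sum>b\<in>?Bj - {b}. sc (c b) (ev b)) \<in> ?S"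
      by (intro span_sum span_scale span_base) auto
    moreover have "(\<Sum>b\<in>?Bj. sc (c b) (ev b)) = sc (c b) (ev b) + (\<Sum>b\<in>?Bj - {b}. sc (c b) (ev b))"
      using b j B(1) by (intro sum.remove) auto
    ultimately have "sc (c b) (ev b) \<in> ?S"
      using span_diff by fastforce
    then have "sc (inverse (c b)) (sc (c b) (ev b)) \<in> ?S"
      by (rule span_scale)
    then show False
      using ev_ind[OF b(1)] b(2) by simp
  qed
  have "u \<in> I" if "u \<in> K" for u
  proof -
    obtain c i where i: "i \<in> I" "u = (\<Sum>b\<in>B. uea_scale (c b) b) + i"
      using decomp by blast
    then have "(\<Sum>b\<in>B. uea_scale (c b) b) = u - i" by simp
    then have "(\<Sum>b\<in>B. uea_scale (c b) b) \<in> K"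
      using uea.subspace_diff[OF subspace_K that, of i] i(1) I(2) by auto
    then have "(\<Sum>b\<in>B. uea_scale (c b) b) = 0"
      using key by (intro sum.neutral) auto
    with i show ?thesis by simp
  qed
  then show "I = K"
    using I(2) by blast
  have "UNIV \<subseteq> uea.span (B \<union> I)"
  proof
    fix u
    obtain c i where i: "i \<in> I" "u = (\<Sum>b\<in>B. uea_scale (c b) b) + i"
      using decomp by blast
    show "u \<in> uea.span (B \<union> I)"
      unfolding i(2) using i(1)
      by (intro uea.span_add uea.span_sum uea.span_scale uea.span_base) auto
  qed
  then show "\<exists>B. finite B \<and> card B = card C \<and> uea.span (B \<union> I) = UNIV
      \<and> (\<forall>c. (\<Sum>b\<in>B. uea_scale (c b) b) \<in> I \<longrightarrow> (\<forall>b\<in>B. c b = 0))"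
    using B(1) card_B key I(2) by (intro exI[of _ B]) blast
qed

end

section \<open>Isomorphisms and dimensions of cyclic quotients\<close>

lemma has_dim_quotient:
  fixes I :: "'l :: lie_superalgebra uea set"
  assumes I: "uea.subspace I" "\<And>u a. a \<in> I \<Longrightarrow> u * a \<in> I" and B: "finite B" "uea.span (B \<union> I) = UNIV"
    and ind: "\<And>c. (\<Sum>b\<in>B. uea_scale (c b) b) \<in> I \<Longrightarrow> \<forall>b\<in>B. c b = 0"
  shows "has_dim (smod_quotient (uea_regular :: ('l, 'l uea) smodule) I) (card B)"
proof -
  interpret reg: coord_space uea_scale "uea_regular :: ('l, 'l uea) smodule" id
    by (rule coord_space_regular)
  interpret q: coord_quotient uea_scale "uea_regular :: ('l, 'l uea) smodule" id I
    by unfold_locales (rule I(1))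
  have crr: "u \<in> carrier (uea_regular :: ('l, 'l uea) smodule)" for u
    by (simp add: uea_regular_def)
  have N: "q.N = I"
    unfolding q.N_def by (simp add: uea_regular_def)
  have eq: "q.cos u = q.cos w \<longleftrightarrow> u - w \<in> I" for u w
    using q.cos_eq_iff[OF crr crr, of u w] by simp
  have inj: "inj_on q.cos B"
  proof (rule inj_onI, rule ccontr)
    fix b b' assume b: "b \<in> B" "b' \<in> B" "q.cos b = q.cos b'" "b \<noteq> b'"
    have "(\<Sum>a\<in>B. uea_scale (if a = b then 1 else if a = b' then - 1 else 0) a)
        = (\<Sum>a\<in>B. (if a = b then b else 0) + (if a = b' then - b' else 0))"
      using b(4) by (intro sum.cong) auto
    also have "\<dots> = b - b'"
      using b B(1) by (simp add: sum.distrib)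
    also have "\<dots> \<in> I"
      using b eq by simp
    finally show False
      using ind b(1) by fastforce
  qed
  have fin: "finsum q.Q (\<lambda>A. c A \<odot>\<^bsub>q.Q\<^esub> A) (q.cos ` B) = q.cos (\<Sum>b\<in>B. uea_scale (c (q.cos b)) b)" for c
  proof -
    define s where "s = inv_into B q.cos"
    have s: "s (q.cos b) = b" if "b \<in> B" for b
      unfolding s_def using that inj by simp
    interpret Q: abelian_group q.Q by (rule q.abelian_group_Q)
    have sm: "c A \<odot>\<^bsub>q.Q\<^esub> A = q.cos (uea_scale (c A) (s A))" if A: "A \<in> q.cos ` B" for A
    proof -
      obtain b where b: "b \<in> B" "A = q.cos b"
        using A by blast
      then show ?thesis
        using q.smult_Q[OF crr, of "c A" b] s[OF b(1)] by (simp add: uea_regular_def)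
    qed
    have "finsum q.Q (\<lambda>A. c A \<odot>\<^bsub>q.Q\<^esub> A) (q.cos ` B)
        = finsum q.Q (\<lambda>A. q.cos (uea_scale (c A) (s A))) (q.cos ` B)"
    proof (rule Q.finsum_cong'[OF refl])
      show "(\<lambda>A. q.cos (uea_scale (c A) (s A))) \<in> q.cos ` B \<rightarrow> carrier q.Q"
        unfolding q.carrier_Q using crr by blast
    qed (rule sm)
    also have "\<dots> = q.cos (finsum uea_regular (\<lambda>A. uea_scale (c A) (s A)) (q.cos ` B))"
      using B(1) by (intro q.finsum_Q crr) auto
    also have "finsum uea_regular (\<lambda>A. uea_scale (c A) (s A)) (q.cos ` B)
        = (\<Sum>A\<in>q.cos ` B. uea_scale (c A) (s A))"
      using reg.theta_finsum[of "q.cos ` B" "\<lambda>A. uea_scale (c A) (s A)"] B(1) crr by simp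
    also have "\<dots> = (\<Sum>b\<in>B. uea_scale (c (q.cos b)) b)"
      by (simp add: sum.reindex[OF inj] s)
    finally show ?thesis .
  qed
  have "smod_basis q.Q (q.cos ` B)"
    unfolding smod_basis_def
  proof (intro conjI ballI)
    show "finite (q.cos ` B)"
      using B(1) by simp
    show "q.cos ` B \<subseteq> carrier q.Q"
      unfolding q.carrier_Q using crr by blast
    fix A assume "A \<in> carrier q.Q"
    then obtain u where u: "A = q.cos u"
      unfolding q.carrier_Q by blast
    have "u \<in> uea.span (B \<union> I)"
      using B(2) by simp
    then obtain x i where x: "u = x + i" "x \<in> uea.span B" "i \<in> uea.span I"
      using uea.span_Un[of B I] by auto
    then obtain c where c: "x = (\<Sum>b\<in>B. uea_scale (c b) b)"
      using uea.span_finite[OF B(1)] by auto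
    have i: "i \<in> I"
      using x(3) I(1) by (metis uea.span_eq_iff)
    show "\<exists>!c. (\<forall>b. b \<notin> q.cos ` B \<longrightarrow> c b = 0)
        \<and> A = (\<Oplus>\<^bsub>q.Q\<^esub>b\<in>q.cos ` B. c b \<odot>\<^bsub>q.Q\<^esub> b)"
    proof (rule ex1I)
      let ?c = "\<lambda>A. if A \<in> q.cos ` B then c (inv_into B q.cos A) else 0"
      have "(\<Sum>b\<in>B. uea_scale (?c (q.cos b)) b) = x"
        unfolding c using inj by (intro sum.cong) auto
      then show "(\<forall>b. b \<notin> q.cos ` B \<longrightarrow> ?c b = 0)
          \<and> A = (\<Oplus>\<^bsub>q.Q\<^esub>b\<in>q.cos ` B. ?c b \<odot>\<^bsub>q.Q\<^esub> b)"
        unfolding fin u using x(1) i by (simp add: eq)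
      fix c' assume c': "(\<forall>b. b \<notin> q.cos ` B \<longrightarrow> c' b = 0)
          \<and> A = (\<Oplus>\<^bsub>q.Q\<^esub>b\<in>q.cos ` B. c' b \<odot>\<^bsub>q.Q\<^esub> b)"
      then have "u - (\<Sum>b\<in>B. uea_scale (c' (q.cos b)) b) \<in> I"
        unfolding fin u by (simp add: eq)
      then have "u - (\<Sum>b\<in>B. uea_scale (c' (q.cos b)) b) - i \<in> I"
        by (rule uea.subspace_diff[OF I(1) _ i])
      also have "u - (\<Sum>b\<in>B. uea_scale (c' (q.cos b)) b) - i
          = (\<Sum>b\<in>B. uea_scale (c b - c' (q.cos b)) b)"
        by (simp add: x(1) c uea.scale_left_diff_distrib sum_subtractf)
      finally have "\<forall>b\<in>B. c b - c' (q.cos b) = 0"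
        by (rule ind)
      then have "c' (q.cos b) = c b" if "b \<in> B" for b
        using that by simp
      then show "c' = ?c"
        using c' inj by (auto simp: fun_eq_iff)
    qed
  qed
  then show ?thesis
    unfolding has_dim_def N using card_image[OF inj] N by auto
qed

lemma smod_iso_quotient:
  fixes I :: "'l :: lie_superalgebra uea set" and F :: "('l, 'f) smodule" and \<Phi> :: "'l uea \<Rightarrow> 'f"
  assumes I: "uea.subspace I" "\<And>u a. a \<in> I \<Longrightarrow> u * a \<in> I"
    and carrier: "carrier F = range \<Phi>" and eq: "\<And>u w. \<Phi> u = \<Phi> w \<longleftrightarrow> u - w \<in> I"
    and add: "\<And>u w. \<Phi> u \<oplus>\<^bsub>F\<^esub> \<Phi> w = \<Phi> (u + w)"
    and smult: "\<And>c u. c \<odot>\<^bsub>F\<^esub> \<Phi> u = \<Phi> (uea_scale c u)"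
    and act: "\<And>x u. act F x (\<Phi> u) = \<Phi> (uea_inc x * u)"
  shows "smod_iso (smod_quotient (uea_regular :: ('l, 'l uea) smodule) I) F"
proof -
  interpret reg: coord_space uea_scale "uea_regular :: ('l, 'l uea) smodule" id
    by (rule coord_space_regular)
  interpret q: coord_quotient uea_scale "uea_regular :: ('l, 'l uea) smodule" id I
    by unfold_locales (rule I(1))
  have crr: "u \<in> carrier (uea_regular :: ('l, 'l uea) smodule)" for u
    by (simp add: uea_regular_def)
  have N: "q.N = I"
    unfolding q.N_def by (simp add: uea_regular_def)
  have cos: "q.cos u = q.cos w \<longleftrightarrow> \<Phi> u = \<Phi> w" for u w
    using q.cos_eq_iff[OF crr crr, of u w] eq by simp
  define f where "f A = \<Phi> (SOME u. A = q.cos u)" for A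
  have f: "f (q.cos u) = \<Phi> u" for u
  proof -
    have "q.cos u = q.cos (SOME w. q.cos u = q.cos w)"
      by (rule someI) (rule refl)
    then show ?thesis
      unfolding f_def cos by simp
  qed
  have carrier_Q: "\<exists>u. A = q.cos u" if "A \<in> carrier q.Q" for A
    using that unfolding q.carrier_Q by blast
  have "smod_iso q.Q F"
    unfolding smod_iso_def
  proof (intro exI[of _ f] conjI allI ballI)
    show "bij_betw f (carrier q.Q) (carrier F)"
    proof (rule bij_betw_imageI)
      show "inj_on f (carrier q.Q)"
      proof (rule inj_onI)
        fix A A' assume "A \<in> carrier q.Q" "A' \<in> carrier q.Q" and eq': "f A = f A'"
        then obtain u w where uw: "A = q.cos u" "A' = q.cos w"
          using carrier_Q by blast
        show "A = A'"
          using eq' unfolding uw f cos .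
      qed
      show "f ` carrier q.Q = carrier F"
      proof (rule Set.equalityI)
        show "f ` carrier q.Q \<subseteq> carrier F"
        proof (rule image_subsetI)
          fix A assume "A \<in> carrier q.Q"
          then obtain u where "A = q.cos u"
            using carrier_Q by blast
          then show "f A \<in> carrier F"
            unfolding carrier by (simp only: f rangeI)
        qed
        show "carrier F \<subseteq> f ` carrier q.Q"
        proof
          fix y assume "y \<in> carrier F"
          then obtain u where "y = f (q.cos u)"
            unfolding carrier f by blast
          then show "y \<in> f ` carrier q.Q"
            unfolding q.carrier_Q using crr by blast
        qed
      qed
    qed
  next
    fix A A' assume "A \<in> carrier q.Q" "A' \<in> carrier q.Q"
    then obtain u w where uw: "A = q.cos u" "A' = q.cos w"
      using carrier_Q by blast
    have "A \<oplus>\<^bsub>q.Q\<^esub> A' = q.cos (u + w)"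
      unfolding uw q.add_Q[OF crr crr] by (simp add: uea_regular_def)
    then show "f (A \<oplus>\<^bsub>q.Q\<^esub> A') = f A \<oplus>\<^bsub>F\<^esub> f A'"
      by (simp only: uw f add)
  next
    fix c A assume "A \<in> carrier q.Q"
    then obtain u where u: "A = q.cos u"
      using carrier_Q by blast
    have "c \<odot>\<^bsub>q.Q\<^esub> A = q.cos (uea_scale c u)"
      unfolding u q.smult_Q[OF crr] by (simp add: uea_regular_def)
    then show "f (c \<odot>\<^bsub>q.Q\<^esub> A) = c \<odot>\<^bsub>F\<^esub> f A"
      by (simp only: u f smult)
  next
    fix x A assume "A \<in> carrier q.Q"
    then obtain u where u: "A = q.cos u"
      using carrier_Q by blast
    have "smodule.act q.Q x (q.cos u) = q.cos (smodule.act uea_regular x u)"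
    proof (rule q.act_Q[OF crr crr])
      fix b assume "id b - id u \<in> I"
      then show "id (smodule.act uea_regular x b) - id (smodule.act uea_regular x u) \<in> I"
        using I(2)[of "b - u" "uea_inc x"] by (simp add: uea_regular_def right_diff_distrib)
    qed
    then have "smodule.act q.Q x A = q.cos (uea_inc x * u)"
      unfolding u by (simp add: uea_regular_def)
    then show "f (smodule.act q.Q x A) = smodule.act F x (f A)"
      by (simp only: u f act)
  qed
  then show ?thesis
    unfolding N .
qed

section \<open>The fusion product of Kac modules\<close>

locale fusion_setup = weyl_weight lam n
  for lam :: weight and n :: nat +
  fixes z \<kappa> :: "nat \<Rightarrow> complex"
  assumes inj_z: "inj_on z {1..n}" and sum_\<kappa>: "(\<Sum>i=1..n. \<kappa> i) = fst lam"
begin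

definition ps :: "(complex \<times> complex) list" where
  "ps = map (\<lambda>i. (\<kappa> i, z i)) [1..<n+1]"

definition gen :: "(sl12 uea set list \<Rightarrow>\<^sub>0 complex) set" where
  "gen = pure_tensor (map eval_kac ps) (map (\<lambda>i. kac_gen (\<kappa> i, 1)) [1..<n+1])"

lemma length_ps: "length ps = n"
  by (simp add: ps_def)

lemma fusion_eq:
  "fusion_product (map (\<lambda>i. (kac (\<kappa> i, 1), kac_gen (\<kappa> i, 1), z i)) [1..<n+1])
    = gr_module (fam.T ps) gen"
  by (simp add: fusion_product_def gen_def ps_def Let_def comp_def)

lemma gens_in_V: "fam.in_V ps (map (\<lambda>i. kac_gen (\<kappa> i, 1)) [1..<n+1])"
  by (simp add: ps_def list_all2_conv_all_nth kac_module.co_kac_gen del: upt_Suc)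

abbreviation vac :: "nat list \<Rightarrow> complex" where
  "vac \<equiv> unit_fun (replicate n 0)"

lemma tcoord_gen: "fam.tcoord ps gen = vac"
proof -
  have "list_all2 (\<lambda>v p. kac_module.co (fst p) v = unit_fun 0)
      (map (\<lambda>i. kac_gen (\<kappa> i, 1)) [1..<n+1]) ps"
    by (simp add: ps_def list_all2_conv_all_nth kac_module.co_kac_gen del: upt_Suc)
  from fam.coprod_unit[OF this] show ?thesis
    unfolding gen_def fam.tcoord_pure_tensor[OF gens_in_V] by (simp add: length_ps)
qed

sublocale T: coord_current cscale "fam.T ps" "fam.tcoord ps" "fam.tensor_act ps" gen
proof (intro coord_current.intro fam.coord_module_tensor coord_current_axioms.intro)
  show "gen \<in> carrier (fam.T ps)"
    unfolding gen_def by (rule fam.pure_tensor_closed[OF gens_in_V])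
qed

lemma ev_eq: "T.ev u = T.tact u vac"
  by (simp add: tcoord_gen)

lemma kac_eval_monom: "kac_eval_matrix p (monom x m) i j = snd p ^ m * kac_matrix (fst p) x i j"
  by (simp add: case_prod_unfold evalp_monom kacm.mat_lscale)

lemma nplus_vac: "x \<in> nplus \<Longrightarrow> fam.tensor_act ps (monom x m) vac = 0"
  unfolding nplus_def
proof (induction rule: lie.span_induct_alt)
  case base
  show ?case using T.rho_zero_left by simp
next
  case (step c x y)
  obtain q where q: "lpart q x = x"
    using step(1) lpart_sl_simps by auto
  have "fam.tensor_act ps (monom x m) (unit_fun (replicate (length ps) 0))
      = cscale (\<Sum>p\<leftarrow>ps. 0) (unit_fun (replicate (length ps) 0))"
  proof (rule fam.tensor_act_vacuum[where q = q])
    show "kac_eval_matrix p (monom x m) i 0 = (if i = 0 then 0 else 0)" for p i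
      unfolding kac_eval_monom using step(1) by (auto simp: kac_matrix_basis)
  qed (simp_all add: lpart_monom q kpar_def)
  then have "fam.tensor_act ps (monom x m) vac = 0"
    by (simp add: length_ps fun_eq_iff fun_scale_def)
  then show ?case
    using step(2)
    by (simp add: T.rho_add_left T.rho_scale_left flip: add_monom lscale_monom)
qed

lemma cartan_vac: "fam.tensor_act ps (monom (cartan_elt a b) r) vac
    = cscale (\<Sum>p\<leftarrow>ps. snd p ^ r * (a * fst p + b)) vac"
proof -
  have "lpart 0 (cartan_elt a b) = cartan_elt a b"
    by (simp add: cartan_elt_def lpart_add lpart_lscale lpart_sl_simps)
  then have "fam.tensor_act ps (monom (cartan_elt a b) r) (unit_fun (replicate (length ps) 0))
      = cscale (\<Sum>p\<leftarrow>ps. snd p ^ r * (a * fst p + b)) (unit_fun (replicate (length ps) 0))"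
    by (intro fam.tensor_act_vacuum[where q = 0])
      (simp_all add: lpart_monom kpar_def kac_eval_monom kac_matrix_basis del: split_beta)
  then show ?thesis
    by (simp add: length_ps)
qed

lemma y2_vac: "(fam.tensor_act ps (monom sl_y2 0) ^^ Suc n) vac = 0"
proof -
  have "(fam.tensor_act ps (monom sl_y2 0) ^^ Suc (length ps)) vac = (\<lambda>_. 0)"
    by (rule fam.tensor_act_nilpotent[where e = 3])
      (simp_all add: lpart_monom lpart_sl_simps kac_eval_monom kac_matrix_basis del: split_beta)
  then show ?thesis
    by (simp add: length_ps fun_eq_iff)
qed

text \<open>On the tensor product of the generators, \<open>h\<^sub>1(r)\<close> and \<open>h\<^sub>2(r)\<close> act by the scalars
  \<open>\<Sum> \<kappa>\<^sub>i z\<^sub>i^r\<close> and \<open>\<Sum> z\<^sub>i^r\<close>. For \<open>r = 0\<close> these are the values of the weight, by the condition on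
  the numbers \<open>\<kappa>\<^sub>i\<close>. For \<open>r > 0\<close> the result has degree zero instead of \<open>r\<close> and vanishes in the
  graded module. The other relations hold already in the tensor product.\<close>

lemma I_subset_K: "I \<subseteq> T.K"
  unfolding I_def weyl_ideal_def
proof (rule left_ideal_least)
  show "0 \<in> T.K"
    by (rule uea.subspace_0[OF T.subspace_K])
  show "a + b \<in> T.K" if "a \<in> T.K" "b \<in> T.K" for a b
    using that by (rule uea.subspace_add[OF T.subspace_K])
  show "u * a \<in> T.K" if "a \<in> T.K" for u a
    using that by (rule T.K_mult)
  have G0: "0 \<in> T.Gpred m" for m
    by (rule funs.subspace_0[OF T.subspace_Gpred])
  have 1: "uea_inc p \<in> T.K" if "\<forall>i. coeff p i \<in> nplus" for p
    using that nplus_vac by (intro T.K_I) (simp add: dcomp_inc ev_eq T.tact_inc G0)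
  have 2: "cur (cartan_elt a b) r - uea_const (if r = 0 then wt_apply lam a b else 0) \<in> T.K" for a b r
  proof (rule T.K_I)
    fix m
    let ?c = "if r = 0 then wt_apply lam a b else 0"
    have dc: "dcomp m (cur (cartan_elt a b) r - uea_const ?c)
        = (if m = r then cur (cartan_elt a b) r else 0) - (if m = 0 then uea_const ?c else 0)"
      by (auto simp: dcomp_diff dcomp_inc uea_const_eq_scale dcomp_scale dcomp_one)
    show "T.ev (dcomp m (cur (cartan_elt a b) r - uea_const ?c)) \<in> T.Gpred m"
    proof (cases "m = r")
      case False
      then have "dcomp m (cur (cartan_elt a b) r - uea_const ?c) = 0"
        unfolding dc by (auto simp: uea_const_eq_scale)
      then show ?thesis by (simp add: G0)
    next
      case m: True
      show ?thesis
      proof (cases "r = 0")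
        case True
        have "(\<Sum>p\<leftarrow>ps. a * fst p + b) = a * (\<Sum>i=1..n. \<kappa> i) + b * of_nat n"
        proof -
          have "(\<Sum>p\<leftarrow>ps. a * fst p + b) = (\<Sum>i=1..n. a * \<kappa> i + b)"
            by (simp add: ps_def comp_def sum_list_distinct_conv_sum_set atLeastLessThanSuc_atLeastAtMost
                del: upt_Suc)
          then show ?thesis
            by (simp add: sum.distrib sum_distrib_left mult.commute)
        qed
        then have "(\<Sum>p\<leftarrow>ps. a * fst p + b) = wt_apply lam a b"
          by (simp only: sum_\<kappa> wt_apply_def lam)
        then have "T.ev (cur (cartan_elt a b) 0 - uea_const (wt_apply lam a b)) = 0"
          by (simp add: ev_eq T.tact_diff T.tact_inc T.tact_const cartan_vac)
        then show ?thesis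
          unfolding dc using m True by (simp add: G0)
      next
        case False
        have "vac = T.ev 1"
          by (simp add: ev_eq)
        also have "\<dots> \<in> T.Gpred r"
          using T.G_I[OF one_in_uea_deg, of "r - 1"] False by (simp add: T.Gpred_def)
        finally have "cscale c vac \<in> T.Gpred r" for c
          by (rule funs.subspace_scale[OF T.subspace_Gpred])
        then show ?thesis
          unfolding dc using m False by (simp add: ev_eq T.tact_inc cartan_vac uea_const_eq_scale)
      qed
    qed
  qed
  have 3: "cur sl_y2 0 ^ (wt_nat lam + 1) \<in> T.K"
  proof (rule T.K_I)
    fix m
    have "cur sl_y2 0 ^ k \<in> uea_deg 0" for k
    proof (induction k)
      case (Suc k)
      then show ?case
        using uea_deg_mult[of "cur sl_y2 0 ^ k" 0 sl_y2 0] by simp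
    qed (simp add: one_in_uea_deg)
    then have "dcomp m (cur sl_y2 0 ^ Suc n) = (if m = 0 then cur sl_y2 0 ^ Suc n else 0)"
      by (rule dcomp_uea_deg)
    moreover have "T.ev (cur sl_y2 0 ^ Suc n) = 0"
      unfolding ev_eq T.tact_power by (rule y2_vac)
    ultimately show "T.ev (dcomp m (cur sl_y2 0 ^ (wt_nat lam + 1))) \<in> T.Gpred m"
      by (simp add: wt_nat_eq[OF lam] G0 del: power_Suc)
  qed
  show "uea_inc ` {p. \<forall>i. coeff p i \<in> nplus}
     \<union> {cur (cartan_elt a b) r - uea_const (if r = 0 then wt_apply lam a b else 0) | a b r. True}
     \<union> {cur sl_y2 0 ^ (wt_nat lam + 1)} \<subseteq> T.K"
    using 1 2 3 by blast
qed

lemma set_box: "cs \<in> fam.box n \<longleftrightarrow> length cs = n \<and> set cs \<subseteq> {..<4}"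
  by (simp add: fam.box_def)

text \<open>The entries of the index list are changed from \<open>0\<close> to their final values one after the other. The
  element that changes the entry \<open>i\<close> is one of \<open>x\<^sub>1\<close>, \<open>y\<^sub>3\<close>, \<open>y\<^sub>2\<close>, multiplied by a polynomial \<open>L\<close>
  in \<open>t\<close> that is \<open>1\<close> at the corresponding point and \<open>0\<close> at the other ones.\<close>

lemma unit_in_range:
  assumes cs: "cs \<in> fam.box n"
  shows "unit_fun cs \<in> range T.ev"
proof -
  have len: "length cs = n" and cs4: "\<And>i. i < n \<Longrightarrow> cs ! i < 4"
    using cs by (auto simp: set_box) (meson lessThan_iff nth_mem subsetD)
  have "i \<le> n \<Longrightarrow> unit_fun (take i cs @ replicate (n - i) 0) \<in> range T.ev" for i
  proof (induction i)
    case 0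
    show ?case
      by (rule range_eqI[of _ _ 1]) (simp add: ev_eq)
  next
    case (Suc i)
    then have i: "i < n" by simp
    have rep: "replicate (n - i) (0 :: nat) = 0 # replicate (n - Suc i) 0"
      using i by (metis Suc_diff_Suc replicate_Suc)
    have tk: "take (Suc i) cs @ replicate (n - Suc i) 0
        = take i cs @ cs ! i # replicate (n - Suc i) 0"
      using i len by (simp add: take_Suc_conv_app_nth)
    obtain u where u: "unit_fun (take i cs @ 0 # replicate (n - Suc i) 0) = T.ev u"
      using Suc i unfolding rep by auto
    show ?case
    proof (cases "cs ! i = 0")
      case True
      then show ?thesis
        unfolding tk using u by simp
    next
      case False
      define x where "x = (if cs ! i = 1 then sl_x1 else if cs ! i = 2 then sl_y3 else sl_y2)"
      have col: "kac_matrix k x j 0 = (if j = cs ! i then 1 else 0)" for k j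
        using cs4[OF i] False by (auto simp: x_def kac_matrix_basis)
      obtain q where q: "lpart q x = x"
        using lpart_sl_simps unfolding x_def by metis
      \<comment> \<open>The factors are indexed from \<open>0\<close> in the list and from \<open>1\<close> in \<open>z\<close>.\<close>
      have "z (Suc i) \<notin> z ` ({1..n} - {Suc i})"
        using inj_z i by (auto dest: inj_onD)
      then obtain L where L: "poly L (z (Suc i)) = 1" "\<And>j. j \<in> {1..n} \<Longrightarrow> j \<noteq> Suc i \<Longrightarrow> poly L (z j) = 0"
        using interpolation_poly[of "z ` ({1..n} - {Suc i})" "z (Suc i)"] by auto
      let ?g = "map_poly (\<lambda>c. lscale c x) L"
      have g: "kac_eval_matrix p ?g a b = poly L (snd p) * kac_matrix (fst p) x a b" for p a b
        by (simp add: case_prod_unfold evalp_map_poly kacm.mat_lscale)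
      have qg: "lpart q ?g = ?g"
        by (rule poly_eqI) (simp add: coeff_lpart_poly coeff_map_poly lpart_lscale q)
      have psi: "ps ! j = (\<kappa> (Suc j), z (Suc j))" if "j < n" for j
        using that by (simp add: ps_def del: upt_Suc)
      have split: "ps = take i ps @ ps ! i # drop (Suc i) ps"
        using i by (simp add: id_take_nth_drop length_ps)
      have off: "kac_eval_matrix p ?g a b = 0" if p: "p \<in> set (take i ps) \<union> set (drop (Suc i) ps)" for p a b
      proof -
        have "\<exists>j<n. j \<noteq> i \<and> p = ps ! j"
          using p
        proof
          assume "p \<in> set (take i ps)"
          then obtain j where "j < i" "p = ps ! j"
            by (auto simp: in_set_conv_nth length_ps)
          then show ?thesis
            using i by (intro exI[of _ j]) simp
        next
          assume "p \<in> set (drop (Suc i) ps)"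
          then obtain j where "j < n - Suc i" "p = ps ! (Suc i + j)"
            by (auto simp: in_set_conv_nth length_ps)
          then show ?thesis
            using i by (intro exI[of _ "Suc i + j"]) simp
        qed
        then obtain j where "j < n" "j \<noteq> i" "p = ps ! j" by blast
        then show ?thesis
          unfolding g using L(2)[of "Suc j"] psi[of j] by simp
      qed
      have "\<exists>\<epsilon>. \<epsilon> \<noteq> 0 \<and> fam.tensor_act (take i ps @ ps ! i # drop (Suc i) ps) ?g
          (unit_fun (take i cs @ 0 # replicate (n - Suc i) 0))
        = cscale \<epsilon> (unit_fun (take i cs @ cs ! i # replicate (n - Suc i) 0))"
      proof (rule fam.tensor_act_site[OF qg])
        show "kac_eval_matrix (ps ! i) ?g j 0 = (if j = cs ! i then 1 else 0)" for j
          unfolding g using L(1) psi[OF i] by (simp add: col)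
        show "kac_eval_matrix p ?g a b = 0" if "p \<in> set (drop (Suc i) ps)" for p a b
          using off that by blast
        show "kac_eval_matrix p ?g a b = 0" if "p \<in> set (take i ps)" for p a b
          using off that by blast
      qed (use i len in \<open>simp_all add: length_ps\<close>)
      then obtain \<epsilon> where \<epsilon>: "\<epsilon> \<noteq> 0" "T.ev (uea_inc ?g * u)
          = cscale \<epsilon> (unit_fun (take i cs @ cs ! i # replicate (n - Suc i) 0))"
        unfolding split[symmetric] T.tact_mult T.tact_inc u by blast
      then have e: "T.ev (uea_scale (inverse \<epsilon>) (uea_inc ?g * u))
          = unit_fun (take i cs @ cs ! i # replicate (n - Suc i) 0)"
        unfolding T.tact_scale \<epsilon>(2) by (simp add: funs.scale_scale)
      show ?thesis
        unfolding tk e[symmetric] by (rule rangeI)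
    qed
  qed
  from this[of n] show ?thesis
    using len by simp
qed

lemma independent_units: "funs.independent (unit_fun ` fam.box n)"
  and card_units: "card (unit_fun ` fam.box n) = 4 ^ n"
proof -
  have inj: "inj_on unit_fun (fam.box n)"
    by (rule inj_onI) (metis unit_fun_def zero_neq_one)
  then show "card (unit_fun ` fam.box n) = 4 ^ n"
    by (simp add: card_image fam.card_box)
  show "funs.independent (unit_fun ` fam.box n)"
  proof (rule funs.independent_if_scalars_zero)
    show "finite (unit_fun ` fam.box n)"
      by (simp add: fam.finite_box)
    fix c and x :: "nat list \<Rightarrow> complex"
    assume 0: "(\<Sum>x\<in>unit_fun ` fam.box n. cscale (c x) x) = 0" and "x \<in> unit_fun ` fam.box n"
    then obtain cs where cs: "cs \<in> fam.box n" "x = unit_fun cs" by blast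
    have "0 = (\<Sum>x\<in>unit_fun ` fam.box n. cscale (c x) x) cs"
      by (simp add: 0)
    also have "\<dots> = (\<Sum>ds\<in>fam.box n. if ds = cs then c (unit_fun cs) else 0)"
      unfolding sum_fun_apply sum.reindex[OF inj] by (rule sum.cong) (auto simp: fun_scale_def unit_fun_def)
    also have "\<dots> = c x"
      using cs fam.finite_box by simp
    finally show "c x = 0" by simp
  qed
qed

theorem weyl_fusion:
  "smod_iso (local_weyl lam) (gr_module (fam.T ps) gen) \<and> has_dim (local_weyl lam) (4 ^ n)"
proof -
  obtain X where X: "finite X" "card X \<le> 4 ^ n" "mspan X = UNIV"
    using weyl_spanning by blast
  have fin: "finite (unit_fun ` fam.box n)" and sub: "unit_fun ` fam.box n \<subseteq> range T.ev"
    using unit_in_range by (auto simp: fam.finite_box)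
  have card: "card X \<le> card (unit_fun ` fam.box n)"
    using X(2) by (simp add: card_units)
  note kernel = T.ideal_eq_kernel[OF I_subspace I_subset_K X(1,3) independent_units fin sub card]
  obtain B where B: "finite B" "card B = 4 ^ n" "mspan B = UNIV"
      "\<And>c. (\<Sum>b\<in>B. uea_scale (c b) b) \<in> I \<Longrightarrow> \<forall>b\<in>B. c b = 0"
    using kernel(2) unfolding card_units by blast
  have W: "local_weyl lam = smod_quotient uea_regular I"
    by (simp add: local_weyl_def I_def)
  have "smod_iso (local_weyl lam) (gr_module (fam.T ps) gen)"
    unfolding W
  proof (rule smod_iso_quotient[OF I_subspace I_mult T.gr_carrier _ T.gr_ops T.gr_act_cls])
    show "(\<lambda>n. T.cls n u) = (\<lambda>n. T.cls n w) \<longleftrightarrow> u - w \<in> I" for u w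
      unfolding kernel(1) by (rule T.gr_eq_iff)
  qed
  moreover have "has_dim (local_weyl lam) (4 ^ n)"
    unfolding W B(2)[symmetric] by (rule has_dim_quotient[OF I_subspace I_mult B(1,3,4)])
  ultimately show ?thesis ..
qed

end

theorem theorem3p6:
  fixes lam :: weight and n :: nat and z \<kappa> :: "nat \<Rightarrow> complex"
  assumes "lam \<in> Pplus" and "snd lam = of_nat n"
    and "inj_on z {1..n}"
    and "(\<Sum>i=1..n. \<kappa> i) = fst lam"
  shows "smod_iso (local_weyl lam)
           (fusion_product (map (\<lambda>i. (kac (\<kappa> i, 1), kac_gen (\<kappa> i, 1), z i)) [1..<n+1]))
       \<and> has_dim (local_weyl lam) (4 ^ n)"
proof -
  interpret fusion_setup lam n z \<kappa>
    by unfold_locales (fact assms(2-4))+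
  show ?thesis
    unfolding fusion_eq by (rule weyl_fusion)
qed

end
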